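(* Let $n\ge 2$ be an integer, let $G$ be a locally compact abelian group with dual group $\Gamma$ (written additively), and let $\omega=(\omega_1,\dots,\omega_n)\in\Gamma^n$. The crossed product $\mathcal{O}_n\rtimes_{\alpha^\omega}G$ is simple and purely infinite if and only if $\Gamma=\overline{\{\omega_\mu\mid\mu\in\mathcal{W}_n\}}$.
   Context: $\mathcal{O}_n$ is the Cuntz algebra, the universal $C^*$-algebra generated by isometries $S_1,\dots,S_n$ with $\sum_{i=1}^nS_iS_i^*=1$. $\mathcal{W}_n$ is the set of all finite words $\mu=(i_1,\dots,i_k)$, $k\ge 0$, with letters in $\{1,\dots,n\}$ (including the empty word $\emptyset$). For $\mu=(i_1,\dots,i_k)$, $\omega_\mu=\sum_{j=1}^k\omega_{i_j}\in\Gamma$ (so $\omega_\emptyset=0$). Denote the pairing of $t\in G$ and $\gamma\in\Gamma$ by $\langle t\,|\,\gamma\rangle\in\mathbb{T}$. The action $\alpha^\omega$ of $G$ on $\mathcal{O}_n$ is determined by $\alpha^\omega_t(S_i)=\langle t\,|\,\omega_i\rangle S_i$ for $t\in G$, $i=1,\dots,n$. $\mathcal{O}_n\rtimes_{\alpha^\omega}G$ is the crossed product (full and reduced coincide since $G$ is amenable). The closure is taken in $\Gamma$. A simple $C^*$-algebra is called purely infinite if every non-zero hereditary $C^*$-subalgebra contains an infinite projection (a projection Murray–von Neumann equivalent to a proper subprojection of itself). *)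

theory Defs
  imports "HOL-Analysis.Analysis"
begin

section \<open>C*-algebras\<close>

text \<open>Complex C*-algebras, not necessarily unital. A unital non-zero C*-algebra has the sort
  \<open>{cstar_algebra, real_normed_algebra_1}\<close>.\<close>

class cstar_algebra = banach + real_normed_algebra +
  fixes scaleC :: "complex \<Rightarrow> 'a \<Rightarrow> 'a" (infixr \<open>*\<^sub>C\<close> 75)
    and star :: "'a \<Rightarrow> 'a"
  assumes scaleC_add_right: "c *\<^sub>C (x + y) = c *\<^sub>C x + c *\<^sub>C y"
    and scaleC_add_left: "(c + d) *\<^sub>C x = c *\<^sub>C x + d *\<^sub>C x"
    and scaleC_scaleC: "c *\<^sub>C d *\<^sub>C x = (c * d) *\<^sub>C x"
    and scaleC_of_real: "complex_of_real r *\<^sub>C x = r *\<^sub>R x"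
    and mult_scaleC_left: "(c *\<^sub>C x) * y = c *\<^sub>C (x * y)"
    and mult_scaleC_right: "x * (c *\<^sub>C y) = c *\<^sub>C (x * y)"
    and norm_scaleC: "norm (c *\<^sub>C x) = cmod c * norm x"
    and star_add: "star (x + y) = star x + star y"
    and star_scaleC: "star (c *\<^sub>C x) = cnj c *\<^sub>C star x"
    and star_mult: "star (x * y) = star y * star x"
    and star_star: "star (star x) = x"
    and cstar_identity: "norm (star x * x) = (norm x)\<^sup>2"

instantiation complex :: cstar_algebra
begin

definition scaleC_complex :: "complex \<Rightarrow> complex \<Rightarrow> complex" where
  "scaleC_complex = (*)"

definition star_complex :: "complex \<Rightarrow> complex" where
  "star_complex = cnj"

instance
  by standard
    (simp_all add: scaleC_complex_def star_complex_def ring_distribs scaleR_conv_of_real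
      norm_mult power2_eq_square)

end

definition star_hom :: "('a::cstar_algebra \<Rightarrow> 'b::cstar_algebra) \<Rightarrow> bool" where
  "star_hom \<phi> \<longleftrightarrow>
     (\<forall>x y. \<phi> (x + y) = \<phi> x + \<phi> y) \<and> (\<forall>c x. \<phi> (c *\<^sub>C x) = c *\<^sub>C \<phi> x) \<and>
     (\<forall>x y. \<phi> (x * y) = \<phi> x * \<phi> y) \<and> (\<forall>x. \<phi> (star x) = star (\<phi> x))"

definition complex_subspace :: "'a::cstar_algebra set \<Rightarrow> bool" where
  "complex_subspace V \<longleftrightarrow>
     0 \<in> V \<and> (\<forall>x\<in>V. \<forall>y\<in>V. x + y \<in> V) \<and> (\<forall>c. \<forall>x\<in>V. c *\<^sub>C x \<in> V)"

definition closed_ideal :: "'a::cstar_algebra set \<Rightarrow> bool" where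
  "closed_ideal I \<longleftrightarrow>
     closed I \<and> complex_subspace I \<and> (\<forall>x\<in>I. \<forall>a. a * x \<in> I \<and> x * a \<in> I)"

definition simple_cstar :: "'a::cstar_algebra itself \<Rightarrow> bool" where
  "simple_cstar T \<longleftrightarrow>
     (\<exists>x::'a. x \<noteq> 0) \<and> (\<forall>I::'a set. closed_ideal I \<longrightarrow> I = {0} \<or> I = UNIV)"

definition cstar_subalgebra :: "'a::cstar_algebra set \<Rightarrow> bool" where
  "cstar_subalgebra B \<longleftrightarrow>
     closed B \<and> complex_subspace B \<and> (\<forall>x\<in>B. \<forall>y\<in>B. x * y \<in> B) \<and> (\<forall>x\<in>B. star x \<in> B)"

definition cstar_positive :: "'a::cstar_algebra \<Rightarrow> bool" where
  "cstar_positive a \<longleftrightarrow> (\<exists>x. a = star x * x)"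

definition hereditary_subalgebra :: "'a::cstar_algebra set \<Rightarrow> bool" where
  "hereditary_subalgebra B \<longleftrightarrow> cstar_subalgebra B \<and>
     (\<forall>b\<in>B. \<forall>a. cstar_positive a \<and> cstar_positive (b - a) \<longrightarrow> a \<in> B)"

definition projection :: "'a::cstar_algebra \<Rightarrow> bool" where
  "projection p \<longleftrightarrow> p * p = p \<and> star p = p"

definition infinite_projection :: "'a::cstar_algebra \<Rightarrow> bool" where
  "infinite_projection p \<longleftrightarrow> projection p \<and>
     (\<exists>q v. projection q \<and> p * q = q \<and> q \<noteq> p \<and> star v * v = p \<and> v * star v = q)"

text \<open>This is the notion for simple C*-algebras; it is only used together with
  \<^const>\<open>simple_cstar\<close>.\<close>

definition purely_infinite :: "'a::cstar_algebra itself \<Rightarrow> bool" where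
  "purely_infinite T \<longleftrightarrow>
     (\<forall>B::'a set. hereditary_subalgebra B \<and> B \<noteq> {0} \<longrightarrow> (\<exists>p\<in>B. infinite_projection p))"


section \<open>Universal C*-completions of *-algebras\<close>

text \<open>The *-algebras to be completed are given as a set \<open>V\<close> of functions with pointwise linear
  structure, a multiplication \<open>mul\<close> and an involution \<open>adj\<close>.  The C*-seminorms on \<open>V\<close> are
  exactly the functions \<open>x \<mapsto> norm (\<pi> x)\<close> for *-homomorphisms \<open>\<pi>\<close> from \<open>V\<close> into C*-algebras, so
  quantifying over them is quantifying over all *-representations of \<open>V\<close> without any restriction
  on the type in which these take their values.\<close>

definition cstar_seminorm_on ::
  "('x \<Rightarrow> 'v::cstar_algebra) set \<Rightarrow> (('x \<Rightarrow> 'v) \<Rightarrow> ('x \<Rightarrow> 'v) \<Rightarrow> ('x \<Rightarrow> 'v)) \<Rightarrow>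
   (('x \<Rightarrow> 'v) \<Rightarrow> ('x \<Rightarrow> 'v)) \<Rightarrow> (('x \<Rightarrow> 'v) \<Rightarrow> real) \<Rightarrow> bool" where
  "cstar_seminorm_on V mul adj p \<longleftrightarrow>
     (\<forall>f\<in>V. 0 \<le> p f) \<and>
     (\<forall>f\<in>V. \<forall>g\<in>V. p (\<lambda>x. f x + g x) \<le> p f + p g) \<and>
     (\<forall>c. \<forall>f\<in>V. p (\<lambda>x. c *\<^sub>C f x) = cmod c * p f) \<and>
     (\<forall>f\<in>V. \<forall>g\<in>V. p (mul f g) \<le> p f * p g) \<and>
     (\<forall>f\<in>V. p (mul (adj f) f) = (p f)\<^sup>2)"

text \<open>\<open>\<iota>\<close> exhibits the C*-algebra \<open>'c\<close> as the (Hausdorff) completion of \<open>V\<close> in the largest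
  C*-seminorm satisfying the condition \<open>P\<close>.\<close>

definition universal_cstar_completion ::
  "('x \<Rightarrow> 'v::cstar_algebra) set \<Rightarrow> (('x \<Rightarrow> 'v) \<Rightarrow> ('x \<Rightarrow> 'v) \<Rightarrow> ('x \<Rightarrow> 'v)) \<Rightarrow>
   (('x \<Rightarrow> 'v) \<Rightarrow> ('x \<Rightarrow> 'v)) \<Rightarrow> ((('x \<Rightarrow> 'v) \<Rightarrow> real) \<Rightarrow> bool) \<Rightarrow>
   (('x \<Rightarrow> 'v) \<Rightarrow> 'c::cstar_algebra) \<Rightarrow> bool" where
  "universal_cstar_completion V mul adj P \<iota> \<longleftrightarrow>
     (\<forall>f\<in>V. \<forall>g\<in>V. \<iota> (\<lambda>x. f x + g x) = \<iota> f + \<iota> g) \<and>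
     (\<forall>c. \<forall>f\<in>V. \<iota> (\<lambda>x. c *\<^sub>C f x) = c *\<^sub>C \<iota> f) \<and>
     (\<forall>f\<in>V. \<forall>g\<in>V. \<iota> (mul f g) = \<iota> f * \<iota> g) \<and>
     (\<forall>f\<in>V. \<iota> (adj f) = star (\<iota> f)) \<and>
     closure (\<iota> ` V) = UNIV \<and>
     P (\<lambda>f. norm (\<iota> f)) \<and>
     (\<forall>p. cstar_seminorm_on V mul adj p \<and> P p \<longrightarrow> (\<forall>f\<in>V. p f \<le> norm (\<iota> f)))"


section \<open>Cuntz algebras\<close>

text \<open>The free unital *-algebra on generators \<open>1, \<dots>, n\<close> consists of the finitely supported
  functions on words in the letters \<open>(i, b)\<close>, where \<open>(i, False)\<close> stands for the \<open>i\<close>-th generator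
  and \<open>(i, True)\<close> for its adjoint.\<close>

type_synonym free_star = "(nat \<times> bool) list \<Rightarrow> complex"

definition free_star_algebra :: "nat \<Rightarrow> free_star set" where
  "free_star_algebra n =
     {x. finite {w. x w \<noteq> 0} \<and> (\<forall>w. x w \<noteq> 0 \<longrightarrow> w \<in> lists ({1..n} \<times> UNIV))}"

definition free_mult :: "free_star \<Rightarrow> free_star \<Rightarrow> free_star" where
  "free_mult x y = (\<lambda>w. \<Sum>k\<le>length w. x (take k w) * y (drop k w))"

definition free_adj :: "free_star \<Rightarrow> free_star" where
  "free_adj x = (\<lambda>w. cnj (x (rev (map (\<lambda>(i, b). (i, \<not> b)) w))))"

definition free_one :: free_star where
  "free_one = (\<lambda>w. if w = [] then 1 else 0)"

definition free_gen :: "nat \<Rightarrow> free_star" where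
  "free_gen i = (\<lambda>w. if w = [(i, False)] then 1 else 0)"

text \<open>The seminorm \<open>p\<close> annihilates \<open>S\<^sub>i\<^sup>* S\<^sub>i - 1\<close> and \<open>(\<Sum>\<^sub>i S\<^sub>i S\<^sub>i\<^sup>*) - 1\<close>, i.e. the
  corresponding representation satisfies the Cuntz relations.\<close>

definition kills_cuntz_relations :: "nat \<Rightarrow> (free_star \<Rightarrow> real) \<Rightarrow> bool" where
  "kills_cuntz_relations n p \<longleftrightarrow>
     (\<forall>i\<in>{1..n}. p (\<lambda>w. free_mult (free_adj (free_gen i)) (free_gen i) w - free_one w) = 0) \<and>
     p (\<lambda>w. (\<Sum>i=1..n. free_mult (free_gen i) (free_adj (free_gen i)) w) - free_one w) = 0"

text \<open>\<open>'a\<close> is the universal C*-algebra \<open>O\<^sub>n\<close>, with canonical generators \<open>S 1, \<dots>, S n\<close>.\<close>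

definition cuntz_algebra ::
  "nat \<Rightarrow> (nat \<Rightarrow> 'a::{cstar_algebra, real_normed_algebra_1}) \<Rightarrow> bool" where
  "cuntz_algebra n S \<longleftrightarrow>
     (\<exists>\<pi>. universal_cstar_completion (free_star_algebra n) free_mult free_adj
            (kills_cuntz_relations n) \<pi> \<and>
          \<pi> free_one = 1 \<and> (\<forall>i\<in>{1..n}. \<pi> (free_gen i) = S i))"


section \<open>The dual group\<close>

typedef (overloaded) 'g character =
  "{\<eta>. continuous_on UNIV \<eta> \<and> (\<forall>t. cmod (\<eta> t) = 1) \<and> (\<forall>s t. \<eta> (s + t) = \<eta> s * \<eta> t)}
    :: ('g::topological_ab_group_add \<Rightarrow> complex) set"
  morphisms char_fun Abs_character
  by (rule exI[of _ "\<lambda>_. 1"]) simp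

setup_lifting type_definition_character

definition pairing :: "'g::topological_ab_group_add \<Rightarrow> 'g character \<Rightarrow> complex" where
  "pairing t \<gamma> = char_fun \<gamma> t"

instantiation character :: (topological_ab_group_add) ab_group_add
begin

lift_definition zero_character :: "'a character" is "\<lambda>_. 1"
  by simp

lift_definition plus_character :: "'a character \<Rightarrow> 'a character \<Rightarrow> 'a character"
  is "\<lambda>\<eta> \<psi> t. \<eta> t * \<psi> t"
  by (auto intro!: continuous_intros simp: norm_mult)

lift_definition uminus_character :: "'a character \<Rightarrow> 'a character" is "\<lambda>\<eta> t. cnj (\<eta> t)"
  by (auto intro!: continuous_intros)

definition minus_character :: "'a character \<Rightarrow> 'a character \<Rightarrow> 'a character" where
  "minus_character \<eta> \<psi> = \<eta> + - \<psi>"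

instance
proof
  fix a b c :: "'a character"
  show "a + b + c = a + (b + c)" by transfer (simp add: mult.assoc)
  show "a + b = b + a" by transfer (simp add: mult.commute)
  show "0 + a = a" by transfer simp
  have "cnj (char_fun a t) * char_fun a t = 1" for t
    using complex_norm_square[of "char_fun a t"] char_fun[of a] by (simp add: mult.commute)
  then show "- a + a = 0"
    by (simp add: char_fun_inject[symmetric] plus_character.rep_eq uminus_character.rep_eq
      zero_character.rep_eq)
  show "a - b = a + - b" by (fact minus_character_def)
qed

end

text \<open>The topology of uniform convergence on compact sets.\<close>

instantiation character :: (topological_ab_group_add) topological_space
begin

definition open_character :: "'a character set \<Rightarrow> bool" where
  "open_character U \<longleftrightarrow>
     (\<forall>\<eta>\<in>U. \<exists>K e. compact K \<and> e > 0 \<and>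
        (\<forall>\<psi>. (\<forall>t\<in>K. cmod (pairing t \<psi> - pairing t \<eta>) < e) \<longrightarrow> \<psi> \<in> U))"

instance
proof
  show "open (UNIV :: 'a character set)"
    unfolding open_character_def by (intro ballI exI[of _ "{}"] exI[of _ 1]) simp
next
  fix S T :: "'a character set"
  assume S: "open S" and T: "open T"
  show "open (S \<inter> T)"
    unfolding open_character_def
  proof
    fix \<eta> assume \<eta>: "\<eta> \<in> S \<inter> T"
    obtain K d where K: "compact K" "d > 0"
      "\<And>\<psi>. (\<forall>t\<in>K. cmod (pairing t \<psi> - pairing t \<eta>) < d) \<Longrightarrow> \<psi> \<in> S"
      using bspec[OF S[unfolded open_character_def], of \<eta>] \<eta> by auto
    obtain L e where L: "compact L" "e > 0"
      "\<And>\<psi>. (\<forall>t\<in>L. cmod (pairing t \<psi> - pairing t \<eta>) < e) \<Longrightarrow> \<psi> \<in> T"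
      using bspec[OF T[unfolded open_character_def], of \<eta>] \<eta> by auto
    have "compact (K \<union> L)" "min d e > 0"
      using K(1,2) L(1,2) by (simp_all add: compact_Un)
    moreover have "\<psi> \<in> S \<inter> T"
      if "\<forall>t\<in>K \<union> L. cmod (pairing t \<psi> - pairing t \<eta>) < min d e" for \<psi>
      using that by (intro IntI K(3) L(3)) simp_all
    ultimately show "\<exists>K e. compact K \<and> e > 0 \<and>
        (\<forall>\<psi>. (\<forall>t\<in>K. cmod (pairing t \<psi> - pairing t \<eta>) < e) \<longrightarrow> \<psi> \<in> S \<inter> T)"
      by blast
  qed
next
  fix \<U> :: "'a character set set"
  assume \<U>: "\<forall>S\<in>\<U>. open S"
  show "open (\<Union>\<U>)"
    unfolding open_character_def
  proof
    fix \<eta> assume "\<eta> \<in> \<Union>\<U>"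
    then obtain S where S: "S \<in> \<U>" "\<eta> \<in> S"
      by blast
    with \<U> have "open S"
      by blast
    obtain K e where K: "compact K" "e > 0"
      "\<And>\<psi>. (\<forall>t\<in>K. cmod (pairing t \<psi> - pairing t \<eta>) < e) \<Longrightarrow> \<psi> \<in> S"
      using bspec[OF \<open>open S\<close>[unfolded open_character_def] S(2)] by auto
    then show "\<exists>K e. compact K \<and> e > 0 \<and>
        (\<forall>\<psi>. (\<forall>t\<in>K. cmod (pairing t \<psi> - pairing t \<eta>) < e) \<longrightarrow> \<psi> \<in> \<Union>\<U>)"
      using S(1) by (intro exI[of _ K] exI[of _ e]) auto
  qed
qed

end


section \<open>Crossed products by locally compact abelian groups\<close>

definition haar_measure :: "'g::topological_ab_group_add measure \<Rightarrow> bool" where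
  "haar_measure \<mu> \<longleftrightarrow>
     sets \<mu> = sets borel \<and>
     (\<forall>B\<in>sets borel. \<forall>t. emeasure \<mu> ((\<lambda>s. t + s) ` B) = emeasure \<mu> B) \<and>
     (\<forall>K. compact K \<longrightarrow> emeasure \<mu> K < \<infinity>) \<and>
     (\<forall>U. open U \<and> U \<noteq> {} \<longrightarrow> emeasure \<mu> U > 0) \<and>
     (\<forall>B\<in>sets borel. emeasure \<mu> B = (INF U\<in>{U. open U \<and> B \<subseteq> U}. emeasure \<mu> U)) \<and>
     (\<forall>U. open U \<longrightarrow> emeasure \<mu> U = (SUP K\<in>{K. compact K \<and> K \<subseteq> U}. emeasure \<mu> K))"

definition cstar_action ::
  "('g::topological_ab_group_add \<Rightarrow> 'a::cstar_algebra \<Rightarrow> 'a) \<Rightarrow> bool" where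
  "cstar_action \<alpha> \<longleftrightarrow>
     (\<forall>t. star_hom (\<alpha> t) \<and> bij (\<alpha> t)) \<and> (\<forall>s t x. \<alpha> (s + t) x = \<alpha> s (\<alpha> t x)) \<and>
     (\<forall>x. continuous_on UNIV (\<lambda>t. \<alpha> t x))"

definition compactly_supported :: "('g::topological_space \<Rightarrow> 'a::real_normed_vector) set" where
  "compactly_supported =
     {f. continuous_on UNIV f \<and> (\<exists>K. compact K \<and> (\<forall>t. t \<notin> K \<longrightarrow> f t = 0))}"

definition twisted_conv ::
  "'g measure \<Rightarrow> ('g \<Rightarrow> 'a \<Rightarrow> 'a) \<Rightarrow> ('g \<Rightarrow> 'a) \<Rightarrow> ('g \<Rightarrow> 'a) \<Rightarrow>
   ('g::topological_ab_group_add \<Rightarrow> 'a::{cstar_algebra, second_countable_topology})" where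
  "twisted_conv \<mu> \<alpha> f g = (\<lambda>t. \<integral>s. f s * \<alpha> s (g (t - s)) \<partial>\<mu>)"

definition twisted_adj ::
  "('g \<Rightarrow> 'a \<Rightarrow> 'a) \<Rightarrow> ('g \<Rightarrow> 'a) \<Rightarrow> ('g::topological_ab_group_add \<Rightarrow> 'a::cstar_algebra)" where
  "twisted_adj \<alpha> f = (\<lambda>t. \<alpha> t (star (f (- t))))"

text \<open>The (full) crossed product is the enveloping C*-algebra of the \<open>L\<^sup>1\<close>-algebra of the
  action: the completion of the convolution *-algebra \<open>C\<^sub>c(G, A)\<close> in the largest C*-seminorm
  dominated by the \<open>L\<^sup>1\<close>-norm. The sort \<open>second_countable_topology\<close>, which the Bochner integral
  requires, says that \<open>A\<close> is separable.\<close>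

definition crossed_product ::
  "'g::topological_ab_group_add measure \<Rightarrow>
   ('g \<Rightarrow> 'a::{cstar_algebra, second_countable_topology} \<Rightarrow> 'a) \<Rightarrow>
   (('g \<Rightarrow> 'a) \<Rightarrow> 'c::cstar_algebra) \<Rightarrow> bool" where
  "crossed_product \<mu> \<alpha> \<iota> \<longleftrightarrow>
     universal_cstar_completion compactly_supported (twisted_conv \<mu> \<alpha>) (twisted_adj \<alpha>)
       (\<lambda>p. \<forall>f\<in>compactly_supported. p f \<le> (\<integral>s. norm (f s) \<partial>\<mu>)) \<iota>"

end

theory Submission
  imports Defs
begin

text \<open>
  The crossed product acts on the space with basis all triples (infinite word, element of the dual
  group, gauge degree): \<open>S\<^sub>i\<close> prepends the letter \<open>i\<close> and adds \<open>\<omega>\<^sub>i\<close> to the degree, and \<open>C\<^sub>c(G)\<close> acts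
  diagonally through Fourier transforms of the degree. On sums of \<open>S\<^sub>u \<phi> S\<^sub>v\<^sup>*\<close> with words of length at
  most \<open>L\<close> the norm is at most \<open>2L + 1\<close> times the operator norm; applying this to powers of \<open>x\<^sup>*x\<close>
  shows that the matrix coefficients are faithful.

  If the weights \<open>\<omega>\<^sub>\<mu>\<close> are dense, a nonzero positive element is compressed, along an aperiodic word, to
  a function of the degree that is nearly constant on a small open set. Words whose weights
  approximate prescribed degrees move this set into itself, which yields an element \<open>y\<close> supported
  there such that \<open>1 - y\<close> is an isometry; its defect projection is infinite.

  Conversely, if the algebra is simple, the coefficients on a nonempty set of basis triples that is
  stable under prepending and deleting letters are already faithful. If some \<open>-\<omega>\<^sub>i\<close> is a limit of
  weights, a function supported off the closure of the weights vanishes on such a set, so the weights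
  are dense. Otherwise every element is approximated by ones with finite diagonal blocks on such
  a set; a finite isometric block has no defect, which rules out infinite projections.
\<close>

section \<open>C*-algebra preliminaries\<close>

text \<open>Operators are handled as matrices whose forms on finitely supported vectors are bounded.
  Their norm is a C*-seminorm, so the universal property makes the coefficients contractive and they
  extend to the completions. A product of coefficients is a finite sum only if the right factor has
  finite columns, hence the frequent return to the dense span of \<open>S_u \<phi> S_v^*\<close>.
  The gauge degree is carried along because the weights may satisfy relations (even \<omega> = 0):
  the integer separates the terms by length difference, and cutting a matrix down to one difference
  does not raise its norm. Terms with words of one common length form matrices over functions on the
  dual group. Bounding their norm by suprema of Fourier transforms needs Gelfand theory, as does the
  orthogonality of the ranges of the \<open>S_i\<close>; minimal C*-seminorms supply the characters.
  The closure of the weights is only a semigroup. If it contains some \<open>- \<omega> i\<close>,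
  an orbit can be continued backwards inside it; if it contains none, Dickson's lemma shows that
  only finitely many words return to a bounded region of the dual group, and this makes the diagonal
  blocks finite.\<close>

abbreviation (input) "Cc \<equiv> compactly_supported"
abbreviation (input) "Wn n \<equiv> lists {1..n::nat}"
abbreviation (input) "wt \<omega> w \<equiv> sum_list (map \<omega> w)"
abbreviation (input) "sesq A M \<xi> \<eta> \<equiv> \<Sum>e\<in>A. \<Sum>e'\<in>A. cnj (\<eta> e) * M e e' * (\<xi> e' :: complex)"

lemma scaleC_zero_left [simp]: "(0::complex) *\<^sub>C x = 0"
 using scaleC_of_real[of 0 x] by simp

lemma scaleC_one [simp]: "(1::complex) *\<^sub>C x = x"
 using scaleC_of_real[of 1 x] by simp

lemma scaleC_zero_right [simp]: "c *\<^sub>C (0::'a::cstar_algebra) = 0"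
 using scaleC_add_right[of c "0::'a" 0] by simp

lemma scaleC_minus_right [simp]: "c *\<^sub>C (- x) = - (c *\<^sub>C x)"
 using scaleC_add_right[of c x "- x"] by (simp add: eq_neg_iff_add_eq_0 add.commute)

lemma scaleC_minus_left [simp]: "(- c) *\<^sub>C x = - (c *\<^sub>C x)"
 using scaleC_add_left[of c "- c" x] by (simp add: eq_neg_iff_add_eq_0 add.commute)

lemma scaleC_diff_right: "c *\<^sub>C (x - y) = c *\<^sub>C x - c *\<^sub>C y"
 using scaleC_add_right[of c x "- y"] by simp

lemma scaleC_diff_left: "(c - d) *\<^sub>C x = c *\<^sub>C x - d *\<^sub>C x"
 using scaleC_add_left[of c "- d" x] by simp

lemma scaleC_sum_right: "c *\<^sub>C (\<Sum>i\<in>A. f i) = (\<Sum>i\<in>A. c *\<^sub>C f i)"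
 by (induction A rule: infinite_finite_induct) (simp_all add: scaleC_add_right)

lemma star_zero [simp]: "star (0::'a::cstar_algebra) = 0"
 using star_add[of "0::'a" 0] by simp

lemma star_minus [simp]: "star (- x) = - star x"
 using star_add[of x "- x"] by (simp add: eq_neg_iff_add_eq_0 add.commute)

lemma star_diff: "star (x - y) = star x - star y"
 using star_add[of x "- y"] by simp

lemma star_sum: "star (\<Sum>i\<in>A. f i) = (\<Sum>i\<in>A. star (f i))"
 by (induction A rule: infinite_finite_induct) (simp_all add: star_add)

lemma star_scaleR: "star (r *\<^sub>R x) = r *\<^sub>R star x"
 using star_scaleC[of "complex_of_real r" x] by (simp add: scaleC_of_real)

declare star_star [simp]

lemma star_one [simp]: "star (1::'a::{cstar_algebra,real_normed_algebra_1}) = 1"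
 by (metis star_mult star_star mult_1_left mult_1_right)

lemma norm_star [simp]: "norm (star x) = norm x"
proof -
 have *: "norm x \<le> norm (star x)" for x :: 'a
 proof (cases "x = 0")
  case False
  have "(norm x)\<^sup>2 \<le> norm (star x) * norm x"
   using norm_mult_ineq[of "star x" x] by (simp add: cstar_identity)
  then show ?thesis using False by (simp add: power2_eq_square)
 qed simp
 show ?thesis using *[of x] *[of "star x"] by simp
qed

lemma star_mult_self_eq_0 [simp]: "star x * x = 0 \<longleftrightarrow> x = 0"
 using cstar_identity[of x] by (metis norm_eq_zero zero_eq_power2 mult_zero_right)

lemma bounded_linear_star: "bounded_linear star"
 by (rule bounded_linear_intro[of _ 1]) (simp_all add: star_add star_scaleR)

lemma bounded_bilinear_scaleC: "bounded_bilinear (%c x. c *\<^sub>C x)"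
proof
 fix r :: real and c :: complex and x :: 'a
 show "(r *\<^sub>R c) *\<^sub>C x = r *\<^sub>R c *\<^sub>C x"
  by (simp add: scaleR_conv_of_real scaleC_scaleC[symmetric] scaleC_of_real)
 show "c *\<^sub>C r *\<^sub>R x = r *\<^sub>R c *\<^sub>C x"
  by (simp add: scaleC_of_real[symmetric] scaleC_scaleC mult.commute)
 show "\<exists>K. \<forall>a (b::'a). norm (a *\<^sub>C b) \<le> norm a * norm b * K"
  by (rule exI[of _ 1]) (simp add: norm_scaleC)
qed (simp_all add: scaleC_add_left scaleC_add_right)

lemmas tendsto_star [tendsto_intros] = bounded_linear.tendsto[OF bounded_linear_star]
lemmas continuous_on_star [continuous_intros] =
 bounded_linear.continuous_on[OF bounded_linear_star]
lemmas tendsto_scaleC [tendsto_intros] = bounded_bilinear.tendsto[OF bounded_bilinear_scaleC]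
lemmas continuous_on_scaleC [continuous_intros] =
 bounded_bilinear.continuous_on[OF bounded_bilinear_scaleC]

section \<open>Characters of commutative *-subalgebras\<close>

text \<open>Not assumed closed, so that the image of \<open>C_c(G)\<close> in the crossed product
  qualifies.\<close>

definition comm_star_subalgebra :: "'c::cstar_algebra set => bool" where
 "comm_star_subalgebra D \<longleftrightarrow> complex_subspace D \<and>
   (\<forall>x\<in>D. star x \<in> D \<and> (\<forall>y\<in>D. x * y \<in> D \<and> x * y = y * x))"

text \<open>The absolute value of a character is a multiplicative C*-seminorm; characters are found
  below by producing such a seminorm first.\<close>

definition cseminorm :: "'c::cstar_algebra set => ('c => real) => bool" where
 "cseminorm D q \<longleftrightarrow>
   (\<forall>x\<in>D. 0 \<le> q x \<and> q (star x * x) = (q x)\<^sup>2 \<and> (\<forall>c. q (c *\<^sub>C x) = cmod c * q x) \<and>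
    (\<forall>y\<in>D. q (x + y) \<le> q x + q y \<and> q (x * y) \<le> q x * q y))"

lemma cseminormD:
 assumes "cseminorm D q" "x \<in> D"
 shows "0 \<le> q x" "q (star x * x) = (q x)\<^sup>2" "q (c *\<^sub>C x) = cmod c * q x"
  "y \<in> D ==> q (x + y) \<le> q x + q y" "y \<in> D ==> q (x * y) \<le> q x * q y"
 using assms unfolding cseminorm_def by auto

text \<open>The approximating sequence may depend on the pair \<open>x\<close>, \<open>y\<close>:
  the infimum of a chain of seminorms is the limit of one sequence only at finitely many points at a
  time.\<close>

lemma cseminorm_limit:
 fixes q :: "nat => 'c::cstar_algebra => real"
 assumes "comm_star_subalgebra D"
  and "\<And>x y. x \<in> D ==> y \<in> D ==> \<exists>q. (\<forall>k. cseminorm D (q k)) \<and>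
    (\<forall>z\<in>{x, y, x + y, x * y, star x * x}. (%k. q k z) \<longlonglongrightarrow> u z) \<and>
    (\<forall>c. c *\<^sub>C x = y --> (%k. q k (c *\<^sub>C x)) \<longlonglongrightarrow> u (c *\<^sub>C x))"
 shows "cseminorm D u"
 unfolding cseminorm_def
proof (intro ballI conjI allI)
 fix x assume x: "x \<in> D"
 obtain q where q: "\<And>k. cseminorm D (q k)" "(%k. q k x) \<longlonglongrightarrow> u x"
   "(%k. q k (star x * x)) \<longlonglongrightarrow> u (star x * x)"
  using assms(2)[OF x x] by auto
 show "0 \<le> u x"
  using cseminormD(1)[OF q(1) x] by (intro LIMSEQ_le_const[OF q(2)]) auto
 have "(%k. q k (star x * x)) \<longlonglongrightarrow> (u x)\<^sup>2"
  unfolding cseminormD(2)[OF q(1) x] by (intro tendsto_intros q)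
 with q(3) show "u (star x * x) = (u x)\<^sup>2" by (rule LIMSEQ_unique)
next
 fix x and c :: complex assume x: "x \<in> D"
 have cx: "c *\<^sub>C x \<in> D" using assms(1) x unfolding comm_star_subalgebra_def complex_subspace_def by auto
 obtain q where q: "\<And>k. cseminorm D (q k)" "(%k. q k x) \<longlonglongrightarrow> u x"
   "(%k. q k (c *\<^sub>C x)) \<longlonglongrightarrow> u (c *\<^sub>C x)"
  using assms(2)[OF x cx] by auto
 have "(%k. q k (c *\<^sub>C x)) \<longlonglongrightarrow> cmod c * u x"
  unfolding cseminormD(3)[OF q(1) x] by (intro tendsto_intros q)
 with q(3) show "u (c *\<^sub>C x) = cmod c * u x" by (rule LIMSEQ_unique)
next
 fix x y assume x: "x \<in> D" and y: "y \<in> D"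
 obtain q where q: "\<And>k. cseminorm D (q k)" "(%k. q k x) \<longlonglongrightarrow> u x" "(%k. q k y) \<longlonglongrightarrow> u y"
   "(%k. q k (x + y)) \<longlonglongrightarrow> u (x + y)" "(%k. q k (x * y)) \<longlonglongrightarrow> u (x * y)"
  using assms(2)[OF x y] by auto
 show "u (x + y) \<le> u x + u y"
  by (rule LIMSEQ_le[OF q(4) tendsto_add[OF q(2,3)]])
   (auto intro: cseminormD(4)[OF q(1) x y])
 show "u (x * y) \<le> u x * u y"
  by (rule LIMSEQ_le[OF q(5) tendsto_mult[OF q(2,3)]])
   (auto intro: cseminormD(5)[OF q(1) x y])
qed

text \<open>Zorn's lemma for the pointwise order: the infimum of a chain is again a C*-seminorm and
  keeps the prescribed value at \<open>x0\<close>.\<close>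

lemma minimal_cseminorm:
 fixes x0 :: "'c::cstar_algebra"
 assumes D: "comm_star_subalgebra D" and x0: "x0 \<in> D"
 obtains q where "cseminorm D q" "\<And>x. x \<in> D ==> q x \<le> norm x" "q x0 = norm x0"
  "\<And>q' x. cseminorm D q' ==> (\<And>x. x \<in> D ==> q' x \<le> q x) ==> q' x0 = norm x0 ==> x \<in> D ==> q' x = q x"
proof -
 have Dsub: "complex_subspace D" using D by (simp add: comm_star_subalgebra_def)
 have Dc: "x + y \<in> D" "x * y \<in> D" "star x \<in> D" "c *\<^sub>C x \<in> D" if "x \<in> D" "y \<in> D" for x y c
  using D that unfolding comm_star_subalgebra_def complex_subspace_def by auto
 \<comment> \<open>Fixing the value 0 off \<open>D\<close> makes functions that agree on
   \<open>D\<close> equal, so minimality can be read off on \<open>D\<close> alone.\<close>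
 define A where "A = {q. cseminorm D q \<and> (\<forall>x\<in>D. q x \<le> norm x) \<and> q x0 = norm x0 \<and> (\<forall>x. x \<notin> D --> q x = (0::real))}"
 define P where "P = (%q q' :: 'c => real. q' \<le> q)"
 have norm_cs: "cseminorm D norm"
  by (simp add: cseminorm_def cstar_identity norm_scaleC norm_triangle_ineq norm_mult_ineq)
 have restr: "cseminorm D (%x. if x \<in> D then q x else 0)" if "cseminorm D q" for q :: "'c => real"
  using that Dc unfolding cseminorm_def by auto
 have "\<exists>m\<in>A. \<forall>a\<in>A. P m a --> a = m"
 proof (rule predicate_Zorn)
  show "partial_order_on A (relation_of P A)"
   by (rule partial_order_on_relation_ofI) (auto simp: P_def)
 next
  fix C assume C: "C \<in> Chains (relation_of P A)"
  show "\<exists>u\<in>A. \<forall>a\<in>C. P a u"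
  proof (cases "C = {}")
   case True
   have "(%x. if x \<in> D then norm x else 0) \<in> A"
    using restr[OF norm_cs] x0 by (simp add: A_def)
   with True show ?thesis by blast
  next
   case False
   have CA: "C \<subseteq> A" using C unfolding Chains_def relation_of_def by auto
   have tot: "q \<le> q' \<or> q' \<le> q" if "q \<in> C" "q' \<in> C" for q q'
    using C that unfolding Chains_def relation_of_def P_def by auto
   have nn: "0 \<le> q x" if "q \<in> C" for q x
    using that CA cseminormD(1)[of D q x] unfolding A_def by (cases "x \<in> D") auto
   define u where "u = (%x. INF q\<in>C. q x)"
   have bdd: "bdd_below ((%q. q x) ` C)" for x
    using nn by (intro bdd_belowI2[of _ 0]) auto
   have ule: "u x \<le> q x" if "q \<in> C" for q x
    unfolding u_def by (rule cINF_lower[OF bdd that])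
   \<comment> \<open>In a chain one member is close to the infimum at finitely many points at once:
     of two members the smaller one serves both.\<close>
   have ex: "\<exists>q\<in>C. \<forall>x\<in>F. q x < u x + e" if "finite F" "e > 0" for F and e :: real
    using that
   proof (induction F rule: finite_induct)
    case empty then show ?case using False by auto
   next
    case (insert x F)
    then obtain q where q: "q \<in> C" "\<forall>x\<in>F. q x < u x + e" by auto
    have "\<exists>q\<in>C. q x < u x + e"
     using cINF_less_iff[OF False bdd, of x "u x + e"] insert.prems unfolding u_def by auto
    then obtain q' where q': "q' \<in> C" "q' x < u x + e" by auto
    show ?case
    proof (cases "q \<le> q'")
     case True
     then have "q x < u x + e" using q'(2) by (meson le_funD order.strict_trans1)
     with q show ?thesis by auto
    next
     case F: False
     then have "q' \<le> q" using tot[OF q(1) q'(1)] by auto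
     then have "\<forall>x\<in>F. q' x < u x + e" using q(2) by (meson le_funD order.strict_trans1)
     with q' show ?thesis by auto
    qed
   qed
   have seq: "\<exists>s. (\<forall>k. s k \<in> C) \<and> (\<forall>x\<in>F. (%k. s k x) \<longlonglongrightarrow> u x)" if F: "finite F" for F
   proof -
    have "\<forall>k. \<exists>q\<in>C. \<forall>x\<in>F. q x < u x + inverse (real (Suc k))"
     using ex[OF F] by simp
    then obtain s where s: "\<And>k. s k \<in> C" "\<And>k x. x \<in> F ==> s k x < u x + inverse (real (Suc k))"
     by metis
    have "(%k. s k x) \<longlonglongrightarrow> u x" if "x \<in> F" for x
    proof (rule tendsto_sandwich[of "%k. u x" _ _ "%k. u x + inverse (real (Suc k))"])
     show "(%k. u x + inverse (real (Suc k))) \<longlonglongrightarrow> u x"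
      using tendsto_add[OF tendsto_const[of "u x"] LIMSEQ_inverse_real_of_nat] by simp
     show "\<forall>\<^sub>F k in sequentially. s k x \<le> u x + inverse (real (Suc k))"
      using s(2)[OF that] by (intro always_eventually allI less_imp_le)
    qed (use s ule that in auto)
    with s show ?thesis by blast
   qed
   have "cseminorm D u"
   proof (rule cseminorm_limit[OF D])
    fix x y assume "x \<in> D" "y \<in> D"
    obtain s where s: "\<And>k. s k \<in> C" "\<And>z. z \<in> {x, y, x + y, x * y, star x * x} ==> (%k. s k z) \<longlonglongrightarrow> u z"
     using seq[of "{x, y, x + y, x * y, star x * x}"] by auto
    then show "\<exists>q. (\<forall>k. cseminorm D (q k)) \<and>
     (\<forall>z\<in>{x, y, x + y, x * y, star x * x}. (%k. q k z) \<longlonglongrightarrow> u z) \<and>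
     (\<forall>c. c *\<^sub>C x = y --> (%k. q k (c *\<^sub>C x)) \<longlonglongrightarrow> u (c *\<^sub>C x))"
     using CA unfolding A_def by (intro exI[of _ s]) auto
   qed
   moreover have "u x \<le> norm x" if "x \<in> D" for x
   proof -
    obtain q where "q \<in> C" using False by auto
    then show ?thesis using ule[of q x] CA that unfolding A_def by force
   qed
   moreover have "u x0 = norm x0" "x \<notin> D ==> u x = 0" for x
   proof -
    have "(%q. q x0) ` C = (%q. norm x0) ` C"
     by (rule image_cong) (use CA in \<open>auto simp: A_def\<close>)
    then show "u x0 = norm x0" using False unfolding u_def by (simp add: image_constant_conv)
    assume "x \<notin> D"
    then have "(%q. q x) ` C = (%q. 0) ` C"
     by (intro image_cong) (use CA in \<open>auto simp: A_def\<close>)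
    then show "u x = 0" using False unfolding u_def by (simp add: image_constant_conv)
   qed
   ultimately have "u \<in> A" unfolding A_def by auto
   with ule show ?thesis unfolding P_def le_fun_def by auto
  qed
 qed
 then obtain q where q: "q \<in> A" "\<And>a. a \<in> A ==> a \<le> q ==> a = q"
  unfolding P_def by blast
 show ?thesis
 proof (rule that[of q])
  fix q' :: "'c => real" and x
  assume q': "cseminorm D q'" "\<And>x. x \<in> D ==> q' x \<le> q x" "q' x0 = norm x0" "x \<in> D"
  define a where "a = (%x. if x \<in> D then q' x else 0)"
  have "a \<in> A" using restr[OF q'(1)] q' q(1) x0 unfolding A_def a_def by force
  moreover have "a \<le> q" using q'(2) q(1) unfolding a_def A_def by (auto simp: le_fun_def)
  ultimately have "a x = q x" using q(2)[of a] by simp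
  with q'(4) show "q' x = q x" by (simp add: a_def)
 qed (use q(1) in \<open>auto simp: A_def\<close>)
qed


text \<open>The iterate of left multiplication stands for \<open>x^k y\<close>; without a unit there
  is no \<open>x^0\<close> to multiply by.\<close>

lemma funpow_mult_comm:
 fixes x :: "'c::cstar_algebra"
 assumes D: "comm_star_subalgebra D" and x: "x \<in> D" "star x = x"
 shows "y \<in> D ==> ((*) x ^^ k) y \<in> D"
  and "((*) x ^^ k) (y + z) = ((*) x ^^ k) y + ((*) x ^^ k) z"
  and "((*) x ^^ k) (c *\<^sub>C y) = c *\<^sub>C ((*) x ^^ k) y"
  and "y \<in> D ==> z \<in> D ==> ((*) x ^^ (k + l)) (y * z) = ((*) x ^^ k) y * ((*) x ^^ l) z"
  and "y \<in> D ==> star (((*) x ^^ k) y) = ((*) x ^^ k) (star y)"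
proof -
 have Dc: "a * b \<in> D" "star a \<in> D" "a * b = b * a" if "a \<in> D" "b \<in> D" for a b
  using D that unfolding comm_star_subalgebra_def complex_subspace_def by auto
 show 1: "((*) x ^^ k) y \<in> D" if "y \<in> D" for k y
  using that by (induction k) (auto simp: Dc x)
 show "((*) x ^^ k) (y + z) = ((*) x ^^ k) y + ((*) x ^^ k) z"
  by (induction k) (simp_all add: distrib_left)
 show "((*) x ^^ k) (c *\<^sub>C y) = c *\<^sub>C ((*) x ^^ k) y"
  by (induction k) (simp_all add: mult_scaleC_right)
 have 2: "((*) x ^^ l) (y * z) = y * ((*) x ^^ l) z" if "y \<in> D" "z \<in> D" for l y z
  using that by (induction l) (simp_all add: mult.assoc[symmetric] Dc x)
 show "((*) x ^^ (k + l)) (y * z) = ((*) x ^^ k) y * ((*) x ^^ l) z" if "y \<in> D" "z \<in> D"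
  using that by (induction k) (simp_all add: 2 mult.assoc)
 show "star (((*) x ^^ k) y) = ((*) x ^^ k) (star y)" if "y \<in> D"
  using that by (induction k) (simp_all add: star_mult x Dc 1)
qed

text \<open>Multiplication by \<open>x\<close> does not increase \<open>q\<close> because
  \<open>q x \<le> 1\<close>, so the limit exists. The multiplicative laws survive since
  \<open>x^(2 k) (y z) = (x^k y) (x^k z)\<close>, which is read along the even subsequence.\<close>

lemma cseminorm_averaged:
 fixes x :: "'c::cstar_algebra"
 assumes D: "comm_star_subalgebra D" and x: "x \<in> D" "star x = x" and q: "cseminorm D q" "q x \<le> 1"
 obtains q' where "cseminorm D q'" "\<And>y. y \<in> D ==> (%k. q (((*) x ^^ k) y)) \<longlonglongrightarrow> q' y"
  "\<And>y k. y \<in> D ==> q' y \<le> q (((*) x ^^ k) y)"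
proof -
 note fm = funpow_mult_comm[OF D x]
 have Dc: "a + b \<in> D" "a * b \<in> D" "star a \<in> D" "c *\<^sub>C a \<in> D" if "a \<in> D" "b \<in> D" for a b c
  using D that unfolding comm_star_subalgebra_def complex_subspace_def by auto
 define Q where "Q = (%k y. q (((*) x ^^ k) y))"
 have dec: "decseq (%k. Q k y)" if y: "y \<in> D" for y
 proof (rule decseq_SucI)
  fix k
  have "Q (Suc k) y \<le> q x * Q k y"
   unfolding Q_def using cseminormD(5)[OF q(1) x(1) fm(1)[OF y]] by simp
  also have "\<dots> \<le> 1 * Q k y"
   by (intro mult_right_mono q) (simp add: Q_def cseminormD(1)[OF q(1)] fm y)
  finally show "Q (Suc k) y \<le> Q k y" by simp
 qed
 have lim: "(%k. Q k y) \<longlonglongrightarrow> lim (%k. Q k y)" if y: "y \<in> D" for y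
 proof -
  have "convergent (%k. Q k y)"
   using decseq_convergent[OF dec[OF y], of 0] cseminormD(1)[OF q(1)] fm(1)[OF y]
   unfolding Q_def convergent_def by metis
  then show ?thesis by (simp add: convergent_LIMSEQ_iff)
 qed
 define u where "u = (%y. lim (%k. Q k y))"
 have u: "(%k. Q k y) \<longlonglongrightarrow> u y" if "y \<in> D" for y using lim[OF that] by (simp add: u_def)
 have even: "(%k. Q (k + k) y) \<longlonglongrightarrow> u y" if "y \<in> D" for y
  using LIMSEQ_subseq_LIMSEQ[OF u[OF that], of "%k. k + k"] by (simp add: strict_mono_def o_def)
 have "cseminorm D u"
  unfolding cseminorm_def
 proof (intro ballI conjI allI)
  fix y assume y: "y \<in> D"
  show "0 \<le> u y"
   using cseminormD(1)[OF q(1)] fm(1)[OF y] by (intro LIMSEQ_le_const[OF u[OF y]]) (auto simp: Q_def)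
  have "Q (k + k) (star y * y) = (Q k y)\<^sup>2" for k
   unfolding Q_def using y Dc fm
   by (simp add: fm(5)[symmetric] cseminormD(2)[OF q(1), symmetric])
  then have "(%k. Q (k + k) (star y * y)) \<longlonglongrightarrow> (u y)\<^sup>2" using u[OF y] by (auto intro!: tendsto_intros)
  then show "u (star y * y) = (u y)\<^sup>2"
   by (rule LIMSEQ_unique[OF even[OF Dc(2)[OF Dc(3)[OF y y] y]]])
  fix c
  have "Q k (c *\<^sub>C y) = cmod c * Q k y" for k
   unfolding Q_def using y fm by (simp add: cseminormD(3)[OF q(1)])
  then have "(%k. Q k (c *\<^sub>C y)) \<longlonglongrightarrow> cmod c * u y" using u[OF y] by (auto intro!: tendsto_intros)
  then show "u (c *\<^sub>C y) = cmod c * u y"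
   by (rule LIMSEQ_unique[OF u[OF Dc(4)[OF y y]]])
 next
  fix y z assume y: "y \<in> D" and z: "z \<in> D"
  have "Q k (y + z) \<le> Q k y + Q k z" for k
   unfolding Q_def fm(2) by (rule cseminormD(4)[OF q(1)]) (auto simp: fm y z)
  then show "u (y + z) \<le> u y + u z"
   using LIMSEQ_le[OF u[OF Dc(1)[OF y z]] tendsto_add[OF u[OF y] u[OF z]]] by blast
  have "Q (k + k) (y * z) \<le> Q k y * Q k z" for k
   unfolding Q_def fm(4)[OF y z] by (rule cseminormD(5)[OF q(1)]) (auto simp: fm y z)
  then show "u (y * z) \<le> u y * u z"
   using LIMSEQ_le[OF even[OF Dc(2)[OF y z]] tendsto_mult[OF u[OF y] u[OF z]]] by blast
 qed
 moreover have "u y \<le> Q k y" if "y \<in> D" for y k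
  by (rule decseq_ge[OF dec u]) (use that in auto)
 ultimately show ?thesis using that[of u] u unfolding Q_def by blast
qed

text \<open>The C*-identity gives the value 1 at arbitrarily high powers, passing from exponent
  \<open>m + 1\<close> to \<open>2 m + 2\<close>, and the values decrease in the exponent, so all of
  them are 1.\<close>

lemma cseminorm_power:
 fixes x :: "'c::cstar_algebra"
 assumes D: "comm_star_subalgebra D" and x: "x \<in> D" "star x = x" and q: "cseminorm D q" "q x = 1"
 shows "q (((*) x ^^ k) x) = 1"
proof -
 note fm = funpow_mult_comm[OF D x]
 have up: "q (((*) x ^^ (j + k)) x) \<le> q (((*) x ^^ k) x)" for j k
 proof (induction j)
  case (Suc j)
  have "q (((*) x ^^ (Suc j + k)) x) \<le> q x * q (((*) x ^^ (j + k)) x)"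
   using cseminormD(5)[OF q(1) x(1) fm(1)[OF x(1)]] by simp
  with Suc q(2) show ?case by simp
 qed simp
 have pw: "\<exists>m\<ge>j. q (((*) x ^^ m) x) = 1" for j
 proof (induction j)
  case 0 then show ?case using q(2) by (intro exI[of _ 0]) auto
 next
  case (Suc j)
  then obtain m where m: "m \<ge> j" "q (((*) x ^^ m) x) = 1" by blast
  have "((*) x ^^ (Suc (m + m))) x = ((*) x ^^ m) x * ((*) x ^^ m) x"
   using fm(4)[OF x(1) x(1), of m m] by (simp add: funpow_swap1)
  also have "\<dots> = star (((*) x ^^ m) x) * ((*) x ^^ m) x" by (simp add: fm x)
  finally have "q (((*) x ^^ (Suc (m + m))) x) = 1"
   using cseminormD(2)[OF q(1) fm(1)[OF x(1), of m]] m(2) by simp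
  with m(1) show ?case by (intro exI[of _ "Suc (m + m)"]) auto
 qed
 obtain m where "m \<ge> k" "q (((*) x ^^ m) x) = 1" using pw by blast
 then have "1 \<le> q (((*) x ^^ k) x)" using up[of "m - k" k] by simp
 moreover have "q (((*) x ^^ k) x) \<le> 1" using up[of k 0] q(2) by simp
 ultimately show ?thesis by simp
qed

text \<open>If \<open>q\<close> is minimal among the C*-seminorms with prescribed value at the self-adjoint element
 \<open>x\<^sub>0\<close>, then \<open>y \<mapsto> lim q (x\<^sup>k y)\<close> cannot be strictly smaller than \<open>q\<close>.\<close>

lemma multiplicative_cseminorm:
 fixes x0 :: "'c::cstar_algebra"
 assumes D: "comm_star_subalgebra D" and x0: "x0 \<in> D" "star x0 = x0" "norm x0 = 1"
 obtains q where "cseminorm D q" "\<And>x. x \<in> D ==> q x \<le> norm x" "q x0 = 1"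
  "\<And>x y. x \<in> D ==> y \<in> D ==> q (x * y) = q x * q y"
proof -
 have Dc: "a + b \<in> D" "a * b \<in> D" "star a \<in> D" "c *\<^sub>C a \<in> D" "a * b = b * a" if "a \<in> D" "b \<in> D" for a b c
  using D that unfolding comm_star_subalgebra_def complex_subspace_def by auto
 obtain q where q: "cseminorm D q" "\<And>x. x \<in> D ==> q x \<le> norm x" "q x0 = 1" and
  min: "\<And>q' x. cseminorm D q' ==> (\<And>x. x \<in> D ==> q' x \<le> q x) ==> q' x0 = 1 ==> x \<in> D ==> q' x = q x"
  by (rule minimal_cseminorm[OF D x0(1), unfolded x0(3)]) blast
 \<comment> \<open>The limit \<open>q'\<close> lies below \<open>q\<close> and keeps the value at
   \<open>x0\<close>, so minimality gives \<open>q' y = q y\<close>, while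
   \<open>q' y \<le> q (x * y) \<le> q y\<close>.\<close>
 have key: "q (x * y) = q y"
  if x: "x \<in> D" "star x = x" "q x = 1" "\<And>k. q (((*) x ^^ k) x0) = 1" and y: "y \<in> D" for x y
 proof -
  obtain q' where q': "cseminorm D q'" "\<And>y. y \<in> D ==> (%k. q (((*) x ^^ k) y)) \<longlonglongrightarrow> q' y"
   "\<And>y k. y \<in> D ==> q' y \<le> q (((*) x ^^ k) y)"
   by (rule cseminorm_averaged[OF D x(1,2) q(1) eq_refl[OF x(3)]]) blast
  have "q' x0 = 1" using q'(2)[OF x0(1)] x(4) by (simp add: LIMSEQ_const_iff)
  moreover have "q' z \<le> q z" if "z \<in> D" for z using q'(3)[OF that, of 0] by simp
  ultimately have "q' y = q y" using min[OF q'(1)] y by blast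
  moreover have "q' y \<le> q (x * y)" using q'(3)[OF y, of 1] by simp
  moreover have "q (x * y) \<le> q y" using cseminormD(5)[OF q(1) x(1) y] x(3) by simp
  ultimately show ?thesis by simp
 qed
 have a: "q (x0 * y) = q y" if "y \<in> D" for y
  by (rule key) (use cseminorm_power[OF D x0(1,2) q(1,3)] x0 q that in auto)
 \<comment> \<open>The condition on \<open>x^k x0\<close> holds because multiplication by
   \<open>x0\<close> is already known to preserve \<open>q\<close>.\<close>
 have sa1: "q (x * y) = q y" if x: "x \<in> D" "star x = x" "q x = 1" and y: "y \<in> D" for x y
 proof (rule key[OF x _ y])
  fix k
  note fm = funpow_mult_comm[OF D x(1,2)]
  show "q (((*) x ^^ k) x0) = 1"
  proof (cases k)
   case (Suc j)
   have "((*) x ^^ k) x0 = ((*) x ^^ (j + 0)) (x * x0)" by (simp add: Suc funpow_swap1)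
   also have "\<dots> = x0 * ((*) x ^^ j) x" using fm(4)[OF x(1) x0(1), of j 0] Dc x x0 fm by simp
   finally show ?thesis using a fm x cseminorm_power[OF D x(1,2) q(1) x(3)] by simp
  qed (use q in simp)
 qed
 have sa: "q (x * y) = q x * q y" if x: "x \<in> D" "star x = x" and y: "y \<in> D" for x y
 proof (cases "q x = 0")
  case True
  then show ?thesis
   using cseminormD(5)[OF q(1) x(1) y] cseminormD(1)[OF q(1) Dc(2)[OF x(1) y]] by simp
 next
  case False
  define r where "r = complex_of_real (1 / q x)"
  have r: "cmod r = 1 / q x" using False cseminormD(1)[OF q(1) x(1)] by (simp add: r_def norm_divide)
  have "q ((r *\<^sub>C x) * y) = q y"
   by (rule sa1) (use x y Dc r False in \<open>auto simp: cseminormD(3)[OF q(1)] star_scaleC r_def\<close>)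
  then show ?thesis using r False x y Dc by (simp add: mult_scaleC_left cseminormD(3)[OF q(1)] field_simps)
 qed
 \<comment> \<open>Squaring reduces the general case to the self-adjoint elements
   \<open>star x * x\<close> and \<open>star y * y\<close>.\<close>
 have "q (x * y) = q x * q y" if x: "x \<in> D" and y: "y \<in> D" for x y
 proof -
  have "star (x * y) * (x * y) = (star x * x) * (star y * y)"
   using Dc(5)[OF Dc(3)[OF y y] Dc(2)[OF Dc(3)[OF x x] x]] by (simp add: star_mult flip: mult.assoc)
  then have "(q (x * y))\<^sup>2 = (q x * q y)\<^sup>2"
   using sa[of "star x * x" "star y * y"] x y Dc
   by (simp add: cseminormD(2)[OF q(1), symmetric] star_mult power_mult_distrib)
  then show ?thesis using x y Dc cseminormD(1)[OF q(1)] by (simp add: power2_eq_iff_nonneg)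
 qed
 with that q show ?thesis by blast
qed

text \<open>Ostrowski's argument: if the minimum \<open>m\<close> of \<open>z \<mapsto> q (x - z a)\<close> were positive, factoring
 \<open>w\<^sup>N - d\<^sup>N a\<^sup>N\<close> for \<open>N = 2\<^sup>k\<close> would show that it is attained on a whole disc around each minimiser.\<close>

lemma multiplicative_cseminorm_spans:
 fixes a :: "'c::cstar_algebra"
 assumes D: "comm_star_subalgebra D" and q: "cseminorm D q"
  and mult: "\<And>x y. x \<in> D ==> y \<in> D ==> q (x * y) = q x * q y"
  and a: "a \<in> D" "q a = 1" and x: "x \<in> D"
 shows "\<exists>z. q (x - z *\<^sub>C a) = 0"
proof -
 have Dc: "y + z \<in> D" "y * z \<in> D" "c *\<^sub>C y \<in> D" "y * z = z * y" if "y \<in> D" "z \<in> D" for y z c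
  using D that unfolding comm_star_subalgebra_def complex_subspace_def by auto
 have Dd: "y - z \<in> D" if "y \<in> D" "z \<in> D" for y z
  using Dc(1)[OF that(1) Dc(3)[OF that(2) that(2), of "-1"]] by simp
 have qm: "q (- y) = q y" if "y \<in> D" for y using cseminormD(3)[OF q that, of "-1"] by simp
 have tri: "q (y - z) \<le> q y + q z" if "y \<in> D" "z \<in> D" for y z
  using cseminormD(4)[OF q that(1) Dc(3)[OF that(2) that(2), of "-1"]] qm that by simp
 define g where "g = (%z. q (x - z *\<^sub>C a))"
 have gD: "x - z *\<^sub>C a \<in> D" for z by (intro Dd x Dc(3)[OF a(1) a(1)])
 have g_lip: "g z \<le> g z' + cmod (z' - z)" for z z'
  using cseminormD(4)[OF q gD[of z'] Dc(3)[OF a(1) a(1), of "z' - z"]] a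
  by (simp add: g_def cseminormD(3)[OF q a(1)]) (simp add: scaleC_diff_left)
 have g_lip': "\<bar>g z - g z'\<bar> \<le> cmod (z - z')" for z z'
  using g_lip[of z z'] g_lip[of z' z] by (simp add: norm_minus_commute)
 have g_cont: "continuous_on UNIV g"
  by (rule lipschitz_on_continuous_on[OF lipschitz_onI[of _ _ 1]])
   (use g_lip' in \<open>auto simp: dist_norm\<close>)
 \<comment> \<open>Growth at infinity confines the infimum of \<open>g\<close> to the disc of radius
   \<open>2 * q x\<close>.\<close>
 have coer: "cmod z - q x \<le> g z" for z
  using tri[OF x gD[of z]] a cseminormD(3)[OF q a(1), of z] by (simp add: g_def)
 define R where "R = 2 * q x"
 have R: "0 \<le> R" using cseminormD(1)[OF q x] by (simp add: R_def)
 obtain z0 where z0: "z0 \<in> cball 0 R" "\<And>z. z \<in> cball 0 R ==> g z0 \<le> g z"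
  using continuous_attains_inf[OF compact_cball _ continuous_on_subset[OF g_cont subset_UNIV], of 0 R] R
  by (metis cball_eq_empty not_less)
 have inf: "g z0 \<le> g z" for z
 proof (cases "z \<in> cball 0 R")
  case False
  then have "q x < g z" using coer[of z] by (simp add: R_def)
  moreover have "g z0 \<le> g 0" using R by (intro z0) auto
  ultimately show ?thesis by (simp add: g_def)
 qed (use z0 in auto)
 define m where "m = g z0"
 have m0: "0 \<le> m" using cseminormD(1)[OF q gD] by (simp add: m_def g_def)
 show ?thesis
 proof (cases "m = 0")
  case True then show ?thesis unfolding m_def g_def by blast
 next
  case False
  then have m: "0 < m" using m0 by simp
  define sq where "sq = (%(y::'c) k. ((%y. y * y) ^^ k) y)"
  have sqS: "sq y (Suc k) = sq y k * sq y k" for y k by (simp add: sq_def)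
  have sq0: "sq y 0 = y" for y by (simp add: sq_def)
  have sqD: "sq y k \<in> D" if "y \<in> D" for y k
   using that by (induction k) (auto simp: sqS sq0 Dc)
  have sqq: "q (sq y k) = q y ^ (2 ^ k)" if "y \<in> D" for y k
   by (induction k) (auto simp: sqS sq0 mult sqD that power_add[symmetric] mult_2)
  have step: "g (z1 + d) = m" if z1: "g z1 = m" and d: "cmod d \<le> m / 2" for z1 d
  proof -
   define w where "w = x - z1 *\<^sub>C a"
   have w: "w \<in> D" "q w = m" using gD z1 by (auto simp: w_def g_def)
   have wd: "w - e *\<^sub>C a = x - (z1 + e) *\<^sub>C a" for e by (simp add: w_def scaleC_add_left)
   have wge: "m \<le> q (w - e *\<^sub>C a)" for e unfolding wd using inf[of "z1 + e"] by (simp add: g_def m_def)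
   \<comment> \<open>With \<open>W\<close>, \<open>A\<close>, \<open>c\<close> the
     \<open>2^k\<close>-th powers of \<open>w\<close>, \<open>a\<close>, \<open>e\<close>, the next
     difference factors as \<open>(W - c A) (W + c A)\<close>. The second factor is at least
     \<open>m^(2^k)\<close>, by the induction hypothesis at a root \<open>e'\<close> of
     \<open>e'^(2^k) = - c\<close>.\<close>
   have low: "q (w - e *\<^sub>C a) * m ^ (2 ^ k - 1) \<le> q (sq w k - (e ^ (2 ^ k)) *\<^sub>C sq a k)" for e k
   proof (induction k arbitrary: e)
    case 0 then show ?case by (simp add: sq0)
   next
    case (Suc k)
    define W A c where "W = sq w k" and "A = sq a k" and "c = e ^ (2 ^ k)"
    have WA: "W \<in> D" "A \<in> D" using sqD w a by (auto simp: W_def A_def)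
    obtain e' where e'': "- c = e' ^ (2 ^ k)"
     by (rule exists_complex_root[of "2 ^ k" "- c"]) auto
    then have e': "e' ^ (2 ^ k) = - c" by simp
    have "sq w (Suc k) - (e ^ (2 ^ Suc k)) *\<^sub>C sq a (Suc k) = W * W - (c * c) *\<^sub>C (A * A)"
     by (simp add: sqS W_def A_def c_def power_add[symmetric] mult_2)
    also have "\<dots> = (W - c *\<^sub>C A) * (W - (- c) *\<^sub>C A)"
     using Dc(4)[OF WA] by (simp add: algebra_simps mult_scaleC_left mult_scaleC_right scaleC_scaleC
       scaleC_diff_right)
    finally have eq: "q (sq w (Suc k) - (e ^ (2 ^ Suc k)) *\<^sub>C sq a (Suc k)) =
      q (W - c *\<^sub>C A) * q (W - (- c) *\<^sub>C A)"
     using mult WA Dd Dc by metis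
    have "m ^ (2 ^ k) = m * m ^ (2 ^ k - 1)" by (metis power_eq_if power_not_zero zero_neq_numeral)
    also have "\<dots> \<le> q (w - e' *\<^sub>C a) * m ^ (2 ^ k - 1)" using wge m by (intro mult_right_mono) auto
    also have "\<dots> \<le> q (W - (- c) *\<^sub>C A)" using Suc.IH[of e'] by (simp only: e' W_def A_def)
    finally have 1: "m ^ (2 ^ k) \<le> q (W - (- c) *\<^sub>C A)" .
    have 2: "q (w - e *\<^sub>C a) * m ^ (2 ^ k - 1) \<le> q (W - c *\<^sub>C A)"
     using Suc.IH[of e] by (simp only: c_def W_def A_def)
    have "(2::nat) ^ Suc k - 1 = (2 ^ k - 1) + 2 ^ k" by simp
    then have "q (w - e *\<^sub>C a) * m ^ (2 ^ Suc k - 1) = (q (w - e *\<^sub>C a) * m ^ (2 ^ k - 1)) * m ^ (2 ^ k)"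
     by (simp only: power_add mult.assoc)
    also have "\<dots> \<le> q (W - c *\<^sub>C A) * q (W - (- c) *\<^sub>C A)"
     using 1 2 m WA Dd Dc by (intro mult_mono cseminormD(1)[OF q]) auto
    finally show ?case by (simp only: eq)
   qed
   have bd: "q (w - d *\<^sub>C a) \<le> m * (1 + (1 / 2) ^ (2 ^ k))" for k
   proof -
    have "q (sq w k - (d ^ (2 ^ k)) *\<^sub>C sq a k) \<le> q (sq w k) + cmod (d ^ (2 ^ k)) * q (sq a k)"
     using tri[OF sqD[OF w(1)] Dc(3)[OF sqD[OF a(1)] a(1)]] cseminormD(3)[OF q sqD[OF a(1)]] by metis
    also have "\<dots> = m ^ (2 ^ k) + cmod d ^ (2 ^ k)" using sqq w a by (simp add: norm_power)
    also have "\<dots> \<le> m ^ (2 ^ k) + (m / 2) ^ (2 ^ k)" using d by (intro add_left_mono power_mono) auto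
    also have "\<dots> = m ^ (2 ^ k) * (1 + (1 / 2) ^ (2 ^ k))" by (simp add: power_divide field_simps)
    also have "m ^ (2 ^ k) = m * m ^ (2 ^ k - 1)" by (metis power_eq_if power_not_zero zero_neq_numeral)
    finally have "q (w - d *\<^sub>C a) * m ^ (2 ^ k - 1) \<le> (m * (1 + (1 / 2) ^ (2 ^ k))) * m ^ (2 ^ k - 1)"
     using low[of d k] by (simp add: mult_ac)
    then show ?thesis using m by (simp add: mult_le_cancel_right)
   qed
   have "(%k::nat. (1/2::real) ^ (2 ^ k)) \<longlonglongrightarrow> 0"
    using LIMSEQ_subseq_LIMSEQ[of "%k. (1/2::real) ^ k" 0 "%k. 2 ^ k"]
    by (simp add: o_def strict_mono_def LIMSEQ_power_zero)
   then have "(%k::nat. m * (1 + (1/2::real) ^ (2 ^ k))) \<longlonglongrightarrow> m * (1 + 0)" by (intro tendsto_intros)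
   then have "q (w - d *\<^sub>C a) \<le> m * (1 + 0)" by (rule LIMSEQ_le_const) (use bd in auto)
   then show ?thesis using wge[of d] by (simp add: wd g_def)
  qed
  \<comment> \<open>Steps of length \<open>m / 2\<close> carry the minimum arbitrarily far out,
    against the growth of \<open>g\<close>.\<close>
  have all: "g (z0 + of_nat N * complex_of_real (m / 2)) = m" for N
  proof (induction N)
   case (Suc N)
   show ?case using step[OF Suc.IH, of "complex_of_real (m / 2)"] m by (simp add: algebra_simps add_divide_distrib)
  qed (simp add: m_def)
  obtain N :: nat where N: "real N * (m / 2) > m + q x + cmod z0"
   using m by (metis half_gt_zero reals_Archimedean3)
  have "cmod (of_nat N * complex_of_real (m / 2)) = real N * (m / 2)" using m by (simp add: norm_mult norm_divide)
  then have "real N * (m / 2) \<le> cmod (z0 + of_nat N * complex_of_real (m / 2)) + cmod z0"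
   by (metis add.commute norm_triangle_ineq2 diff_le_eq add_diff_cancel_left' norm_minus_commute norm_triangle_ineq4)
  with coer[of "z0 + of_nat N * complex_of_real (m / 2)"] N all[of N] show ?thesis by linarith
 qed
qed

text \<open>Modulo the kernel of a multiplicative seminorm \<open>q\<close> the algebra is the line
  through \<open>a\<close>, and \<open>f\<close> is the coordinate on that line.\<close>

lemma comm_star_subalgebra_character:
 fixes x0 :: "'c::cstar_algebra"
 assumes D: "comm_star_subalgebra D" and x0: "x0 \<in> D" "star x0 = x0"
 obtains \<kappa> :: "'c => complex" where
  "\<And>x y. x \<in> D ==> y \<in> D ==> \<kappa> (x + y) = \<kappa> x + \<kappa> y"
  "\<And>c x. x \<in> D ==> \<kappa> (c *\<^sub>C x) = c * \<kappa> x"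
  "\<And>x y. x \<in> D ==> y \<in> D ==> \<kappa> (x * y) = \<kappa> x * \<kappa> y"
  "\<And>x. x \<in> D ==> cmod (\<kappa> x) \<le> norm x" "cmod (\<kappa> x0) = norm x0"
proof (cases "x0 = 0")
 case True then show ?thesis using that[of "%_. 0"] by simp
next
 case False
 have Dc: "y + z \<in> D" "y * z \<in> D" "c *\<^sub>C y \<in> D" "y * z = z * y" if "y \<in> D" "z \<in> D" for y z c
  using D that unfolding comm_star_subalgebra_def complex_subspace_def by auto
 have Dd: "y - z \<in> D" if "y \<in> D" "z \<in> D" for y z
  using Dc(1)[OF that(1) Dc(3)[OF that(2) that(2), of "-1"]] by simp
 define a where "a = complex_of_real (1 / norm x0) *\<^sub>C x0"
 have a: "a \<in> D" "star a = a" "norm a = 1"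
  using False x0 Dc by (auto simp: a_def star_scaleC norm_scaleC norm_divide)
 obtain q where q: "cseminorm D q" "\<And>x. x \<in> D ==> q x \<le> norm x" "q a = 1"
  and mult: "\<And>x y. x \<in> D ==> y \<in> D ==> q (x * y) = q x * q y"
  using multiplicative_cseminorm[OF D a] by metis
 have tri: "q (y + z) \<le> q y + q z" if "y \<in> D" "z \<in> D" for y z by (rule cseminormD(4)[OF q(1) that])
 have sc: "q (c *\<^sub>C y) = cmod c * q y" if "y \<in> D" for y c by (rule cseminormD(3)[OF q(1) that])
 have nn: "0 \<le> q y" if "y \<in> D" for y by (rule cseminormD(1)[OF q(1) that])
 have "\<exists>f. \<forall>x\<in>D. q (x - f x *\<^sub>C a) = 0"
  using multiplicative_cseminorm_spans[OF D q(1) mult a(1) q(3)] by (intro bchoice) blast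
 then obtain f where f: "\<And>x. x \<in> D ==> q (x - f x *\<^sub>C a) = 0" by blast
 have zero_add: "q (y + z) = 0" if "q y = 0" "q z = 0" "y \<in> D" "z \<in> D" for y z
  using tri[of y z] nn[of "y + z"] Dc that by fastforce
 have neg: "q (y - z) = q (z - y)" if "y \<in> D" "z \<in> D" for y z
  using sc[OF Dd[OF that], of "-1"] by simp
 have fuq: "f x = z" if "x \<in> D" "q (x - z *\<^sub>C a) = 0" for x z
 proof -
  have "(x - z *\<^sub>C a) + (- 1) *\<^sub>C (x - f x *\<^sub>C a) = (f x - z) *\<^sub>C a" by (simp add: scaleC_diff_left)
  moreover have "q ((x - z *\<^sub>C a) + (- 1) *\<^sub>C (x - f x *\<^sub>C a)) = 0"
   by (rule zero_add) (use that f sc Dd Dc a neg[of _ x] in auto)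
  ultimately have "cmod (f x - z) * q a = 0" using sc a by metis
  then show ?thesis using q(3) by simp
 qed
 have fq: "cmod (f x) = q x" if "x \<in> D" for x
 proof -
  have "q x \<le> q (x - f x *\<^sub>C a) + q (f x *\<^sub>C a)" using tri[of "x - f x *\<^sub>C a" "f x *\<^sub>C a"] that Dd Dc a by simp
  moreover have "q (f x *\<^sub>C a) \<le> q x + q ((- 1) *\<^sub>C (x - f x *\<^sub>C a))"
   using tri[of x "(- 1) *\<^sub>C (x - f x *\<^sub>C a)"] that Dd Dc a by simp
  ultimately show ?thesis using f[OF that] that Dd Dc a neg[of _ x] by (simp add: sc q(3))
 qed
 \<comment> \<open>\<open>a\<close> is only a multiple of the unit of the quotient line:
   \<open>f (x * y) = c * f x * f y\<close>, and multiplying \<open>f\<close> by \<open>c\<close>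
   makes it multiplicative.\<close>
 define c where "c = f (a * a)"
 have c: "cmod c = 1" using fq[of "a * a"] mult a q(3) Dc by (simp add: c_def)
 have f_add: "f (x + y) = f x + f y" if "x \<in> D" "y \<in> D" for x y
 proof (rule fuq)
  have "q ((x - f x *\<^sub>C a) + (y - f y *\<^sub>C a)) = 0" by (rule zero_add) (use that f Dd Dc a in auto)
  then show "q (x + y - (f x + f y) *\<^sub>C a) = 0" by (simp add: scaleC_add_left algebra_simps)
 qed (use that Dc in auto)
 have f_sc: "f (d *\<^sub>C x) = d * f x" if "x \<in> D" for x d
 proof (rule fuq)
  have "d *\<^sub>C x - (d * f x) *\<^sub>C a = d *\<^sub>C (x - f x *\<^sub>C a)" by (simp add: scaleC_diff_right scaleC_scaleC)
  then show "q (d *\<^sub>C x - (d * f x) *\<^sub>C a) = 0" using that f sc Dd Dc a by simp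
 qed (use that Dc in auto)
 have f_mult: "f (x * y) = c * (f x * f y)" if x: "x \<in> D" and y: "y \<in> D" for x y
 proof (rule fuq)
  have "x * y - (c * (f x * f y)) *\<^sub>C a =
    x * (y - f y *\<^sub>C a) + (f y *\<^sub>C ((x - f x *\<^sub>C a) * a) + (f x * f y) *\<^sub>C (a * a - c *\<^sub>C a))"
   by (simp add: algebra_simps mult_scaleC_left mult_scaleC_right scaleC_scaleC scaleC_diff_right)
  moreover have "q \<dots> = 0"
   by (intro zero_add) (use x y f mult sc Dd Dc a c_def in auto)
  ultimately show "q (x * y - (c * (f x * f y)) *\<^sub>C a) = 0" by simp
 qed (use that Dc in auto)
 have x0a: "x0 = complex_of_real (norm x0) *\<^sub>C a" using False by (simp add: a_def scaleC_scaleC)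
 show ?thesis
 proof (rule that[of "%x. c * f x"])
  show "cmod (c * f x) \<le> norm x" if "x \<in> D" for x using that c fq q(2) by (simp add: norm_mult)
  have "cmod (c * f x0) = q x0" using c fq x0 by (simp add: norm_mult)
  also have "\<dots> = norm x0" using sc[OF a(1), of "complex_of_real (norm x0)"] q(3) x0a by simp
  finally show "cmod (c * f x0) = norm x0" .
 qed (use f_add f_sc f_mult in \<open>auto simp: algebra_simps\<close>)
qed

section \<open>Square roots, projections and ideals\<close>

text \<open>\<open>h\<close> stands for \<open>1 - (1 - t)\<^bsup>1/2\<^esup>\<close>, which makes sense without a unit.\<close>

lemma sqrt_exists:
 fixes t :: "'c::cstar_algebra"
 assumes t: "star t = t" "norm t < 1"
 obtains h where "star h = h" "h + h = t + h * h" "norm h \<le> norm t"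
  "\<And>y. y * t = t * y ==> y * h = h * y"
proof -
 define r where "r = norm t"
 \<comment> \<open>Self-adjointness and commutation with the commutant of \<open>t\<close> are
   closed conditions preserved by the iteration, so the fixed point inherits them.\<close>
 define s where "s = {h. norm h \<le> r \<and> star h = h \<and> (\<forall>y. y * t = t * y --> y * h = h * y)}"
 define f where "f = (%h. (1/2) *\<^sub>R (t + h * h))"
 have sD: "norm h \<le> r" "star h = h" "y * t = t * y ==> y * h = h * y" if "h \<in> s" for h y
  using that unfolding s_def by blast+
 have "closed s" unfolding s_def
  by (intro closed_Collect_conj closed_Collect_all closed_Collect_imp open_Collect_const
    closed_Collect_le closed_Collect_eq continuous_intros)
 then have "complete s" by (simp add: complete_eq_closed)
 moreover have "s \<noteq> {}" using t by (auto simp: s_def r_def intro!: exI[of _ 0])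
 moreover have "f ` s \<subseteq> s"
 proof (rule image_subsetI)
  fix h assume h: "h \<in> s"
  have "norm (t + h * h) \<le> norm t + norm (h * h)" by (rule norm_triangle_ineq)
  also have "norm (h * h) \<le> norm h * norm h" by (rule norm_mult_ineq)
  also have "\<dots> \<le> r * 1"
   using sD(1)[OF h] t by (intro mult_mono) (auto simp: r_def)
  finally have "norm (f h) \<le> r" by (simp add: f_def r_def)
  moreover have "star (f h) = f h"
   using sD(2)[OF h] t by (simp add: f_def star_scaleR star_add star_mult)
  moreover have "y * f h = f h * y" if "y * t = t * y" for y
  proof -
   have yh: "y * h = h * y" by (rule sD(3)[OF h that])
   have "y * (h * h) = h * y * h" by (simp only: yh flip: mult.assoc)
   then have "y * (h * h) = h * h * y" by (simp only: mult.assoc yh)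
   then show ?thesis using that by (simp add: f_def distrib_left distrib_right)
  qed
  ultimately show "f h \<in> s" unfolding s_def by (intro CollectI conjI allI impI)
 qed
 moreover have "dist (f h) (f k) \<le> r * dist h k" if "h \<in> s" "k \<in> s" for h k
 proof -
  have "f h - f k = (1/2) *\<^sub>R (h * (h - k) + (h - k) * k)"
   by (simp add: f_def algebra_simps)
  also have "norm \<dots> \<le> (1/2) * (norm h * norm (h - k) + norm (h - k) * norm k)"
   using norm_triangle_ineq[of "h * (h - k)" "(h - k) * k"] norm_mult_ineq[of h "h - k"]
    norm_mult_ineq[of "h - k" k] by simp
  also have "\<dots> \<le> (1/2) * (r * norm (h - k) + norm (h - k) * r)"
   using sD(1)[OF that(1)] sD(1)[OF that(2)]
   by (intro mult_left_mono add_mono mult_right_mono) auto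
  finally show ?thesis by (simp add: dist_norm)
 qed
 ultimately have "\<exists>!h. h \<in> s \<and> f h = h"
  by (intro Banach_fix[of s r f]) (use t(2) in \<open>auto simp: r_def\<close>)
 then obtain h where "h \<in> s" "f h = h" by blast
 moreover have "h + h = t + h * h"
 proof -
  have "h + h = 2 *\<^sub>R f h" using \<open>f h = h\<close> by (simp add: scaleR_2)
  then show ?thesis by (simp add: f_def)
 qed
 ultimately show ?thesis using sD[of h] unfolding r_def by (intro that[of h])
qed

text \<open>A self-adjoint \<open>a\<close> of norm below 1 is the real part of the unitary
  \<open>a + \<i> (1 - a^2)^(1/2)\<close>. The image of this unitary is still an isometry, so
  \<open>\<phi> a\<close> has norm at most 1; the C*-identity extends the bound to all
  elements.\<close>

lemma star_hom_contractive:
 fixes \<phi> :: "'a::{cstar_algebra,real_normed_algebra_1} => 'b::{cstar_algebra,real_normed_algebra_1}"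
 assumes \<phi>: "star_hom \<phi>" and one: "\<phi> 1 = 1"
 shows "norm (\<phi> x) \<le> norm x"
proof -
 have h: "\<phi> (x + y) = \<phi> x + \<phi> y" "\<phi> (x * y) = \<phi> x * \<phi> y" "\<phi> (star x) = star (\<phi> x)"
  "\<phi> (c *\<^sub>C x) = c *\<^sub>C \<phi> x" for x y c
  using \<phi> unfolding star_hom_def by auto
 have hr: "\<phi> (r *\<^sub>R x) = r *\<^sub>R \<phi> x" for r x
  using h(4)[of "complex_of_real r" x] by (simp add: scaleC_of_real)
 have sa: "norm (\<phi> a) \<le> 1" if a: "star a = a" "norm a < 1" for a
 proof -
  have saa: "star (a * a) = a * a" by (simp add: star_mult a)
  have naa: "norm (a * a) < 1" using cstar_identity[of a] a by (simp add: power_less_one_iff abs_square_less_1)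
  obtain k where k: "star k = k" "k + k = a * a + k * k" "norm k \<le> norm (a * a)"
   and kc: "\<And>y. y * (a * a) = a * a * y ==> y * k = k * y"
   by (rule sqrt_exists[OF saa naa]) (rule that)
  have "a * k = k * a" using kc[of a] by (simp only: mult.assoc)
  from arg_cong[OF this, of \<phi>] have ak: "\<phi> a * \<phi> k = \<phi> k * \<phi> a" by (simp only: h)
  have s\<phi>: "star (\<phi> a) = \<phi> a" "star (\<phi> k) = \<phi> k"
   using h(3)[of a, symmetric] h(3)[of k, symmetric] by (simp_all only: a(1) k(1))
  define u where "u = \<phi> a + \<i> *\<^sub>C (1 - \<phi> k)"
  have su: "star u = \<phi> a - \<i> *\<^sub>C (1 - \<phi> k)"
   by (simp add: u_def star_add star_scaleC star_diff s\<phi>)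
  have kk: "\<phi> k + \<phi> k = \<phi> a * \<phi> a + \<phi> k * \<phi> k" using arg_cong[OF k(2), of \<phi>] by (simp only: h)
  have "star u * u = \<phi> a * \<phi> a + (1 - \<phi> k) * (1 - \<phi> k)"
   unfolding su unfolding u_def using ak
   by (simp add: algebra_simps mult_scaleC_left mult_scaleC_right scaleC_scaleC scaleC_diff_right
     scaleC_add_right)
  also have "\<dots> = 1 + (\<phi> a * \<phi> a + \<phi> k * \<phi> k) - (\<phi> k + \<phi> k)" by (simp add: algebra_simps)
  also have "\<dots> = 1" by (simp add: kk)
  finally have "norm u = 1" using cstar_identity[of u] by (simp add: power2_eq_1_iff) (metis norm_ge_zero not_one_le_zero neg_0_le_iff_le)
  moreover have "\<phi> a = (1/2) *\<^sub>R (u + star u)" by (simp add: su) (simp add: u_def scaleR_2[symmetric])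
  ultimately show ?thesis using norm_triangle_ineq[of u "star u"] by simp
 qed
 show ?thesis
 proof (rule dense_ge)
  fix r assume r: "norm x < r"
  have r0: "r > 0" using r norm_ge_zero[of x] by linarith
  define a where "a = inverse (r\<^sup>2) *\<^sub>R (star x * x)"
  have "(norm x)\<^sup>2 < r\<^sup>2" using r by (intro power_strict_mono) auto
  then have na: "norm a < 1"
   using r0 by (simp add: a_def cstar_identity field_simps)
  have "star a = a" by (simp add: a_def star_scaleR star_mult)
  then have "norm (\<phi> a) \<le> 1" using sa na by blast
  then have "(norm (\<phi> x))\<^sup>2 \<le> r\<^sup>2"
   using r0 by (simp add: a_def h hr cstar_identity field_simps)
  then show "norm (\<phi> x) \<le> r" using r0 power2_le_imp_le by force
 qed
qed

text \<open>The unit is an extreme point of the unit ball.\<close>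

lemma self_adjoint_eq_0:
 fixes g :: "'a::{cstar_algebra,real_normed_algebra_1}"
 assumes g: "star g = g" "norm (1 + g) \<le> 1" "norm (1 - g) \<le> 1"
 shows "g = 0"
proof -
 \<comment> \<open>The bicommutant of \<open>g\<close>: a commutative subalgebra that contains 1 and
   \<open>g\<close>.\<close>
 define D where "D = {x. \<forall>y. y * g = g * y --> x * y = y * x}"
 have star_comm: "star y * g = g * star y" if "y * g = g * y" for y
  using arg_cong[OF that, of star] g(1) by (simp add: star_mult)
 have "comm_star_subalgebra D"
  unfolding comm_star_subalgebra_def complex_subspace_def
 proof (intro conjI ballI allI)
  fix x y assume x: "x \<in> D"
  show "star x \<in> D" unfolding D_def
  proof (intro CollectI allI impI)
   fix y assume "y * g = g * y"
   then have "x * star y = star y * x" using x star_comm unfolding D_def by blast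
   from arg_cong[OF this, of star] show "star x * y = y * star x" by (simp add: star_mult)
  qed
  assume y: "y \<in> D"
  show "x + y \<in> D" unfolding D_def
  proof (intro CollectI allI impI)
   fix z assume "z * g = g * z"
   then have "x * z = z * x" "y * z = z * y" using x y unfolding D_def by blast+
   then show "(x + y) * z = z * (x + y)" by (simp only: distrib_left distrib_right)
  qed
  have "y * g = g * y" using y unfolding D_def by blast
  then show "x * y = y * x" using x unfolding D_def by blast
  show "x * y \<in> D" unfolding D_def
  proof (intro CollectI allI impI)
   fix z assume "z * g = g * z"
   then have "x * z = z * x" "y * z = z * y" using x y unfolding D_def by blast+
   then show "x * y * z = z * (x * y)" by (metis mult.assoc)
  qed
 qed (auto simp: D_def mult_scaleC_left mult_scaleC_right)
 moreover have gD: "g \<in> D" and oD: "1 \<in> D" by (auto simp: D_def)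
 ultimately obtain \<kappa> where \<kappa>: "\<And>x y. x \<in> D ==> y \<in> D ==> \<kappa> (x + y) = \<kappa> x + \<kappa> y"
  "\<And>c x. x \<in> D ==> \<kappa> (c *\<^sub>C x) = c * \<kappa> x"
  "\<And>x y. x \<in> D ==> y \<in> D ==> \<kappa> (x * y) = \<kappa> x * \<kappa> y"
  "\<And>x. x \<in> D ==> cmod (\<kappa> x) \<le> norm x" "cmod (\<kappa> g) = norm g"
  using comm_star_subalgebra_character[OF _ gD g(1)] by blast
 show ?thesis
 proof (rule ccontr)
  assume "g \<noteq> 0"
  then have "\<kappa> g \<noteq> 0" using \<kappa>(5) by auto
  moreover have "\<kappa> g = \<kappa> 1 * \<kappa> g" using \<kappa>(3)[OF oD gD] by simp
  ultimately have k1: "\<kappa> 1 = 1" by simp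
  define z where "z = \<kappa> g"
  have mg: "- g \<in> D" and kmg: "\<kappa> (- g) = - z" using gD \<kappa>(2)[OF gD, of "-1"] by (auto simp: D_def z_def)
  have pD: "1 + g \<in> D" "1 - g \<in> D" by (auto simp: D_def algebra_simps)
  have p: "cmod (1 + z) \<le> 1" using \<kappa>(4)[OF pD(1)] \<kappa>(1)[OF oD gD] g(2) k1 by (simp add: z_def)
  have m: "cmod (1 - z) \<le> 1" using \<kappa>(4)[OF pD(2)] \<kappa>(1)[OF oD mg] g(3) k1 kmg by simp
  \<comment> \<open>The parallelogram law leaves only \<open>z = 0\<close>.\<close>
  have "(cmod (1 + z))\<^sup>2 + (cmod (1 - z))\<^sup>2 = 2 + 2 * (cmod z)\<^sup>2"
   unfolding cmod_power2 by (simp add: power2_eq_square algebra_simps)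
  moreover have "(cmod (1 + z))\<^sup>2 \<le> 1" "(cmod (1 - z))\<^sup>2 \<le> 1" using p m by (simp_all add: power_le_one)
  ultimately have "(cmod z)\<^sup>2 \<le> 0" by linarith
  then show False using \<open>\<kappa> g \<noteq> 0\<close> by (simp add: z_def)
 qed
qed

text \<open>The elements \<open>star (S j) * S k * star (S k) * S j\<close> sum to 1 and the one for
  \<open>k = j\<close> already equals 1, so the others sum to 0. Being positive they vanish;
  positivity enters as \<open>norm (1 - c k) \<le> 1\<close>, the form in which
  \<open>self_adjoint_eq_0\<close> can use it.\<close>

lemma isometries_orthogonal:
 fixes S :: "'i => 'a::{cstar_algebra,real_normed_algebra_1}"
 assumes fin: "finite N" and iso: "\<And>i. i \<in> N ==> star (S i) * S i = 1"
  and sum: "(\<Sum>i\<in>N. S i * star (S i)) = 1" and ij: "i \<in> N" "j \<in> N" "i \<noteq> j"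
 shows "star (S i) * S j = 0"
proof -
 define c where "c = (%i. star (S j) * (S i * star (S i)) * S j)"
 have nS: "norm (S j) = 1" using cstar_identity[of "S j"] iso[OF ij(2)]
  by (simp add: power2_eq_1_iff) (metis norm_ge_zero not_one_le_zero neg_0_le_iff_le)
 have nc: "norm (1 - c k) \<le> 1" if k: "k \<in> N" for k
 proof -
  define P where "P = 1 - S k * star (S k)"
  have "star P * P = P"
   using iso[OF k] by (simp add: P_def star_diff star_mult algebra_simps) (simp flip: mult.assoc)
  then have "(norm P)\<^sup>2 = norm P" using cstar_identity[of P] by simp
  then have P: "norm P \<le> 1" by (auto simp: power2_eq_square)
  have "1 - c k = star (S j) * P * S j"
   using iso[OF ij(2)] by (simp add: c_def P_def algebra_simps)
  also have "norm \<dots> \<le> norm (star (S j)) * norm P * norm (S j)"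
   by (meson norm_mult_ineq order_trans mult_right_mono norm_ge_zero)
  finally show ?thesis using nS P by simp
 qed
 have "(\<Sum>k\<in>N. c k) = star (S j) * (\<Sum>k\<in>N. S k * star (S k)) * S j"
  by (simp add: c_def sum_distrib_left sum_distrib_right)
 also have "\<dots> = 1" using sum iso[OF ij(2)] by simp
 finally have s1: "(\<Sum>k\<in>N. c k) = 1" .
 have "c j = (star (S j) * S j) * (star (S j) * S j)" by (simp add: c_def mult.assoc)
 then have "c j = 1" using iso[OF ij(2)] by simp
 then have s0: "(\<Sum>k\<in>N - {j}. c k) = 0"
  using s1 sum.remove[OF fin ij(2), of c] by simp
 define J where "J = N - {j} - {i}"
 have s2: "c i = - (\<Sum>k\<in>J. c k)"
  using s0 sum.remove[of "N - {j}" i c] fin ij by (simp add: J_def eq_neg_iff_add_eq_0)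
 have "c i = 0"
 proof (cases "J = {}")
  case True then show ?thesis using s2 by simp
 next
  case False
  define m where "m = real (card J)"
  have m: "m \<ge> 1" using False fin by (simp add: m_def J_def Suc_le_eq card_gt_0_iff)
  \<comment> \<open>Dividing by the number \<open>m\<close> of remaining terms turns
    \<open>1 + g\<close> into an average of the elements \<open>1 - c k\<close>.\<close>
  define g where "g = (1/m) *\<^sub>R c i"
  have sg: "star g = g" by (simp add: g_def c_def star_scaleR star_mult mult.assoc)
  have "1 + g = (1/m) *\<^sub>R (\<Sum>k\<in>J. 1 - c k)"
  proof -
   have "(\<Sum>k\<in>J. 1 - c k) = m *\<^sub>R 1 - (\<Sum>k\<in>J. c k)"
    by (simp add: sum_subtractf m_def scaleR_conv_of_real)
   then show ?thesis using m by (simp add: g_def s2 scaleR_diff_right)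
  qed
  also have "norm \<dots> \<le> (1/m) * (\<Sum>k\<in>J. 1)"
   using m by (simp add: divide_le_cancel) (rule order_trans[OF sum_norm_le[of J _ "%_. 1"]],
    use nc in \<open>auto simp: J_def m_def field_simps\<close>)
  also have "\<dots> = 1" using m by (simp add: m_def)
  finally have 1: "norm (1 + g) \<le> 1" .
  have "1 - g = (1 - 1/m) *\<^sub>R 1 + (1/m) *\<^sub>R (1 - c i)"
   by (simp add: g_def algebra_simps)
  also have "norm \<dots> \<le> (1 - 1/m) * 1 + (1/m) * 1"
   using nc[OF ij(1)] m by (intro order_trans[OF norm_triangle_ineq] add_mono) (auto simp: divide_right_mono)
  finally have "norm (1 - g) \<le> 1" by simp
  then have "g = 0" using self_adjoint_eq_0[OF sg 1] by blast
  then show ?thesis using m by (simp add: g_def)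
 qed
 then have "star (star (S i) * S j) * (star (S i) * S j) = 0"
  by (simp add: c_def star_mult mult.assoc)
 then show ?thesis by (simp only: star_mult_self_eq_0)
qed

section \<open>Perturbation inside corners and hereditary subalgebras\<close>

text \<open>The solution is \<open>(1 - h)^(-1) p\<close>, which makes sense even if the algebra has
  no unit.\<close>

lemma fixpoint_right_inverse:
 fixes h :: "'c::cstar_algebra"
 assumes "norm h < 1"
 obtains g where "g = p + h * g"
proof -
 have "dist (p + h * x) (p + h * y) \<le> norm h * dist x y" for x y
  using norm_mult_ineq[of h "x - y"] by (simp add: dist_norm algebra_simps)
 then show ?thesis
  using banach_fix_type[of "norm h" "%g. p + h * g"] assms that by (metis norm_ge_zero)
qed

lemma norm_projection_le:
 assumes "projection p"
 shows "norm p \<le> 1"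
proof -
 have "(norm p)\<^sup>2 = norm p" using cstar_identity[of p] assms by (simp add: projection_def)
 then show ?thesis by (auto simp: power2_eq_square)
qed

lemma norm_compress:
 assumes p: "projection p" and y: "norm (y - p) < 1"
 shows "norm (p - p * y * p) < 1"
proof -
 have "norm (p - p * y * p) = norm (p * (y - p) * p)"
  using p by (subst norm_minus_commute) (simp add: projection_def algebra_simps)
 also have "\<dots> \<le> 1 * norm (y - p) * 1"
  using norm_projection_le[OF p]
  by (intro order_trans[OF norm_mult_ineq] mult_mono) auto
 finally show ?thesis using y by simp
qed

text \<open>\<open>y\<close> is within distance 1 of \<open>p\<close> in the corner of
  \<open>p\<close>, hence invertible there: \<open>y * g = p\<close>.\<close>

lemma projection_mem_ideal:
 assumes I: "closed_ideal I" "x \<in> I" and p: "projection p"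
  and z: "norm (star z * (star x * x) * z - p) < 1"
 shows "p \<in> I"
proof -
 define y where "y = p * (star z * (star x * x) * z) * p"
 have "norm (p - y) < 1" unfolding y_def by (rule norm_compress[OF p z])
 then obtain g where g: "g = p + (p - y) * g" by (rule fixpoint_right_inverse)
 have pp: "p * p = p" using p by (simp add: projection_def)
 have "p * g = p * p + (p * p - p * y) * g" by (subst g) (simp add: algebra_simps)
 also have "p * y = y" by (simp add: y_def pp flip: mult.assoc)
 finally have "p * g = g" using g pp by simp
 then have "y * g = p" using g by (simp add: algebra_simps)
 moreover have "y * g \<in> I" using I unfolding closed_ideal_def y_def by (metis mult.assoc)
 ultimately show ?thesis by simp
qed

text \<open>Infiniteness is invariant under Murray-von Neumann equivalence: conjugation by
  \<open>w\<close> carries the witnesses over.\<close>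

lemma infinite_projection_transport:
 assumes p: "infinite_projection p" and w: "star w * w = p"
 shows "infinite_projection (w * star w)"
proof -
 obtain q v where q: "projection q" "p * q = q" "q \<noteq> p" and v: "star v * v = p" "v * star v = q"
  using p unfolding infinite_projection_def by blast
 have pp: "p * p = p" "star p = p" using p unfolding infinite_projection_def projection_def by auto
 have part: "u * (star u * u) = u" if "star u * u = p" for u
 proof -
  have "star (u * p - u) * (u * p - u) = p * (star u * u) * p - p * (star u * u) - (star u * u) * p + star u * u"
   by (simp add: star_diff star_mult pp algebra_simps)
  also have "\<dots> = 0" by (simp add: that pp)
  finally have "u * p - u = 0" by (simp only: star_mult_self_eq_0)
  then show ?thesis using that by simp
 qed
 have wp: "w * p = w" using part[OF w] w by simp
 have vp: "v * p = v" using part[OF v(1)] v by simp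
 have pv: "p * v = v"
 proof -
  have "q * v = v" using vp v by (metis mult.assoc)
  then show ?thesis using q(2) by (metis mult.assoc)
 qed
 have pw: "p * star w = star w" using arg_cong[OF wp, of star] pp by (simp add: star_mult)
 have psv: "p * star v = star v" "star v * p = star v"
  using arg_cong[OF vp, of star] arg_cong[OF pv, of star] pp by (simp_all add: star_mult)
 define v' where "v' = w * v * star w"
 have "star v' * v' = w * star v * (star w * w) * v * star w"
  by (simp add: v'_def star_mult mult.assoc)
 also have "\<dots> = w * (star v * (p * v)) * star w" by (simp add: w mult.assoc)
 also have "\<dots> = w * star w" by (simp add: pv v wp)
 finally have 1: "star v' * v' = w * star w" .
 have "v' * star v' = w * v * (star w * w) * star v * star w"
  by (simp add: v'_def star_mult mult.assoc)
 also have "\<dots> = w * (v * (p * star v)) * star w" by (simp add: w mult.assoc)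
 also have "\<dots> = w * q * star w" by (simp add: psv v)
 finally have 2: "v' * star v' = w * q * star w" .
 have wsw: "star w * (w * x) = p * x" for x by (simp add: w flip: mult.assoc)
 have qq: "q * q = q" "star q = q" using q by (simp_all add: projection_def)
 have qp: "q * p = q" using arg_cong[OF q(2), of star] pp qq by (simp add: star_mult)
 have "projection (w * star w)"
  by (simp add: projection_def star_mult mult.assoc wsw pw)
 moreover have "projection (w * q * star w)"
  by (simp add: projection_def star_mult mult.assoc wsw qq) (simp add: q qq flip: mult.assoc)
 moreover have "w * star w * (w * q * star w) = w * q * star w"
  by (simp add: mult.assoc wsw) (simp add: q flip: mult.assoc)
 moreover have "w * q * star w \<noteq> w * star w"
 proof
  assume "w * q * star w = w * star w"
  then have "star w * (w * q * star w) * w = star w * (w * star w) * w" by simp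
  then have "p * q * p = p * p" by (simp add: mult.assoc wsw w)
  then show False using q qp pp by simp
 qed
 ultimately show ?thesis unfolding infinite_projection_def using 1 2 by metis
qed

text \<open>The element is dominated by \<open>K d^2\<close>: with
  \<open>t = (r * star r) / K\<close>, of norm below 1 by the choice of \<open>K\<close>, the square
  root \<open>1 - h\<close> of \<open>1 - t\<close> writes the difference as
  \<open>star y * y\<close>.\<close>

lemma hereditary_compress:
 assumes B: "hereditary_subalgebra B" and d: "d \<in> B" "star d = d"
 shows "d * r * star r * d \<in> B"
proof -
 define K where "K = norm (r * star r) + 1"
 have K: "K > 0" by (simp add: K_def add_nonneg_pos)
 define t where "t = (1/K) *\<^sub>R (r * star r)"
 have "star t = t" by (simp add: t_def star_scaleR star_mult)
 moreover have "norm t < 1" using K by (simp add: t_def K_def)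
 ultimately obtain h where h: "star h = h" "h + h = t + h * h" by (rule sqrt_exists)
 define y where "y = sqrt K *\<^sub>R (d - h * d)"
 have "star y * y = K *\<^sub>R (d * d - d * (h + h) * d + d * (h * h) * d)"
  using K by (simp add: y_def star_scaleR star_diff star_mult d h(1) algebra_simps)
 also have "\<dots> = K *\<^sub>R (d * d) - d * r * star r * d"
  unfolding h(2) using K by (simp add: t_def algebra_simps)
 finally have 1: "cstar_positive (K *\<^sub>R (d * d) - d * r * star r * d)"
  unfolding cstar_positive_def by metis
 have "star (star r * d) * (star r * d) = d * r * star r * d" by (simp add: star_mult d mult.assoc)
 then have 2: "cstar_positive (d * r * star r * d)" unfolding cstar_positive_def by metis
 have "complex_of_real K *\<^sub>C (d * d) \<in> B"
  using B d unfolding hereditary_subalgebra_def cstar_subalgebra_def complex_subspace_def by auto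
 then have "K *\<^sub>R (d * d) \<in> B" by (simp add: scaleC_of_real)
 with 1 2 B show ?thesis unfolding hereditary_subalgebra_def by blast
qed

text \<open>The hypothesis is applied to \<open>d = star x * x\<close> from the hereditary
  subalgebra. Compression by \<open>p\<close> gives an element \<open>y\<close> that is invertible
  in the corner of \<open>p\<close>, and from it some \<open>w = d * r\<close> with
  \<open>star w * w = p\<close>. Then \<open>w * star w\<close> is infinite, and it lies in the
  subalgebra by \<open>hereditary_compress\<close>.\<close>

lemma purely_infinite_criterion:
 assumes "\<And>x::'c::cstar_algebra. x \<noteq> 0 ==>
   \<exists>z p. infinite_projection p \<and> norm (star z * (star x * x) * z - p) < 1"
 shows "purely_infinite TYPE('c)"
 unfolding purely_infinite_def
proof (intro allI impI)
 fix B :: "'c set" assume B: "hereditary_subalgebra B \<and> B \<noteq> {0}"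
 then have sub: "cstar_subalgebra B" by (simp add: hereditary_subalgebra_def)
 then have "0 \<in> B" by (simp add: cstar_subalgebra_def complex_subspace_def)
 with B obtain x where x: "x \<in> B" "x \<noteq> 0" by blast
 define d where "d = star x * x"
 have d: "d \<in> B" "star d = d" "d \<noteq> 0"
  using x sub by (auto simp: d_def cstar_subalgebra_def star_mult)
 obtain z p where p: "infinite_projection p" and z: "norm (star z * (star d * d) * z - p) < 1"
  using assms[OF d(3)] by blast
 have pr: "projection p" using p by (simp add: infinite_projection_def)
 have pp: "p * p = p" "star p = p" using pr by (auto simp: projection_def)
 define y where "y = p * (star z * (star d * d) * z) * p"
 define t where "t = p - y"
 have yy: "p * y = y" "y * p = y" by (simp_all add: y_def pp mult.assoc) (simp_all add: pp flip: mult.assoc)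
 have t: "norm t < 1" "star t = t" "p * t = t * p"
  using norm_compress[OF pr z] by (simp add: t_def y_def, simp add: t_def y_def pp star_diff star_mult mult.assoc)
   (simp add: t_def left_diff_distrib right_diff_distrib yy)
 obtain h where h: "star h = h" "h + h = t + h * h" "norm h \<le> norm t" and hc: "\<And>y. y * t = t * y ==> y * h = h * y"
  by (rule sqrt_exists[OF t(2,1)]) (rule that)
 have ph: "p * h = h * p" using hc t(3) by blast
 \<comment> \<open>\<open>p - k\<close> is the square root of \<open>y\<close> in the corner of
   \<open>p\<close>; \<open>g\<close> below is its right inverse there.\<close>
 define k where "k = p * h"
 have k1: "star k = k" unfolding k_def star_mult pp(2) h(1) by (rule ph[symmetric])
 have k2: "p * k = k" unfolding k_def mult.assoc[symmetric] pp(1) by (rule refl)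
 have k3: "k * p = k" using arg_cong[OF k2, of star] unfolding star_mult pp(2) k1 .
 note k = k1 k2 k3
 have "norm k \<le> 1 * norm h" unfolding k_def
  by (intro order_trans[OF norm_mult_ineq] mult_right_mono norm_projection_le pr norm_ge_zero)
 then have "norm k < 1" using h(3) t(1) by simp
 then obtain g where g: "g = p + k * g" by (rule fixpoint_right_inverse)
 have "p * g = p * p + (p * k) * g" by (subst g) (simp add: algebra_simps)
 then have pg: "p * g = g" using g k pp by simp
 then have kg: "(p - k) * g = p" using g by (simp add: algebra_simps)
 have "k * k = p * (h * h)" using ph unfolding k_def by (metis mult.assoc pp(1))
 then have "(p - k) * (p - k) = p - p * (h + h) + p * (h * h)"
  using k pp by (simp add: algebra_simps k_def)
 also have "\<dots> = p - p * t" unfolding h(2) by (simp add: algebra_simps)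
 also have "\<dots> = y" by (simp add: t_def algebra_simps pp yy)
 finally have sq: "(p - k) * (p - k) = y" .
 define r where "r = z * p * g"
 define w where "w = d * r"
 have "star w * w = star g * y * g"
  by (simp add: w_def r_def y_def star_mult pp mult.assoc d(2))
 also have "\<dots> = star ((p - k) * g) * ((p - k) * g)"
  by (simp add: sq[symmetric] star_mult star_diff k(1) pp(2) mult.assoc)
 also have "\<dots> = p" by (simp add: kg pp)
 finally have "star w * w = p" .
 then have "infinite_projection (w * star w)" by (rule infinite_projection_transport[OF p])
 moreover have "w * star w \<in> B"
  using hereditary_compress[of B d r] B d by (simp add: w_def star_mult mult.assoc)
 ultimately show "\<exists>p\<in>B. infinite_projection p" by blast
qed

section \<open>Bounded infinite matrices\<close>

definition l2 :: "('i => complex) => 'i set => real" where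
 "l2 \<xi> A = L2_set (%e. cmod (\<xi> e)) A"

text \<open>\<open>mbd M c\<close> says that \<open>M\<close> is the matrix of an operator on \<open>\<ell>\<^sup>2\<close> of norm at most \<open>c\<close>; only
 finitely supported vectors are needed to express this.\<close>

definition mbd :: "('i => 'i => complex) => real => bool" where
 "mbd M c \<longleftrightarrow> 0 \<le> c \<and> (\<forall>A \<xi> \<eta>. finite A -->
   cmod (sesq A M \<xi> \<eta>) \<le> c * l2 \<xi> A * l2 \<eta> A)"

definition adjm :: "('i => 'i => complex) => 'i => 'i => complex" where
 "adjm M e e' = cnj (M e' e)"

text \<open>The product is only meaningful if the columns of \<open>N\<close> are finitely supported.\<close>

definition mm :: "('i => 'i => complex) => ('i => 'i => complex) => 'i => 'i => complex" where
 "mm M N e e' = (\<Sum>e''\<in>{e''. N e'' e' \<noteq> 0}. M e e'' * N e'' e')"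

definition col_finite :: "('i => 'i => complex) => bool" where
 "col_finite M \<longleftrightarrow> (\<forall>e'. finite {e. M e e' \<noteq> 0})"

definition opn :: "('i => 'i => complex) => real" where
 "opn M = Inf {c. mbd M c}"

lemma l2_nonneg [simp]: "0 \<le> l2 \<xi> A"
 by (simp add: l2_def)

lemma l2_power2: "finite A ==> (l2 \<xi> A)\<^sup>2 = (\<Sum>e\<in>A. (cmod (\<xi> e))\<^sup>2)"
 by (simp add: l2_def L2_set_def sum_nonneg)

lemma of_real_l2_power2: "finite A ==> complex_of_real ((l2 v A)\<^sup>2) = (\<Sum>e\<in>A. cnj (v e) * v e)"
 by (simp only: l2_power2 of_real_sum complex_norm_square mult.commute)

lemma l2_mono: "finite B ==> A \<subseteq> B ==> l2 \<xi> A \<le> l2 \<xi> B"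
 by (simp add: l2_def L2_set_def sum_mono2)

lemma l2_cong: "(\<And>e. e \<in> A ==> \<xi> e = \<eta> e) ==> l2 \<xi> A = l2 \<eta> A"
 by (simp add: l2_def cong: L2_set_cong)

lemma l2_restrict: "finite B ==> A \<subseteq> B ==> (\<And>e. e \<in> B - A ==> \<xi> e = 0) ==> l2 \<xi> B = l2 \<xi> A"
 unfolding l2_def L2_set_def by (intro arg_cong[where f = sqrt] sum.mono_neutral_right) auto

lemma l2_cauchy_schwarz: "cmod (\<Sum>e\<in>A. cnj (\<eta> e) * \<xi> e) \<le> l2 \<eta> A * l2 \<xi> A"
proof -
 have "cmod (\<Sum>e\<in>A. cnj (\<eta> e) * \<xi> e) \<le> (\<Sum>e\<in>A. \<bar>cmod (\<eta> e)\<bar> * \<bar>cmod (\<xi> e)\<bar>)"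
  by (rule order_trans[OF norm_sum]) (simp add: norm_mult)
 also have "\<dots> \<le> l2 \<eta> A * l2 \<xi> A" unfolding l2_def by (rule L2_set_mult_ineq)
 finally show ?thesis .
qed

lemma mbd_nonneg: "mbd M c ==> 0 \<le> c"
 by (simp add: mbd_def)

lemma mbd_form:
 assumes "mbd M c" "finite A" "finite B"
 shows "cmod (\<Sum>e\<in>B. \<Sum>e'\<in>A. cnj (\<eta> e) * M e e' * \<xi> e') \<le> c * l2 \<xi> A * l2 \<eta> B"
proof -
 define \<xi>0 \<eta>0 where "\<xi>0 = (%e. if e \<in> A then \<xi> e else 0)" and "\<eta>0 = (%e. if e \<in> B then \<eta> e else 0)"
 define C where "C = A \<union> B"
 have C: "finite C" "A \<subseteq> C" "B \<subseteq> C" using assms by (auto simp: C_def)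
 have "(\<Sum>e\<in>C. \<Sum>e'\<in>C. cnj (\<eta>0 e) * M e e' * \<xi>0 e') = (\<Sum>e\<in>B. \<Sum>e'\<in>C. cnj (\<eta>0 e) * M e e' * \<xi>0 e')"
  using C by (intro sum.mono_neutral_right) (auto simp: \<eta>0_def)
 also have "\<dots> = (\<Sum>e\<in>B. \<Sum>e'\<in>A. cnj (\<eta>0 e) * M e e' * \<xi>0 e')"
  using C by (intro sum.cong refl sum.mono_neutral_right) (auto simp: \<xi>0_def)
 also have "\<dots> = (\<Sum>e\<in>B. \<Sum>e'\<in>A. cnj (\<eta> e) * M e e' * \<xi> e')"
  by (intro sum.cong refl) (auto simp: \<xi>0_def \<eta>0_def)
 finally have eq: "(\<Sum>e\<in>C. \<Sum>e'\<in>C. cnj (\<eta>0 e) * M e e' * \<xi>0 e') = (\<Sum>e\<in>B. \<Sum>e'\<in>A. cnj (\<eta> e) * M e e' * \<xi> e')" .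
 have "l2 \<xi>0 C = l2 \<xi>0 A" "l2 \<eta>0 C = l2 \<eta>0 B" using C by (auto intro!: l2_restrict simp: \<xi>0_def \<eta>0_def)
 moreover have "l2 \<xi>0 A = l2 \<xi> A" "l2 \<eta>0 B = l2 \<eta> B" by (auto intro!: l2_cong simp: \<xi>0_def \<eta>0_def)
 moreover have "cmod (\<Sum>e\<in>C. \<Sum>e'\<in>C. cnj (\<eta>0 e) * M e e' * \<xi>0 e') \<le> c * l2 \<xi>0 C * l2 \<eta>0 C"
  using assms(1) C(1) unfolding mbd_def by blast
 ultimately show ?thesis by (simp only: eq)
qed

lemma mbd_vec:
 assumes "mbd M c" "finite A" "finite B"
 shows "l2 (%e. \<Sum>e'\<in>A. M e e' * \<xi> e') B \<le> c * l2 \<xi> A"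
proof -
 define v where "v = (%e. \<Sum>e'\<in>A. M e e' * \<xi> e')"
 have "complex_of_real ((l2 v B)\<^sup>2) = (\<Sum>e\<in>B. cnj (v e) * v e)"
  by (rule of_real_l2_power2[OF assms(3)])
 also have "\<dots> = (\<Sum>e\<in>B. \<Sum>e'\<in>A. cnj (v e) * M e e' * \<xi> e')"
  by (subst (2) v_def) (simp add: sum_distrib_left mult.assoc)
 finally have "(l2 v B)\<^sup>2 = cmod (\<Sum>e\<in>B. \<Sum>e'\<in>A. cnj (v e) * M e e' * \<xi> e')"
  by (metis abs_power2 norm_of_real)
 also have "\<dots> \<le> c * l2 \<xi> A * l2 v B" by (rule mbd_form[OF assms])
 finally have "l2 v B * l2 v B \<le> (c * l2 \<xi> A) * l2 v B" by (simp add: power2_eq_square)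
 moreover have "0 \<le> c * l2 \<xi> A" using mbd_nonneg[OF assms(1)] by simp
 ultimately have "l2 v B \<le> c * l2 \<xi> A"
  by (cases "l2 v B = 0") (auto simp: mult_le_cancel_right less_le)
 then show ?thesis by (simp add: v_def)
qed

lemma mbd_from_vec:
 assumes "0 \<le> c" "\<And>A \<xi>. finite A ==> l2 (%e. \<Sum>e'\<in>A. M e e' * \<xi> e') A \<le> c * l2 \<xi> A"
 shows "mbd M c"
 unfolding mbd_def
proof (intro conjI allI impI assms(1))
 fix A :: "'a set" and \<xi> \<eta> :: "'a => complex" assume A: "finite A"
 have "(sesq A M \<xi> \<eta>) = (\<Sum>e\<in>A. cnj (\<eta> e) * (\<Sum>e'\<in>A. M e e' * \<xi> e'))"
  by (simp add: sum_distrib_left mult.assoc)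
 also have "cmod \<dots> \<le> l2 \<eta> A * l2 (%e. \<Sum>e'\<in>A. M e e' * \<xi> e') A" by (rule l2_cauchy_schwarz)
 also have "\<dots> \<le> l2 \<eta> A * (c * l2 \<xi> A)" by (intro mult_left_mono assms A) simp
 finally show "cmod (sesq A M \<xi> \<eta>) \<le> c * l2 \<xi> A * l2 \<eta> A"
  by (simp add: mult_ac)
qed

lemma mbd_entry:
 assumes "mbd M c"
 shows "cmod (M e e') \<le> c"
 using mbd_form[OF assms, of "{e'}" "{e}" "%_. 1" "%_. 1"] by (simp add: l2_def)

lemma mbd_mono:
 assumes "mbd M c" "c \<le> d"
 shows "mbd M d"
 unfolding mbd_def
proof (intro conjI allI impI)
 show "0 \<le> d" using mbd_nonneg[OF assms(1)] assms(2) by simp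
 fix A \<xi> \<eta> assume "finite (A :: 'a set)"
 then have "cmod (sesq A M \<xi> \<eta>) \<le> c * l2 \<xi> A * l2 \<eta> A"
  using assms(1) unfolding mbd_def by blast
 also have "\<dots> \<le> d * l2 \<xi> A * l2 \<eta> A" by (intro mult_right_mono assms(2)) simp_all
 finally show "cmod (sesq A M \<xi> \<eta>) \<le> d * l2 \<xi> A * l2 \<eta> A" .
qed

lemma mbd_add:
 assumes "mbd M c" "mbd N d"
 shows "mbd (%e e'. M e e' + N e e') (c + d)"
 unfolding mbd_def
proof (intro conjI allI impI)
 show "0 \<le> c + d" using assms by (simp add: mbd_def)
 fix A \<xi> \<eta> assume A: "finite (A :: 'a set)"
 have "(\<Sum>e\<in>A. \<Sum>e'\<in>A. cnj (\<eta> e) * (M e e' + N e e') * \<xi> e') =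
  (sesq A M \<xi> \<eta>) + (\<Sum>e\<in>A. \<Sum>e'\<in>A. cnj (\<eta> e) * N e e' * \<xi> e')"
  by (simp add: algebra_simps sum.distrib)
 also have "cmod \<dots> \<le> c * l2 \<xi> A * l2 \<eta> A + d * l2 \<xi> A * l2 \<eta> A"
  using assms A unfolding mbd_def by (intro order_trans[OF norm_triangle_ineq] add_mono) auto
 finally show "cmod (\<Sum>e\<in>A. \<Sum>e'\<in>A. cnj (\<eta> e) * (M e e' + N e e') * \<xi> e') \<le> (c + d) * l2 \<xi> A * l2 \<eta> A"
  by (simp add: algebra_simps)
qed

lemma mbd_scale:
 assumes "mbd M c"
 shows "mbd (%e e'. z * M e e') (cmod z * c)"
 unfolding mbd_def
proof (intro conjI allI impI)
 show "0 \<le> cmod z * c" using assms by (simp add: mbd_def)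
 fix A \<xi> \<eta> assume A: "finite (A :: 'a set)"
 have "(\<Sum>e\<in>A. \<Sum>e'\<in>A. cnj (\<eta> e) * (z * M e e') * \<xi> e') =
  z * (sesq A M \<xi> \<eta>)"
  by (simp add: sum_distrib_left mult_ac)
 also have "cmod \<dots> \<le> cmod z * (c * l2 \<xi> A * l2 \<eta> A)"
  using assms A unfolding mbd_def norm_mult by (intro mult_left_mono) auto
 finally show "cmod (\<Sum>e\<in>A. \<Sum>e'\<in>A. cnj (\<eta> e) * (z * M e e') * \<xi> e') \<le> cmod z * c * l2 \<xi> A * l2 \<eta> A"
  by (simp add: mult.assoc)
qed

lemma mbd_zero: "mbd (%e e'. 0) 0"
 by (simp add: mbd_def)

lemma mbd_sum:
 "finite T ==> (\<And>t. t \<in> T ==> mbd (M t) (c t)) ==> mbd (%e e'. \<Sum>t\<in>T. M t e e') (\<Sum>t\<in>T. c t)"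
 by (induction T rule: finite_induct) (auto simp: mbd_zero intro: mbd_add)

lemma mbd_adjm:
 assumes "mbd M c"
 shows "mbd (adjm M) c"
 unfolding mbd_def
proof (intro conjI allI impI)
 show "0 \<le> c" using assms by (simp add: mbd_def)
 fix A \<xi> \<eta> assume A: "finite (A :: 'a set)"
 have "(sesq A (adjm M) \<xi> \<eta>) =
  cnj (\<Sum>e'\<in>A. \<Sum>e\<in>A. cnj (\<xi> e') * M e' e * \<eta> e)"
  by (subst sum.swap) (simp add: adjm_def mult_ac)
 also have "cmod \<dots> \<le> c * l2 \<eta> A * l2 \<xi> A"
  using assms A unfolding mbd_def complex_mod_cnj by blast
 finally show "cmod (sesq A (adjm M) \<xi> \<eta>) \<le> c * l2 \<xi> A * l2 \<eta> A"
  by (simp add: mult_ac)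
qed

lemma mm_superset:
 assumes "finite C" "\<And>e''. N e'' e' \<noteq> 0 ==> e'' \<in> C"
 shows "mm M N e e' = (\<Sum>e''\<in>C. M e e'' * N e'' e')"
 unfolding mm_def using assms by (intro sum.mono_neutral_left) auto

lemma col_finite_cover:
 assumes "col_finite N" "finite A"
 obtains C where "finite C" "\<And>e'' e'. e' \<in> A ==> N e'' e' \<noteq> 0 ==> e'' \<in> C"
 using assms that[of "\<Union>e'\<in>A. {e''. N e'' e' \<noteq> 0}"] by (auto simp: col_finite_def)

lemma mbd_mm:
 assumes M: "mbd M c" and N: "mbd N d" and fin: "col_finite N"
 shows "mbd (mm M N) (c * d)"
proof (rule mbd_from_vec)
 show "0 \<le> c * d" using mbd_nonneg[OF M] mbd_nonneg[OF N] by simp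
 fix A :: "'a set" and \<xi> :: "'a => complex" assume A: "finite A"
 obtain C where C: "finite C" "\<And>e'' e'. e' \<in> A ==> N e'' e' \<noteq> 0 ==> e'' \<in> C"
  using col_finite_cover[OF fin A] by metis
 have "(\<Sum>e'\<in>A. mm M N e e' * \<xi> e') = (\<Sum>e''\<in>C. M e e'' * (\<Sum>e'\<in>A. N e'' e' * \<xi> e'))" for e
 proof -
  have "(\<Sum>e'\<in>A. mm M N e e' * \<xi> e') = (\<Sum>e'\<in>A. \<Sum>e''\<in>C. M e e'' * N e'' e' * \<xi> e')"
   by (intro sum.cong refl) (simp add: mm_superset[OF C] sum_distrib_right)
  also have "\<dots> = (\<Sum>e''\<in>C. \<Sum>e'\<in>A. M e e'' * N e'' e' * \<xi> e')" by (rule sum.swap)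
  finally show ?thesis by (simp add: sum_distrib_left mult.assoc)
 qed
 then have "l2 (%e. \<Sum>e'\<in>A. mm M N e e' * \<xi> e') A \<le> c * l2 (%e''. \<Sum>e'\<in>A. N e'' e' * \<xi> e') C"
  using mbd_vec[OF M C(1) A] by simp
 also have "\<dots> \<le> c * (d * l2 \<xi> A)"
  by (intro mult_left_mono mbd_vec[OF N A C(1)] mbd_nonneg[OF M])
 finally show "l2 (%e. \<Sum>e'\<in>A. mm M N e e' * \<xi> e') A \<le> c * d * l2 \<xi> A" by simp
qed

lemma form_mm_adjm:
 assumes "col_finite M" "finite A"
 obtains C where "finite C" "\<And>e e'. e' \<in> A ==> M e e' \<noteq> 0 ==> e \<in> C"
  "(\<Sum>a\<in>A. \<Sum>b\<in>A. cnj (\<xi> a) * mm (adjm M) M a b * \<xi> b) = complex_of_real ((l2 (%e. \<Sum>e'\<in>A. M e e' * \<xi> e') C)\<^sup>2)"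
proof -
 obtain C where C: "finite C" "\<And>e'' e'. e' \<in> A ==> M e'' e' \<noteq> 0 ==> e'' \<in> C"
  using col_finite_cover[OF assms] by metis
 define v where "v = (%e. \<Sum>e'\<in>A. M e e' * \<xi> e')"
 have "(\<Sum>a\<in>A. \<Sum>b\<in>A. cnj (\<xi> a) * mm (adjm M) M a b * \<xi> b) =
   (\<Sum>a\<in>A. \<Sum>b\<in>A. \<Sum>e\<in>C. cnj (\<xi> a) * (cnj (M e a) * M e b) * \<xi> b)"
  by (intro sum.cong refl) (simp add: mm_superset[OF C] adjm_def sum_distrib_left sum_distrib_right)
 also have "\<dots> = (\<Sum>a\<in>A. \<Sum>e\<in>C. \<Sum>b\<in>A. cnj (\<xi> a) * (cnj (M e a) * M e b) * \<xi> b)"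
  by (intro sum.cong refl sum.swap)
 also have "\<dots> = (\<Sum>e\<in>C. \<Sum>a\<in>A. \<Sum>b\<in>A. cnj (\<xi> a) * (cnj (M e a) * M e b) * \<xi> b)"
  by (rule sum.swap)
 also have "\<dots> = (\<Sum>e\<in>C. cnj (v e) * v e)"
  unfolding v_def cnj_sum sum_product by (intro sum.cong refl) (simp add: mult_ac)
 also have "\<dots> = complex_of_real ((l2 v C)\<^sup>2)"
  by (rule of_real_l2_power2[OF C(1), symmetric])
 finally show ?thesis using that[OF C] by (simp add: v_def)
qed

text \<open>The half of the C*-identity that is not submultiplicativity: \<open>form_mm_adjm\<close>
  identifies the form of the product with the squared length of the image vector.\<close>

lemma mbd_cstar:
 assumes "col_finite M" "mbd (mm (adjm M) M) c"
 shows "mbd M (sqrt c)"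
proof (rule mbd_from_vec)
 show "0 \<le> sqrt c" using mbd_nonneg assms by simp
 fix A :: "'a set" and \<xi> :: "'a => complex" assume A: "finite A"
 define v where "v = (%e. \<Sum>e'\<in>A. M e e' * \<xi> e')"
 obtain C where C: "finite C" "\<And>e'' e'. e' \<in> A ==> M e'' e' \<noteq> 0 ==> e'' \<in> C"
  "(\<Sum>a\<in>A. \<Sum>b\<in>A. cnj (\<xi> a) * mm (adjm M) M a b * \<xi> b) = complex_of_real ((l2 v C)\<^sup>2)"
  by (rule form_mm_adjm[OF assms(1) A, of \<xi>, folded v_def]) (rule that)
 have "(l2 v C)\<^sup>2 \<le> c * l2 \<xi> A * l2 \<xi> A"
  using mbd_form[OF assms(2) A A, of \<xi> \<xi>] unfolding C(3) norm_of_real by simp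
 then have "(l2 v C)\<^sup>2 \<le> c * (l2 \<xi> A)\<^sup>2" by (simp add: power2_eq_square)
 then have "l2 v C \<le> sqrt (c * (l2 \<xi> A)\<^sup>2)" by (rule real_le_rsqrt)
 also have "\<dots> = sqrt c * l2 \<xi> A" by (simp add: real_sqrt_mult)
 finally have 1: "l2 v C \<le> sqrt c * l2 \<xi> A" .
 have "v e = 0" if "e \<notin> C" for e unfolding v_def using C(2) that by (intro sum.neutral) fastforce
 then have "l2 v (A \<union> C) = l2 v C" using A C by (intro l2_restrict) auto
 moreover have "l2 v A \<le> l2 v (A \<union> C)" using A C by (intro l2_mono) auto
 ultimately show "l2 (%e. \<Sum>e'\<in>A. M e e' * \<xi> e') A \<le> sqrt c * l2 \<xi> A" using 1 by (simp add: v_def)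
qed

text \<open>Cauchy-Schwarz along the partial bijection formed by the nonzero entries. The matrices
  of words are of this kind.\<close>

lemma mbd_partial_injection:
 assumes c: "0 \<le> c" "\<And>e e'. cmod (M e e') \<le> c"
  and row: "\<And>e a b. M e a \<noteq> 0 ==> M e b \<noteq> 0 ==> a = b"
  and col: "\<And>e a b. M a e \<noteq> 0 ==> M b e \<noteq> 0 ==> a = b"
 shows "mbd M c"
 unfolding mbd_def
proof (intro conjI allI impI c(1))
 fix A \<xi> \<eta> assume A: "finite (A :: 'a set)"
 define P where "P = {p \<in> A \<times> A. M (fst p) (snd p) \<noteq> 0}"
 have P: "finite P" "fst ` P \<subseteq> A" "snd ` P \<subseteq> A" using A by (auto simp: P_def)
 have inj: "inj_on fst P" "inj_on snd P" using row col by (auto simp: P_def inj_on_def)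
 have "(sesq A M \<xi> \<eta>) = (\<Sum>p\<in>P. cnj (\<eta> (fst p)) * M (fst p) (snd p) * \<xi> (snd p))"
  unfolding sum.cartesian_product using A by (intro sum.mono_neutral_cong_right) (auto simp: P_def)
 also have "cmod \<dots> \<le> (\<Sum>p\<in>P. c * (\<bar>cmod (\<eta> (fst p))\<bar> * \<bar>cmod (\<xi> (snd p))\<bar>))"
 proof (rule order_trans[OF norm_sum sum_mono])
  fix p
  show "cmod (cnj (\<eta> (fst p)) * M (fst p) (snd p) * \<xi> (snd p)) \<le> c * (\<bar>cmod (\<eta> (fst p))\<bar> * \<bar>cmod (\<xi> (snd p))\<bar>)"
   using mult_right_mono[OF c(2)[of "fst p" "snd p"], of "cmod (\<eta> (fst p)) * cmod (\<xi> (snd p))"]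
   by (simp add: norm_mult mult_ac)
 qed
 also have "\<dots> \<le> c * (L2_set (%p. cmod (\<eta> (fst p))) P * L2_set (%p. cmod (\<xi> (snd p))) P)"
  unfolding sum_distrib_left[symmetric] by (intro mult_left_mono L2_set_mult_ineq c)
 also have "L2_set (%p. cmod (\<eta> (fst p))) P = l2 \<eta> (fst ` P)"
  unfolding l2_def L2_set_def using inj by (simp add: sum.reindex)
 also have "L2_set (%p. cmod (\<xi> (snd p))) P = l2 \<xi> (snd ` P)"
  unfolding l2_def L2_set_def using inj by (simp add: sum.reindex)
 also have "c * (l2 \<eta> (fst ` P) * l2 \<xi> (snd ` P)) \<le> c * (l2 \<eta> A * l2 \<xi> A)"
  using P A c by (intro mult_left_mono mult_mono l2_mono) auto
 finally show "cmod (sesq A M \<xi> \<eta>) \<le> c * l2 \<xi> A * l2 \<eta> A"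
  by (simp add: mult_ac)
qed

section \<open>The operator norm of a matrix\<close>

lemma opn_le: "mbd M c ==> opn M \<le> c"
 unfolding opn_def by (intro cInf_lower bdd_belowI[of _ 0]) (auto simp: mbd_def)

text \<open>The infimum is attained because each form gives a closed condition on the bound.\<close>

lemma mbd_opn:
 assumes "mbd M c"
 shows "mbd M (opn M)"
 unfolding mbd_def
proof (intro conjI allI impI)
 have ne: "{c. mbd M c} \<noteq> {}" using assms by auto
 show "0 \<le> opn M" unfolding opn_def by (rule cInf_greatest[OF ne]) (auto simp: mbd_def)
 fix A \<xi> \<eta> assume A: "finite (A :: 'a set)"
 let ?F = "cmod (sesq A M \<xi> \<eta>)" and ?X = "l2 \<xi> A * l2 \<eta> A"
 have *: "?F \<le> d * ?X" if "mbd M d" for d using that A unfolding mbd_def by (simp add: mult.assoc)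
 have X: "0 \<le> ?X" by simp
 have "?F \<le> opn M * ?X"
 proof (cases "?X = 0")
  case True
  have "?F \<le> 0" using *[OF assms] unfolding True by simp
  then show ?thesis unfolding True by simp
 next
  case False
  then have "?X > 0" using X by linarith
  moreover have "?F / ?X \<le> opn M" unfolding opn_def
   using * \<open>?X > 0\<close> by (intro cInf_greatest[OF ne]) (auto simp: field_simps)
  ultimately show ?thesis by (simp only: pos_divide_le_eq)
 qed
 then show "?F \<le> opn M * l2 \<xi> A * l2 \<eta> A" by (simp add: mult.assoc)
qed

lemma opn_nonneg: "mbd M c ==> 0 \<le> opn M"
 using mbd_opn mbd_nonneg by blast

lemma opn_add: "mbd M c ==> mbd N d ==> opn (%e e'. M e e' + N e e') \<le> opn M + opn N"
 by (intro opn_le mbd_add mbd_opn)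

lemma opn_scale:
 assumes "mbd M c"
 shows "opn (%e e'. z * M e e') = cmod z * opn M"
proof (cases "z = 0")
 case True
 then show ?thesis using antisym[OF opn_le[OF mbd_zero] opn_nonneg[OF mbd_zero]] by simp
next
 case False
 have 1: "opn (%e e'. z * M e e') \<le> cmod z * opn M" by (intro opn_le mbd_scale mbd_opn[OF assms])
 have "mbd (%e e'. inverse z * (z * M e e')) (cmod (inverse z) * opn (%e e'. z * M e e'))"
  by (intro mbd_scale mbd_opn[OF mbd_scale[OF assms]])
 then have "opn M \<le> cmod (inverse z) * opn (%e e'. z * M e e')"
  using False opn_le by (simp flip: mult.assoc)
 then have "cmod z * opn M \<le> cmod z * (inverse (cmod z) * opn (%e e'. z * M e e'))"
  by (intro mult_left_mono) (simp_all only: norm_inverse norm_ge_zero)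
 then have "cmod z * opn M \<le> opn (%e e'. z * M e e')"
  using False by (simp add: field_simps)
 with 1 show ?thesis by simp
qed

lemma opn_mm:
 assumes "mbd M c" "mbd N d" "col_finite N"
 shows "opn (mm M N) \<le> opn M * opn N"
 by (intro opn_le mbd_mm mbd_opn assms) (use assms mbd_opn in auto)

lemma opn_cstar:
 assumes "mbd M c" "col_finite M"
 shows "opn (mm (adjm M) M) = (opn M)\<^sup>2"
proof (rule antisym)
 show "opn (mm (adjm M) M) \<le> (opn M)\<^sup>2"
  unfolding power2_eq_square by (intro opn_le mbd_mm mbd_adjm mbd_opn[OF assms(1)] assms)
 have b: "mbd (mm (adjm M) M) (c * c)" by (intro mbd_mm mbd_adjm assms)
 have "opn M \<le> sqrt (opn (mm (adjm M) M))" by (intro opn_le mbd_cstar assms mbd_opn[OF b])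
 then have "(opn M)\<^sup>2 \<le> (sqrt (opn (mm (adjm M) M)))\<^sup>2" using opn_nonneg[OF assms(1)] by (intro power_mono)
 then show "(opn M)\<^sup>2 \<le> opn (mm (adjm M) M)" using opn_nonneg[OF b] by simp
qed

section \<open>A permutation representation of the free *-algebra\<close>

text \<open>A basis vector is an infinite word together with a degree in the dual group and a gauge degree;
 the generator \<open>S\<^sub>i\<close> prepends the letter \<open>i\<close>.\<close>

type_synonym 'g idx = "(nat => nat) \<times> 'g character \<times> int"

definition icons :: "(nat => 'g::topological_ab_group_add character) => nat => 'g idx => 'g idx" where
 "icons \<omega> i e = (case_nat i (fst e), fst (snd e) + \<omega> i, snd (snd e) + 1)"

text \<open>The inverse of prepending the first letter. It is total because both degrees live in
  groups; the level may become negative.\<close>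

definition itl :: "(nat => 'g::topological_ab_group_add character) => 'g idx => 'g idx" where
 "itl \<omega> e = (%k. fst e (Suc k), fst (snd e) - \<omega> (fst e 0), snd (snd e) - 1)"

definition ihd :: "'g idx => nat" where
 "ihd e = fst e 0"

definition deg :: "'g idx => 'g character" where
 "deg e = fst (snd e)"

definition lev :: "'g idx => int" where
 "lev e = snd (snd e)"

definition idx :: "nat => 'g idx set" where
 "idx n = {e. range (fst e) \<subseteq> {1..n}}"

lemma icons_itl [simp]: "icons \<omega> (ihd e) (itl \<omega> e) = e"
 by (simp add: icons_def itl_def ihd_def fun_eq_iff prod_eq_iff split: nat.split)

lemma itl_icons [simp]: "itl \<omega> (icons \<omega> i e) = e"
 by (simp add: icons_def itl_def fun_eq_iff prod_eq_iff)

lemma ihd_icons [simp]: "ihd (icons \<omega> i e) = i"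
 by (simp add: icons_def ihd_def)

lemma deg_icons [simp]: "deg (icons \<omega> i e) = deg e + \<omega> i"
 by (simp add: icons_def deg_def)

lemma lev_icons [simp]: "lev (icons \<omega> i e) = lev e + 1"
 by (simp add: icons_def lev_def)

lemma icons_in_idx [simp]: "icons \<omega> i e \<in> idx n \<longleftrightarrow> i \<in> {1..n} \<and> e \<in> idx n"
proof -
 have "(\<forall>k. case_nat i (fst e) k \<in> {1..n}) \<longleftrightarrow> i \<in> {1..n} \<and> (\<forall>k. fst e k \<in> {1..n})"
  by (metis nat.case(1) nat.case(2) not0_implies_Suc)
 then show ?thesis by (auto simp: idx_def icons_def image_subset_iff)
qed

lemma ihd_in: "e \<in> idx n ==> ihd e \<in> {1..n}"
 by (auto simp: idx_def ihd_def image_subset_iff)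

lemma itl_in_idx: "e \<in> idx n ==> itl \<omega> e \<in> idx n"
 using icons_in_idx[of \<omega> "ihd e" "itl \<omega> e" n] by simp

lemma icons_eq_iff: "icons \<omega> i e = e' \<longleftrightarrow> ihd e' = i \<and> itl \<omega> e' = e"
 by auto

text \<open>\<open>None\<close> stands for the zero vector: an adjoint letter annihilates words with
  another first letter. Every letter thus acts as a partial injection of the basis.\<close>

definition lop :: "(nat => 'g::topological_ab_group_add character) => nat \<times> bool => 'g idx => 'g idx option" where
 "lop \<omega> l e = (if snd l then if ihd e = fst l then Some (itl \<omega> e) else None else Some (icons \<omega> (fst l) e))"

primrec wop :: "(nat => 'g::topological_ab_group_add character) => (nat \<times> bool) list => 'g idx => 'g idx option" where
 "wop \<omega> [] e = Some e"
| "wop \<omega> (l # w) e = Option.bind (wop \<omega> w e) (lop \<omega> l)"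

definition flip_letters :: "(nat \<times> bool) list => (nat \<times> bool) list" where
 "flip_letters w = rev (map (%(i, b). (i, \<not> b)) w)"

lemma flip_letters_flip [simp]: "flip_letters (flip_letters w) = w"
 by (simp add: flip_letters_def rev_map o_def case_prod_beta)

lemma wop_append: "wop \<omega> (u @ v) e = Option.bind (wop \<omega> v e) (wop \<omega> u)"
 by (induction u) (simp_all only: append_Nil append_Cons wop.simps Option.bind_assoc,
  cases "wop \<omega> v e", simp_all)

lemma lop_flip: "lop \<omega> (i, \<not> b) e = Some e' \<longleftrightarrow> lop \<omega> (i, b) e' = Some e"
 by (auto simp: lop_def icons_eq_iff)

lemma wop_flip1: "wop \<omega> w e = Some e' ==> wop \<omega> (flip_letters w) e' = Some e"
proof (induction w arbitrary: e')
 case (Cons l w)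
 obtain e1 where e1: "wop \<omega> w e = Some e1" "lop \<omega> l e1 = Some e'" using Cons.prems by (auto simp: bind_eq_Some_conv)
 have "lop \<omega> (fst l, \<not> snd l) e' = Some e1" using e1(2) lop_flip[of \<omega> "fst l" "snd l" e' e1] by simp
 with Cons.IH[OF e1(1)] show ?case by (simp add: flip_letters_def wop_append case_prod_beta)
qed (simp add: flip_letters_def)

lemma wop_flip: "wop \<omega> (flip_letters w) e' = Some e \<longleftrightarrow> wop \<omega> w e = Some e'"
 using wop_flip1[of \<omega> w e e'] wop_flip1[of \<omega> "flip_letters w" e' e] by auto

lemma wop_in_idx:
 assumes "w \<in> lists ({1..n} \<times> UNIV)" "e \<in> idx n" "wop \<omega> w e = Some e'"
 shows "e' \<in> idx n"
 using assms
proof (induction w arbitrary: e')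
 case (Cons l w)
 obtain e1 where "wop \<omega> w e = Some e1" "lop \<omega> l e1 = Some e'" using Cons.prems by (auto simp: bind_eq_Some_conv)
 then show ?case using Cons by (cases l) (auto simp: lop_def itl_in_idx split: if_splits)
qed simp

section \<open>Matrices of words and of elements of the free algebra\<close>

definition wm :: "nat => (nat => 'g::topological_ab_group_add character) => (nat \<times> bool) list => 'g idx => 'g idx => complex" where
 "wm n \<omega> w e e' = (if e' \<in> idx n \<and> wop \<omega> w e' = Some e then 1 else 0)"

definition fm :: "nat => (nat => 'g::topological_ab_group_add character) => free_star => 'g idx => 'g idx => complex" where
 "fm n \<omega> x e e' = (\<Sum>w\<in>{w. x w \<noteq> 0}. x w * wm n \<omega> w e e')"

lemma fm_superset:
 assumes "finite T" "\<And>w. x w \<noteq> 0 ==> w \<in> T"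
 shows "fm n \<omega> x e e' = (\<Sum>w\<in>T. x w * wm n \<omega> w e e')"
 unfolding fm_def using assms by (intro sum.mono_neutral_left) auto

lemma free_finite: "x \<in> free_star_algebra n ==> finite {w. x w \<noteq> 0}"
 by (simp add: free_star_algebra_def)

lemma fm_add:
 assumes "x \<in> free_star_algebra n" "y \<in> free_star_algebra n"
 shows "fm n \<omega> (%w. x w + y w) e e' = fm n \<omega> x e e' + fm n \<omega> y e e'"
proof -
 define T where "T = {w. x w \<noteq> 0} \<union> {w. y w \<noteq> 0}"
 have T: "finite T" using assms by (simp add: T_def free_finite)
 have "fm n \<omega> (%w. x w + y w) e e' = (\<Sum>w\<in>T. (x w + y w) * wm n \<omega> w e e')"
  by (rule fm_superset[OF T]) (auto simp: T_def)
 also have "\<dots> = (\<Sum>w\<in>T. x w * wm n \<omega> w e e') + (\<Sum>w\<in>T. y w * wm n \<omega> w e e')"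
  by (simp add: distrib_right sum.distrib)
 also have "(\<Sum>w\<in>T. x w * wm n \<omega> w e e') = fm n \<omega> x e e'"
  by (rule fm_superset[OF T, symmetric]) (auto simp: T_def)
 also have "(\<Sum>w\<in>T. y w * wm n \<omega> w e e') = fm n \<omega> y e e'"
  by (rule fm_superset[OF T, symmetric]) (auto simp: T_def)
 finally show ?thesis .
qed

lemma fm_scale: "fm n \<omega> (%w. c *\<^sub>C x w) e e' = c * fm n \<omega> x e e'"
 by (cases "c = 0") (simp_all add: fm_def scaleC_complex_def sum_distrib_left mult.assoc)

lemma wm_nonzeroD: "wm n \<omega> w e e' \<noteq> 0 ==> e' \<in> idx n \<and> wop \<omega> w e' = Some e"
 by (rule ccontr) (simp add: wm_def)

lemma mbd_wm: "mbd (wm n \<omega> w) 1"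
proof (rule mbd_partial_injection)
 fix e a b assume "wm n \<omega> w e a \<noteq> 0" "wm n \<omega> w e b \<noteq> 0"
 then have "wop \<omega> w a = Some e" "wop \<omega> w b = Some e" by (blast dest: wm_nonzeroD)+
 then have "wop \<omega> (flip_letters w) e = Some a" "wop \<omega> (flip_letters w) e = Some b"
  by (simp_all add: wop_flip)
 then show "a = b" by simp
next
 fix e a b assume "wm n \<omega> w a e \<noteq> 0" "wm n \<omega> w b e \<noteq> 0"
 then have "wop \<omega> w e = Some a" "wop \<omega> w e = Some b" by (blast dest: wm_nonzeroD)+
 then show "a = b" by simp
qed (simp_all add: wm_def)

lemma mbd_fm:
 assumes "x \<in> free_star_algebra n"
 shows "mbd (fm n \<omega> x) (\<Sum>w\<in>{w. x w \<noteq> 0}. cmod (x w) * 1)"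
 unfolding fm_def by (intro mbd_sum free_finite[OF assms] mbd_scale mbd_wm)

lemma col_finite_wm: "col_finite (wm n \<omega> w)"
 unfolding col_finite_def
proof
 fix e' show "finite {e. wm n \<omega> w e e' \<noteq> 0}"
  by (rule finite_subset[of _ "set_option (wop \<omega> w e')"]) (auto simp: wm_def)
qed

lemma col_finite_sum:
 assumes "finite T" "\<And>t. t \<in> T ==> col_finite (M t)"
 shows "col_finite (%e e'. \<Sum>t\<in>T. c t * M t e e')"
 unfolding col_finite_def
proof
 fix e'
 have "{e. (\<Sum>t\<in>T. c t * M t e e') \<noteq> 0} \<subseteq> (\<Union>t\<in>T. {e. M t e e' \<noteq> 0})"
  by (auto elim!: sum.not_neutral_contains_not_neutral)
 moreover have "finite (\<Union>t\<in>T. {e. M t e e' \<noteq> 0})" using assms unfolding col_finite_def by blast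
 ultimately show "finite {e. (\<Sum>t\<in>T. c t * M t e e') \<noteq> 0}" by (rule finite_subset)
qed

lemma col_finite_fm: "x \<in> free_star_algebra n ==> col_finite (fm n \<omega> x)"
 unfolding fm_def by (intro col_finite_sum col_finite_wm free_finite)

lemma mm_wm:
 assumes "v \<in> lists ({1..n} \<times> UNIV)"
 shows "mm (wm n \<omega> u) (wm n \<omega> v) e e' = wm n \<omega> (u @ v) e e'"
proof (cases "e' \<in> idx n \<and> (\<exists>e1. wop \<omega> v e' = Some e1)")
 case True
 then obtain e1 where e1: "e' \<in> idx n" "wop \<omega> v e' = Some e1" by blast
 then have "e1 \<in> idx n" using wop_in_idx assms by blast
 have "mm (wm n \<omega> u) (wm n \<omega> v) e e' = (\<Sum>e''\<in>{e1}. wm n \<omega> u e e'' * wm n \<omega> v e'' e')"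
  by (rule mm_superset) (auto simp: wm_def e1 split: if_splits)
 then show ?thesis using e1 \<open>e1 \<in> idx n\<close> by (simp add: wm_def wop_append)
next
 case False
 then have "mm (wm n \<omega> u) (wm n \<omega> v) e e' = (\<Sum>e''\<in>{}. wm n \<omega> u e e'' * wm n \<omega> v e'' e')"
  by (intro mm_superset) (auto simp: wm_def split: if_splits)
 then show ?thesis using False by (auto simp: wm_def wop_append bind_eq_Some_conv)
qed

lemma fm_mult:
 assumes x: "x \<in> free_star_algebra n" and y: "y \<in> free_star_algebra n"
 shows "fm n \<omega> (free_mult x y) = mm (fm n \<omega> x) (fm n \<omega> y)"
proof (intro ext)
 fix e e'
 define X Y where "X = {w. x w \<noteq> 0}" and "Y = {w. y w \<noteq> 0}"
 have X: "finite X" and Y: "finite Y" using x y by (auto simp: X_def Y_def free_finite)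
 have Yl: "v \<in> lists ({1..n} \<times> UNIV)" if "v \<in> Y" for v using y that by (auto simp: Y_def free_star_algebra_def)
 define T where "T = (%(u, v). u @ v) ` (X \<times> Y)"
 have T: "finite T" using X Y by (simp add: T_def)
 define Q where "Q = {(w, k). w \<in> T \<and> k \<le> length w}"
 have Q: "Q = Sigma T (%w. {..length w})" by (auto simp: Q_def)
 have finQ: "finite Q" using T by (simp add: Q)
 define h where "h = (%p. x (take (snd p) (fst p)) * y (drop (snd p) (fst p)) * wm n \<omega> (fst p) e e')"
 \<comment> \<open>The cuts whose two factors lie in the supports. Recording the position
   \<open>length u\<close> keeps different splittings of the same word apart.\<close>
 define Q' where "Q' = (%(u, v). (u @ v, length u)) ` (X \<times> Y)"
 have "fm n \<omega> (free_mult x y) e e' = (\<Sum>w\<in>T. free_mult x y w * wm n \<omega> w e e')"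
 proof (rule fm_superset[OF T])
  fix w assume "free_mult x y w \<noteq> 0"
  then obtain k where "x (take k w) * y (drop k w) \<noteq> 0"
   unfolding free_mult_def by (auto elim!: sum.not_neutral_contains_not_neutral)
  then have "(take k w, drop k w) \<in> X \<times> Y" by (auto simp: X_def Y_def)
  then show "w \<in> T" unfolding T_def by (metis (mono_tags, lifting) append_take_drop_id case_prod_conv image_eqI)
 qed
 also have "\<dots> = (\<Sum>w\<in>T. \<Sum>k\<in>{..length w}. h (w, k))"
  by (simp add: free_mult_def h_def sum_distrib_right)
 also have "\<dots> = (\<Sum>p\<in>Q. h p)" unfolding Q using T by (subst sum.Sigma) (auto simp: case_prod_beta)
 also have "\<dots> = (\<Sum>p\<in>Q'. h p)"
 proof (rule sum.mono_neutral_right[OF finQ])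
  show "Q' \<subseteq> Q" by (auto simp: Q'_def Q_def T_def)
  show "\<forall>p\<in>Q - Q'. h p = 0"
  proof
   fix p assume p: "p \<in> Q - Q'"
   obtain w k where wk: "p = (w, k)" "k \<le> length w" using p by (auto simp: Q_def)
   have "(take k w, drop k w) \<notin> X \<times> Y"
   proof
    assume "(take k w, drop k w) \<in> X \<times> Y"
    then have "(take k w @ drop k w, length (take k w)) \<in> Q'" unfolding Q'_def by (metis (mono_tags, lifting) case_prod_conv image_eqI)
    then show False using p wk by simp
   qed
   then show "h p = 0" by (auto simp: h_def wk X_def Y_def)
  qed
 qed
 also have "\<dots> = (\<Sum>(u, v)\<in>X \<times> Y. h (u @ v, length u))"
  unfolding Q'_def by (subst sum.reindex) (auto simp: inj_on_def case_prod_beta)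
 also have "\<dots> = (\<Sum>u\<in>X. \<Sum>v\<in>Y. x u * y v * wm n \<omega> (u @ v) e e')"
  by (simp add: h_def sum.cartesian_product)
 finally have 1: "fm n \<omega> (free_mult x y) e e' = (\<Sum>u\<in>X. \<Sum>v\<in>Y. x u * y v * wm n \<omega> (u @ v) e e')" .
 define C where "C = (\<Union>v\<in>Y. {e''. wm n \<omega> v e'' e' \<noteq> 0})"
 have C: "finite C"
  unfolding C_def using Y col_finite_wm[unfolded col_finite_def] by blast
 have "mm (fm n \<omega> x) (fm n \<omega> y) e e' = (\<Sum>e''\<in>C. fm n \<omega> x e e'' * fm n \<omega> y e'' e')"
  by (rule mm_superset[OF C]) (auto simp: C_def fm_def Y_def elim!: sum.not_neutral_contains_not_neutral)
 also have "\<dots> = (\<Sum>e''\<in>C. \<Sum>u\<in>X. \<Sum>v\<in>Y. x u * y v * (wm n \<omega> u e e'' * wm n \<omega> v e'' e'))"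
  by (simp add: fm_def X_def[symmetric] Y_def[symmetric] sum_product mult_ac)
 also have "\<dots> = (\<Sum>u\<in>X. \<Sum>e''\<in>C. \<Sum>v\<in>Y. x u * y v * (wm n \<omega> u e e'' * wm n \<omega> v e'' e'))" by (rule sum.swap)
 also have "\<dots> = (\<Sum>u\<in>X. \<Sum>v\<in>Y. \<Sum>e''\<in>C. x u * y v * (wm n \<omega> u e e'' * wm n \<omega> v e'' e'))"
  by (intro sum.cong refl sum.swap)
 also have "\<dots> = (\<Sum>u\<in>X. \<Sum>v\<in>Y. x u * y v * wm n \<omega> (u @ v) e e')"
 proof (intro sum.cong refl)
  fix u v assume v: "v \<in> Y"
  have "mm (wm n \<omega> u) (wm n \<omega> v) e e' = (\<Sum>e''\<in>C. wm n \<omega> u e e'' * wm n \<omega> v e'' e')"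
   by (rule mm_superset[OF C]) (use v in \<open>auto simp: C_def\<close>)
  then show "(\<Sum>e''\<in>C. x u * y v * (wm n \<omega> u e e'' * wm n \<omega> v e'' e')) = x u * y v * wm n \<omega> (u @ v) e e'"
   using mm_wm[OF Yl[OF v], of \<omega> u e e'] by (simp add: sum_distrib_left)
 qed
 finally show "fm n \<omega> (free_mult x y) e e' = mm (fm n \<omega> x) (fm n \<omega> y) e e'" using 1 by simp
qed

lemma fm_adj:
 assumes x: "x \<in> free_star_algebra n"
 shows "fm n \<omega> (free_adj x) = adjm (fm n \<omega> x)"
proof (intro ext)
 fix e e'
 define X where "X = {w. x w \<noteq> 0}"
 have X: "finite X" using x by (simp add: X_def free_finite)
 have Xl: "v \<in> lists ({1..n} \<times> UNIV)" if "v \<in> X" for v using x that by (auto simp: X_def free_star_algebra_def)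
 have ad: "free_adj x w = cnj (x (flip_letters w))" for w by (simp add: free_adj_def flip_letters_def)
 have inj: "inj_on flip_letters X" by (metis flip_letters_flip inj_onI)
 have "fm n \<omega> (free_adj x) e e' = (\<Sum>w\<in>flip_letters ` X. free_adj x w * wm n \<omega> w e e')"
 proof (rule fm_superset)
  fix w assume "free_adj x w \<noteq> 0"
  then have "flip_letters w \<in> X" by (simp add: ad X_def)
  then show "w \<in> flip_letters ` X" by (metis flip_letters_flip image_eqI)
 qed (use X in simp)
 also have "\<dots> = (\<Sum>w\<in>X. cnj (x w) * wm n \<omega> (flip_letters w) e e')"
  by (simp add: sum.reindex[OF inj] ad)
 also have "\<dots> = (\<Sum>w\<in>X. cnj (x w * wm n \<omega> w e' e))"
 proof (intro sum.cong refl)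
  fix w assume w: "w \<in> X"
  have wf: "flip_letters w \<in> lists ({1..n} \<times> UNIV)" using Xl[OF w] by (auto simp: flip_letters_def in_lists_conv_set)
  have "e' \<in> idx n \<and> wop \<omega> (flip_letters w) e' = Some e \<longleftrightarrow> e \<in> idx n \<and> wop \<omega> w e = Some e'"
   using wop_flip wop_in_idx[OF Xl[OF w]] wop_in_idx[OF wf] by metis
  then show "cnj (x w) * wm n \<omega> (flip_letters w) e e' = cnj (x w * wm n \<omega> w e' e)"
   by (simp add: wm_def)
 qed
 finally show "fm n \<omega> (free_adj x) e e' = adjm (fm n \<omega> x) e e'"
  by (simp add: adjm_def fm_def X_def)
qed

section \<open>Monomials of the free algebra and the Cuntz relations\<close>

definition fsingle :: "(nat \<times> bool) list => free_star" where
 "fsingle w = (%w'. if w' = w then 1 else 0)"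

lemma fm_fsingle: "fm n \<omega> (fsingle w) = wm n \<omega> w"
proof (intro ext)
 fix e e' show "fm n \<omega> (fsingle w) e e' = wm n \<omega> w e e'"
  by (subst fm_superset[of "{w}"]) (auto simp: fsingle_def split: if_splits)
qed

lemma fsingle_in: "w \<in> lists ({1..n} \<times> UNIV) ==> fsingle w \<in> free_star_algebra n"
 by (auto simp: fsingle_def free_star_algebra_def)

lemma free_gen_fsingle: "free_gen i = fsingle [(i, False)]"
 by (simp add: free_gen_def fsingle_def)

lemma free_one_fsingle: "free_one = fsingle []"
 by (simp add: free_one_def fsingle_def)

lemma free_adj_fsingle: "free_adj (fsingle w) = fsingle (flip_letters w)"
proof
 fix w'
 have "flip_letters w' = w \<longleftrightarrow> w' = flip_letters w" by (metis flip_letters_flip)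
 then show "free_adj (fsingle w) w' = fsingle (flip_letters w) w'"
  by (simp add: free_adj_def fsingle_def flip_letters_def)
qed

lemma free_mult_fsingle: "free_mult (fsingle u) (fsingle v) = fsingle (u @ v)"
proof
 fix w
 have *: "take k w = u \<and> drop k w = v \<longleftrightarrow> w = u @ v \<and> k = length u" if "k \<le> length w" for k
  using that by (metis append_eq_conv_conj append_take_drop_id length_take min.absorb2)
 have "free_mult (fsingle u) (fsingle v) w = (\<Sum>k\<le>length w. if take k w = u \<and> drop k w = v then 1 else 0)"
  unfolding free_mult_def fsingle_def by (intro sum.cong refl) auto
 also have "\<dots> = (\<Sum>k\<le>length w. if k = length u then if w = u @ v then 1 else 0 else 0)"
  by (intro sum.cong refl) (use * in auto)
 also have "\<dots> = fsingle (u @ v) w" by (auto simp: fsingle_def)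
 finally show "free_mult (fsingle u) (fsingle v) w = fsingle (u @ v) w" .
qed

lemma free_star_algebra_closed:
 assumes "x \<in> free_star_algebra n" "y \<in> free_star_algebra n"
 shows "(%w. x w + y w) \<in> free_star_algebra n" "(%w. c *\<^sub>C x w) \<in> free_star_algebra n"
proof -
 have "{w. x w + y w \<noteq> 0} \<subseteq> {w. x w \<noteq> 0} \<union> {w. y w \<noteq> 0}" by auto
 moreover have "finite ({w. x w \<noteq> 0} \<union> {w. y w \<noteq> 0})" using assms by (simp add: free_finite)
 ultimately have "finite {w. x w + y w \<noteq> 0}" by (rule finite_subset)
 moreover have "w \<in> lists ({1..n} \<times> UNIV)" if "x w + y w \<noteq> 0" for w
  using that assms unfolding free_star_algebra_def by (cases "x w = 0") auto
 ultimately show "(%w. x w + y w) \<in> free_star_algebra n" unfolding free_star_algebra_def by blast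
 have "{w. c * x w \<noteq> 0} \<subseteq> {w. x w \<noteq> 0}" by auto
 then have "finite {w. c * x w \<noteq> 0}" by (rule finite_subset) (simp add: free_finite[OF assms(1)])
 then show "(%w. c *\<^sub>C x w) \<in> free_star_algebra n"
  using assms(1) unfolding free_star_algebra_def scaleC_complex_def by auto
qed

lemma free_adj_in:
 assumes x: "x \<in> free_star_algebra n"
 shows "free_adj x \<in> free_star_algebra n"
proof -
 have ad: "free_adj x w = cnj (x (flip_letters w))" for w by (simp add: free_adj_def flip_letters_def)
 have "{w. free_adj x w \<noteq> 0} = flip_letters ` {w. x w \<noteq> 0}"
  unfolding ad by (auto simp: image_iff) (metis flip_letters_flip)
 moreover have "flip_letters w \<in> lists ({1..n} \<times> UNIV) ==> w \<in> lists ({1..n} \<times> UNIV)" for w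
  by (auto simp: flip_letters_def in_lists_conv_set)
 ultimately show ?thesis using x by (auto simp: free_star_algebra_def ad)
qed

text \<open>\<open>fm\<close> is a representation by column-finite matrices, so its operator norm
  competes in the universal property of \<open>O_n\<close>; this is what later bounds coefficients
  by the norm.\<close>

lemma cstar_seminorm_fm:
 "cstar_seminorm_on (free_star_algebra n) free_mult free_adj (%x. opn (fm n \<omega> x))"
proof -
 have sum: "opn (fm n \<omega> (%w. x w + y w)) \<le> opn (fm n \<omega> x) + opn (fm n \<omega> y)"
  and mult: "opn (fm n \<omega> (free_mult x y)) \<le> opn (fm n \<omega> x) * opn (fm n \<omega> y)"
  if x: "x \<in> free_star_algebra n" and y: "y \<in> free_star_algebra n" for x y
 proof -
  have "fm n \<omega> (%w. x w + y w) = (%e e'. fm n \<omega> x e e' + fm n \<omega> y e e')" by (intro ext fm_add x y)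
  then show "opn (fm n \<omega> (%w. x w + y w)) \<le> opn (fm n \<omega> x) + opn (fm n \<omega> y)"
   by (simp add: opn_add[OF mbd_fm[OF x] mbd_fm[OF y]])
  show "opn (fm n \<omega> (free_mult x y)) \<le> opn (fm n \<omega> x) * opn (fm n \<omega> y)"
   by (subst fm_mult[OF x y]) (rule opn_mm[OF mbd_fm[OF x] mbd_fm[OF y] col_finite_fm[OF y]])
 qed
 have nonneg: "0 \<le> opn (fm n \<omega> x)"
  and star: "opn (fm n \<omega> (free_mult (free_adj x) x)) = (opn (fm n \<omega> x))\<^sup>2"
  and scale: "opn (fm n \<omega> (%w. c *\<^sub>C x w)) = cmod c * opn (fm n \<omega> x)"
  if x: "x \<in> free_star_algebra n" for x c
 proof -
  note bx = mbd_fm[OF x, of \<omega>]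
  show "0 \<le> opn (fm n \<omega> x)" by (rule opn_nonneg[OF bx])
  show "opn (fm n \<omega> (free_mult (free_adj x) x)) = (opn (fm n \<omega> x))\<^sup>2"
   unfolding fm_mult[OF free_adj_in[OF x] x] fm_adj[OF x] by (rule opn_cstar[OF bx col_finite_fm[OF x]])
  have "fm n \<omega> (%w. c *\<^sub>C x w) = (%e e'. c * fm n \<omega> x e e')" by (intro ext fm_scale)
  then show "opn (fm n \<omega> (%w. c *\<^sub>C x w)) = cmod c * opn (fm n \<omega> x)" by (simp add: opn_scale[OF bx])
 qed
 show ?thesis
  unfolding cstar_seminorm_on_def by (intro conjI ballI allI sum mult nonneg star scale)
qed

lemma kills_cuntz_relations_fm: "kills_cuntz_relations n (%x. opn (fm n \<omega> x))"
proof -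
 have zero: "opn M = 0" if "\<And>e e'. M e e' = 0" for M :: "'i => 'i => complex"
 proof -
  have "M = (%e e'. 0)" by (intro ext that)
  then show ?thesis using opn_le[OF mbd_zero] opn_nonneg[OF mbd_zero] by (metis antisym)
 qed
 have gl: "[(i, b)] \<in> lists ({1..n} \<times> UNIV)" "[(i, b), (i, b')] \<in> lists ({1..n} \<times> UNIV)"
  if "i \<in> {1..n}" for i b b' using that by auto
 have fl: "flip_letters [(i, b)] = [(i, \<not> b)]" for i b by (simp add: flip_letters_def)
 have neg: "(%w. (- 1) *\<^sub>C fsingle [] w) \<in> free_star_algebra n"
  by (rule free_star_algebra_closed(2)[OF fsingle_in fsingle_in[of "[]"]]) simp_all
 have fneg: "fm n \<omega> (%w. (- 1) *\<^sub>C fsingle [] w) e e' = - wm n \<omega> [] e e'" for e e'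
  by (simp only: fm_scale fm_fsingle) simp
 show ?thesis
  unfolding kills_cuntz_relations_def free_gen_fsingle free_one_fsingle free_adj_fsingle free_mult_fsingle fl
 proof (intro conjI ballI)
  fix i assume i: "i \<in> {1..n}"
  have eq: "(%w. fsingle ([(i, \<not> False)] @ [(i, False)]) w - fsingle [] w) =
    (%w. fsingle [(i, True), (i, False)] w + (- 1) *\<^sub>C fsingle [] w)"
   by (simp add: scaleC_complex_def)
  show "opn (fm n \<omega> (%w. fsingle ([(i, \<not> False)] @ [(i, False)]) w - fsingle [] w)) = 0"
  proof (rule zero)
   fix e e'
   show "fm n \<omega> (%w. fsingle ([(i, \<not> False)] @ [(i, False)]) w - fsingle [] w) e e' = 0"
    unfolding eq fm_add[OF fsingle_in[OF gl(2)[OF i]] neg] fneg fm_fsingle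
    by (simp add: wm_def lop_def)
  qed
 next
  \<comment> \<open>Additivity is available for two summands, so the sum over the generators is
    built up one term at a time.\<close>
  define y where "y = (%m w. \<Sum>i=1..m. fsingle [(i, False), (i, True)] w)"
  have y: "y m \<in> free_star_algebra n \<and> fm n \<omega> (y m) = (%e e'. \<Sum>i=1..m. wm n \<omega> [(i, False), (i, True)] e e')"
   if "m \<le> n" for m
   using that
  proof (induction m)
   case 0 then show ?case by (auto simp: y_def free_star_algebra_def fm_def)
  next
   case (Suc m)
   have i: "Suc m \<in> {1..n}" using Suc.prems by simp
   have eq: "y (Suc m) = (%w. y m w + fsingle [(Suc m, False), (Suc m, True)] w)" by (simp add: y_def fun_eq_iff)
   have m: "y m \<in> free_star_algebra n" "fm n \<omega> (y m) = (%e e'. \<Sum>i=1..m. wm n \<omega> [(i, False), (i, True)] e e')"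
    using Suc by auto
   show ?case unfolding eq using free_star_algebra_closed(1)[OF m(1) fsingle_in[OF gl(2)[OF i]]]
    by (auto simp: fun_eq_iff fm_add[OF m(1) fsingle_in[OF gl(2)[OF i]]] m(2) fm_fsingle)
  qed
  have eq: "(%w. (\<Sum>i=1..n. fsingle ([(i, False)] @ [(i, \<not> False)]) w) - fsingle [] w) =
    (%w. y n w + (- 1) *\<^sub>C fsingle [] w)"
   by (simp add: scaleC_complex_def y_def)
  show "opn (fm n \<omega> (%w. (\<Sum>i=1..n. fsingle ([(i, False)] @ [(i, \<not> False)]) w) - fsingle [] w)) = 0"
  proof (rule zero)
   fix e e'
   \<comment> \<open>\<open>S_i\<close> times its adjoint projects onto the words that begin with
     \<open>i\<close>, and every word has exactly one first letter.\<close>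
   have w1: "wm n \<omega> [(i, False), (i, True)] e e' = (if i = ihd e' then wm n \<omega> [] e e' else 0)" for i
    by (auto simp: wm_def lop_def)
   have "(\<Sum>i=1..n. wm n \<omega> [(i, False), (i, True)] e e') = wm n \<omega> [] e e'"
    unfolding w1 using ihd_in[of e' n] by (auto simp: wm_def)
   then show "fm n \<omega> (%w. (\<Sum>i=1..n. fsingle ([(i, False)] @ [(i, \<not> False)]) w) - fsingle [] w) e e' = 0"
    unfolding eq fm_add[OF conjunct1[OF y[OF order_refl]] neg] fneg conjunct2[OF y[OF order_refl]]
    by simp
  qed
 qed
qed

section \<open>Integration on locally compact abelian groups\<close>

lemma csI:
 "continuous_on UNIV f ==> compact K ==> (\<And>t. t \<notin> K ==> f t = 0) ==> f \<in> Cc"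
 unfolding compactly_supported_def by blast

lemma csE:
 assumes "f \<in> Cc"
 obtains K where "continuous_on UNIV f" "compact K" "\<And>t. t \<notin> K ==> f t = 0"
 using assms unfolding compactly_supported_def by blast

lemma cs_continuous: "f \<in> Cc ==> continuous_on UNIV f"
 by (simp add: compactly_supported_def)

lemma cs_add:
 assumes "f \<in> Cc" "g \<in> Cc"
 shows "(%t. f t + g t) \<in> Cc"
proof -
 obtain K where K: "continuous_on UNIV f" "compact K" "\<And>t. t \<notin> K ==> f t = 0"
  using assms(1) by (rule csE) (rule that)
 obtain L where L: "continuous_on UNIV g" "compact L" "\<And>t. t \<notin> L ==> g t = 0"
  using assms(2) by (rule csE) (rule that)
 show ?thesis
  by (rule csI[of _ "K \<union> L"])
   (auto intro!: continuous_on_add K L compact_Un simp: K L)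
qed

lemma cs_bounded_linear:
 assumes "f \<in> Cc" "bounded_linear h"
 shows "(%t. h (f t)) \<in> Cc"
proof -
 obtain K where K: "continuous_on UNIV f" "compact K" "\<And>t. t \<notin> K ==> f t = 0"
  using assms(1) by (rule csE) (rule that)
 show ?thesis
  by (rule csI[OF bounded_linear.continuous_on[OF assms(2) K(1)] K(2)])
   (simp add: K linear_0 bounded_linear.linear[OF assms(2)])
qed

lemma cs_mult:
 fixes f :: "'g::topological_space => 'b::real_normed_vector" and h :: "'c::real_normed_vector => 'b => 'd::real_normed_vector"
 assumes "bounded_bilinear h" "f \<in> Cc" "continuous_on UNIV c"
 shows "(%t. h (c t) (f t)) \<in> Cc"
proof -
 obtain K where K: "continuous_on UNIV f" "compact K" "\<And>t. t \<notin> K ==> f t = 0"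
  using assms(2) by (rule csE) (rule that)
 show ?thesis
  by (rule csI[OF bounded_bilinear.continuous_on[OF assms(1) assms(3) K(1)] K(2)])
   (simp add: K bounded_bilinear.zero_right[OF assms(1)])
qed

lemma cs_sum:
 "(\<And>i. i \<in> A ==> f i \<in> Cc) ==> (%t. \<Sum>i\<in>A. f i t) \<in> Cc"
 by (induction A rule: infinite_finite_induct)
  (auto intro: cs_add csI[of _ "{}"])

lemma compact_add_sets:
 fixes K L :: "'g::topological_ab_group_add set"
 assumes "compact K" "compact L"
 shows "compact ((%p. fst p + snd p) ` (K \<times> L))" "compact ((%p. fst p - snd p) ` (K \<times> L))"
 by (intro compact_continuous_image compact_Times assms continuous_intros)+

locale lca =
 fixes \<mu> :: "'g::{topological_ab_group_add, t2_space} measure"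
 assumes loc_compact: "locally compact (UNIV :: 'g set)" and haar: "haar_measure \<mu>"
begin

lemma sets_haar [simp, measurable_cong]: "sets \<mu> = sets borel"
 using haar by (simp add: haar_measure_def)

lemma space_haar [simp]: "space \<mu> = UNIV"
 using sets_eq_imp_space_eq[OF sets_haar] by simp

lemma emeasure_compact: "compact K ==> emeasure \<mu> K < \<infinity>"
 using haar by (simp add: haar_measure_def)

lemma continuous_measurable: "continuous_on UNIV f ==> f \<in> borel_measurable \<mu>"
 using borel_measurable_continuous_onI[of f] by (simp cong: measurable_cong_sets)

lemma integrable_bounded:
 fixes f :: "'g => 'b::{banach, second_countable_topology}"
 assumes "continuous_on UNIV f" "compact K" "\<And>t. t \<notin> K ==> f t = 0"
 shows "integrable \<mu> f"
proof -
 have "bounded (f ` K)"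
  by (intro compact_imp_bounded compact_continuous_image continuous_on_subset[OF assms(1)] assms(2)) simp
 then obtain B where "\<And>t. t \<in> K ==> norm (f t) \<le> B" by (auto simp: bounded_iff)
 then show ?thesis
  by (intro integrableI_bounded_set[of K _ _ B] continuous_measurable assms emeasure_compact)
   (auto intro: borel_compact assms)
qed

lemma integrable_cs:
 fixes f :: "'g => 'b::{banach, second_countable_topology}"
 shows "f \<in> Cc ==> integrable \<mu> f"
 by (erule csE) (rule integrable_bounded)

lemma norm_cs_integral:
 fixes f :: "'g => 'b::{banach, second_countable_topology}"
 shows "f \<in> Cc ==> norm (\<integral>t. f t \<partial>\<mu>) \<le> (\<integral>t. norm (f t) \<partial>\<mu>)"
 by (rule integral_norm_bound)

lemma integral_norm_le:
 fixes f :: "'g => 'b::{banach, second_countable_topology}"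
 assumes "continuous_on UNIV f" "compact K" "\<And>t. t \<notin> K ==> f t = 0" "\<And>t. norm (f t) \<le> e"
 shows "(\<integral>t. norm (f t) \<partial>\<mu>) \<le> e * measure \<mu> K"
proof -
 have "(\<integral>t. norm (f t) \<partial>\<mu>) \<le> (\<integral>t. e * indicator K t \<partial>\<mu>)"
 proof (rule integral_mono)
  show "integrable \<mu> (%t. norm (f t))" using integrable_bounded[OF assms(1-3)] by simp
  show "integrable \<mu> (%t. e * indicator K t)"
   using emeasure_compact[OF assms(2)] borel_compact[OF assms(2)] by (auto intro!: integrable_mult_right)
  show "norm (f t) \<le> e * indicator K t" for t
   using assms(3,4)[of t] by (auto simp: indicator_def)
 qed
 also have "\<dots> = e * measure \<mu> K" using borel_compact[OF assms(2)] by simp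
 finally show ?thesis .
qed

lemma integral_bound:
 fixes f :: "'g => 'b::{banach, second_countable_topology}"
 assumes "continuous_on UNIV f" "compact K" "\<And>t. t \<notin> K ==> f t = 0" "\<And>t. norm (f t) \<le> e"
 shows "norm (\<integral>t. f t \<partial>\<mu>) \<le> e * measure \<mu> K"
 by (rule order_trans[OF integral_norm_bound integral_norm_le[OF assms]])

lemma emeasure_translate: "B \<in> sets borel ==> emeasure \<mu> ((%s. t + s) ` B) = emeasure \<mu> B"
 using haar unfolding haar_measure_def by simp

lemma emeasure_open_pos: "open U ==> U \<noteq> {} ==> emeasure \<mu> U > 0"
proof -
 have "\<forall>U. open U \<and> U \<noteq> {} --> emeasure \<mu> U > 0"
  using haar unfolding haar_measure_def by (elim conjE)
 then show "open U ==> U \<noteq> {} ==> emeasure \<mu> U > 0" by blast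
qed

lemma distr_translate: "distr \<mu> \<mu> (%t. s + t) = \<mu>"
proof (rule measure_eqI)
 have m: "(%t. s + t) \<in> measurable \<mu> \<mu>"
  using borel_measurable_continuous_onI[of "%t. s + t"] by (simp cong: measurable_cong_sets add: continuous_intros)
 fix B assume "B \<in> sets (distr \<mu> \<mu> (%t. s + t))"
 then have B: "B \<in> sets borel" by simp
 have "(%t. s + t) -` B = (%t. - s + t) ` B"
 proof (intro set_eqI iffI)
  fix t assume "t \<in> (%t. s + t) -` B"
  then show "t \<in> (%t. - s + t) ` B" by (intro image_eqI[of _ _ "s + t"]) auto
 qed auto
 then have "emeasure (distr \<mu> \<mu> (%t. s + t)) B = emeasure \<mu> ((%t. - s + t) ` B)"
  using B m by (simp add: emeasure_distr)
 also have "\<dots> = emeasure \<mu> B" using B by (rule emeasure_translate)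
 finally show "emeasure (distr \<mu> \<mu> (%t. s + t)) B = emeasure \<mu> B" .
qed simp

lemma integral_translate:
 fixes f :: "'g => 'b::{banach, second_countable_topology}"
 assumes "continuous_on UNIV f"
 shows "(\<integral>t. f (s + t) \<partial>\<mu>) = (\<integral>t. f t \<partial>\<mu>)"
proof -
 have m: "(%t. s + t) \<in> measurable \<mu> \<mu>"
  using borel_measurable_continuous_onI[of "%t. s + t"] by (simp cong: measurable_cong_sets add: continuous_intros)
 show ?thesis
  using integral_distr[OF m continuous_measurable[OF assms]] by (simp add: distr_translate)
qed

lemma compact_nbhd: "\<exists>U K. open U \<and> compact K \<and> (x::'g) \<in> U \<and> U \<subseteq> K"
 using loc_compact[unfolded locally_def, rule_format, of UNIV x] by auto

lemma compact_nbhd_set: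
 assumes "compact (K :: 'g set)"
 obtains U L where "open U" "compact L" "K \<subseteq> U" "U \<subseteq> L"
proof -
 obtain U L where U: "\<And>x::'g. open (U x)" "\<And>x. x \<in> U x" and L: "\<And>x::'g. compact (L x)" "\<And>x. U x \<subseteq> L x"
  using compact_nbhd by metis
 obtain J where J: "J \<subseteq> K" "finite J" "K \<subseteq> (\<Union>x\<in>J. U x)"
  by (rule compactE_image[OF assms, of K U]) (use U in auto)
 show ?thesis
  by (rule that[of "\<Union>x\<in>J. U x" "\<Union>x\<in>J. L x"]) (use J U L in \<open>auto intro!: compact_UN dest!: subsetD[OF L(2)]\<close>)
qed

section \<open>Bump functions and partitions of unity\<close>

lemma urysohn:
 assumes "open U" "(x::'g) \<in> U"
 obtains f :: "'g => real" where "continuous_on UNIV f" "\<And>t. 0 \<le> f t" "\<And>t. f t \<le> 1" "f x = 1"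
  "\<And>t. t \<notin> U ==> f t = 0"
proof -
 have "Hausdorff_space (euclidean :: 'g topology)"
  unfolding Hausdorff_space_def using hausdorff by (auto simp: disjnt_def)
 moreover have lc: "locally_compact_space (euclidean :: 'g topology)"
  unfolding locally_compact_space_def using compact_nbhd by (metis compactin_euclidean_iff open_openin)
 ultimately have "completely_regular_space (euclidean :: 'g topology)"
  using locally_compact_regular_imp_completely_regular_space locally_compact_Hausdorff_or_regular by blast
 moreover have "closedin euclidean (- U)" "x \<in> topspace euclidean - (- U)" using assms by (auto simp: closed_Compl)
 ultimately obtain f :: "'g => real" where f: "continuous_map euclidean (top_of_set {0..1}) f" "f x = 0" "f ` (- U) \<subseteq> {1}"
  unfolding completely_regular_space_def by blast
 have "continuous_on UNIV f" "\<And>t. f t \<in> {0..1}"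
  using f(1) by (auto simp: continuous_map_in_subtopology)
 then show ?thesis
  using f(2,3) by (intro that[of "%t. 1 - f t"]) (auto intro!: continuous_intros)
qed

text \<open>A partition of unity subordinate to the sets where \<open>F s\<close> is nearly constant
  in \<open>s\<close>, uniformly in the parameter \<open>x\<close>. It replaces a kernel by a finite
  sum of products.\<close>

lemma partition_approx:
 fixes F :: "'g => 'x => 'b::real_normed_vector"
 assumes K: "compact K" and V: "open V" "K \<subseteq> V" "V \<subseteq> K1" and e: "0 \<le> e"
  and F0: "\<And>s x. s \<notin> K ==> F s x = 0"
  and eq: "\<And>s0. s0 \<in> K ==> \<exists>U. open U \<and> s0 \<in> U \<and> (\<forall>s\<in>U. \<forall>x. norm (F s x - F s0 x) \<le> e)"
 obtains J :: "'g set" and \<phi> :: "'g => 'g => real" where "finite J" "J \<subseteq> K"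
  "\<And>j. j \<in> J ==> continuous_on UNIV (\<phi> j)" "\<And>j s. j \<in> J ==> 0 \<le> \<phi> j s"
  "\<And>j s. j \<in> J ==> s \<notin> K1 ==> \<phi> j s = 0" "\<And>s. (\<Sum>j\<in>J. \<phi> j s) \<le> 1"
  "\<And>s x. norm (F s x - (\<Sum>j\<in>J. \<phi> j s *\<^sub>R F j x)) \<le> e"
proof -
 obtain U where U: "\<And>s0. s0 \<in> K ==> open (U s0) \<and> s0 \<in> U s0 \<and> (\<forall>s\<in>U s0. \<forall>x. norm (F s x - F s0 x) \<le> e)"
  using eq by metis
 have "\<exists>b. continuous_on UNIV b \<and> (\<forall>t. 0 \<le> (b t::real)) \<and> b s = 1 \<and> (\<forall>t. t \<notin> U s \<inter> V --> b t = 0)"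
  if "s \<in> K" for s
 proof -
  have "open (U s \<inter> V)" "s \<in> U s \<inter> V" using U[OF that] V that by auto
  then show ?thesis using urysohn by metis
 qed
 then obtain b where b: "\<And>s. s \<in> K ==> continuous_on UNIV (b s)" "\<And>s t. s \<in> K ==> 0 \<le> (b s t::real)"
  "\<And>s. s \<in> K ==> b s s = 1" "\<And>s t. s \<in> K ==> t \<notin> U s \<inter> V ==> b s t = 0"
  by metis
 have op: "open {t. 1/2 < b s t}" if "s \<in> K" for s
  using b(1)[OF that] by (intro open_Collect_less) (auto intro: continuous_intros)
 obtain J where J: "J \<subseteq> K" "finite J" "K \<subseteq> (\<Union>s\<in>J. {t. 1/2 < b s t})"
  by (rule compactE_image[OF K, of K "%s. {t. 1/2 < b s t}"]) (use op b(3) in force)+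
 define \<sigma> where "\<sigma> = (%t. \<Sum>j\<in>J. b j t)"
 \<comment> \<open>On \<open>K\<close> some bump exceeds 1/2, so there the denominator is
   \<open>\<sigma>\<close> and the weights sum to 1. Elsewhere the bound 1/2 keeps the quotient
   continuous and the sum at most 1.\<close>
 define \<phi> where "\<phi> = (%j t. b j t / max (\<sigma> t) (1/2))"
 have \<sigma>_cont: "continuous_on UNIV \<sigma>" unfolding \<sigma>_def using b(1) J by (intro continuous_on_sum) auto
 have \<phi>_cont: "continuous_on UNIV (\<phi> j)" if "j \<in> J" for j
  unfolding \<phi>_def using b(1)[of j] that J(1) \<sigma>_cont by (intro continuous_intros) (auto simp: max_def)
 have sum\<phi>: "(\<Sum>j\<in>J. \<phi> j s) = \<sigma> s / max (\<sigma> s) (1/2)" for s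
  by (simp add: \<phi>_def \<sigma>_def sum_divide_distrib)
 have \<phi>0: "0 \<le> \<phi> j s" if "j \<in> J" for j s using b(2)[of j s] that J by (auto simp: \<phi>_def)
 have sum1: "(\<Sum>j\<in>J. \<phi> j s) \<le> 1" for s unfolding sum\<phi> by (simp add: max_def)
 have sumK: "(\<Sum>j\<in>J. \<phi> j s) = 1" if sK: "s \<in> K" for s
 proof -
  obtain j where j: "j \<in> J" "1/2 < b j s" using J(3) sK by blast
  have "b j s \<le> \<sigma> s" unfolding \<sigma>_def using J b(2) j by (intro member_le_sum) auto
  then show ?thesis using j unfolding sum\<phi> by (simp add: max_def)
 qed
 have near: "norm (F s x - (\<Sum>j\<in>J. \<phi> j s *\<^sub>R F j x)) \<le> e" for s x
 proof -
  have "F s x = (\<Sum>j\<in>J. \<phi> j s) *\<^sub>R F s x" using sumK[of s] F0[of s x] by (cases "s \<in> K") auto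
  then have "F s x - (\<Sum>j\<in>J. \<phi> j s *\<^sub>R F j x) = (\<Sum>j\<in>J. \<phi> j s *\<^sub>R (F s x - F j x))"
   by (simp add: scaleR_diff_right sum_subtractf scaleR_sum_left)
  also have "norm \<dots> \<le> (\<Sum>j\<in>J. \<phi> j s * e)"
  proof (rule sum_norm_le)
   fix j assume j: "j \<in> J"
   show "norm (\<phi> j s *\<^sub>R (F s x - F j x)) \<le> \<phi> j s * e"
   proof (cases "s \<in> U j")
    case True
    then have "norm (F s x - F j x) \<le> e" using U[of j] j J(1) by auto
    then show ?thesis using \<phi>0[OF j] by (simp add: mult_left_mono)
   next
    case False
    then have "\<phi> j s = 0" using b(4)[of j s] j J(1) by (auto simp: \<phi>_def)
    then show ?thesis by simp
   qed
  qed
  also have "\<dots> \<le> 1 * e"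
   unfolding sum_distrib_right[symmetric] using sum1 e by (intro mult_right_mono)
  finally show ?thesis by simp
 qed
 have "\<phi> j s = 0" if "j \<in> J" "s \<notin> K1" for j s
 proof -
  have "s \<notin> V" "j \<in> K" using that V J by auto
  then show ?thesis using b(4)[of j s] by (simp add: \<phi>_def)
 qed
 then show ?thesis using that[OF J(2,1) \<phi>_cont \<phi>0 _ sum1 near] by blast
qed

text \<open>Tube argument over the compact set \<open>L\<close>; outside \<open>L\<close> both
  values vanish.\<close>

lemma equicontinuous_section:
 fixes F :: "'g \<times> 'h::topological_space => 'b::real_normed_vector"
 assumes F: "continuous_on UNIV F" and V: "open V" "s0 \<in> V"
  and L: "compact L" "\<And>s t. s \<in> V ==> t \<notin> L ==> F (s, t) = 0" and e: "0 < e"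
 shows "\<exists>U. open U \<and> s0 \<in> U \<and> (\<forall>s\<in>U. \<forall>t. norm (F (s, t) - F (s0, t)) \<le> e)"
proof -
 have "\<exists>A B. open A \<and> open B \<and> s0 \<in> A \<and> t0 \<in> B \<and> (\<forall>s\<in>A. \<forall>t\<in>B. norm (F (s, t) - F (s0, t0)) < e / 2)" for t0
 proof -
  have "open (F -` ball (F (s0, t0)) (e/2))" by (rule open_vimage[OF open_ball F])
  moreover have "(s0, t0) \<in> F -` ball (F (s0, t0)) (e/2)" using e by simp
  ultimately obtain A B where "open A" "open B" "(s0, t0) \<in> A \<times> B" "A \<times> B \<subseteq> F -` ball (F (s0, t0)) (e/2)"
   by (rule open_prod_elim) (rule that)
  then show ?thesis
   by (intro exI[of _ A] exI[of _ B]) (force simp: dist_norm norm_minus_commute)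
 qed
 then obtain A B where AB: "\<And>t. open (A t)" "\<And>t. open (B t)" "\<And>t. s0 \<in> A t" "\<And>t. t \<in> B t"
  "\<And>t0 s t. s \<in> A t0 ==> t \<in> B t0 ==> norm (F (s, t) - F (s0, t0)) < e / 2"
  by metis
 obtain J where J: "J \<subseteq> L" "finite J" "L \<subseteq> (\<Union>x\<in>J. B x)"
  by (rule compactE_image[OF L(1), of L B]) (use AB in auto)
 show ?thesis
 proof (intro exI[of _ "V \<inter> (\<Inter>x\<in>J. A x)"] conjI ballI allI)
  show "open (V \<inter> (\<Inter>x\<in>J. A x))" by (intro open_Int open_INT V J ballI AB)
  show "s0 \<in> V \<inter> (\<Inter>x\<in>J. A x)" using AB V by auto
  fix s t assume s: "s \<in> V \<inter> (\<Inter>x\<in>J. A x)"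
  show "norm (F (s, t) - F (s0, t)) \<le> e"
  proof (cases "t \<in> L")
   case True
   then obtain x where x: "x \<in> J" "t \<in> B x" using J by auto
   have "norm (F (s, t) - F (s0, x)) < e / 2" using AB(5)[OF _ x(2)] s x(1) by auto
   moreover have "norm (F (s0, t) - F (s0, x)) < e / 2" using AB(5)[OF AB(3) x(2)] .
   ultimately show ?thesis
    using norm_triangle_ineq4[of "F (s, t) - F (s0, x)" "F (s0, t) - F (s0, x)"] by simp
  qed (use L V s e in simp)
 qed
qed

lemma continuous_on_section:
 assumes "continuous_on UNIV F"
 shows "continuous_on UNIV (%t. F (s, t))" "continuous_on UNIV (%s. F (s, t))"
 by (intro continuous_on_compose2[OF assms] continuous_intros; simp)+

section \<open>Exchanging functionals and integrals\<close>

text \<open>The integral and the multiplicative functionals of the convolution algebra are both of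
  this kind, so a single exchange theorem covers both.\<close>

definition L1_functional :: "(('g => 'b::{banach, second_countable_topology}) => 'd::real_normed_vector) => bool" where
 "L1_functional \<kappa> \<longleftrightarrow>
   (\<forall>f\<in>Cc. \<forall>g\<in>Cc. \<kappa> (%t. f t + g t) = \<kappa> f + \<kappa> g) \<and>
   (\<forall>f\<in>Cc. (\<forall>r. \<kappa> (%t. r *\<^sub>R f t) = r *\<^sub>R \<kappa> f) \<and> norm (\<kappa> f) \<le> (\<integral>t. norm (f t) \<partial>\<mu>))"

lemma L1_functionalD:
 assumes "L1_functional \<kappa>" "f \<in> Cc"
 shows "g \<in> Cc ==> \<kappa> (%t. f t + g t) = \<kappa> f + \<kappa> g" "\<kappa> (%t. r *\<^sub>R f t) = r *\<^sub>R \<kappa> f"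
  "norm (\<kappa> f) \<le> (\<integral>t. norm (f t) \<partial>\<mu>)"
 using assms unfolding L1_functional_def by auto

lemma L1_functional_integral: "L1_functional (%f. \<integral>t. f t \<partial>\<mu>)"
 by (simp add: L1_functional_def integrable_cs norm_cs_integral)

lemma cs_diff:
 fixes f :: "'g => 'b::real_normed_vector"
 shows "f \<in> Cc ==> g \<in> Cc ==> (%t. f t - g t) \<in> Cc"
 using cs_add[of f "%t. - g t"]
  cs_bounded_linear[OF _ bounded_linear_minus[OF bounded_linear_ident], of g] by simp

lemma L1_functional_diff:
 assumes \<kappa>: "L1_functional \<kappa>" and f: "f \<in> Cc" and g: "g \<in> Cc"
 shows "\<kappa> (%t. f t - g t) = \<kappa> f - \<kappa> g"
proof -
 have "\<kappa> (%t. (f t - g t) + g t) = \<kappa> (%t. f t - g t) + \<kappa> g"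
  by (rule L1_functionalD(1)[OF \<kappa> cs_diff[OF f g] g])
 then show ?thesis by simp
qed

context
 fixes F :: "'g \<times> 'g => 'b::{banach, second_countable_topology}" and \<kappa> :: "('g => 'b) => 'd::{banach, second_countable_topology}" and L
 assumes F: "continuous_on UNIV F" and L: "compact L" "\<And>s t. t \<notin> L ==> F (s, t) = 0" and \<kappa>: "L1_functional \<kappa>"
begin

lemma section_in: "(%t. F (s, t)) \<in> Cc"
 by (rule csI[OF continuous_on_section(1)[OF F] L])

lemma continuous_on_section_functional: "continuous_on UNIV (%s. \<kappa> (%t. F (s, t)))"
 unfolding continuous_on_eq_continuous_at[OF open_UNIV] isCont_def
proof (intro ballI tendstoI)
 fix s0 and e :: real assume e: "0 < e"
 have m: "0 < measure \<mu> L + 1" by (simp add: add_nonneg_pos)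
 define d where "d = (e / 2) / (measure \<mu> L + 1)"
 have d: "0 < d" "d * (measure \<mu> L + 1) = e / 2" using e m unfolding d_def by (simp, metis nonzero_divide_eq_eq less_irrefl)
 obtain U where U: "open U" "s0 \<in> U" "\<And>s t. s \<in> U ==> norm (F (s, t) - F (s0, t)) \<le> d"
  using equicontinuous_section[OF F open_UNIV UNIV_I L d(1), of s0] by blast
 have "dist (\<kappa> (%t. F (s, t))) (\<kappa> (%t. F (s0, t))) < e" if s: "s \<in> U" for s
 proof -
  note dc = cs_diff[OF section_in section_in]
  have "norm (\<kappa> (%t. F (s, t) - F (s0, t))) \<le> (\<integral>t. norm (F (s, t) - F (s0, t)) \<partial>\<mu>)"
   by (rule L1_functionalD(3)[OF \<kappa> dc])
  also have "\<dots> \<le> d * measure \<mu> L"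
   by (rule integral_norm_le[OF cs_continuous[OF dc] L(1)]) (simp_all add: L(2) U(3)[OF s])
  also have "\<dots> \<le> d * (measure \<mu> L + 1)" using d by simp
  also have "\<dots> < e" using e d by simp
  finally show ?thesis by (simp add: dist_norm L1_functional_diff[OF \<kappa> section_in section_in])
 qed
 then show "\<forall>\<^sub>F s in at s0. dist (\<kappa> (%t. F (s, t))) (\<kappa> (%t. F (s0, t))) < e"
  unfolding eventually_at_topological using U by blast
qed

end

lemmas continuous_on_section_integral = continuous_on_section_functional[OF _ _ _ L1_functional_integral]

text \<open>Haar measure need not be sigma-finite, so the exchange is proved directly: the kernel is
  uniformly close to a finite sum of products \<open>\<phi> j s *\<^sub>R F (j, t)\<close>, for
  which both sides agree, and the compact supports control the errors. With the integral for
  \<open>\<kappa>\<close> this is Fubini.\<close>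

lemma functional_integral:
 fixes F :: "'g \<times> 'g => 'b::{banach, second_countable_topology}" and \<kappa> :: "('g => 'b) => 'd::{banach, second_countable_topology}"
 assumes F: "continuous_on UNIV F" and K: "compact K" "\<And>s t. s \<notin> K ==> F (s, t) = 0"
  and L: "compact L" "\<And>s t. t \<notin> L ==> F (s, t) = 0" and \<kappa>: "L1_functional \<kappa>"
 shows "(\<integral>s. \<kappa> (%t. F (s, t)) \<partial>\<mu>) = \<kappa> (%t. \<integral>s. F (s, t) \<partial>\<mu>)"
proof -
 obtain V K1 where V: "open V" "compact K1" "K \<subseteq> V" "V \<subseteq> K1" using K(1) by (rule compact_nbhd_set) (rule that)
 define G where "G s = \<kappa> (%t. F (s, t))" for s
 define I where "I t = (\<integral>s. F (s, t) \<partial>\<mu>)" for t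
 define m where "m = measure \<mu> K1 * measure \<mu> L"
 have m0: "0 \<le> m" by (simp add: m_def)
 note add = L1_functionalD(1)[OF \<kappa>] and scale = L1_functionalD(2)[OF \<kappa>] and bound = L1_functionalD(3)[OF \<kappa>]
 note Fin = section_in[OF F L \<kappa>]
 have K1: "F (s, t) = 0" if "s \<notin> K1" for s t using K(2) V that by auto
 have \<kappa>0: "\<kappa> (%t. 0) = 0" using scale[OF Fin, where r = 0] by simp
 have Gc: "continuous_on UNIV G" unfolding G_def[abs_def] by (rule continuous_on_section_functional[OF F L \<kappa>])
 have GK1: "G s = 0" if "s \<notin> K1" for s by (simp add: G_def K1[OF that] \<kappa>0)
 have Iin: "I \<in> Cc"
 proof (rule csI[OF _ L(1)])
  have "continuous_on UNIV (%p. F (snd p, fst p))" by (intro continuous_on_compose2[OF F] continuous_intros) auto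
  from continuous_on_section_integral[OF this V(2)] K1 show "continuous_on UNIV I" by (simp add: I_def[abs_def])
 qed (simp add: I_def L(2))
 have close: "norm (\<kappa> I - (\<integral>s. G s \<partial>\<mu>)) \<le> 2 * (e * m)" if e: "0 < e" for e
 proof -
  have equi: "\<exists>U. open U \<and> s0 \<in> U \<and> (\<forall>s\<in>U. \<forall>t. norm (F (s, t) - F (s0, t)) \<le> e)" for s0
   by (rule equicontinuous_section[OF F open_UNIV UNIV_I L e])
  obtain J \<phi> where J: "finite J" "J \<subseteq> K" and \<phi>: "\<And>j. j \<in> J ==> continuous_on UNIV (\<phi> j)"
   "\<And>j s. j \<in> J ==> 0 \<le> \<phi> j s" "\<And>j s. j \<in> J ==> s \<notin> K1 ==> (\<phi> j s :: real) = 0" "\<And>s. (\<Sum>j\<in>J. \<phi> j s) \<le> 1"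
   and near: "\<And>s t. norm (F (s, t) - (\<Sum>j\<in>J. \<phi> j s *\<^sub>R F (j, t))) \<le> e"
   by (rule partition_approx[OF K(1) V(1,3,4) less_imp_le[OF e], of "%s t. F (s, t)", OF K(2) equi]) (assumption | rule that)+
  have int\<phi>: "integrable \<mu> (\<phi> j)" if "j \<in> J" for j by (rule integrable_bounded[OF \<phi>(1)[OF that] V(2) \<phi>(3)[OF that]])
  have sum_in: "(%t. \<Sum>j\<in>J'. c j *\<^sub>R F (j, t)) \<in> Cc" for c and J' :: "'g set"
   by (intro cs_sum cs_bounded_linear[OF Fin bounded_linear_scaleR_right])
  have \<kappa>sum: "\<kappa> (%t. \<Sum>j\<in>J'. c j *\<^sub>R F (j, t)) = (\<Sum>j\<in>J'. c j *\<^sub>R G j)" for c and J' :: "'g set"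
  proof (induction J' rule: infinite_finite_induct)
   case (insert j J')
   have "\<kappa> (%t. c j *\<^sub>R F (j, t) + (\<Sum>j\<in>J'. c j *\<^sub>R F (j, t))) = c j *\<^sub>R G j + (\<Sum>j\<in>J'. c j *\<^sub>R G j)"
    using add[OF cs_bounded_linear[OF Fin bounded_linear_scaleR_right] sum_in] insert.IH
    by (simp add: scale[OF Fin] G_def)
   then show ?case using insert by simp
  qed (simp_all add: \<kappa>0)
  \<comment> \<open>The approximating sum integrated over \<open>s\<close>; both sides of the claim
    are compared with \<open>\<kappa> h\<close>.\<close>
  define h where "h t = (\<Sum>j\<in>J. (\<integral>s. \<phi> j s \<partial>\<mu>) *\<^sub>R F (j, t))" for t
  have hin: "h \<in> Cc" unfolding h_def[abs_def] by (rule sum_in)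
  have "norm (\<kappa> I - \<kappa> h) \<le> (e * measure \<mu> K1) * measure \<mu> L"
  proof -
   note dc = cs_diff[OF Iin hin]
   have "norm (\<kappa> I - \<kappa> h) \<le> (\<integral>t. norm (I t - h t) \<partial>\<mu>)"
    unfolding L1_functional_diff[OF \<kappa> Iin hin, symmetric] by (rule bound[OF dc])
   also have "\<dots> \<le> (e * measure \<mu> K1) * measure \<mu> L"
   proof (rule integral_norm_le[OF cs_continuous[OF dc] L(1)])
    show "I t - h t = 0" if "t \<notin> L" for t using L(2)[OF that] by (simp add: I_def h_def)
    fix t
    have "integrable \<mu> (%s. F (s, t))" by (rule integrable_bounded[OF continuous_on_section(2)[OF F] V(2) K1])
    then have "I t - h t = (\<integral>s. F (s, t) - (\<Sum>j\<in>J. \<phi> j s *\<^sub>R F (j, t)) \<partial>\<mu>)"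
     using int\<phi> by (simp add: I_def h_def)
    also have "norm \<dots> \<le> e * measure \<mu> K1"
     by (rule integral_bound[OF _ V(2)])
      (use near K1 \<phi> in \<open>auto intro!: continuous_intros continuous_on_section(2)[OF F]\<close>)
    finally show "norm (I t - h t) \<le> e * measure \<mu> K1" .
   qed
   finally show ?thesis .
  qed
  moreover have "norm (\<kappa> h - (\<integral>s. G s \<partial>\<mu>)) \<le> (e * measure \<mu> L) * measure \<mu> K1"
  proof -
   have "\<kappa> h - (\<integral>s. G s \<partial>\<mu>) = - (\<integral>s. G s - (\<Sum>j\<in>J. \<phi> j s *\<^sub>R G j) \<partial>\<mu>)"
    using integrable_bounded[OF Gc V(2) GK1] int\<phi> by (simp add: h_def[abs_def] \<kappa>sum)
   also have "norm \<dots> \<le> (e * measure \<mu> L) * measure \<mu> K1"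
    unfolding norm_minus_cancel
   proof (rule integral_bound[OF _ V(2)])
    show "continuous_on UNIV (%s. G s - (\<Sum>j\<in>J. \<phi> j s *\<^sub>R G j))" by (intro continuous_intros Gc \<phi>)
    show "G s - (\<Sum>j\<in>J. \<phi> j s *\<^sub>R G j) = 0" if "s \<notin> K1" for s using that \<phi>(3) by (simp add: GK1)
    fix s
    note dc = cs_diff[OF Fin[of s] sum_in[of "%j. \<phi> j s" J]]
    have "G s - (\<Sum>j\<in>J. \<phi> j s *\<^sub>R G j) = \<kappa> (%t. F (s, t) - (\<Sum>j\<in>J. \<phi> j s *\<^sub>R F (j, t)))"
     by (simp add: L1_functional_diff[OF \<kappa> Fin sum_in] \<kappa>sum G_def)
    also have "norm \<dots> \<le> (\<integral>t. norm (F (s, t) - (\<Sum>j\<in>J. \<phi> j s *\<^sub>R F (j, t))) \<partial>\<mu>)" by (rule bound[OF dc])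
    also have "\<dots> \<le> e * measure \<mu> L"
     by (rule integral_norm_le[OF cs_continuous[OF dc] L(1)]) (simp_all add: L(2) near)
    finally show "norm (G s - (\<Sum>j\<in>J. \<phi> j s *\<^sub>R G j)) \<le> e * measure \<mu> L" .
   qed
   finally show ?thesis .
  qed
  ultimately show ?thesis
   using norm_triangle_ineq[of "\<kappa> I - \<kappa> h" "\<kappa> h - (\<integral>s. G s \<partial>\<mu>)"] by (simp add: m_def mult_ac)
 qed
 have "norm (\<kappa> I - (\<integral>s. G s \<partial>\<mu>)) \<le> 0"
 proof (rule field_le_epsilon)
  fix e :: real assume e: "0 < e"
  have "norm (\<kappa> I - (\<integral>s. G s \<partial>\<mu>)) \<le> 2 * (e / (2 * (m + 1)) * m)"
   using e m0 by (intro close) (simp add: add_nonneg_pos)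
  also have "\<dots> \<le> e" using e m0 by (simp add: field_simps)
  finally show "norm (\<kappa> I - (\<integral>s. G s \<partial>\<mu>)) \<le> 0 + e" by simp
 qed
 then show ?thesis by (simp add: G_def I_def[abs_def])
qed

lemmas fubini_cs = functional_integral[OF _ _ _ _ _ L1_functional_integral]

section \<open>Functions of positive integral and invariance under inversion\<close>

lemma bump_integral_pos:
 assumes "open U" "(x::'g) \<in> U"
 obtains f :: "'g => real" where "f \<in> Cc" "\<And>t. 0 \<le> f t" "\<And>t. t \<notin> U ==> f t = 0" "0 < (\<integral>t. f t \<partial>\<mu>)"
proof -
 obtain V K where V: "open V" "compact K" "x \<in> V" "V \<subseteq> K" using compact_nbhd by metis
 obtain f :: "'g => real" where f: "continuous_on UNIV f" "\<And>t. 0 \<le> f t" "\<And>t. f t \<le> 1" "f x = 1" "\<And>t. t \<notin> U \<inter> V ==> f t = 0"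
  by (rule urysohn[of "U \<inter> V" x]) (use V assms in auto)
 have cs: "f \<in> Cc" by (rule csI[OF f(1) V(2)]) (use V f(5) in auto)
 have "(\<integral>t. f t \<partial>\<mu>) \<noteq> 0"
 proof
  assume "(\<integral>t. f t \<partial>\<mu>) = 0"
  then have "AE t in \<mu>. f t = 0"
   using integral_nonneg_eq_0_iff_AE[OF integrable_cs[OF cs]] f(2) by simp
  then have "emeasure \<mu> {t. f t \<noteq> 0} = 0"
   using AE_iff_measurable[of "{t. f t \<noteq> 0}" \<mu> "%t. f t = 0"] continuous_measurable[OF f(1)]
    borel_open[OF open_Collect_neq[OF f(1) continuous_on_const[of UNIV 0]]] by simp
  moreover have "0 < emeasure \<mu> {t. f t \<noteq> 0}"
   by (rule emeasure_open_pos[OF open_Collect_neq[OF f(1) continuous_on_const]])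
    (use f(4) in \<open>auto intro!: exI[of _ x]\<close>)
  ultimately show False by simp
 qed
 moreover have "0 \<le> (\<integral>t. f t \<partial>\<mu>)" using f(2) by simp
 ultimately show ?thesis using that[OF cs f(2)] f(5) by force
qed

text \<open>Fubini for compactly supported functions suffices; uniqueness of Haar measure is not needed.\<close>

lemma integral_uminus:
 fixes f :: "'g => complex"
 assumes f: "f \<in> Cc"
 shows "(\<integral>t. f (- t) \<partial>\<mu>) = (\<integral>t. f t \<partial>\<mu>)"
proof -
 \<comment> \<open>Both orders of integration of \<open>f (s + c t) * h t\<close>; translation
   invariance removes \<open>c t\<close> from the integral over \<open>s\<close>.\<close>
 have fub: "(\<integral>s. f s \<partial>\<mu>) * (\<integral>t. h t \<partial>\<mu>) = (\<integral>s. (\<integral>t. f (s + c t) * h t \<partial>\<mu>) \<partial>\<mu>)"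
  if f: "f \<in> Cc" and h: "h \<in> Cc" and c: "continuous_on UNIV c"
  for f h :: "'g => complex" and c
 proof -
  obtain K where K: "continuous_on UNIV f" "compact K" "\<And>t. t \<notin> K ==> f t = 0"
   using f by (rule csE) (rule that)
  obtain L where L: "continuous_on UNIV h" "compact L" "\<And>t. t \<notin> L ==> h t = 0"
   using h by (rule csE) (rule that)
  define M where "M = (%p. fst p - snd p) ` (K \<times> c ` L)"
  have M: "compact M" unfolding M_def
   by (intro compact_add_sets(2) K(2) compact_continuous_image continuous_on_subset[OF c] L(2)) simp
  have 1: "continuous_on UNIV (%p. f (fst p + c (snd p)) * h (snd p))"
   by (intro continuous_on_mult continuous_on_compose2[OF K(1)] continuous_on_compose2[OF L(1)]
     continuous_on_compose2[OF c] continuous_intros subset_UNIV)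
  have 2: "f (s + c t) * h t = 0" if "s \<notin> M" for s t
  proof (rule ccontr)
   assume "f (s + c t) * h t \<noteq> 0"
   then have "s + c t \<in> K" "t \<in> L" using K(3) L(3) by auto
   then have "s \<in> M" unfolding M_def by (intro image_eqI[where x = "(s + c t, c t)"]) auto
   then show False using that by simp
  qed
  have "(\<integral>s. f (s + c t) \<partial>\<mu>) = (\<integral>s. f s \<partial>\<mu>)" for t
   using integral_translate[OF K(1), of "c t"] by (simp add: add.commute)
  then show ?thesis using fubini_cs[OF 1 M _ L(2)] 2 L(3) by simp
 qed
 \<comment> \<open>\<open>fub\<close> is used with \<open>c t = t\<close> and with
   \<open>c t = - t\<close>; a function of nonzero integral is cancelled at the end.\<close>
 have key: "(\<integral>s. f s \<partial>\<mu>) * (\<integral>t. g (- t) \<partial>\<mu>) = (\<integral>t. f t \<partial>\<mu>) * (\<integral>s. g s \<partial>\<mu>)"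
  if f: "f \<in> Cc" and g: "g \<in> Cc" for f g :: "'g => complex"
 proof -
  obtain L where L: "continuous_on UNIV g" "compact L" "\<And>t. t \<notin> L ==> g t = 0"
   using g by (rule csE) (rule that)
  have gn: "(%t. g (- t)) \<in> Cc"
  proof (rule csI)
   show "continuous_on UNIV (%t. g (- t))" by (rule continuous_on_compose2[OF L(1)]) (auto intro: continuous_intros)
   show "compact (uminus ` L)" by (intro compact_continuous_image continuous_intros L(2))
   show "g (- t) = 0" if "t \<notin> uminus ` L" for t using L(3)[of "- t"] that by (metis image_eqI minus_minus)
  qed
  have "(\<integral>t. f (s + t) * g (- t) \<partial>\<mu>) = (\<integral>t. g (s + - t) * f t \<partial>\<mu>)" for s
  proof -
   have "continuous_on UNIV (%t. g (s + - t) * f t)"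
    by (intro continuous_on_mult continuous_on_compose2[OF L(1)] cs_continuous[OF f] continuous_intros subset_UNIV)
   from integral_translate[OF this, of s] show ?thesis by (simp add: mult.commute)
  qed
  then show ?thesis
   using fub[OF f gn continuous_on_id] fub[OF g f continuous_on_minus[OF continuous_on_id]] by (simp add: mult.commute)
 qed
 obtain h :: "'g => real" where h: "h \<in> Cc" "0 < (\<integral>t. h t \<partial>\<mu>)"
  using bump_integral_pos[OF open_UNIV UNIV_I] by metis
 have hc: "(%t. complex_of_real (h t)) \<in> Cc"
  by (rule cs_bounded_linear[OF h(1) bounded_linear_of_real])
 have hi: "(\<integral>t. complex_of_real (h t) \<partial>\<mu>) \<noteq> 0" using h(2) by simp
 from key[OF hc f] hi show ?thesis by simp
qed

end

section \<open>Fourier transforms and characters of the convolution algebra\<close>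

lemma pairing_add_right: "pairing t (gm + \<theta>) = pairing t gm * pairing t \<theta>"
 by (simp add: pairing_def plus_character.rep_eq)

lemma pairing_zero_right [simp]: "pairing t 0 = 1"
 by (simp add: pairing_def zero_character.rep_eq)

lemma pairing_minus_right: "pairing t (- gm) = cnj (pairing t gm)"
 by (simp add: pairing_def uminus_character.rep_eq)

lemma pairing_diff_right: "pairing t (gm - \<theta>) = pairing t gm * cnj (pairing t \<theta>)"
 by (simp add: diff_conv_add_uminus pairing_add_right pairing_minus_right del: add_uminus_conv_diff)

lemma norm_pairing [simp]: "cmod (pairing t gm) = 1"
 using char_fun[of gm] by (simp add: pairing_def)

lemma pairing_cnj [simp]: "pairing t gm * cnj (pairing t gm) = 1" "cnj (pairing t gm) * pairing t gm = 1"
 using complex_norm_square[of "pairing t gm"] by (simp_all add: mult.commute)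

lemma pairing_add_left: "pairing (s + t) gm = pairing s gm * pairing t gm"
 using char_fun[of gm] by (simp add: pairing_def)

lemma pairing_zero_left [simp]: "pairing 0 gm = 1"
proof -
 have "pairing 0 gm \<noteq> 0" by (metis norm_pairing norm_zero zero_neq_one)
 then show ?thesis using pairing_add_left[of 0 0 gm] by simp
qed

lemma pairing_minus_left: "pairing (- t) gm = cnj (pairing t gm)"
proof -
 have "pairing (- t) gm = pairing (- t) gm * pairing t gm * cnj (pairing t gm)"
  by (simp add: mult.assoc)
 also have "pairing (- t) gm * pairing t gm = 1" by (simp flip: pairing_add_left)
 finally show ?thesis by simp
qed

lemma continuous_on_pairing [continuous_intros]:
 assumes "continuous_on A f"
 shows "continuous_on A (%t. pairing (f t) gm)"
proof -
 have "continuous_on UNIV (%t. pairing t gm)" using char_fun[of gm] by (simp add: pairing_def)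
 then show ?thesis by (rule continuous_on_compose2[OF _ assms]) simp
qed

lemma cs_compose:
 assumes "f \<in> Cc" "continuous_on UNIV h" "continuous_on UNIV k"
  "\<And>t. h (k t) = t" "\<And>t. k (h t) = t"
 shows "(%t. f (h t)) \<in> Cc"
proof -
 obtain K where K: "continuous_on UNIV f" "compact K" "\<And>t. t \<notin> K ==> f t = 0"
  using assms(1) by (rule csE) (rule that)
 show ?thesis
 proof (rule csI[of _ "k ` K"])
  show "continuous_on UNIV (%t. f (h t))" by (rule continuous_on_compose2[OF K(1) assms(2)]) simp
  show "compact (k ` K)" by (intro compact_continuous_image continuous_on_subset[OF assms(3)] K) simp
  show "f (h t) = 0" if "t \<notin> k ` K" for t using that assms(5) K(3) by (metis image_eqI)
 qed
qed

lemma cs_translate: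
 fixes f :: "'g::topological_ab_group_add => 'b::real_normed_vector"
 shows "f \<in> Cc ==> (%t. f (t - s)) \<in> Cc"
 by (rule cs_compose[where k = "%t. t + s"]) (auto intro!: continuous_intros)

lemma cs_uminus:
 fixes f :: "'g::topological_ab_group_add => 'b::real_normed_vector"
 shows "f \<in> Cc ==> (%t. f (- t)) \<in> Cc"
 by (rule cs_compose[where k = uminus]) (auto intro!: continuous_intros)

lemma cs_cmult:
 fixes f :: "'g::topological_space => complex"
 shows "f \<in> Cc ==> continuous_on UNIV c ==> (%t. c t * f t) \<in> Cc"
 by (rule cs_mult[OF bounded_bilinear_mult])

definition cadj :: "('g::ab_group_add => complex) => 'g => complex" where
 "cadj f t = cnj (f (- t))"

text \<open>Multiplication by a character translates the Fourier transform by
  \<open>\<theta>\<close>.\<close>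

definition twist :: "'g character => ('g::topological_ab_group_add => complex) => 'g => complex" where
 "twist \<theta> f t = pairing t \<theta> * f t"

lemma twist_zero [simp]: "twist 0 f = f"
 by (simp add: twist_def fun_eq_iff)

lemma twist_in: "f \<in> Cc ==> twist \<theta> f \<in> Cc"
 unfolding twist_def[abs_def] by (intro cs_cmult continuous_intros)

lemma cadj_in:
 fixes f :: "'g::topological_ab_group_add => complex"
 assumes "f \<in> Cc"
 shows "cadj f \<in> Cc"
 using cs_bounded_linear[OF cs_uminus[OF assms] bounded_linear_cnj]
 unfolding cadj_def[abs_def] .

context lca
begin

definition conv :: "('g => complex) => ('g => complex) => 'g => complex" where
 "conv f g t = (\<integral>s. f s * g (t - s) \<partial>\<mu>)"

definition fourier :: "('g => complex) => 'g character => complex" where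
 "fourier f gm = (\<integral>t. pairing t gm * f t \<partial>\<mu>)"

text \<open>Compact supports in both variables, as the exchange of integrals requires.\<close>

lemma conv_integrand:
 fixes f g :: "'g => complex"
 assumes f: "f \<in> Cc" and g: "g \<in> Cc"
 obtains K M where "continuous_on UNIV (%p. f (fst p) * g (snd p - fst p))" "compact K" "compact M"
  "\<And>s t. s \<notin> K ==> f s * g (t - s) = 0" "\<And>s t. t \<notin> M ==> f s * g (t - s) = 0"
proof -
 obtain K where K: "continuous_on UNIV f" "compact K" "\<And>t. t \<notin> K ==> f t = 0"
  using f by (rule csE) (rule that)
 obtain L where L: "continuous_on UNIV g" "compact L" "\<And>t. t \<notin> L ==> g t = 0"
  using g by (rule csE) (rule that)
 show ?thesis
 proof (rule that[OF _ K(2) compact_add_sets(1)[OF K(2) L(2)]])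
  show "continuous_on UNIV (%p. f (fst p) * g (snd p - fst p))"
   by (intro continuous_on_mult continuous_on_compose2[OF K(1)] continuous_on_compose2[OF L(1)] continuous_intros) auto
  show "f s * g (t - s) = 0" if "s \<notin> K" for s t using K(3)[OF that] by simp
  fix s t assume t: "t \<notin> (%p. fst p + snd p) ` (K \<times> L)"
  show "f s * g (t - s) = 0"
  proof (rule ccontr)
   assume "f s * g (t - s) \<noteq> 0"
   then have "(s, t - s) \<in> K \<times> L" using K(3) L(3) by auto
   then have "fst (s, t - s) + snd (s, t - s) \<in> (%p. fst p + snd p) ` (K \<times> L)" by (rule imageI)
   then show False using t by simp
  qed
 qed
qed

lemma conv_in:
 assumes f: "f \<in> Cc" and g: "g \<in> Cc"
 shows "conv f g \<in> Cc"
proof -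
 obtain K M where KM: "continuous_on UNIV (%p. f (fst p) * g (snd p - fst p))" "compact K" "compact M"
  "\<And>s t. s \<notin> K ==> f s * g (t - s) = 0" "\<And>s t. t \<notin> M ==> f s * g (t - s) = 0"
  using conv_integrand[OF f g] by blast
 have sw: "continuous_on UNIV (%p::'g \<times> 'g. (snd p, fst p))" by (intro continuous_intros)
 have "continuous_on UNIV (%p. f (snd p) * g (fst p - snd p))"
  using continuous_on_compose2[OF KM(1) sw] by simp
 then have "continuous_on UNIV (conv f g)" unfolding conv_def[abs_def]
  using continuous_on_section_integral[of "%p. f (snd p) * g (fst p - snd p)" K] KM by simp
 then show ?thesis
  by (rule csI[OF _ KM(3)]) (simp add: conv_def KM(5))
qed

lemma integrable_pairing: "f \<in> Cc ==> integrable \<mu> (%t. pairing t gm * f t)"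
 by (intro integrable_cs cs_cmult continuous_intros)

lemma fourier_add: "f \<in> Cc ==> g \<in> Cc ==>
  fourier (%t. f t + g t) gm = fourier f gm + fourier g gm"
 unfolding fourier_def by (simp add: distrib_left integrable_pairing)

lemma fourier_scale: "fourier (%t. c * f t) gm = c * fourier f gm"
 unfolding fourier_def by (simp add: mult.left_commute)

lemma norm_fourier: "f \<in> Cc ==> cmod (fourier f gm) \<le> (\<integral>t. cmod (f t) \<partial>\<mu>)"
 unfolding fourier_def using integral_norm_bound[of \<mu> "%t. pairing t gm * f t"] by (simp add: norm_mult)

lemma fourier_twist: "fourier (twist \<theta> f) gm = fourier f (gm + \<theta>)"
 by (simp add: fourier_def twist_def pairing_add_right mult.assoc)

lemma fourier_cadj: "f \<in> Cc ==> fourier (cadj f) gm = cnj (fourier f gm)"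
proof -
 assume f: "f \<in> Cc"
 have "fourier (cadj f) gm = (\<integral>t. cnj (pairing (- t) gm * f (- t)) \<partial>\<mu>)"
  by (simp add: fourier_def cadj_def pairing_minus_left)
 also have "\<dots> = (\<integral>t. cnj (pairing t gm * f t) \<partial>\<mu>)"
  using integral_uminus[of "%t. cnj (pairing t gm * f t)"] f
  by (simp add: cs_bounded_linear[OF _ bounded_linear_cnj] cs_cmult continuous_intros del: complex_cnj_mult)
 also have "\<dots> = cnj (fourier f gm)" unfolding fourier_def
  by (rule integral_bounded_linear[OF bounded_linear_cnj integrable_pairing[OF f]])
 finally show ?thesis .
qed

lemma fourier_translate:
 assumes "f \<in> Cc"
 shows "fourier (%t. f (t - s)) gm = pairing s gm * fourier f gm"
proof -
 have "fourier (%t. f (t - s)) gm = (\<integral>t. pairing (s + t) gm * f (s + t - s) \<partial>\<mu>)"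
  unfolding fourier_def using assms
  by (intro integral_translate[symmetric] continuous_on_mult continuous_intros cs_continuous cs_translate)
 also have "\<dots> = pairing s gm * fourier f gm"
  unfolding fourier_def by (simp add: pairing_add_left mult.assoc)
 finally show ?thesis .
qed

lemma fourier_conv:
 assumes f: "f \<in> Cc" and g: "g \<in> Cc"
 shows "fourier (conv f g) gm = fourier f gm * fourier g gm"
proof -
 obtain K M where KM: "continuous_on UNIV (%p. f (fst p) * g (snd p - fst p))" "compact K" "compact M"
  "\<And>s t. s \<notin> K ==> f s * g (t - s) = 0" "\<And>s t. t \<notin> M ==> f s * g (t - s) = 0"
  using conv_integrand[OF f g] by blast
 have "fourier (conv f g) gm = (\<integral>t. (\<integral>s. pairing t gm * (f s * g (t - s)) \<partial>\<mu>) \<partial>\<mu>)"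
  by (simp add: fourier_def conv_def)
 also have "\<dots> = (\<integral>s. (\<integral>t. pairing t gm * (f s * g (t - s)) \<partial>\<mu>) \<partial>\<mu>)"
 proof -
  have "continuous_on UNIV (%p. pairing (snd p) gm * (f (fst p) * g (snd p - fst p)))"
   by (intro continuous_on_mult[OF _ KM(1)] continuous_intros)
  from fubini_cs[OF this KM(2) _ KM(3)] show ?thesis using KM(4,5) by simp
 qed
 also have "\<dots> = (\<integral>s. f s * fourier (%t. g (t - s)) gm \<partial>\<mu>)"
  by (simp add: fourier_def mult.left_commute)
 also have "\<dots> = (\<integral>s. (pairing s gm * f s) * fourier g gm \<partial>\<mu>)"
  by (simp add: fourier_translate[OF g] mult_ac)
 also have "\<dots> = fourier f gm * fourier g gm" unfolding fourier_def by (rule integral_mult_left_zero)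
 finally show ?thesis .
qed

lemma conv_commute:
 assumes f: "f \<in> Cc" and g: "g \<in> Cc"
 shows "conv f g = conv g f"
proof
 fix t :: 'g
 have fc: "continuous_on UNIV f" and gc: "continuous_on UNIV g" using f g by (auto intro: cs_continuous)
 have ts: "continuous_on UNIV (%s. t - s)" by (intro continuous_intros)
 have h: "(%s. f s * g (t - s)) \<in> Cc"
  using cs_cmult[OF f continuous_on_compose2[OF gc ts]] by (simp add: mult.commute)
 have "conv f g t = (\<integral>s. f (- s) * g (t - - s) \<partial>\<mu>)" unfolding conv_def by (rule integral_uminus[OF h, symmetric])
 also have "\<dots> = (\<integral>s. f (- (- t + s)) * g (t - - (- t + s)) \<partial>\<mu>)"
  by (rule integral_translate[symmetric])
   (intro continuous_on_mult continuous_on_compose2[OF fc] continuous_on_compose2[OF gc] continuous_intros; simp)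
 also have "\<dots> = conv g f t" by (simp add: conv_def mult.commute)
 finally show "conv f g t = conv g f t" .
qed

lemma conv_translate:
 assumes "f \<in> Cc" "g \<in> Cc"
 shows "conv (%t. f (t - s)) g = conv f (%t. g (t - s))"
proof
 fix t :: 'g
 have fc: "continuous_on UNIV f" and gc: "continuous_on UNIV g" using assms by (auto intro: cs_continuous)
 have "conv (%t. f (t - s)) g t = (\<integral>u. f (s + u - s) * g (t - (s + u)) \<partial>\<mu>)" unfolding conv_def
  by (rule integral_translate[symmetric])
   (intro continuous_on_mult continuous_on_compose2[OF fc] continuous_on_compose2[OF gc] continuous_intros; simp)
 also have "\<dots> = conv f (%t. g (t - s)) t" by (simp add: conv_def algebra_simps)
 finally show "conv (%t. f (t - s)) g t = conv f (%t. g (t - s)) t" .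
qed

lemma translation_L1_continuous:
 fixes g :: "'g => 'b::{banach, second_countable_topology}"
 assumes g: "g \<in> Cc" and e: "0 < e"
 shows "\<exists>U. open U \<and> s0 \<in> U \<and> (\<forall>s\<in>U. (\<integral>t. norm (g (t - s) - g (t - s0)) \<partial>\<mu>) \<le> e)"
proof -
 obtain K where K: "continuous_on UNIV g" "compact K" "\<And>t. t \<notin> K ==> g t = 0"
  using g by (rule csE) (rule that)
 obtain V K1 where V: "open V" "s0 \<in> V" "V \<subseteq> K1" and K1: "compact K1" using compact_nbhd[of s0] by blast
 define M where "M = (%p. fst p + snd p) ` (K \<times> K1)"
 have M: "compact M" unfolding M_def by (rule compact_add_sets(1)[OF K(2) K1])
 have gM: "g (t - s) = 0" if "s \<in> V" "t \<notin> M" for s t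
 proof (rule ccontr)
  assume "g (t - s) \<noteq> 0"
  then have "(t - s, s) \<in> K \<times> K1" using K(3) that(1) V(3) by blast
  then have "fst (t - s, s) + snd (t - s, s) \<in> M" unfolding M_def by (rule imageI)
  then show False using that(2) by simp
 qed
 define d where "d = e / (measure \<mu> M + 1)"
 have m1: "measure \<mu> M + 1 > 0" by (simp add: add_nonneg_pos)
 have d: "0 < d" using e m1 by (simp add: d_def)
 have gc: "continuous_on UNIV (%p :: 'g \<times> 'g. g (snd p - fst p))"
  by (rule continuous_on_compose2[OF K(1)]) (auto intro!: continuous_intros)
 obtain U where U: "open U" "s0 \<in> U" "\<And>s t. s \<in> U ==> norm (g (t - s) - g (t - s0)) \<le> d"
  using equicontinuous_section[OF gc V(1,2) M _ d] gM by auto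
 have "(\<integral>t. norm (g (t - s) - g (t - s0)) \<partial>\<mu>) \<le> e" if s: "s \<in> U \<inter> V" for s
 proof -
  have "continuous_on UNIV (%t. g (t - s))" for s using continuous_on_section(1)[OF gc, of s] by simp
  then have "(\<integral>t. norm (g (t - s) - g (t - s0)) \<partial>\<mu>) \<le> d * measure \<mu> M"
   by (intro integral_norm_le continuous_on_diff M) (use s U(3) V(2) gM in auto)
  also have "\<dots> \<le> d * (measure \<mu> M + 1)" using d by simp
  also have "\<dots> = e" using m1 by (simp add: d_def)
  finally show ?thesis .
 qed
 then show ?thesis using U V by (intro exI[of _ "U \<inter> V"]) auto
qed

lemma fourier_nonzero: "\<exists>f\<in>Cc. fourier f gm \<noteq> 0"
proof -
 obtain h :: "'g => real" where h: "h \<in> Cc" "0 < (\<integral>t. h t \<partial>\<mu>)"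
  using bump_integral_pos[OF open_UNIV UNIV_I] by metis
 define f where "f = (%t. cnj (pairing t gm) * complex_of_real (h t))"
 have "f \<in> Cc" unfolding f_def
  by (intro cs_cmult cs_bounded_linear[OF h(1) bounded_linear_of_real] continuous_intros)
 moreover have "fourier f gm = complex_of_real (\<integral>t. h t \<partial>\<mu>)"
  unfolding fourier_def f_def by (simp flip: mult.assoc)
 ultimately show ?thesis using h(2) by force
qed

text \<open>A nonzero multiplicative functional turns translation by \<open>s\<close> into
  multiplication by a number \<open>\<eta> s\<close>, and \<open>\<eta>\<close> is a bounded
  continuous homomorphism, hence a character. Pulling the functional under the convolution integral
  of \<open>f\<close> and \<open>f0\<close> then identifies it.\<close>

lemma functional_is_fourier:
 fixes \<kappa> :: "('g => complex) => complex"
 assumes add: "\<And>f g. f \<in> Cc ==> g \<in> Cc ==> \<kappa> (%t. f t + g t) = \<kappa> f + \<kappa> g"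
  and scale: "\<And>c f. f \<in> Cc ==> \<kappa> (%t. c * f t) = c * \<kappa> f"
  and mult: "\<And>f g. f \<in> Cc ==> g \<in> Cc ==> \<kappa> (conv f g) = \<kappa> f * \<kappa> g"
  and bound: "\<And>f. f \<in> Cc ==> cmod (\<kappa> f) \<le> (\<integral>t. cmod (f t) \<partial>\<mu>)"
  and f0: "f0 \<in> Cc" "\<kappa> f0 \<noteq> 0"
 obtains gm where "\<And>f. f \<in> Cc ==> \<kappa> f = fourier f gm"
proof -
 define \<eta> where "\<eta> = (%s. \<kappa> (%t. f0 (t - s)) / \<kappa> f0)"
 have eig: "\<kappa> (%t. f (t - s)) = \<eta> s * \<kappa> f" if f: "f \<in> Cc" for f s
 proof -
  have "\<kappa> (%t. f (t - s)) * \<kappa> f0 = \<kappa> f * \<kappa> (%t. f0 (t - s))"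
   using mult[OF cs_translate[OF f] f0(1), of s] mult[OF f cs_translate[OF f0(1)], of s]
   by (simp add: conv_translate[OF f f0(1)])
  then show ?thesis using f0(2) by (simp add: \<eta>_def field_simps)
 qed
 have \<eta>_add: "\<eta> (s + t) = \<eta> s * \<eta> t" for s t
 proof -
  have "\<kappa> (%u. f0 (u - s - t)) = \<eta> s * \<kappa> (%u. f0 (u - t))"
   by (rule eig[OF cs_translate[OF f0(1)]])
  then show ?thesis using f0(2) by (simp add: \<eta>_def diff_diff_eq)
 qed
 have \<eta>0: "\<eta> 0 = 1" using f0(2) by (simp add: \<eta>_def)
 have \<eta>k: "\<eta> (((%u. s + u) ^^ k) 0) = \<eta> s ^ k" for s k by (induction k) (simp_all add: \<eta>0 \<eta>_add)
 define B where "B = (\<integral>t. cmod (f0 t) \<partial>\<mu>) / cmod (\<kappa> f0)"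
 have \<eta>B: "cmod (\<eta> s) \<le> B" for s
 proof -
  have "cmod (\<kappa> (%t. f0 (t - s))) \<le> (\<integral>t. cmod (f0 (t - s)) \<partial>\<mu>)"
   by (rule bound[OF cs_translate[OF f0(1)]])
  also have "\<dots> = (\<integral>t. cmod (f0 t) \<partial>\<mu>)"
   using integral_translate[of "%t. cmod (f0 t)" "- s"] cs_continuous[OF f0(1)]
   by (simp add: continuous_intros)
  finally show ?thesis using f0(2) by (simp add: \<eta>_def B_def norm_divide divide_right_mono)
 qed
 \<comment> \<open>\<open>B\<close> bounds \<open>\<eta>\<close> at all multiples of
   \<open>s\<close>, so the powers of \<open>\<eta> s\<close> cannot grow.\<close>
 have le1: "cmod (\<eta> s) \<le> 1" for s
 proof (rule ccontr)
  assume "\<not> cmod (\<eta> s) \<le> 1"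
  then obtain k where "B < cmod (\<eta> s) ^ k" using real_arch_pow[of "cmod (\<eta> s)" B] by auto
  then show False using \<eta>B[of "((%u. s + u) ^^ k) 0"] by (simp add: \<eta>k norm_power)
 qed
 have eq1: "cmod (\<eta> s) = 1" for s
 proof -
  have "cmod (\<eta> s) * cmod (\<eta> (- s)) = 1" using \<eta>_add[of s "- s"] \<eta>0 by (simp flip: norm_mult)
  moreover have "cmod (\<eta> s) * cmod (\<eta> (- s)) \<le> cmod (\<eta> s) * 1" by (intro mult_left_mono le1) simp
  ultimately show ?thesis using le1[of s] by simp
 qed
 have \<kappa>: "L1_functional \<kappa>" unfolding L1_functional_def using add scale bound by (simp add: scaleR_conv_of_real)
 have \<eta>_cont: "continuous_on UNIV \<eta>"
  unfolding continuous_on_eq_continuous_at[OF open_UNIV] isCont_def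
 proof (intro ballI tendstoI)
  fix s0 and e :: real assume e: "0 < e"
  define d where "d = e * cmod (\<kappa> f0) / 2"
  have d: "0 < d" using e f0(2) by (simp add: d_def)
  obtain U where U': "open U \<and> s0 \<in> U \<and> (\<forall>s\<in>U. (\<integral>t. norm (f0 (t - s) - f0 (t - s0)) \<partial>\<mu>) \<le> d)"
   using translation_L1_continuous[OF f0(1) d, of s0] ..
  then have U: "open U" "s0 \<in> U" "\<And>s. s \<in> U ==> (\<integral>t. norm (f0 (t - s) - f0 (t - s0)) \<partial>\<mu>) \<le> d"
   by simp_all
  have "dist (\<eta> s) (\<eta> s0) < e" if "s \<in> U" for s
  proof -
   have "cmod (\<eta> s - \<eta> s0) * cmod (\<kappa> f0) = cmod (\<kappa> (%t. f0 (t - s) - f0 (t - s0)))"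
    using f0(2) cs_translate[OF f0(1)]
    by (simp add: \<eta>_def L1_functional_diff[OF \<kappa>] diff_divide_distrib[symmetric] norm_divide)
   also have "\<dots> \<le> d" by (rule order_trans[OF bound U(3)[OF that]]) (intro cs_diff cs_translate f0)
   also have "\<dots> < e * cmod (\<kappa> f0)" using e f0(2) by (simp add: d_def)
   finally show ?thesis using f0(2) by (simp add: dist_norm)
  qed
  then show "\<forall>\<^sub>F s in at s0. dist (\<eta> s) (\<eta> s0) < e" unfolding eventually_at_topological using U by blast
 qed
 define gm where "gm = Abs_character \<eta>"
 have gm: "pairing t gm = \<eta> t" for t
  unfolding pairing_def gm_def using \<eta>_cont eq1 \<eta>_add by (subst Abs_character_inverse) auto
 have "\<kappa> f = fourier f gm" if f: "f \<in> Cc" for f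
 proof -
  obtain K M where KM: "continuous_on UNIV (%p. f (fst p) * f0 (snd p - fst p))" "compact K" "compact M"
   "\<And>s t. s \<notin> K ==> f s * f0 (t - s) = 0" "\<And>s t. t \<notin> M ==> f s * f0 (t - s) = 0"
   using conv_integrand[OF f f0(1)] by blast
  have "\<kappa> f * \<kappa> f0 = \<kappa> (%t. \<integral>s. (%p. f (fst p) * f0 (snd p - fst p)) (s, t) \<partial>\<mu>)"
   unfolding mult[OF f f0(1), symmetric] by (simp add: conv_def[abs_def])
  also have "\<dots> = (\<integral>s. \<kappa> (%t. f s * f0 (t - s)) \<partial>\<mu>)"
   using functional_integral[OF KM(1,2) _ KM(3) _ \<kappa>] KM(4,5) by simp
  also have "\<dots> = (\<integral>s. (pairing s gm * f s) * \<kappa> f0 \<partial>\<mu>)"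
   by (simp add: scale[OF cs_translate[OF f0(1)]] eig[OF f0(1)] gm mult_ac)
  also have "\<dots> = fourier f gm * \<kappa> f0" unfolding fourier_def by (rule integral_mult_left_zero)
  finally show ?thesis using f0(2) by simp
 qed
 then show ?thesis using that by blast
qed

end

section \<open>Matrix coefficients on the Cuntz algebra\<close>

text \<open>\<open>L\<close> is given on \<open>V\<close>, not on its image; the contraction
  hypothesis makes it factor through \<open>\<iota>\<close> and extend to the completion.\<close>

lemma extend_contraction:
 fixes \<iota> :: "'v => 'x::metric_space" and L :: "'v => 'b::complete_space"
 assumes dense: "closure (\<iota> ` V) = UNIV"
  and L: "\<And>f g. f \<in> V ==> g \<in> V ==> dist (L f) (L g) \<le> dist (\<iota> f) (\<iota> g)"
 shows "\<exists>R. (\<forall>f\<in>V. R (\<iota> f) = L f) \<and> (\<forall>x y. dist (R x) (R y) \<le> dist x y)"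
proof -
 have "\<exists>f\<in>V. dist (\<iota> f) x < inverse (real (Suc k))" for x k
  using dense closure_approachable[of x "\<iota> ` V"] by simp
 then have "\<exists>s. \<forall>x k. s x k \<in> V \<and> dist (\<iota> (s x k)) x < inverse (real (Suc k))"
  unfolding Bex_def by (intro choice allI)
 then obtain s where s: "\<And>x k. s x k \<in> V" "\<And>x k. dist (\<iota> (s x k)) x < inverse (real (Suc k))"
  by blast
 have lim: "(%k. \<iota> (s x k)) \<longlonglongrightarrow> x" for x
 proof -
  have "(%k. dist (\<iota> (s x k)) x) \<longlonglongrightarrow> 0"
  proof (rule tendsto_sandwich[OF _ _ tendsto_const LIMSEQ_inverse_real_of_nat])
   show "\<forall>\<^sub>F k in sequentially. dist (\<iota> (s x k)) x \<le> inverse (real (Suc k))"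
    by (rule always_eventually, rule allI, rule less_imp_le, rule s(2))
  qed simp
  then show ?thesis by (rule iffD2[OF tendsto_dist_iff])
 qed
 have "Cauchy (%k. L (s x k))" for x
 proof (rule metric_CauchyI)
  fix e :: real assume "0 < e"
  obtain M where M: "\<forall>k\<ge>M. \<forall>l\<ge>M. dist (\<iota> (s x k)) (\<iota> (s x l)) < e"
   using metric_CauchyD[OF LIMSEQ_imp_Cauchy[OF lim] \<open>0 < e\<close>] by blast
  then show "\<exists>M. \<forall>k\<ge>M. \<forall>l\<ge>M. dist (L (s x k)) (L (s x l)) < e"
   using L[OF s(1) s(1)] by (meson le_less_trans)
 qed
 then have "convergent (%k. L (s x k))" for x by (rule Cauchy_convergent)
 then obtain R where R: "\<And>x. (%k. L (s x k)) \<longlonglongrightarrow> R x" unfolding convergent_def by metis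
 have "dist (R x) (R y) \<le> dist x y" for x y
  by (rule LIMSEQ_le[OF tendsto_dist[OF R R] tendsto_dist[OF lim lim]]) (auto intro: L s)
 moreover have "R (\<iota> f) = L f" if f: "f \<in> V" for f
 proof -
  have "dist (R (\<iota> f)) (L f) \<le> dist (\<iota> f) (\<iota> f)"
   by (rule LIMSEQ_le[OF tendsto_dist[OF R tendsto_const] tendsto_dist[OF lim tendsto_const]]) (auto intro: L s f)
  then show ?thesis by simp
 qed
 ultimately show ?thesis by blast
qed

lemma dense_closed_imp:
 assumes "closure A = UNIV" "closed {x. P x}" "\<And>x. x \<in> A ==> P x"
 shows "P x"
 using closure_minimal[of A "{x. P x}"] assms by auto

section \<open>Additive spans\<close>

text \<open>Sums without scalars: the generating sets used here already absorb scalars, and this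
  gives a plain induction over finite sums.\<close>

inductive_set addspan :: "'x::comm_monoid_add set => 'x set" for B where
 zero: "0 \<in> addspan B"
| add: "b \<in> B ==> x \<in> addspan B ==> b + x \<in> addspan B"

lemma addspan_base: "b \<in> B ==> b \<in> addspan B"
 using addspan.add[OF _ addspan.zero, of b B] by simp

lemma addspan_add: "x \<in> addspan B ==> y \<in> addspan B ==> x + y \<in> addspan B"
 by (induction rule: addspan.induct) (auto simp: add.assoc intro: addspan.add)

lemma addspan_sum: "(\<And>i. i \<in> T ==> f i \<in> addspan B) ==> (\<Sum>i\<in>T. f i) \<in> addspan B"
 by (induction T rule: infinite_finite_induct) (auto intro: addspan_add addspan.zero)

lemma addspan_image:
 assumes "h 0 = 0" "\<And>x y. h (x + y) = h x + h y" "\<And>b. b \<in> B ==> h b \<in> addspan C" "x \<in> addspan B"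
 shows "h x \<in> addspan C"
 using assms(4) by induction (auto simp: assms intro: addspan.zero addspan_add)

lemma addspan_mult:
 fixes x y :: "'x::semiring_0"
 assumes bc: "\<And>b c. b \<in> B ==> c \<in> C ==> b * c \<in> addspan D" and x: "x \<in> addspan B" and y: "y \<in> addspan C"
 shows "x * y \<in> addspan D"
proof -
 have b_y: "b * y \<in> addspan D" if "b \<in> B" for b
  by (rule addspan_image[where h = "%y. b * y", OF _ _ bc[OF that] y]) (simp_all add: distrib_left)
 show ?thesis
  by (rule addspan_image[where h = "%x. x * y", OF _ _ b_y x]) (simp_all add: distrib_right)
qed

lemma free_mult_in:
 assumes x: "x \<in> free_star_algebra n" and y: "y \<in> free_star_algebra n"
 shows "free_mult x y \<in> free_star_algebra n"
proof -
 have ex: "\<exists>u v. w = u @ v \<and> x u \<noteq> 0 \<and> y v \<noteq> 0" if nz: "free_mult x y w \<noteq> 0" for w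
 proof -
  obtain k where "x (take k w) * y (drop k w) \<noteq> 0"
   using nz unfolding free_mult_def by (auto elim!: sum.not_neutral_contains_not_neutral)
  then show ?thesis by (intro exI[of _ "take k w"] exI[of _ "drop k w"]) auto
 qed
 have "{w. free_mult x y w \<noteq> 0} \<subseteq> (%(u, v). u @ v) ` ({w. x w \<noteq> 0} \<times> {w. y w \<noteq> 0})"
  using ex by fastforce
 then have "finite {w. free_mult x y w \<noteq> 0}"
  by (rule finite_subset) (simp add: free_finite[OF x] free_finite[OF y])
 moreover have "w \<in> lists ({1..n} \<times> UNIV)" if "free_mult x y w \<noteq> 0" for w
 proof -
  obtain u v where uv: "w = u @ v" "x u \<noteq> 0" "y v \<noteq> 0" using ex[OF \<open>free_mult x y w \<noteq> 0\<close>] by blast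
  then have "u \<in> lists ({1..n} \<times> UNIV)" "v \<in> lists ({1..n} \<times> UNIV)"
   using x y unfolding free_star_algebra_def by blast+
  then show ?thesis by (simp add: uv)
 qed
 ultimately show ?thesis unfolding free_star_algebra_def by blast
qed

lemma fm_outside:
 assumes x: "x \<in> free_star_algebra n" and e: "e \<notin> idx n \<or> e' \<notin> idx n"
 shows "fm n \<omega> x e e' = 0"
 unfolding fm_def
proof (intro sum.neutral ballI)
 fix w assume "w \<in> {w. x w \<noteq> 0}"
 then have "w \<in> lists ({1..n} \<times> UNIV)" using x unfolding free_star_algebra_def by blast
 then have "wm n \<omega> w e e' = 0" using wop_in_idx[of w n e' \<omega> e] e wm_nonzeroD[of n \<omega> w e e'] by blast
 then show "x w * wm n \<omega> w e e' = 0" by simp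
qed

lemma idx_iff: "e \<in> idx n \<longleftrightarrow> ihd e \<in> {1..n} \<and> itl \<omega> e \<in> idx n"
 using icons_in_idx[of \<omega> "ihd e" "itl \<omega> e" n] by simp

lemma finite_col_fm: "x \<in> free_star_algebra n ==> finite {e''. fm n \<omega> x e'' e' \<noteq> 0}"
 using col_finite_fm[of x n \<omega>] unfolding col_finite_def by blast

text \<open>A letter on the left only relabels rows, so the formula contains a single coefficient
  and passes to limits.\<close>

lemma fm_cons_False:
 assumes x: "x \<in> free_star_algebra n" and i: "i \<in> {1..n}"
 shows "fm n \<omega> (free_mult (fsingle [(i, False)]) x) e e' =
  (if e \<in> idx n \<and> ihd e = i then fm n \<omega> x (itl \<omega> e) e' else 0)"
proof -
 have s: "fsingle [(i, False)] \<in> free_star_algebra n" using i by (intro fsingle_in) auto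
 have w: "wm n \<omega> [(i, False)] e e'' = (if e'' = itl \<omega> e \<and> e \<in> idx n \<and> ihd e = i then 1 else 0)" for e''
  using i idx_iff[of e n \<omega>] by (auto simp: wm_def lop_def icons_eq_iff)
 have "fm n \<omega> (free_mult (fsingle [(i, False)]) x) e e' = mm (wm n \<omega> [(i, False)]) (fm n \<omega> x) e e'"
  by (simp add: fm_mult[OF s x] fm_fsingle)
 also have "\<dots> = (\<Sum>e''\<in>insert (itl \<omega> e) {e''. fm n \<omega> x e'' e' \<noteq> 0}. wm n \<omega> [(i, False)] e e'' * fm n \<omega> x e'' e')"
  using finite_col_fm[OF x, of \<omega> e'] by (intro mm_superset) auto
 also have "\<dots> = (\<Sum>e''\<in>{itl \<omega> e}. wm n \<omega> [(i, False)] e e'' * fm n \<omega> x e'' e')"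
  using finite_col_fm[OF x, of \<omega> e'] by (intro sum.mono_neutral_right) (auto simp: w)
 finally show ?thesis by (simp add: w)
qed

lemma fm_cons_True:
 assumes x: "x \<in> free_star_algebra n" and i: "i \<in> {1..n}"
 shows "fm n \<omega> (free_mult (fsingle [(i, True)]) x) e e' = fm n \<omega> x (icons \<omega> i e) e'"
proof (cases "e \<in> idx n")
 case True
 have s: "fsingle [(i, True)] \<in> free_star_algebra n" using i by (intro fsingle_in) auto
 have w: "wm n \<omega> [(i, True)] e e'' = (if e'' = icons \<omega> i e then 1 else 0)" for e''
  using i True by (auto simp: wm_def lop_def)
 have "fm n \<omega> (free_mult (fsingle [(i, True)]) x) e e' = mm (wm n \<omega> [(i, True)]) (fm n \<omega> x) e e'"
  by (simp add: fm_mult[OF s x] fm_fsingle)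
 also have "\<dots> = (\<Sum>e''\<in>insert (icons \<omega> i e) {e''. fm n \<omega> x e'' e' \<noteq> 0}. wm n \<omega> [(i, True)] e e'' * fm n \<omega> x e'' e')"
  using finite_col_fm[OF x, of \<omega> e'] by (intro mm_superset) auto
 also have "\<dots> = (\<Sum>e''\<in>{icons \<omega> i e}. wm n \<omega> [(i, True)] e e'' * fm n \<omega> x e'' e')"
  using finite_col_fm[OF x, of \<omega> e'] by (intro sum.mono_neutral_right) (auto simp: w)
 finally show ?thesis by (simp add: w)
next
 case False
 have s: "fsingle [(i, True)] \<in> free_star_algebra n" using i by (intro fsingle_in) auto
 show ?thesis using False fm_outside[OF x, of "icons \<omega> i e"] fm_outside[OF free_mult_in[OF s x], of e] by simp
qed

lemma fm_one: "fm n \<omega> free_one e e' = (if e = e' \<and> e \<in> idx n then 1 else 0)"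
 by (auto simp: free_one_fsingle fm_fsingle wm_def)

locale cuntz =
 fixes n :: nat and S :: "nat => 'a::{cstar_algebra, real_normed_algebra_1}"
 assumes cuntz: "cuntz_algebra n S"
begin

definition quot :: "free_star => 'a" where
 "quot = (SOME \<pi>. universal_cstar_completion (free_star_algebra n) free_mult free_adj (kills_cuntz_relations n) \<pi> \<and>
     \<pi> free_one = 1 \<and> (\<forall>i\<in>{1..n}. \<pi> (free_gen i) = S i))"

lemma quot_spec: "universal_cstar_completion (free_star_algebra n) free_mult free_adj (kills_cuntz_relations n) quot \<and>
     quot free_one = 1 \<and> (\<forall>i\<in>{1..n}. quot (free_gen i) = S i)"
 using cuntz unfolding cuntz_algebra_def quot_def by (rule someI_ex)

lemma quot_props:
 shows quot_add: "f \<in> free_star_algebra n ==> g \<in> free_star_algebra n ==> quot (%x. f x + g x) = quot f + quot g"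
  and quot_scale: "f \<in> free_star_algebra n ==> quot (%x. c *\<^sub>C f x) = c *\<^sub>C quot f"
  and quot_mult: "f \<in> free_star_algebra n ==> g \<in> free_star_algebra n ==> quot (free_mult f g) = quot f * quot g"
  and quot_adj: "f \<in> free_star_algebra n ==> quot (free_adj f) = star (quot f)"
  and quot_dense: "closure (quot ` free_star_algebra n) = UNIV"
  and quot_kills: "kills_cuntz_relations n (%f. norm (quot f))"
  and quot_universal: "cstar_seminorm_on (free_star_algebra n) free_mult free_adj p ==> kills_cuntz_relations n p ==>
    f \<in> free_star_algebra n ==> p f \<le> norm (quot f)"
 using quot_spec unfolding universal_cstar_completion_def by blast+

lemma quot_one: "quot (fsingle []) = 1"
 using quot_spec by (simp add: free_one_fsingle)

lemma quot_gen: "i \<in> {1..n} ==> quot (fsingle [(i, False)]) = S i"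
 using quot_spec by (simp add: free_gen_fsingle)

lemma quot_gen_star: "i \<in> {1..n} ==> quot (fsingle [(i, True)]) = star (S i)"
 using quot_adj[of "fsingle [(i, False)]"] quot_gen[of i] fsingle_in[of "[(i, False)]" n]
 by (simp add: free_adj_fsingle flip_letters_def)

lemma quot_cons:
 assumes "i \<in> {1..n}" "w \<in> lists ({1..n} \<times> UNIV)"
 shows "quot (fsingle ((i, b) # w)) = (if b then star (S i) else S i) * quot (fsingle w)"
 using quot_mult[of "fsingle [(i, b)]" "fsingle w"] assms fsingle_in[of "[(i, b)]" n] fsingle_in[of w n]
 by (simp add: free_mult_fsingle quot_gen quot_gen_star)

lemma quot_minus_one:
 assumes x: "x \<in> free_star_algebra n" and z: "norm (quot (%w. x w - fsingle [] w)) = 0"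
 shows "quot x = 1"
proof -
 have o: "fsingle [] \<in> free_star_algebra n" by (simp add: fsingle_in)
 have m: "(%w. (- 1) *\<^sub>C fsingle [] w) \<in> free_star_algebra n" using free_star_algebra_closed(2)[OF o o] .
 have "(%w. x w - fsingle [] w) = (%w. x w + (- 1) *\<^sub>C fsingle [] w)" by (simp add: scaleC_complex_def)
 then have "quot (%w. x w - fsingle [] w) = quot x + (- 1) *\<^sub>C quot (fsingle [])"
  using quot_add[OF x m] quot_scale[OF o, of "-1"] by simp
 with z show ?thesis by (simp add: quot_one)
qed

lemma gen_lists: "i \<in> {1..n} ==> [(i, b)] \<in> lists ({1..n} \<times> UNIV)" "i \<in> {1..n} ==> [(i, b), (i, b')] \<in> lists ({1..n} \<times> UNIV)"
 by auto

lemma S_isometry: "i \<in> {1..n} ==> star (S i) * S i = 1"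
proof -
 assume i: "i \<in> {1..n}"
 have "norm (quot (%w. fsingle [(i, True), (i, False)] w - fsingle [] w)) = 0"
  using quot_kills i unfolding kills_cuntz_relations_def free_gen_fsingle free_one_fsingle free_adj_fsingle free_mult_fsingle
  by (simp add: flip_letters_def)
 then have "quot (fsingle [(i, True), (i, False)]) = 1"
  by (rule quot_minus_one[OF fsingle_in[OF gen_lists(2)[OF i]]])
 then show ?thesis using quot_cons[OF i gen_lists(1)[OF i], of True False] quot_gen[OF i] by simp
qed

lemma S_sum: "(\<Sum>i=1..n. S i * star (S i)) = 1"
proof -
 define y where "y = (%m w. \<Sum>i=1..m. fsingle [(i, False), (i, True)] w)"
 have y: "y m \<in> free_star_algebra n \<and> quot (y m) = (\<Sum>i=1..m. S i * star (S i))" if "m \<le> n" for m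
  using that
 proof (induction m)
  case 0
  have z: "(%w. 0) = (%w. (0::complex) *\<^sub>C fsingle [] w)" by simp
  have "(%w. 0) \<in> free_star_algebra n" by (simp add: free_star_algebra_def)
  moreover have "quot (%w. 0) = 0" unfolding z by (subst quot_scale) (simp_all add: fsingle_in)
  ultimately show ?case by (simp add: y_def)
 next
  case (Suc m)
  have i: "Suc m \<in> {1..n}" using Suc.prems by simp
  have eq: "y (Suc m) = (%w. y m w + fsingle [(Suc m, False), (Suc m, True)] w)" by (simp add: y_def fun_eq_iff)
  have s: "fsingle [(Suc m, False), (Suc m, True)] \<in> free_star_algebra n" by (rule fsingle_in[OF gen_lists(2)[OF i]])
  have m: "y m \<in> free_star_algebra n" "quot (y m) = (\<Sum>i=1..m. S i * star (S i))" using Suc by auto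
  show ?case unfolding eq
   using free_star_algebra_closed(1)[OF m(1) s] quot_add[OF m(1) s] m(2)
    quot_cons[OF i gen_lists(1)[OF i], of False True] quot_gen_star[OF i] by simp
 qed
 have "norm (quot (%w. y n w - fsingle [] w)) = 0"
  using quot_kills unfolding kills_cuntz_relations_def free_gen_fsingle free_one_fsingle free_adj_fsingle free_mult_fsingle
  by (simp add: flip_letters_def y_def)
 then show ?thesis using quot_minus_one[of "y n"] y[of n] by simp
qed

text \<open>Orthogonality is not among the defining relations; it is forced by the ranges summing to
  1.\<close>

lemma S_orthogonal: "i \<in> {1..n} ==> j \<in> {1..n} ==> i \<noteq> j ==> star (S i) * S j = 0"
 by (rule isometries_orthogonal[of "{1..n}" S]) (use S_isometry S_sum in auto)

section \<open>Words in the generators and their normal form\<close>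

primrec Sw :: "nat list => 'a" where
 "Sw [] = 1"
| "Sw (i # w) = S i * Sw w"

lemma Sw_append: "Sw (u @ v) = Sw u * Sw v"
 by (induction u) (simp_all add: mult.assoc)

lemma S_cancel: "i \<in> {1..n} ==> star (S i) * (S i * x) = x"
 using S_isometry by (simp flip: mult.assoc)

lemma S_kill: "i \<in> {1..n} ==> j \<in> {1..n} ==> i \<noteq> j ==> star (S i) * (S j * x) = 0"
 using S_orthogonal by (simp flip: mult.assoc)

lemma Sw_cancel: "w \<in> Wn n ==> star (Sw w) * (Sw w * x) = x"
 by (induction w arbitrary: x) (simp_all add: star_mult mult.assoc S_cancel)

text \<open>Equal first letters cancel and different ones annihilate, so the product is nonzero only
  if one word is a prefix of the other.\<close>

lemma Sw_star_mult:
 "u \<in> Wn n ==> v \<in> Wn n ==> (\<exists>r\<in>Wn n. v = u @ r \<and> star (Sw u) * Sw v = Sw r) \<or>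
   (\<exists>r\<in>Wn n. u = v @ r \<and> star (Sw u) * Sw v = star (Sw r)) \<or> star (Sw u) * Sw v = 0"
proof (induction u arbitrary: v)
 case Nil then show ?case by auto
next
 case (Cons i u)
 note IH = Cons.IH and prems = Cons.prems
 have iu: "i \<in> {1..n}" "u \<in> Wn n" using prems(1) by auto
 show ?case
 proof (cases v)
  case Nil
  then have "i # u = v @ (i # u) \<and> star (Sw (i # u)) * Sw v = star (Sw (i # u))" by simp
  then show ?thesis by (intro disjI2 disjI1 bexI[of _ "i # u"] prems(1))
 next
  case vj: (Cons j v')
  have j: "j \<in> {1..n}" "v' \<in> Wn n" using prems(2) unfolding vj by auto
  show ?thesis
  proof (cases "i = j")
   case True
   have eq: "star (Sw (i # u)) * Sw v = star (Sw u) * Sw v'"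
    using iu by (simp add: vj True[symmetric] star_mult mult.assoc S_cancel)
   have "(v' = u @ r) = (v = (i # u) @ r)" "(u = v' @ r) = (i # u = v @ r)" for r
    by (auto simp: vj True)
   with IH[OF iu(2) j(2)] show ?thesis unfolding eq by simp
  next
   case False
   then have "star (Sw (i # u)) * Sw v = 0" using iu j by (simp add: vj star_mult mult.assoc S_kill)
   then show ?thesis by blast
  qed
 qed
qed

definition gens :: "'a set" where
 "gens = {c *\<^sub>C (Sw u * star (Sw v)) | c u v. u \<in> Wn n \<and> v \<in> Wn n}"

text \<open>The normal form \<open>S_u S_v^*\<close> is stable under a further letter in front: an
  adjoint letter cancels the first letter of \<open>u\<close>, or annihilates, or extends
  \<open>v\<close> when \<open>u\<close> is empty.\<close>

lemma quot_fsingle_in: "w \<in> lists ({1..n} \<times> UNIV) ==> quot (fsingle w) \<in> addspan gens"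
proof (induction w)
 case Nil
 have "1 \<in> gens" unfolding gens_def by (intro CollectI exI[of _ 1] exI[of _ "[]"]) simp
 then show ?case by (simp add: quot_one addspan_base)
next
 case (Cons l w)
 obtain i b where l: "l = (i, b)" by (cases l)
 have i: "i \<in> {1..n}" and w: "w \<in> lists ({1..n} \<times> UNIV)" using Cons.prems l by auto
 define h where "h = (%x::'a. (if b then star (S i) else S i) * x)"
 have hg: "h x \<in> addspan gens" if x: "x \<in> gens" for x
 proof -
  obtain c u v where uv: "x = c *\<^sub>C (Sw u * star (Sw v))" "u \<in> Wn n" "v \<in> Wn n"
   using x unfolding gens_def by blast
  show ?thesis
  proof (cases b)
   case False
   have "h x = c *\<^sub>C (Sw (i # u) * star (Sw v))" by (simp add: h_def False uv mult_scaleC_right mult.assoc)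
   moreover have "i # u \<in> Wn n" using i uv by simp
   ultimately have "h x \<in> gens" unfolding gens_def using uv(3) by blast
   then show ?thesis by (rule addspan_base)
  next
   case b: True
   show ?thesis
   proof (cases u)
    case Nil
    have "h x = c *\<^sub>C (Sw [] * star (Sw (v @ [i])))"
     by (simp add: h_def b uv Nil mult_scaleC_right Sw_append star_mult)
    moreover have "v @ [i] \<in> Wn n" using i uv by simp
    ultimately have "h x \<in> gens" unfolding gens_def by blast
    then show ?thesis by (rule addspan_base)
   next
    case (Cons j u')
    have j: "j \<in> {1..n}" "u' \<in> Wn n" using uv Cons by auto
    show ?thesis
    proof (cases "i = j")
     case True
     have "h x = c *\<^sub>C (Sw u' * star (Sw v))"
      using i by (simp add: h_def b uv Cons True mult_scaleC_right mult.assoc S_cancel)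
     then have "h x \<in> gens" unfolding gens_def using j(2) uv(3) by blast
     then show ?thesis by (rule addspan_base)
    next
     case False
     have "h x = 0" using i j False by (simp add: h_def b uv Cons mult_scaleC_right mult.assoc S_kill)
     then show ?thesis by (simp add: addspan.zero)
    qed
   qed
  qed
 qed
 have "h (quot (fsingle w)) \<in> addspan gens"
  by (rule addspan_image[OF _ _ hg Cons.IH[OF w]]) (simp_all add: h_def distrib_left)
 then show ?case using quot_cons[OF i w, of b] l by (simp add: h_def)
qed

lemma gens_scale: "x \<in> addspan gens ==> c *\<^sub>C x \<in> addspan gens"
proof (rule addspan_image[where h = "%x. c *\<^sub>C x"])
 fix b assume "b \<in> gens"
 then obtain d u v where b: "b = d *\<^sub>C (Sw u * star (Sw v))" and uv: "u \<in> Wn n \<and> v \<in> Wn n"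
  unfolding gens_def by blast
 have "c *\<^sub>C b = (c * d) *\<^sub>C (Sw u * star (Sw v))" by (simp add: b scaleC_scaleC)
 then have "c *\<^sub>C b \<in> gens" unfolding gens_def using uv by blast
 then show "c *\<^sub>C b \<in> addspan gens" by (rule addspan_base)
qed (simp_all add: scaleC_add_right)

lemma quot_in_span:
 assumes x: "x \<in> free_star_algebra n"
 shows "quot x \<in> addspan gens"
proof -
 have X: "finite {w. x w \<noteq> 0}" by (rule free_finite[OF x])
 define r where "r = (%T w. if w \<in> T then x w else 0)"
 have "r T \<in> free_star_algebra n \<and> quot (r T) \<in> addspan gens" if "finite T" "T \<subseteq> {w. x w \<noteq> 0}" for T
  using that
 proof (induction T rule: finite_induct)
  case empty
  have z: "(%w. 0) = (%w. (0::complex) *\<^sub>C fsingle [] w)" by simp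
  have "(%w. 0) \<in> free_star_algebra n" by (simp add: free_star_algebra_def)
  moreover have "quot (%w. 0) = 0" unfolding z by (subst quot_scale) (simp_all add: fsingle_in)
  ultimately show ?case by (simp add: r_def addspan.zero)
 next
  case (insert v T)
  have v: "v \<in> lists ({1..n} \<times> UNIV)" using x insert.prems unfolding free_star_algebra_def by auto
  have sv: "(%w. x v *\<^sub>C fsingle v w) \<in> free_star_algebra n"
   by (rule free_star_algebra_closed(2)[OF fsingle_in[OF v] fsingle_in[OF v]])
  have eq: "r (insert v T) = (%w. x v *\<^sub>C fsingle v w + r T w)"
   using insert.hyps by (auto simp: r_def fsingle_def scaleC_complex_def fun_eq_iff)
  have IH: "r T \<in> free_star_algebra n" "quot (r T) \<in> addspan gens" using insert by auto
  have "quot (%w. x v *\<^sub>C fsingle v w) \<in> addspan gens"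
   unfolding quot_scale[OF fsingle_in[OF v]] by (rule gens_scale[OF quot_fsingle_in[OF v]])
  then show ?case unfolding eq quot_add[OF sv IH(1)]
   using free_star_algebra_closed(1)[OF sv IH(1)] addspan_add[OF _ IH(2)] by blast
 qed
 from this[OF X order_refl] have "quot (r {w. x w \<noteq> 0}) \<in> addspan gens" by blast
 moreover have "r {w. x w \<noteq> 0} = x" by (auto simp: r_def)
 ultimately show ?thesis by simp
qed

lemma gens_dense: "closure (addspan gens) = UNIV"
 using closure_mono[of "quot ` free_star_algebra n" "addspan gens"] quot_in_span quot_dense by blast

section \<open>Coefficients of elements of \<open>O_n\<close>\<close>

text \<open>The norm of \<open>O_n\<close> dominates every C*-seminorm that respects the relations,
  in particular that of the matrices.\<close>

lemma fm_diff:
 assumes "f \<in> free_star_algebra n" "g \<in> free_star_algebra n"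
 shows "mbd (%e e'. fm n \<omega> f e e' - fm n \<omega> g e e') (norm (quot f - quot g))"
proof -
 define h where "h = (%w. f w + (- 1) *\<^sub>C g w)"
 have mg: "(%w. (- 1) *\<^sub>C g w) \<in> free_star_algebra n" by (rule free_star_algebra_closed(2)[OF assms(2,2)])
 have h: "h \<in> free_star_algebra n" unfolding h_def by (rule free_star_algebra_closed(1)[OF assms(1) mg])
 have q: "quot h = quot f - quot g"
  unfolding h_def quot_add[OF assms(1) mg] quot_scale[OF assms(2)] by simp
 have "fm n \<omega> h = (%e e'. fm n \<omega> f e e' - fm n \<omega> g e e')"
  unfolding h_def by (intro ext) (simp only: fm_add[OF assms(1) mg] fm_scale, simp)
 moreover have "mbd (fm n \<omega> h) (norm (quot h))"
  by (rule mbd_mono[OF mbd_opn[OF mbd_fm[OF h]] quot_universal[OF cstar_seminorm_fm kills_cuntz_relations_fm h]])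
 ultimately show ?thesis by (simp add: q)
qed

definition mc_spec :: "(nat => 'g::topological_ab_group_add character) => 'g idx => 'g idx => ('a => complex) => bool" where
 "mc_spec \<omega> e e' R \<longleftrightarrow> (\<forall>f\<in>free_star_algebra n. R (quot f) = fm n \<omega> f e e') \<and> (\<forall>x y. dist (R x) (R y) \<le> dist x y)"

definition mc :: "(nat => 'g::topological_ab_group_add character) => 'a => 'g idx => 'g idx => complex" where
 "mc \<omega> a e e' = (SOME R. mc_spec \<omega> e e' R) a"

lemma mc_spec_mc: "mc_spec \<omega> e e' (%a. mc \<omega> a e e')"
proof -
 have "\<exists>R. mc_spec \<omega> e e' R" unfolding mc_spec_def
  by (rule extend_contraction[OF quot_dense])
   (use mbd_entry[OF fm_diff] in \<open>simp add: dist_norm\<close>)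
 then have "mc_spec \<omega> e e' (SOME R. mc_spec \<omega> e e' R)" by (rule someI_ex)
 then show ?thesis by (simp add: mc_def)
qed

lemma mc_quot: "f \<in> free_star_algebra n ==> mc \<omega> (quot f) e e' = fm n \<omega> f e e'"
 using mc_spec_mc[of \<omega> e e'] unfolding mc_spec_def by blast

lemma dist_mc: "dist (mc \<omega> x e e') (mc \<omega> y e e') \<le> dist x y"
 using mc_spec_mc[of \<omega> e e'] unfolding mc_spec_def by blast

lemma continuous_on_mc [continuous_intros]:
 assumes "continuous_on A f"
 shows "continuous_on A (%x. mc \<omega> (f x) e e')"
proof -
 have "continuous_on UNIV (%a. mc \<omega> a e e')"
  by (rule lipschitz_on_continuous_on[OF lipschitz_onI[of _ _ 1]]) (simp_all add: dist_mc)
 then show ?thesis by (rule continuous_on_compose2[OF _ assms]) simp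
qed

lemma mc_add: "mc \<omega> (a + b) e e' = mc \<omega> a e e' + mc \<omega> b e e'"
proof -
 have 1: "mc \<omega> (quot f + b) e e' = mc \<omega> (quot f) e e' + mc \<omega> b e e'" if f: "f \<in> free_star_algebra n" for f b
 proof (rule dense_closed_imp[OF quot_dense, of "%b. mc \<omega> (quot f + b) e e' = mc \<omega> (quot f) e e' + mc \<omega> b e e'"])
  show "closed {b. mc \<omega> (quot f + b) e e' = mc \<omega> (quot f) e e' + mc \<omega> b e e'}"
   by (intro closed_Collect_eq continuous_intros)
  fix x assume "x \<in> quot ` free_star_algebra n"
  then obtain g where g: "x = quot g" "g \<in> free_star_algebra n" by blast
  show "mc \<omega> (quot f + x) e e' = mc \<omega> (quot f) e e' + mc \<omega> x e e'"
   unfolding g quot_add[OF f g(2), symmetric] mc_quot[OF f] mc_quot[OF g(2)]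
    mc_quot[OF free_star_algebra_closed(1)[OF f g(2)]] by (rule fm_add[OF f g(2)])
 qed
 show ?thesis
 proof (rule dense_closed_imp[OF quot_dense, of "%a. mc \<omega> (a + b) e e' = mc \<omega> a e e' + mc \<omega> b e e'"])
  show "closed {a. mc \<omega> (a + b) e e' = mc \<omega> a e e' + mc \<omega> b e e'}"
   by (intro closed_Collect_eq continuous_intros)
 qed (use 1 in blast)
qed

lemma mc_scale: "mc \<omega> (c *\<^sub>C a) e e' = c * mc \<omega> a e e'"
proof (rule dense_closed_imp[OF quot_dense, of "%a. mc \<omega> (c *\<^sub>C a) e e' = c * mc \<omega> a e e'"])
 show "closed {a. mc \<omega> (c *\<^sub>C a) e e' = c * mc \<omega> a e e'}" by (intro closed_Collect_eq continuous_intros)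
 fix x assume "x \<in> quot ` free_star_algebra n"
 then obtain g where g: "x = quot g" "g \<in> free_star_algebra n" by blast
 show "mc \<omega> (c *\<^sub>C x) e e' = c * mc \<omega> x e e'"
  unfolding g quot_scale[OF g(2), symmetric] mc_quot[OF g(2)]
   mc_quot[OF free_star_algebra_closed(2)[OF g(2) g(2)]] by (rule fm_scale)
qed

lemma mc_zero [simp]: "mc \<omega> 0 e e' = 0"
 using mc_add[of \<omega> 0 0 e e'] by simp

lemma mc_star: "mc \<omega> (star a) e e' = cnj (mc \<omega> a e' e)"
proof (rule dense_closed_imp[OF quot_dense, of "%a. mc \<omega> (star a) e e' = cnj (mc \<omega> a e' e)"])
 show "closed {a. mc \<omega> (star a) e e' = cnj (mc \<omega> a e' e)}" by (intro closed_Collect_eq continuous_intros)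
 fix x assume "x \<in> quot ` free_star_algebra n"
 then obtain g where g: "x = quot g" "g \<in> free_star_algebra n" by blast
 have gi: "free_adj g \<in> free_star_algebra n"
  using free_adj_in[OF g(2)] .
 show "mc \<omega> (star x) e e' = cnj (mc \<omega> x e' e)"
  unfolding g quot_adj[OF g(2), symmetric] mc_quot[OF g(2)] mc_quot[OF gi] fm_adj[OF g(2)] by (simp add: adjm_def)
qed

lemma mc_S:
 assumes i: "i \<in> {1..n}"
 shows "mc \<omega> (S i * a) e e' = (if e \<in> idx n \<and> ihd e = i then mc \<omega> a (itl \<omega> e) e' else 0)"
proof (rule dense_closed_imp[OF quot_dense, of "%a. mc \<omega> (S i * a) e e' = (if e \<in> idx n \<and> ihd e = i then mc \<omega> a (itl \<omega> e) e' else 0)"])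
 show "closed {a. mc \<omega> (S i * a) e e' = (if e \<in> idx n \<and> ihd e = i then mc \<omega> a (itl \<omega> e) e' else 0)}"
  by (cases "e \<in> idx n \<and> ihd e = i") (auto intro!: closed_Collect_eq continuous_intros)
 fix x assume "x \<in> quot ` free_star_algebra n"
 then obtain g where g: "x = quot g" "g \<in> free_star_algebra n" by blast
 have s: "fsingle [(i, False)] \<in> free_star_algebra n" by (rule fsingle_in[OF gen_lists(1)[OF i]])
 show "mc \<omega> (S i * x) e e' = (if e \<in> idx n \<and> ihd e = i then mc \<omega> x (itl \<omega> e) e' else 0)"
  unfolding g quot_gen[OF i, symmetric] quot_mult[OF s g(2), symmetric] mc_quot[OF g(2)] mc_quot[OF free_mult_in[OF s g(2)]]
  by (rule fm_cons_False[OF g(2) i])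
qed

lemma mc_S_star:
 assumes i: "i \<in> {1..n}"
 shows "mc \<omega> (star (S i) * a) e e' = mc \<omega> a (icons \<omega> i e) e'"
proof (rule dense_closed_imp[OF quot_dense, of "%a. mc \<omega> (star (S i) * a) e e' = mc \<omega> a (icons \<omega> i e) e'"])
 show "closed {a. mc \<omega> (star (S i) * a) e e' = mc \<omega> a (icons \<omega> i e) e'}"
  by (intro closed_Collect_eq continuous_intros)
 fix x assume "x \<in> quot ` free_star_algebra n"
 then obtain g where g: "x = quot g" "g \<in> free_star_algebra n" by blast
 have s: "fsingle [(i, True)] \<in> free_star_algebra n" by (rule fsingle_in[OF gen_lists(1)[OF i]])
 show "mc \<omega> (star (S i) * x) e e' = mc \<omega> x (icons \<omega> i e) e'"
  unfolding g quot_gen_star[OF i, symmetric] quot_mult[OF s g(2), symmetric] mc_quot[OF g(2)] mc_quot[OF free_mult_in[OF s g(2)]]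
  by (rule fm_cons_True[OF g(2) i])
qed

lemma mc_one: "mc \<omega> 1 e e' = (if e = e' \<and> e \<in> idx n then 1 else 0)"
proof -
 have s: "fsingle [] \<in> free_star_algebra n" by (rule fsingle_in) simp
 have "mc \<omega> (quot (fsingle [])) e e' = (if e = e' \<and> e \<in> idx n then 1 else 0)"
  unfolding mc_quot[OF s] using fm_one unfolding free_one_fsingle .
 then show ?thesis unfolding quot_one .
qed

lemma mbd_mc: "mbd (mc \<omega> a) (norm a)"
 unfolding mbd_def
proof (intro conjI allI impI)
 fix A \<xi> \<eta> assume A: "finite (A :: 'b idx set)"
 let ?P = "%a. cmod (sesq A (mc \<omega> a) \<xi> \<eta>) \<le> norm a * l2 \<xi> A * l2 \<eta> A"
 show "?P a"
 proof (rule dense_closed_imp[OF quot_dense, of ?P])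
  show "closed {a. ?P a}" by (intro closed_Collect_le continuous_intros)
  fix x assume "x \<in> quot ` free_star_algebra n"
  then obtain g where g: "x = quot g" "g \<in> free_star_algebra n" by blast
  have "mbd (fm n \<omega> g) (norm (quot g))"
   by (rule mbd_mono[OF mbd_opn[OF mbd_fm[OF g(2)]] quot_universal[OF cstar_seminorm_fm kills_cuntz_relations_fm g(2)]])
  then show "?P x" using A unfolding mbd_def g(1) mc_quot[OF g(2)] by blast
 qed
qed simp

end

section \<open>Matrix coefficients on the crossed product\<close>

definition act :: "(nat => 'g::topological_ab_group_add character) => nat list => 'g idx => 'g idx" where
 "act \<omega> w e = foldr (icons \<omega>) w e"

lemma act_simps [simp]: "act \<omega> [] e = e" "act \<omega> (i # w) e = icons \<omega> i (act \<omega> w e)"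
 by (simp_all add: act_def)

lemma act_append: "act \<omega> (u @ v) e = act \<omega> u (act \<omega> v e)"
 by (simp add: act_def)

lemma deg_act [simp]: "deg (act \<omega> w e) = deg e + wt \<omega> w"
 by (induction w) (simp_all add: algebra_simps)

lemma lev_act [simp]: "lev (act \<omega> w e) = lev e + int (length w)"
 by (induction w) simp_all

lemma act_in_idx [simp]: "w \<in> Wn n ==> act \<omega> w e \<in> idx n \<longleftrightarrow> e \<in> idx n"
 by (induction w) simp_all

lemma icons_inject [simp]: "icons \<omega> i e = icons \<omega> j e' \<longleftrightarrow> i = j \<and> e = e'"
 by (auto simp: icons_eq_iff)

lemma act_inject [simp]: "act \<omega> w e = act \<omega> w e' \<longleftrightarrow> e = e'"
 by (induction w) simp_all

lemma act_same_length: "length u = length v ==> act \<omega> u e = act \<omega> v e' ==> u = v \<and> e = e'"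
 by (induction u v rule: list_induct2) auto

context cuntz
begin

lemma mc_outside:
 assumes e: "e \<notin> idx n \<or> e' \<notin> idx n"
 shows "mc \<omega> a e e' = 0"
proof (rule dense_closed_imp[OF quot_dense, of "%a. mc \<omega> a e e' = 0"])
 show "closed {a. mc \<omega> a e e' = 0}" by (intro closed_Collect_eq continuous_intros)
qed (auto simp: mc_quot fm_outside[OF _ e])

lemma mc_Sw: "w \<in> Wn n ==> mc \<omega> (Sw w * a) (act \<omega> w e) e' = mc \<omega> a e e'"
 by (induction w arbitrary: a) (auto simp: mult.assoc mc_S mc_outside)

lemma mc_Sw_zero:
 "w \<in> Wn n ==> (\<And>d. e \<noteq> act \<omega> w d) ==> mc \<omega> (Sw w * a) e e' = 0"
proof (induction w arbitrary: e)
 case Nil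
 from Nil(2)[of e] show ?case by simp
next
 case (Cons i w)
 from Cons.prems(1) have i: "i \<in> {1..n}" and w: "w \<in> Wn n" by simp_all
 have "mc \<omega> (Sw w * a) (itl \<omega> e) e' = 0" if "ihd e = i"
 proof (rule Cons.IH[OF w])
  fix d show "itl \<omega> e \<noteq> act \<omega> w d"
   using Cons.prems(2)[of d] icons_itl[of \<omega> e] that by fastforce
 qed
 then show ?case by (simp add: mult.assoc mc_S[OF i])
qed

lemma mc_star_Sw: "w \<in> Wn n ==> mc \<omega> (star (Sw w) * a) e e' = mc \<omega> a (act \<omega> w e) e'"
 by (induction w arbitrary: a) (simp_all add: star_mult mult.assoc mc_S_star)

text \<open>Taking adjoints turns the formulas for left multiplication into those for right
  multiplication.\<close>

lemma mc_right: "mc \<omega> (a * b) e e' = cnj (mc \<omega> (star b * star a) e' e)"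
 by (simp add: mc_star[symmetric] star_mult star_star)

lemma mc_mult_Sw: "w \<in> Wn n ==> mc \<omega> (a * Sw w) e e' = mc \<omega> a e (act \<omega> w e')"
 unfolding mc_right[of \<omega> a] by (simp add: mc_star_Sw mc_star)

lemma mc_mult_star_Sw: "w \<in> Wn n ==> mc \<omega> (a * star (Sw w)) e (act \<omega> w e') = mc \<omega> a e e'"
 unfolding mc_right[of \<omega> a] by (simp add: star_star mc_Sw mc_star)

lemma mc_mult_star_Sw_zero: "w \<in> Wn n ==> (\<And>d. e' \<noteq> act \<omega> w d) ==> mc \<omega> (a * star (Sw w)) e e' = 0"
 unfolding mc_right[of \<omega> a] by (simp add: star_star mc_Sw_zero)

end

definition tens :: "('g => complex) => 'a::cstar_algebra => 'g => 'a" where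
 "tens \<phi> a t = \<phi> t *\<^sub>C a"

lemma tens_in: "\<phi> \<in> Cc ==> tens \<phi> a \<in> Cc"
 unfolding tens_def[abs_def]
 by (rule cs_bounded_linear[OF _ bounded_bilinear.bounded_linear_left[OF bounded_bilinear_scaleC]])

lemma cs_scale:
 fixes f :: "'g::topological_space => 'b::cstar_algebra"
 shows "f \<in> Cc ==> (%t. c *\<^sub>C f t) \<in> Cc"
 by (rule cs_bounded_linear[OF _ bounded_bilinear.bounded_linear_right[OF bounded_bilinear_scaleC]])

lemma (in lca) cs_section_integral:
 fixes F :: "'g \<times> 'g => 'b::{banach, second_countable_topology}"
 assumes F: "continuous_on UNIV F" and K: "compact K" "\<And>s t. F (s, t) \<noteq> 0 ==> s \<in> K"
  and M: "compact M" "\<And>s t. F (s, t) \<noteq> 0 ==> t \<in> M"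
 shows "(%t. \<integral>s. F (s, t) \<partial>\<mu>) \<in> Cc"
proof (rule csI[OF _ M(1)])
 have "continuous_on UNIV (%p. F (snd p, fst p))"
  by (rule continuous_on_compose2[OF F]) (auto intro!: continuous_intros)
 from continuous_on_section_integral[OF this K(1)] K(2) show "continuous_on UNIV (%t. \<integral>s. F (s, t) \<partial>\<mu>)"
  by fastforce
 fix t assume "t \<notin> M"
 then have "F (s, t) = 0" for s using M(2) by blast
 then show "(\<integral>s. F (s, t) \<partial>\<mu>) = 0" by simp
qed

locale crossed = lca \<mu> + cuntz n S
 for \<mu> :: "'g::{topological_ab_group_add, t2_space} measure" and n :: nat
  and S :: "nat => 'a::{cstar_algebra, real_normed_algebra_1, second_countable_topology}" +
 fixes \<omega> :: "nat => 'g character" and \<alpha> :: "'g => 'a => 'a" and \<iota> :: "('g => 'a) => 'c::cstar_algebra"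
 assumes n2: "n \<ge> 2" and action: "cstar_action \<alpha>"
  and \<alpha>_S: "\<And>t i. i \<in> {1..n} ==> \<alpha> t (S i) = pairing t (\<omega> i) *\<^sub>C S i"
  and crossed: "crossed_product \<mu> \<alpha> \<iota>"
begin

lemma \<alpha>_hom: "\<alpha> t (x + y) = \<alpha> t x + \<alpha> t y" "\<alpha> t (c *\<^sub>C x) = c *\<^sub>C \<alpha> t x"
  "\<alpha> t (x * y) = \<alpha> t x * \<alpha> t y" "\<alpha> t (star x) = star (\<alpha> t x)" "\<alpha> (s + t) x = \<alpha> s (\<alpha> t x)"
  "continuous_on UNIV (%t. \<alpha> t x)"
 using action unfolding cstar_action_def star_hom_def by blast+

lemma \<alpha>_zero [simp]: "\<alpha> t 0 = 0"
 using \<alpha>_hom(2)[of t 0 0] by simp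

lemma \<alpha>_diff: "\<alpha> t (x - y) = \<alpha> t x - \<alpha> t y"
 using \<alpha>_hom(1)[of t "x - y" y] by simp

lemma \<alpha>_one [simp]: "\<alpha> t 1 = 1"
proof -
 have "surj (\<alpha> t)" using action unfolding cstar_action_def by (simp add: bij_is_surj)
 then obtain x where "\<alpha> t x = 1" by (metis surjD)
 with \<alpha>_hom(3)[of t 1 x] show ?thesis by simp
qed

lemma norm_\<alpha>: "norm (\<alpha> t x) \<le> norm x"
 using action by (intro star_hom_contractive) (simp_all add: cstar_action_def)

text \<open>Strong continuity and contractivity of each \<open>\<alpha> t\<close> give joint
  continuity: the argument \<open>x\<close> is first frozen at \<open>p0\<close>.\<close>

lemma continuous_on_\<alpha>:
 fixes s :: "'p::topological_space => 'g"
 assumes s: "continuous_on UNIV s" and x: "continuous_on UNIV x"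
 shows "continuous_on UNIV (%p. \<alpha> (s p) (x p))"
 unfolding continuous_on_def
proof
 fix p0
 have "continuous_on UNIV (%p. \<alpha> (s p) (x p0))"
  by (rule continuous_on_compose2[OF \<alpha>_hom(6) s]) simp
 then have 1: "((%p. \<alpha> (s p) (x p0)) \<longlongrightarrow> \<alpha> (s p0) (x p0)) (at p0)" unfolding continuous_on_def by simp
 have "(x \<longlongrightarrow> x p0) (at p0)" using x unfolding continuous_on_def by simp
 then have "((%p. norm (x p - x p0)) \<longlongrightarrow> 0) (at p0)" by (simp add: LIM_zero tendsto_norm_zero)
 then have 2: "((%p. \<alpha> (s p) (x p - x p0)) \<longlongrightarrow> 0) (at p0)"
  by (rule Lim_null_comparison[rotated]) (simp add: norm_\<alpha>)
 show "((%p. \<alpha> (s p) (x p)) \<longlongrightarrow> \<alpha> (s p0) (x p0)) (at p0)"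
  using tendsto_add[OF 1 2] by (simp flip: \<alpha>_hom(1))
qed

lemma \<alpha>_Sw: "w \<in> Wn n ==> \<alpha> t (Sw w) = pairing t (wt \<omega> w) *\<^sub>C Sw w"
 by (induction w) (simp_all add: \<alpha>_hom \<alpha>_S mult_scaleC_left mult_scaleC_right scaleC_scaleC pairing_add_right mult.commute)

text \<open>Covariance: the diagonal unitary with entries \<open>pairing t (deg e)\<close>
  implements \<open>\<alpha> t\<close>. The property passes from 1, through left multiplication by
  words, adjoints and sums, to a dense subspace.\<close>

lemma mc_\<alpha>: "mc \<omega> (\<alpha> t a) e e' = pairing t (deg e - deg e') * mc \<omega> a e e'"
proof -
 define P where "P a \<longleftrightarrow> (\<forall>e e'. mc \<omega> (\<alpha> t a) e e' = pairing t (deg e - deg e') * mc \<omega> a e e')" for a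
 have PI: "P a" if "\<And>e e'. mc \<omega> (\<alpha> t a) e e' = pairing t (deg e - deg e') * mc \<omega> a e e'" for a
  unfolding P_def by (intro allI that)
 have PD: "mc \<omega> (\<alpha> t a) e e' = pairing t (deg e - deg e') * mc \<omega> a e e'" if "P a" for a e e'
  using that[unfolded P_def, rule_format, of e e'] .
 have S: "P (Sw w * a)" if "w \<in> Wn n" "P a" for w a
  using that
 proof (induction w)
  case (Cons i w)
  then have i: "i \<in> {1..n}" and IH: "P (Sw w * a)" by simp_all
  show ?case
  proof (rule PI)
   fix e e' :: "'g idx"
   have "deg e = deg (itl \<omega> e) + \<omega> (ihd e)" using deg_icons[of \<omega> "ihd e" "itl \<omega> e"] by simp
   then have eq: "pairing t (\<omega> i) * pairing t (deg (itl \<omega> e) - deg e') = pairing t (deg e - deg e')" if "ihd e = i"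
    using that by (simp flip: pairing_add_right) (simp add: algebra_simps)
   have "mc \<omega> (\<alpha> t (Sw (i # w) * a)) e e' = pairing t (\<omega> i) * mc \<omega> (S i * \<alpha> t (Sw w * a)) e e'"
    by (simp add: \<alpha>_hom(3) \<alpha>_S[OF i] mult_scaleC_left mc_scale mult.assoc)
   also have "\<dots> = pairing t (deg e - deg e') * mc \<omega> (Sw (i # w) * a) e e'"
    unfolding mc_S[OF i] PD[OF IH, of "itl \<omega> e" e'] Sw.simps mult.assoc[of "S i"] using eq by (simp flip: mult.assoc)
   finally show "mc \<omega> (\<alpha> t (Sw (i # w) * a)) e e' = pairing t (deg e - deg e') * mc \<omega> (Sw (i # w) * a) e e'" .
  qed
 qed simp
 have star: "P (star a)" if a: "P a" for a
 proof (rule PI)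
  fix e e' :: "'g idx"
  have "cnj (pairing t (deg e' - deg e)) = pairing t (deg e - deg e')"
   by (simp add: pairing_diff_right mult.commute)
  then show "mc \<omega> (\<alpha> t (star a)) e e' = pairing t (deg e - deg e') * mc \<omega> (star a) e e'"
   unfolding \<alpha>_hom(4) mc_star PD[OF a] by simp
 qed
 have one: "P 1" by (rule PI) (simp add: mc_one)
 have gens: "P a" if a: "a \<in> gens" for a
 proof -
  obtain c u v where a: "a = c *\<^sub>C (Sw u * star (Sw v))" "u \<in> Wn n" "v \<in> Wn n"
   using a unfolding gens_def by blast
  have "P (Sw u * star (Sw v))" by (rule S[OF a(2) star]) (use S[OF a(3) one] in simp)
  from PD[OF this] show ?thesis unfolding a(1) by (intro PI) (simp add: \<alpha>_hom(2) mc_scale)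
 qed
 have "P x" if "x \<in> addspan gens" for x
  using that
 proof induction
  case zero show ?case by (rule PI) simp
 next
  case (add b x) then show ?case
   by (intro PI) (simp add: \<alpha>_hom(1) mc_add distrib_left PD[OF gens] PD[OF add.IH])
 qed
 note span = PD[OF this]
 show ?thesis
 proof (rule dense_closed_imp[OF gens_dense, of "%a. mc \<omega> (\<alpha> t a) e e' = pairing t (deg e - deg e') * mc \<omega> a e e'"])
  have "continuous_on UNIV (\<alpha> t)" by (rule continuous_on_\<alpha>[of "%_. t" "%x. x"]) simp_all
  then show "closed {a. mc \<omega> (\<alpha> t a) e e' = pairing t (deg e - deg e') * mc \<omega> a e e'}"
   by (intro closed_Collect_eq continuous_intros) auto
 qed (rule span)
qed

abbreviation tc :: "('g => 'a) => ('g => 'a) => 'g => 'a" where "tc \<equiv> twisted_conv \<mu> \<alpha>"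
abbreviation tadj :: "('g => 'a) => 'g => 'a" where "tadj \<equiv> twisted_adj \<alpha>"

definition L1 :: "('g => 'a) => real" where
 "L1 f = (\<integral>t. norm (f t) \<partial>\<mu>)"

lemma \<iota>_add: "f \<in> Cc ==> g \<in> Cc ==> \<iota> (%t. f t + g t) = \<iota> f + \<iota> g"
 and \<iota>_scale: "f \<in> Cc ==> \<iota> (%t. c *\<^sub>C f t) = c *\<^sub>C \<iota> f"
 and \<iota>_tc: "f \<in> Cc ==> g \<in> Cc ==> \<iota> (tc f g) = \<iota> f * \<iota> g"
 and \<iota>_tadj: "f \<in> Cc ==> \<iota> (tadj f) = star (\<iota> f)"
 and \<iota>_dense: "closure (\<iota> ` Cc) = UNIV"
 and norm_\<iota>: "f \<in> Cc ==> norm (\<iota> f) \<le> L1 f"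
 and \<iota>_universal: "cstar_seminorm_on Cc tc tadj p ==>
   (\<And>f. f \<in> Cc ==> p f \<le> L1 f) ==> f \<in> Cc ==> p f \<le> norm (\<iota> f)"
 using crossed unfolding crossed_product_def universal_cstar_completion_def L1_def by blast+

lemma \<iota>_diff:
 assumes "f \<in> Cc" "g \<in> Cc"
 shows "\<iota> (%t. f t - g t) = \<iota> f - \<iota> g"
 using \<iota>_add[OF cs_diff[OF assms] assms(2)] by simp

lemma L1_nonneg: "0 \<le> L1 f"
 unfolding L1_def by simp

section \<open>The twisted convolution algebra\<close>

lemma twisted_kernel:
 fixes f g :: "'g => 'a"
 assumes f: "f \<in> Cc" and g: "g \<in> Cc"
 obtains K M where "compact K" "compact M" "\<And>s t. f s \<noteq> 0 ==> g (t - s) \<noteq> 0 ==> s \<in> K \<and> t \<in> M"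
  "continuous_on UNIV (%p. f (fst p) * \<alpha> (fst p) (g (snd p - fst p)))"
  "continuous_on UNIV (%p. norm (f (fst p)) * norm (g (snd p - fst p)))"
proof -
 obtain K where K: "continuous_on UNIV f" "compact K" "\<And>t. t \<notin> K ==> f t = 0"
  using f by (rule csE) (rule that)
 obtain L where L: "continuous_on UNIV g" "compact L" "\<And>t. t \<notin> L ==> g t = 0"
  using g by (rule csE) (rule that)
 have c1: "continuous_on UNIV (%p :: 'g \<times> 'g. f (fst p))"
  by (rule continuous_on_compose2[OF K(1)]) (auto intro!: continuous_intros)
 have c2: "continuous_on UNIV (%p :: 'g \<times> 'g. g (snd p - fst p))"
  by (rule continuous_on_compose2[OF L(1)]) (auto intro!: continuous_intros)
 show ?thesis
 proof (rule that[of K "(%p. fst p + snd p) ` (K \<times> L)"])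
  show "s \<in> K \<and> t \<in> (%p. fst p + snd p) ` (K \<times> L)" if "f s \<noteq> 0" "g (t - s) \<noteq> 0" for s t
  proof -
   have "s \<in> K" "t - s \<in> L" using that K(3) L(3) by blast+
   then show ?thesis by (intro conjI image_eqI[of _ _ "(s, t - s)"]) simp_all
  qed
 qed (intro K compact_add_sets L continuous_on_mult continuous_on_norm c1 c2 continuous_on_\<alpha> continuous_on_fst continuous_on_id)+
qed

lemma tc_in:
 assumes f: "f \<in> Cc" and g: "g \<in> Cc"
 shows "tc f g \<in> Cc"
proof -
 obtain K M where KM: "compact K" "compact M" "\<And>s t. f s \<noteq> 0 ==> g (t - s) \<noteq> 0 ==> s \<in> K \<and> t \<in> M"
  "continuous_on UNIV (%p. f (fst p) * \<alpha> (fst p) (g (snd p - fst p)))"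
  by (rule twisted_kernel[OF f g]) (rule that)
 have nz: "s \<in> K \<and> t \<in> M" if "f s * \<alpha> s (g (t - s)) \<noteq> 0" for s t
  by (rule KM(3)) (use that in auto)
 have "(%t. \<integral>s. (%p. f (fst p) * \<alpha> (fst p) (g (snd p - fst p))) (s, t) \<partial>\<mu>) \<in> Cc"
  by (rule cs_section_integral[OF KM(4,1) _ KM(2)]) (use nz in auto)
 then show ?thesis by (simp add: twisted_conv_def[abs_def])
qed

lemma tc_integrable:
 assumes f: "f \<in> Cc" and g: "g \<in> Cc"
 shows "integrable \<mu> (%s. f s * \<alpha> s (g (t - s)))"
proof -
 obtain K M where KM: "compact K" "compact M" "\<And>s t. f s \<noteq> 0 ==> g (t - s) \<noteq> 0 ==> s \<in> K \<and> t \<in> M"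
  "continuous_on UNIV (%p. f (fst p) * \<alpha> (fst p) (g (snd p - fst p)))"
  by (rule twisted_kernel[OF f g]) (rule that)
 show ?thesis
  by (rule integrable_bounded[OF continuous_on_section(2)[OF KM(4), of t, simplified] KM(1)]) (use KM(3)[of _ t] in \<open>metis \<alpha>_zero mult_zero_left mult_zero_right\<close>)
qed

lemma L1_tc:
 assumes f: "f \<in> Cc" and g: "g \<in> Cc"
 shows "L1 (tc f g) \<le> L1 f * L1 g"
proof -
 obtain K M where KM: "compact K" "compact M" "\<And>s t. f s \<noteq> 0 ==> g (t - s) \<noteq> 0 ==> s \<in> K \<and> t \<in> M"
  "continuous_on UNIV (%p. norm (f (fst p)) * norm (g (snd p - fst p)))"
  by (rule twisted_kernel[OF f g]) (rule that)
 let ?F = "%p. norm (f (fst p)) * norm (g (snd p - fst p))"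
 have nz: "?F (s, t) \<noteq> 0 ==> s \<in> K" "?F (s, t) \<noteq> 0 ==> t \<in> M" for s t using KM(3)[of s t] by auto
 have F: "(%t. \<integral>s. ?F (s, t) \<partial>\<mu>) \<in> Cc"
  by (rule cs_section_integral[OF KM(4,1) nz(1) KM(2) nz(2)])
 have int: "integrable \<mu> (%s. norm (f s) * norm (g (t - s)))" for t
  by (rule integrable_bounded[OF continuous_on_section(2)[OF KM(4), of t, simplified] KM(1)]) (use KM(3)[of _ t] in fastforce)
 have "norm (tc f g t) \<le> (\<integral>s. ?F (s, t) \<partial>\<mu>)" for t
 proof -
  have "norm (tc f g t) \<le> (\<integral>s. norm (f s * \<alpha> s (g (t - s))) \<partial>\<mu>)"
   unfolding twisted_conv_def by (rule integral_norm_bound)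
  also have "\<dots> \<le> (\<integral>s. norm (f s) * norm (g (t - s)) \<partial>\<mu>)"
   by (rule integral_mono[OF integrable_norm[OF tc_integrable[OF f g]] int])
    (rule order_trans[OF norm_mult_ineq mult_left_mono[OF norm_\<alpha> norm_ge_zero]])
  finally show ?thesis by simp
 qed
 then have "L1 (tc f g) \<le> (\<integral>t. (\<integral>s. ?F (s, t) \<partial>\<mu>) \<partial>\<mu>)"
  unfolding L1_def by (intro integral_mono integrable_norm integrable_cs tc_in[OF f g] F)
 also have "\<dots> = (\<integral>s. (\<integral>t. ?F (s, t) \<partial>\<mu>) \<partial>\<mu>)"
  by (rule fubini_cs[OF KM(4,1) _ KM(2), symmetric]) (use nz in blast)+
 also have "\<dots> = (\<integral>s. norm (f s) * L1 g \<partial>\<mu>)"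
  using integral_translate[of "%t. norm (g t)" "- s" for s] cs_continuous[OF g]
  by (simp add: L1_def continuous_on_norm)
 also have "\<dots> = L1 f * L1 g" by (simp add: L1_def)
 finally show ?thesis .
qed

lemma tadj_in:
 assumes f: "f \<in> Cc"
 shows "tadj f \<in> Cc"
proof -
 obtain K where K: "continuous_on UNIV (%t. f (- t))" "compact K" "\<And>t. t \<notin> K ==> f (- t) = 0"
  using cs_uminus[OF f] by (rule csE) (rule that)
 show ?thesis unfolding twisted_adj_def
  by (rule csI[OF _ K(2)]) (auto intro!: continuous_on_\<alpha> continuous_intros K simp: K(3))
qed

section \<open>Matrix coefficients of compactly supported functions\<close>

lemma bounded_linear_mc: "bounded_linear (%a. mc \<omega> a e e')"
proof (rule bounded_linear_intro[where K = 1])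
 show "norm (mc \<omega> a e e') \<le> norm a * 1" for a using dist_mc[of \<omega> a e e' 0] by simp
 show "mc \<omega> (r *\<^sub>R a) e e' = r *\<^sub>R mc \<omega> a e e'" for r a
  using mc_scale[of \<omega> "complex_of_real r" a] by (simp add: scaleC_of_real scaleR_conv_of_real)
qed (rule mc_add)

lemma mc_in: "f \<in> Cc ==> (%t. mc \<omega> (f t) e e') \<in> Cc"
 by (rule cs_bounded_linear[OF _ bounded_linear_mc])

text \<open>The integrated form of the covariant representation: \<open>f\<close> acts as the
  integral of \<open>f t\<close> times the diagonal unitary at \<open>t\<close>, and the latter
  multiplies column \<open>e'\<close> by \<open>pairing t (deg e')\<close>.\<close>

definition cm :: "('g => 'a) => 'g idx => 'g idx => complex" where
 "cm f e e' = fourier (%t. mc \<omega> (f t) e e') (deg e')"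

lemma cm_add: "f \<in> Cc ==> g \<in> Cc ==>
  cm (%t. f t + g t) = (%e e'. cm f e e' + cm g e e')"
 by (simp add: cm_def fun_eq_iff mc_add fourier_add mc_in)

lemma cm_scale: "cm (%t. c *\<^sub>C f t) = (%e e'. c * cm f e e')"
 by (simp add: cm_def fun_eq_iff mc_scale fourier_scale)

lemma cm_diff:
 assumes "f \<in> Cc" "g \<in> Cc"
 shows "cm (%t. f t - g t) e e' = cm f e e' - cm g e e'"
 using fun_cong[OF fun_cong[OF cm_add[OF cs_diff[OF assms] assms(2)]], of e e'] by simp

text \<open>The involution carries a twist by \<open>deg e - deg e'\<close>, which moves the point
  of evaluation from the column degree to the row degree.\<close>

lemma cm_tadj:
 assumes f: "f \<in> Cc"
 shows "cm (tadj f) = adjm (cm f)"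
proof (intro ext)
 fix e e' :: "'g idx"
 have "(%t. mc \<omega> (tadj f t) e e') = twist (deg e - deg e') (cadj (%t. mc \<omega> (f t) e' e))"
  by (simp add: fun_eq_iff twisted_adj_def mc_\<alpha> mc_star twist_def cadj_def)
 then show "cm (tadj f) e e' = adjm (cm f) e e'"
  by (simp add: cm_def adjm_def fourier_twist fourier_cadj[OF mc_in[OF f]])
qed

lemma mbd_cm:
 assumes f: "f \<in> Cc"
 shows "mbd (cm f) (L1 f)"
 unfolding mbd_def
proof (intro conjI allI impI L1_nonneg)
 fix A \<xi> \<eta> assume A: "finite (A :: 'g idx set)"
 define G where "G t = (\<Sum>e\<in>A. \<Sum>e'\<in>A. cnj (\<eta> e) * (pairing t (deg e') * mc \<omega> (f t) e e') * \<xi> e')" for t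
 have "(sesq A (cm f) \<xi> \<eta>) = (\<integral>t. G t \<partial>\<mu>)"
  unfolding G_def cm_def fourier_def
  by (simp add: Bochner_Integration.integral_sum integrable_pairing mc_in f)
 also have "cmod \<dots> \<le> (\<integral>t. norm (f t) * (l2 \<xi> A * l2 \<eta> A) \<partial>\<mu>)"
 proof (rule order_trans[OF integral_norm_bound integral_mono])
  show "integrable \<mu> (%t. cmod (G t))"
   unfolding G_def by (intro integrable_norm Bochner_Integration.integrable_sum integrable_mult_left integrable_mult_right integrable_pairing mc_in f)
  show "integrable \<mu> (%t. norm (f t) * (l2 \<xi> A * l2 \<eta> A))"
   by (intro integrable_mult_left integrable_norm integrable_cs f)
  fix t
  have "l2 (%e'. pairing t (deg e') * \<xi> e') A = l2 \<xi> A" by (simp add: l2_def norm_mult)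
  then show "cmod (G t) \<le> norm (f t) * (l2 \<xi> A * l2 \<eta> A)"
   using mbd_form[OF mbd_mc A A, of \<eta> \<omega> "f t" "%e'. pairing t (deg e') * \<xi> e'"]
   unfolding G_def by (simp add: mult_ac)
 qed
 finally show "cmod (sesq A (cm f) \<xi> \<eta>) \<le> L1 f * l2 \<xi> A * l2 \<eta> A"
  by (simp add: L1_def mult.assoc)
qed

text \<open>Finite sums of elementary tensors of functions with \<open>S_u S_v^*\<close>. Their
  matrices have finite columns, which makes matrix products available.\<close>

inductive_set V0 :: "('g => 'a) set" where
 zero: "(%t. 0) \<in> V0"
| add: "\<phi> \<in> Cc ==> u \<in> Wn n ==> v \<in> Wn n ==> g \<in> V0 ==>
  (%t. tens \<phi> (Sw u * star (Sw v)) t + g t) \<in> V0"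

lemma V0_in: "f \<in> V0 ==> f \<in> Cc"
 by (induction rule: V0.induct) (auto intro!: cs_add tens_in csI[of _ "{}"])

lemma V0_add: "f \<in> V0 ==> g \<in> V0 ==> (%t. f t + g t) \<in> V0"
 by (induction rule: V0.induct) (simp_all add: add.assoc V0.add)

lemma tens_in_V0: "\<phi> \<in> Cc ==> a \<in> addspan gens ==> tens \<phi> a \<in> V0"
 if "\<phi> \<in> Cc" for \<phi>
proof -
 assume "a \<in> addspan gens"
 then show ?thesis
 proof induction
  case zero then show ?case using V0.zero by (simp add: tens_def[abs_def])
 next
  case (add b x)
  then obtain c u v where b: "b = c *\<^sub>C (Sw u * star (Sw v))" "u \<in> Wn n" "v \<in> Wn n"
   unfolding gens_def by blast
  have c: "(%t. c * \<phi> t) \<in> Cc" by (rule cs_cmult[OF that]) simp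
  have "tens \<phi> (b + x) = (%t. tens (%t. c * \<phi> t) (Sw u * star (Sw v)) t + tens \<phi> x t)"
   by (simp add: fun_eq_iff tens_def b scaleC_add_right scaleC_scaleC mult.commute)
  then show ?case using V0.add[OF c b(2,3) add.IH] by simp
 qed
qed

lemma V0_dense:
 assumes f: "f \<in> Cc" and e: "0 < e"
 obtains g where "g \<in> V0" "L1 (%t. f t - g t) \<le> e"
proof -
 obtain K where K: "continuous_on UNIV f" "compact K" "\<And>t. t \<notin> K ==> f t = 0"
  using f by (rule csE) (rule that)
 obtain U K1 where U: "open U" "compact K1" "K \<subseteq> U" "U \<subseteq> K1"
  using K(2) by (rule compact_nbhd_set) (rule that)
 \<comment> \<open>Two errors of size \<open>d\<close>, one from the partition and one from
   approximating the values, on a set of measure below \<open>measure \<mu> K1 + 1\<close>.\<close>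
 define d where "d = e / (2 * (measure \<mu> K1 + 1))"
 have m: "0 \<le> measure \<mu> K1" by simp
 have d: "0 < d" unfolding d_def using e m by (intro divide_pos_pos mult_pos_pos add_nonneg_pos) simp_all
 have "\<exists>U. open U \<and> s0 \<in> U \<and> (\<forall>s\<in>U. \<forall>x::unit. norm (f s - f s0) \<le> d)" for s0
 proof -
  have "open (f -` ball (f s0) d)" using open_vimage[OF open_ball K(1)] .
  then show ?thesis
   using d by (intro exI[of _ "f -` ball (f s0) d"]) (auto simp: dist_norm norm_minus_commute less_imp_le)
 qed
 note ex = this
 obtain J \<phi> where J: "finite J" "J \<subseteq> K" "\<And>j. j \<in> J ==> continuous_on UNIV (\<phi> j)"
  "\<And>j s. j \<in> J ==> 0 \<le> (\<phi> j s :: real)" "\<And>j s. j \<in> J ==> s \<notin> K1 ==> \<phi> j s = 0" "\<And>s. (\<Sum>j\<in>J. \<phi> j s) \<le> 1"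
  "\<And>s x. norm (f s - (\<Sum>j\<in>J. \<phi> j s *\<^sub>R f j)) \<le> d"
  by (rule partition_approx[OF K(2) U(1,3,4) less_imp_le[OF d], of "%s (x::unit). f s", OF K(3) ex]) (assumption | rule that)+
 have "\<forall>j. \<exists>a. a \<in> addspan gens \<and> norm (f j - a) \<le> d"
 proof
  fix j
  have "f j \<in> closure (addspan gens)" using gens_dense by simp
  then obtain a where "a \<in> addspan gens" "dist a (f j) < d" using d unfolding closure_approachable by blast
  then show "\<exists>a. a \<in> addspan gens \<and> norm (f j - a) \<le> d"
   by (intro exI[of _ a]) (simp add: dist_norm norm_minus_commute)
 qed
 from choice[OF this] obtain a where a: "\<And>j. a j \<in> addspan gens" "\<And>j. norm (f j - a j) \<le> d" by blast
 define g where "g t = (\<Sum>j\<in>J. tens (%t. complex_of_real (\<phi> j t)) (a j) t)" for t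
 have \<phi>_in: "(%t. complex_of_real (\<phi> j t)) \<in> Cc" if "j \<in> J" for j
  by (rule csI[OF _ U(2)]) (auto intro!: continuous_intros J that simp: J(5)[OF that])
 have gV: "g \<in> V0" unfolding g_def using J(1) \<phi>_in
 proof (induction J)
  case empty then show ?case by (simp add: V0.zero)
 next
  case (insert j J)
  then show ?case by (simp add: V0_add tens_in_V0 a(1))
 qed
 have close: "norm (f t - g t) \<le> 2 * d" for t
 proof -
  have eq: "f t - g t = (f t - (\<Sum>j\<in>J. \<phi> j t *\<^sub>R f j)) + (\<Sum>j\<in>J. \<phi> j t *\<^sub>R (f j - a j))"
   by (simp add: g_def tens_def scaleC_of_real scaleR_diff_right sum_subtractf)
  have "norm (\<Sum>j\<in>J. \<phi> j t *\<^sub>R (f j - a j)) \<le> d"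
  proof -
   have "norm (\<Sum>j\<in>J. \<phi> j t *\<^sub>R (f j - a j)) \<le> (\<Sum>j\<in>J. \<phi> j t * d)"
    by (rule order_trans[OF norm_sum sum_mono]) (simp add: J(4) a(2) mult_left_mono)
   also have "\<dots> \<le> 1 * d" unfolding sum_distrib_right[symmetric] using J(6) d by (intro mult_right_mono) simp_all
   finally show ?thesis by simp
  qed
  from norm_triangle_mono[OF J(7)[of t] this] show ?thesis unfolding eq by simp
 qed
 have "L1 (%t. f t - g t) \<le> 2 * d * measure \<mu> K1"
  unfolding L1_def
 proof (rule integral_norm_le[OF _ U(2) _ close])
  show "continuous_on UNIV (%t. f t - g t)"
   by (rule cs_continuous[OF cs_diff[OF f V0_in[OF gV]]])
  show "f t - g t = 0" if "t \<notin> K1" for t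
   using that K(3) U(3,4) J(5) by (auto simp: g_def tens_def subset_iff intro!: sum.neutral)
 qed
 also have "\<dots> \<le> 2 * d * (measure \<mu> K1 + 1)" using d by (intro mult_left_mono) simp_all
 also have "\<dots> = e" using m by (simp add: d_def field_simps add_nonneg_eq_0_iff)
 finally show ?thesis using gV that by blast
qed

end

context crossed
begin

definition hom_deg :: "'a => 'g character => bool" where
 "hom_deg b \<theta> \<longleftrightarrow> (\<forall>t. \<alpha> t b = pairing t \<theta> *\<^sub>C b)"

lemma hom_deg_Sw: "u \<in> Wn n ==> v \<in> Wn n ==>
  hom_deg (Sw u * star (Sw v)) (wt \<omega> u - wt \<omega> v)"
 by (simp add: hom_deg_def \<alpha>_hom \<alpha>_Sw star_scaleC mult_scaleC_left mult_scaleC_right scaleC_scaleC pairing_diff_right mult.commute)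

lemma hom_deg_one: "hom_deg 1 0"
 by (simp add: hom_deg_def)

lemma tc_tens:
 assumes "hom_deg b \<theta>"
 shows "tc f (tens \<phi> b) t = (\<integral>s. (pairing s \<theta> * \<phi> (t - s)) *\<^sub>C (f s * b) \<partial>\<mu>)"
 using assms by (simp add: twisted_conv_def tens_def hom_deg_def \<alpha>_hom mult_scaleC_right scaleC_scaleC mult.commute)

text \<open>\<open>\<alpha> s b\<close> is a multiple of \<open>b\<close>, so the degree of the
  right factor twists the function of the left one.\<close>

lemma tc_tens_tens:
 assumes b: "hom_deg b \<theta>" and f: "f \<in> Cc" and g: "g \<in> Cc"
 shows "tc (tens f a) (tens g b) = tens (conv (twist \<theta> f) g) (a * b)"
proof
 fix t
 have int: "integrable \<mu> (%s. twist \<theta> f s * g (t - s))"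
 proof -
  obtain K M where "continuous_on UNIV (%p. twist \<theta> f (fst p) * g (snd p - fst p))" "compact K"
   "\<And>s t. s \<notin> K ==> twist \<theta> f s * g (t - s) = 0"
   by (rule conv_integrand[OF twist_in[OF f] g]) (rule that)
  then show ?thesis using integrable_bounded[OF continuous_on_section(2), of "%p. twist \<theta> f (fst p) * g (snd p - fst p)" K t] by simp
 qed
 have "tc (tens f a) (tens g b) t = (\<integral>s. (twist \<theta> f s * g (t - s)) *\<^sub>C (a * b) \<partial>\<mu>)"
  unfolding tc_tens[OF b] by (simp add: tens_def twist_def mult_scaleC_left scaleC_scaleC mult_ac)
 also have "\<dots> = tens (conv (twist \<theta> f) g) (a * b) t"
  unfolding tens_def conv_def
  by (rule integral_bounded_linear[OF bounded_bilinear.bounded_linear_left[OF bounded_bilinear_scaleC] int])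
 finally show "tc (tens f a) (tens g b) t = tens (conv (twist \<theta> f) g) (a * b) t" .
qed

lemma tadj_tens:
 assumes "hom_deg a \<theta>"
 shows "tadj (tens f a) = tens (twist (- \<theta>) (cadj f)) (star a)"
 using assms
 by (simp add: fun_eq_iff twisted_adj_def tens_def twist_def cadj_def hom_deg_def star_scaleC \<alpha>_hom scaleC_scaleC pairing_minus_right mult.commute)

text \<open>For an elementary right factor each column of the product depends on a single column of
  \<open>f\<close>, so multiplicativity involves no infinite sum and \<open>f\<close> may be
  arbitrary.\<close>

lemma cm_tc_tens:
 assumes f: "f \<in> Cc" and \<phi>: "\<phi> \<in> Cc"
  and u: "u \<in> Wn n" and v: "v \<in> Wn n"
 shows "cm (tc f (tens \<phi> (Sw u * star (Sw v)))) e (act \<omega> v d) = cm f e (act \<omega> u d) * fourier \<phi> (deg d + wt \<omega> v)"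
  and "(\<And>d. e' \<noteq> act \<omega> v d) ==> cm (tc f (tens \<phi> (Sw u * star (Sw v)))) e e' = 0"
proof -
 define \<theta> where "\<theta> = wt \<omega> u - wt \<omega> v"
 let ?b = "Sw u * star (Sw v)"
 have \<theta>: "hom_deg ?b \<theta>" unfolding \<theta>_def by (rule hom_deg_Sw[OF u v])
 have eq: "mc \<omega> (tc f (tens \<phi> ?b) t) e e' = (\<integral>s. pairing s \<theta> * \<phi> (t - s) * mc \<omega> (f s * ?b) e e' \<partial>\<mu>)" for t e e'
 proof -
  have "integrable \<mu> (%s. (pairing s \<theta> * \<phi> (t - s)) *\<^sub>C (f s * ?b))"
   using tc_integrable[OF f tens_in[OF \<phi>, of ?b], of t] \<theta>
   by (simp add: tens_def hom_deg_def \<alpha>_hom mult_scaleC_right scaleC_scaleC mult.commute)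
  from integral_bounded_linear[OF bounded_linear_mc this, of e e'] show ?thesis
   unfolding tc_tens[OF \<theta>] by (simp add: mc_scale)
 qed
 have "(%t. mc \<omega> (tc f (tens \<phi> ?b) t) e (act \<omega> v d)) = conv (twist \<theta> (%t. mc \<omega> (f t) e (act \<omega> u d))) \<phi>"
  unfolding eq mult.assoc[symmetric] mc_mult_star_Sw[OF v] mc_mult_Sw[OF u]
  by (simp add: fun_eq_iff conv_def twist_def mult_ac)
 then show "cm (tc f (tens \<phi> ?b)) e (act \<omega> v d) = cm f e (act \<omega> u d) * fourier \<phi> (deg d + wt \<omega> v)"
  by (simp add: cm_def fourier_conv[OF twist_in[OF mc_in[OF f]] \<phi>] fourier_twist \<theta>_def)
 assume "\<And>d. e' \<noteq> act \<omega> v d"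
 then have "mc \<omega> (tc f (tens \<phi> ?b) t) e e' = 0" for t
  unfolding eq mult.assoc[symmetric] by (simp add: mc_mult_star_Sw_zero[OF v])
 then show "cm (tc f (tens \<phi> ?b)) e e' = 0" by (simp add: cm_def fourier_def)
qed

lemma cm_tens:
 assumes u: "u \<in> Wn n" and v: "v \<in> Wn n"
 shows "cm (tens \<phi> (Sw u * star (Sw v))) e (act \<omega> v d) =
   (if d \<in> idx n \<and> e = act \<omega> u d then fourier \<phi> (deg d + wt \<omega> v) else 0)"
  and "(\<And>d. e' \<noteq> act \<omega> v d) ==> cm (tens \<phi> (Sw u * star (Sw v))) e e' = 0"
proof -
 have "mc \<omega> (Sw u) e d = (if d \<in> idx n \<and> e = act \<omega> u d then 1 else 0)"
  using mc_mult_Sw[OF u, of \<omega> 1 e d] act_in_idx[OF u, of \<omega> d] by (auto simp: mc_one)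
 then show "cm (tens \<phi> (Sw u * star (Sw v))) e (act \<omega> v d) =
   (if d \<in> idx n \<and> e = act \<omega> u d then fourier \<phi> (deg d + wt \<omega> v) else 0)"
  by (simp add: cm_def tens_def mc_scale mc_mult_star_Sw[OF v] fourier_def)
qed (simp add: cm_def tens_def mc_scale mc_mult_star_Sw_zero[OF v] fourier_def)

lemma mm_add_right:
 assumes "col_finite N" "col_finite N'"
 shows "mm M (%e e'. N e e' + N' e e') = (%e e'. mm M N e e' + mm M N' e e')"
proof (intro ext)
 fix e e'
 have fin: "finite ({e''. N e'' e' \<noteq> 0} \<union> {e''. N' e'' e' \<noteq> 0})"
  using assms unfolding col_finite_def by blast
 show "mm M (%e e'. N e e' + N' e e') e e' = mm M N e e' + mm M N' e e'"
  by (subst (1 2 3) mm_superset[OF fin]) (auto simp: distrib_left sum.distrib)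
qed

lemma col_finite_add:
 assumes "col_finite N" "col_finite N'"
 shows "col_finite (%e e'. N e e' + N' e e')"
 unfolding col_finite_def
proof
 fix e'
 show "finite {e. N e e' + N' e e' \<noteq> 0}"
  by (rule finite_subset[of _ "{e. N e e' \<noteq> 0} \<union> {e. N' e e' \<noteq> 0}"])
   (use assms in \<open>auto simp: col_finite_def\<close>)
qed

lemma cm_tc_tens_mm:
 assumes f: "f \<in> Cc" and \<phi>: "\<phi> \<in> Cc"
  and u: "u \<in> Wn n" and v: "v \<in> Wn n"
 shows "col_finite (cm (tens \<phi> (Sw u * star (Sw v))))"
  "cm (tc f (tens \<phi> (Sw u * star (Sw v)))) = mm (cm f) (cm (tens \<phi> (Sw u * star (Sw v))))"
proof -
 let ?b = "Sw u * star (Sw v)"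
 have *: "\<exists>a. \<forall>e. (cm (tens \<phi> ?b) e e' \<noteq> 0 --> e = a) \<and> cm (tc f (tens \<phi> ?b)) e e' = cm f e a * cm (tens \<phi> ?b) a e'" for e'
 proof (cases "\<exists>d. e' = act \<omega> v d")
  case True
  then obtain d where d: "e' = act \<omega> v d" by blast
  have "cm f e (act \<omega> u d) = 0" if "d \<notin> idx n" for e
   unfolding cm_def fourier_def by (simp add: mc_outside that act_in_idx[OF u])
  then show ?thesis unfolding d cm_tens(1)[OF u v] cm_tc_tens(1)[OF f \<phi> u v]
   by (intro exI[of _ "act \<omega> u d"]) auto
 next
  case False
  then have "e' \<noteq> act \<omega> v d" for d by blast
  then show ?thesis
   by (intro exI[of _ e'] allI) (simp only: cm_tens(2)[OF u v] cm_tc_tens(2)[OF f \<phi> u v] mult_zero_right simp_thms)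
 qed
 show "col_finite (cm (tens \<phi> ?b))" unfolding col_finite_def
 proof
  fix e'
  obtain a where "\<And>e. cm (tens \<phi> ?b) e e' \<noteq> 0 ==> e = a" using *[of e'] by blast
  then have "{e. cm (tens \<phi> ?b) e e' \<noteq> 0} \<subseteq> {a}" by blast
  then show "finite {e. cm (tens \<phi> ?b) e e' \<noteq> 0}" by (rule finite_subset) simp
 qed
 show "cm (tc f (tens \<phi> ?b)) = mm (cm f) (cm (tens \<phi> ?b))"
 proof (intro ext)
  fix e e'
  obtain a where a: "\<And>e. cm (tens \<phi> ?b) e e' \<noteq> 0 ==> e = a"
   "\<And>e. cm (tc f (tens \<phi> ?b)) e e' = cm f e a * cm (tens \<phi> ?b) a e'" using *[of e'] by blast
  have "mm (cm f) (cm (tens \<phi> ?b)) e e' = (\<Sum>e''\<in>{a}. cm f e e'' * cm (tens \<phi> ?b) e'' e')"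
   by (rule mm_superset) (use a(1) in auto)
  then show "cm (tc f (tens \<phi> ?b)) e e' = mm (cm f) (cm (tens \<phi> ?b)) e e'" by (simp add: a(2))
 qed
qed

lemma tc_add_right:
 assumes f: "f \<in> Cc" and g: "g \<in> Cc" and h: "h \<in> Cc"
 shows "tc f (%t. g t + h t) = (%t. tc f g t + tc f h t)"
 using Bochner_Integration.integral_add[OF tc_integrable[OF f g] tc_integrable[OF f h]]
 by (simp add: fun_eq_iff twisted_conv_def \<alpha>_hom(1) distrib_left)

lemma cm_V0:
 assumes f: "f \<in> Cc" and g: "g \<in> V0"
 shows "col_finite (cm g) \<and> cm (tc f g) = mm (cm f) (cm g)"
 using g
proof induction
 case zero
 have cm: "cm (%t. 0) = (%e e'. 0)" by (intro ext) (simp add: cm_def fourier_def)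
 have "tc f (%t. 0) = (%t. 0)" by (simp add: twisted_conv_def)
 moreover have "mm (cm f) (%e e'. 0) = (%e e'. 0)" by (intro ext) (simp add: mm_def)
 ultimately show ?case by (simp only: cm) (simp add: col_finite_def)
next
 case (add \<phi> u v g)
 note uv = tens_in[OF add(1), of "Sw u * star (Sw v)"] and g = V0_in[OF add(4)] and mm = cm_tc_tens_mm[OF f add(1-3)]
 show ?case
  unfolding tc_add_right[OF f uv g] cm_add[OF uv g] cm_add[OF tc_in[OF f uv] tc_in[OF f g]]
  using add.IH mm by (simp add: mm_add_right col_finite_add)
qed

section \<open>The C*-seminorm of the matrix representation\<close>

definition cn :: "('g => 'a) => real" where
 "cn f = opn (cm f)"

lemma cn_nonneg: "f \<in> Cc ==> 0 \<le> cn f"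
 unfolding cn_def by (rule opn_nonneg[OF mbd_cm])

lemma cn_le: "f \<in> Cc ==> cn f \<le> L1 f"
 unfolding cn_def by (rule opn_le[OF mbd_cm])

lemma cn_add: "f \<in> Cc ==> g \<in> Cc ==> cn (%t. f t + g t) \<le> cn f + cn g"
 unfolding cn_def cm_add by (rule opn_add[OF mbd_cm mbd_cm])

lemma cn_tadj:
 assumes f: "f \<in> Cc"
 shows "cn (tadj f) = cn f"
proof -
 have "cn (tadj g) \<le> cn g" if "g \<in> Cc" for g
  unfolding cn_def cm_tadj[OF that] by (rule opn_le[OF mbd_adjm[OF mbd_opn[OF mbd_cm[OF that]]]])
 from this[OF f] this[OF tadj_in[OF f]] show ?thesis
  by (simp add: cn_def cm_tadj[OF tadj_in[OF f]] cm_tadj[OF f] adjm_def[abs_def])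
qed

text \<open>The matrix of a general \<open>g\<close> may have infinite columns, so \<open>g\<close>
  is replaced by some \<open>h\<close> in \<open>V0\<close> and the \<open>L^1\<close> norm controls
  the error.\<close>

lemma cn_tc:
 assumes f: "f \<in> Cc" and g: "g \<in> Cc"
 shows "cn (tc f g) \<le> cn f * cn g"
proof (rule field_le_epsilon)
 fix e :: real assume e: "0 < e"
 define d where "d = e / (cn f + L1 f + 1)"
 have pos: "0 < cn f + L1 f + 1" using cn_nonneg[OF f] L1_nonneg[of f] by linarith
 obtain h where h: "h \<in> V0" "L1 (%t. g t - h t) \<le> d"
  using e pos by (auto simp: d_def intro: V0_dense[OF g, of d])
 note hc = V0_in[OF h(1)]
 note dc = cs_diff[OF g hc]
 have "cn (tc f h) \<le> cn f * cn h"
  using cm_V0[OF f h(1)] unfolding cn_def by (simp add: opn_mm[OF mbd_cm[OF f] mbd_cm[OF hc]])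
 moreover have "cn h \<le> cn g + d"
 proof -
  have "(%t. g t + (h t - g t)) = h" by simp
  moreover have "L1 (%t. h t - g t) \<le> d" using h(2) by (simp add: L1_def norm_minus_commute)
  ultimately show ?thesis
   using cn_add[OF g cs_diff[OF hc g]] cn_le[OF cs_diff[OF hc g]] by simp
 qed
 moreover have "cn (tc f g) \<le> cn (tc f h) + L1 f * d"
 proof -
  have "tc f g = (%t. tc f h t + tc f (%t. g t - h t) t)"
   using tc_add_right[OF f hc dc] by simp
  then have "cn (tc f g) \<le> cn (tc f h) + cn (tc f (%t. g t - h t))"
   using cn_add[OF tc_in[OF f hc] tc_in[OF f dc]] by simp
  moreover have "cn (tc f (%t. g t - h t)) \<le> L1 f * d"
   using cn_le[OF tc_in[OF f dc]] L1_tc[OF f dc] mult_left_mono[OF h(2) L1_nonneg[of f]] by linarith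
  ultimately show ?thesis by simp
 qed
 ultimately have "cn (tc f g) \<le> cn f * (cn g + d) + L1 f * d"
  using mult_left_mono[of "cn h" "cn g + d", OF _ cn_nonneg[OF f]] by linarith
 also have "\<dots> = cn f * cn g + (cn f + L1 f) * d" by (simp add: algebra_simps)
 also have "(cn f + L1 f) * d \<le> (cn f + L1 f + 1) * d" using e pos unfolding d_def by (intro mult_right_mono) simp_all
 also have "\<dots> = e" using pos by (simp add: d_def)
 finally show "cn (tc f g) \<le> cn f * cn g + e" by simp
qed

lemma cn_cstar:
 assumes f: "f \<in> Cc"
 shows "cn (tc (tadj f) f) = (cn f)\<^sup>2"
proof (rule antisym)
 show "cn (tc (tadj f) f) \<le> (cn f)\<^sup>2"
  using cn_tc[OF tadj_in[OF f] f] cn_tadj[OF f] by (simp add: power2_eq_square)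
 show "(cn f)\<^sup>2 \<le> cn (tc (tadj f) f)"
 proof (rule field_le_epsilon)
  fix e :: real assume e: "0 < e"
  \<comment> \<open>\<open>4 * cn f + 4\<close> adds the errors \<open>2 * cn f + 1\<close> of the
    product and \<open>2 * cn f + 3\<close> of the square; \<open>d \<le> 1\<close> tames the terms
    quadratic in \<open>d\<close>.\<close>
  define d where "d = min 1 (e / (4 * cn f + 4))"
  have pf: "0 \<le> cn f" by (rule cn_nonneg[OF f])
  have "d \<le> e / (4 * cn f + 4)" by (simp add: d_def)
  then have "d * (4 * cn f + 4) \<le> e" using pf by (simp add: pos_le_divide_eq)
  moreover have "0 < d" "d \<le> 1" using e pf by (simp_all add: d_def)
  ultimately have d: "0 < d" "d \<le> 1" "d * (4 * cn f + 4) \<le> e" by blast+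
  obtain h where h: "h \<in> V0" "L1 (%t. f t - h t) \<le> d" by (rule V0_dense[OF f d(1)])
  note hc = V0_in[OF h(1)]
  note dc = cs_diff[OF f hc]
  define r where "r = (%t. f t - h t)"
  define r' where "r' = (%t. h t - f t)"
  have r: "r \<in> Cc" "cn r \<le> d" using dc h(2) cn_le[OF dc] unfolding r_def by auto
  have r': "r' \<in> Cc" "cn r' \<le> d"
   using h(2) cn_le[OF cs_diff[OF hc f]] cs_diff[OF hc f]
   unfolding r'_def by (auto simp: L1_def norm_minus_commute)
  have hf: "h = (%t. f t + r' t)" "(%t. h t + r t) = f" by (simp_all add: r_def r'_def)
  have ph: "cn h \<le> cn f + d" "cn f \<le> cn h + d"
   using cn_add[OF f r'(1)] cn_add[OF hc r(1)] r(2) r'(2) unfolding hf(2) hf(1)[symmetric] by simp_all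
  have th: "cm (tadj h) = adjm (cm h)" by (rule cm_tadj[OF hc])
  have star_eq: "cn (tc (tadj h) h) = (cn h)\<^sup>2"
   using cm_V0[OF tadj_in[OF hc] h(1)] unfolding cn_def th by (simp add: opn_cstar[OF mbd_cm[OF hc]])
  have tadj_h: "tadj h = (%t. tadj f t + tadj r' t)"
   by (simp add: fun_eq_iff twisted_adj_def r'_def star_diff \<alpha>_diff)
  have left: "tc (tadj h) h = (%t. tc (tadj f) h t + tc (tadj r') h t)"
   unfolding tadj_h twisted_conv_def
   using Bochner_Integration.integral_add[OF tc_integrable[OF tadj_in[OF f] hc] tc_integrable[OF tadj_in[OF r'(1)] hc]]
   by (simp add: fun_eq_iff distrib_right)
  have "cn (tc (tadj h) h) \<le> cn (tc (tadj f) h) + cn r' * cn h"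
   unfolding left
   using cn_add[OF tc_in[OF tadj_in[OF f] hc] tc_in[OF tadj_in[OF r'(1)] hc]] cn_tc[OF tadj_in[OF r'(1)] hc] cn_tadj[OF r'(1)]
   by simp
  moreover have "cn (tc (tadj f) h) \<le> cn (tc (tadj f) f) + cn f * cn r'"
   unfolding hf(1) tc_add_right[OF tadj_in[OF f] f r'(1)]
   using cn_add[OF tc_in[OF tadj_in[OF f] f] tc_in[OF tadj_in[OF f] r'(1)]] cn_tc[OF tadj_in[OF f] r'(1)] cn_tadj[OF f]
   by simp
  moreover have "cn r' * cn h \<le> d * (cn f + 1)" "cn f * cn r' \<le> cn f * d"
   using r'(2) ph d pf cn_nonneg[OF hc] cn_nonneg[OF r'(1)] by (intro mult_mono; simp)+
  ultimately have 1: "(cn h)\<^sup>2 \<le> cn (tc (tadj f) f) + d * (2 * cn f + 1)"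
   unfolding star_eq by (simp add: algebra_simps)
  have "(cn f)\<^sup>2 \<le> (cn h + d)\<^sup>2" using ph pf by (intro power_mono)
  also have "\<dots> = (cn h)\<^sup>2 + d * (2 * cn h + d)" by (simp add: power2_eq_square algebra_simps)
  also have "d * (2 * cn h + d) \<le> d * (2 * cn f + 3)" using d ph by (intro mult_left_mono) linarith+
  finally have "(cn f)\<^sup>2 \<le> cn (tc (tadj f) f) + d * (4 * cn f + 4)" using 1 by (simp add: algebra_simps)
  then show "(cn f)\<^sup>2 \<le> cn (tc (tadj f) f) + e" using d(3) by linarith
 qed
qed

lemma cn_le_norm: "f \<in> Cc ==> cn f \<le> norm (\<iota> f)"
proof (rule \<iota>_universal[OF _ cn_le])
 have scale: "cn (%x. c *\<^sub>C f x) = cmod c * cn f" if "f \<in> Cc" for c f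
  unfolding cn_def cm_scale by (rule opn_scale[OF mbd_cm[OF that]])
 show "cstar_seminorm_on Cc tc tadj cn"
  unfolding cstar_seminorm_on_def by (simp add: cn_nonneg cn_add cn_tc cn_cstar scale)
qed

section \<open>Coefficients of elements of the crossed product\<close>

definition rc_spec :: "'g idx => 'g idx => ('c => complex) => bool" where
 "rc_spec e e' R \<longleftrightarrow> (\<forall>f\<in>Cc. R (\<iota> f) = cm f e e') \<and> (\<forall>x y. dist (R x) (R y) \<le> dist x y)"

definition rc :: "'c => 'g idx => 'g idx => complex" where
 "rc x e e' = (SOME R. rc_spec e e' R) x"

lemma rc_spec_rc: "rc_spec e e' (%x. rc x e e')"
proof -
 have "dist (cm f e e') (cm g e e') \<le> dist (\<iota> f) (\<iota> g)"
  if "f \<in> Cc" "g \<in> Cc" for f g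
  using mbd_entry[OF mbd_opn[OF mbd_cm[OF cs_diff[OF that]]], of e e']
   cn_le_norm[OF cs_diff[OF that]]
  unfolding cn_def cm_diff[OF that] \<iota>_diff[OF that] dist_norm by linarith
 then have "\<exists>R. rc_spec e e' R" unfolding rc_spec_def by (rule extend_contraction[OF \<iota>_dense])
 then have "rc_spec e e' (SOME R. rc_spec e e' R)" by (rule someI_ex)
 then show ?thesis by (simp add: rc_def)
qed

lemma rc_\<iota>: "f \<in> Cc ==> rc (\<iota> f) e e' = cm f e e'"
 and dist_rc: "dist (rc x e e') (rc y e e') \<le> dist x y"
 using rc_spec_rc[of e e'] unfolding rc_spec_def by blast+

lemma continuous_on_rc [continuous_intros]:
 assumes "continuous_on A f"
 shows "continuous_on A (%x. rc (f x) e e')"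
proof -
 have "continuous_on UNIV (%a. rc a e e')"
  by (rule lipschitz_on_continuous_on[OF lipschitz_onI[of _ _ 1]]) (simp_all add: dist_rc)
 then show ?thesis by (rule continuous_on_compose2[OF _ assms]) simp
qed

lemma \<iota>_closed_imp:
 assumes "closed {x. P x}" "\<And>f. f \<in> Cc ==> P (\<iota> f)"
 shows "P x"
 by (rule dense_closed_imp[OF \<iota>_dense assms(1)]) (use assms(2) in blast)

lemma rc_add: "rc (x + y) e e' = rc x e e' + rc y e e'"
proof (rule \<iota>_closed_imp[of "%x. rc (x + y) e e' = rc x e e' + rc y e e'" x])
 fix f :: "'g => 'a" assume f: "f \<in> Cc"
 show "rc (\<iota> f + y) e e' = rc (\<iota> f) e e' + rc y e e'"
 proof (rule \<iota>_closed_imp[of "%y. rc (\<iota> f + y) e e' = rc (\<iota> f) e e' + rc y e e'" y])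
  fix g :: "'g => 'a" assume g: "g \<in> Cc"
  show "rc (\<iota> f + \<iota> g) e e' = rc (\<iota> f) e e' + rc (\<iota> g) e e'"
   unfolding \<iota>_add[OF f g, symmetric] using f g cs_add[OF f g] by (simp add: rc_\<iota> cm_add)
 qed (intro closed_Collect_eq continuous_intros)
qed (intro closed_Collect_eq continuous_intros)

lemma rc_scale: "rc (c *\<^sub>C x) e e' = c * rc x e e'"
proof (rule \<iota>_closed_imp[of "%x. rc (c *\<^sub>C x) e e' = c * rc x e e'" x])
 fix f :: "'g => 'a" assume f: "f \<in> Cc"
 show "rc (c *\<^sub>C \<iota> f) e e' = c * rc (\<iota> f) e e'"
  unfolding \<iota>_scale[OF f, symmetric] using f cs_scale[OF f] by (simp add: rc_\<iota> cm_scale)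
qed (intro closed_Collect_eq continuous_intros)

lemma rc_zero [simp]: "rc 0 e e' = 0"
 using rc_add[of 0 0 e e'] by simp

lemma rc_minus [simp]: "rc (- x) e e' = - rc x e e'"
 using rc_add[of x "- x" e e'] by (simp add: add_eq_0_iff)

lemma rc_diff: "rc (x - y) e e' = rc x e e' - rc y e e'"
 using rc_add[of x "- y" e e'] by simp

lemma rc_sum: "rc (\<Sum>i\<in>T. f i) e e' = (\<Sum>i\<in>T. rc (f i) e e')"
 by (induction T rule: infinite_finite_induct) (simp_all add: rc_add)

lemma rc_star: "rc (star x) e e' = cnj (rc x e' e)"
proof (rule \<iota>_closed_imp[of "%x. rc (star x) e e' = cnj (rc x e' e)" x])
 fix f :: "'g => 'a" assume f: "f \<in> Cc"
 show "rc (star (\<iota> f)) e e' = cnj (rc (\<iota> f) e' e)"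
  unfolding \<iota>_tadj[OF f, symmetric] using f tadj_in[OF f] by (simp add: rc_\<iota> cm_tadj adjm_def)
qed (intro closed_Collect_eq continuous_intros)

lemma mbd_rc: "mbd (rc x) (norm x)"
 unfolding mbd_def
proof (intro conjI allI impI)
 fix A \<xi> \<eta> assume A: "finite (A :: 'g idx set)"
 let ?P = "%x. cmod (sesq A (rc x) \<xi> \<eta>) \<le> norm x * l2 \<xi> A * l2 \<eta> A"
 show "?P x"
 proof (rule \<iota>_closed_imp[of ?P])
  show "closed {x. ?P x}" by (intro closed_Collect_le continuous_intros)
  fix f :: "'g => 'a" assume f: "f \<in> Cc"
  have "mbd (cm f) (norm (\<iota> f))"
   using mbd_mono[OF mbd_opn[OF mbd_cm[OF f]]] cn_le_norm[OF f] by (simp add: cn_def)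
  then show "?P (\<iota> f)" using A unfolding mbd_def rc_\<iota>[OF f] by blast
 qed
qed simp

lemma rc_outside: "e \<notin> idx n \<or> e' \<notin> idx n ==> rc x e e' = 0"
proof (rule \<iota>_closed_imp[of "%x. rc x e e' = 0" x])
 fix f :: "'g => 'a" assume "f \<in> Cc" "e \<notin> idx n \<or> e' \<notin> idx n"
 then show "rc (\<iota> f) e e' = 0" by (simp add: rc_\<iota> cm_def mc_outside fourier_def)
qed (intro closed_Collect_eq continuous_intros)

end

section \<open>Faithfulness of the matrix coefficients\<close>

text \<open>The kept entries form blocks with disjoint rows and disjoint columns, one for each
  common value \<open>v\<close>, so a bound for every block bounds the whole. Applied to levels it
  isolates one gauge degree.\<close>

lemma mbd_block:
 assumes M: "mbd M c"
 shows "mbd (%e e'. if r e = s e' then M e e' else 0) c"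
 unfolding mbd_def
proof (intro conjI allI impI)
 show "0 \<le> c" using M by (rule mbd_nonneg)
 fix A \<xi> \<eta> assume A: "finite (A :: 'a set)"
 define V where "V = r ` A \<union> s ` A"
 define Ar where "Ar v = {e \<in> A. r e = v}" for v
 define As where "As v = {e \<in> A. s e = v}" for v
 have V: "finite V" and fin: "finite (Ar v)" "finite (As v)" for v using A by (simp_all add: V_def Ar_def As_def)
 have "(\<Sum>e\<in>A. \<Sum>e'\<in>A. cnj (\<eta> e) * (if r e = s e' then M e e' else 0) * \<xi> e')
   = (\<Sum>v\<in>V. \<Sum>e\<in>Ar v. \<Sum>e'\<in>A. cnj (\<eta> e) * (if r e = s e' then M e e' else 0) * \<xi> e')"
  using sum.group[OF A V, of r "%e. \<Sum>e'\<in>A. cnj (\<eta> e) * (if r e = s e' then M e e' else 0) * \<xi> e'"]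
  unfolding Ar_def by (simp add: V_def)
 also have "\<dots> = (\<Sum>v\<in>V. \<Sum>e\<in>Ar v. \<Sum>e'\<in>As v. cnj (\<eta> e) * M e e' * \<xi> e')"
 proof (rule sum.cong[OF refl], rule sum.cong[OF refl])
  fix v e assume "e \<in> Ar v"
  then have r: "r e = v" by (simp add: Ar_def)
  show "(\<Sum>e'\<in>A. cnj (\<eta> e) * (if r e = s e' then M e e' else 0) * \<xi> e') = (\<Sum>e'\<in>As v. cnj (\<eta> e) * M e e' * \<xi> e')"
   unfolding As_def r using A by (subst sum.inter_filter) (auto intro!: sum.cong)
 qed
 also have "cmod \<dots> \<le> (\<Sum>v\<in>V. c * l2 \<xi> (As v) * l2 \<eta> (Ar v))"
  by (intro order_trans[OF norm_sum sum_mono] mbd_form[OF M] fin)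
 also have "\<dots> = c * (\<Sum>v\<in>V. \<bar>l2 \<xi> (As v)\<bar> * \<bar>l2 \<eta> (Ar v)\<bar>)" by (simp add: sum_distrib_left mult.assoc)
 also have "\<dots> \<le> c * (L2_set (%v. l2 \<xi> (As v)) V * L2_set (%v. l2 \<eta> (Ar v)) V)"
  by (intro mult_left_mono L2_set_mult_ineq mbd_nonneg[OF M])
 also have "L2_set (%v. l2 \<xi> (As v)) V = l2 \<xi> A"
  unfolding L2_set_def l2_power2[OF fin(2)] unfolding As_def l2_def L2_set_def
  by (subst sum.group) (use A in \<open>auto simp: V_def\<close>)
 also have "L2_set (%v. l2 \<eta> (Ar v)) V = l2 \<eta> A"
  unfolding L2_set_def l2_power2[OF fin(1)] unfolding Ar_def l2_def L2_set_def
  by (subst sum.group) (use A in \<open>auto simp: V_def\<close>)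
 finally show "cmod (\<Sum>e\<in>A. \<Sum>e'\<in>A. cnj (\<eta> e) * (if r e = s e' then M e e' else 0) * \<xi> e') \<le> c * l2 \<xi> A * l2 \<eta> A"
  by (simp add: mult.assoc)
qed

text \<open>A norm and a C*-seminorm that are comparable up to a subexponential factor along the powers of
 \<open>x\<^sup>*x\<close> agree at \<open>x\<close>.\<close>

lemma power_trick:
 fixes a b A :: real
 assumes a: "0 \<le> a" and b: "0 \<le> b" and le: "\<And>m. a ^ (2 ^ Suc m) \<le> A * 2 ^ m * b ^ (2 ^ Suc m)"
 shows "a \<le> b"
proof (rule ccontr)
 assume ab: "\<not> a \<le> b"
 show False
 proof (cases "b = 0")
  case True
  with le[of 0] ab a show False by simp
 next
  case False
  with b have b: "0 < b" by simp
  define q where "q = (a / b)\<^sup>2"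
  have "1 < a / b" using ab b by (simp add: less_divide_eq_1)
  then have q: "1 < q" unfolding q_def by (simp add: one_less_power)
  have qm: "q ^ (2 ^ m) \<le> A * 2 ^ m" for m
   using le[of m] b by (simp add: q_def power_divide divide_le_eq flip: power_mult)
  have "(%k. of_nat k / q ^ k) \<longlonglongrightarrow> 0" by (rule lim_n_over_pown) (use q in simp)
  then have "(%k. A * (of_nat k / q ^ k)) \<longlonglongrightarrow> A * 0" by (intro tendsto_intros)
  then have "eventually (%k. A * (of_nat k / q ^ k) < 1) sequentially"
   by (rule order_tendstoD) simp
  then obtain N where N: "\<And>k. k \<ge> N ==> A * (of_nat k / q ^ k) < 1"
   unfolding eventually_sequentially by blast
  \<comment> \<open>The null sequence is read at the index \<open>2^N\<close>, which is at least
    \<open>N\<close>.\<close>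
  have "A * (of_nat (2 ^ N) / q ^ (2 ^ N)) < 1" by (rule N) (simp add: less_imp_le)
  moreover have "0 < q ^ (2 ^ N)" using q by simp
  ultimately show False using qm[of N] by (simp add: divide_less_eq)
 qed
qed

context crossed
begin

text \<open>In the representation the multiplier by the Fourier transform of \<open>\<phi>\<close>
  acts first, at the degree of the column, and \<open>S_u S_v^*\<close> afterwards.\<close>

definition el :: "nat list => nat list => ('g => complex) => 'c" where
 "el u v \<phi> = \<iota> (tens \<phi> (Sw u * star (Sw v)))"

lemma rc_el:
 assumes "\<phi> \<in> Cc" "u \<in> Wn n" "v \<in> Wn n"
 shows "rc (el u v \<phi>) e (act \<omega> v d) = (if d \<in> idx n \<and> e = act \<omega> u d then fourier \<phi> (deg d + wt \<omega> v) else 0)"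
  and "(\<And>d. e' \<noteq> act \<omega> v d) ==> rc (el u v \<phi>) e e' = 0"
proof -
 show "rc (el u v \<phi>) e (act \<omega> v d) = (if d \<in> idx n \<and> e = act \<omega> u d then fourier \<phi> (deg d + wt \<omega> v) else 0)"
  unfolding el_def rc_\<iota>[OF tens_in[OF assms(1)]] by (rule cm_tens(1)[OF assms(2,3)])
 show "rc (el u v \<phi>) e e' = 0" if "\<And>d. e' \<noteq> act \<omega> v d"
  unfolding el_def rc_\<iota>[OF tens_in[OF assms(1)]] by (rule cm_tens(2)[OF assms(2,3) that])
qed

lemma el_add:
 assumes "\<phi> \<in> Cc" "\<psi> \<in> Cc"
 shows "el u v (%t. \<phi> t + \<psi> t) = el u v \<phi> + el u v \<psi>"
 unfolding el_def \<iota>_add[OF tens_in[OF assms(1)] tens_in[OF assms(2)], symmetric]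
 by (simp add: tens_def[abs_def] scaleC_add_left)

lemma el_scale:
 assumes "\<phi> \<in> Cc"
 shows "el u v (%t. c * \<phi> t) = c *\<^sub>C el u v \<phi>"
 unfolding el_def \<iota>_scale[OF tens_in[OF assms], symmetric] by (simp add: tens_def[abs_def] scaleC_scaleC)

text \<open>\<open>S_u\<close> acts only as a multiplier of the crossed product, so its being an
  isometry is used inside \<open>star (S_u f) * (S_u f) = star f * f\<close>.\<close>

lemma norm_lmult:
 assumes f: "f \<in> Cc" and u: "u \<in> Wn n"
 shows "norm (\<iota> (%t. Sw u * f t)) = norm (\<iota> f)"
proof -
 have F: "(%t. Sw u * f t) \<in> Cc"
  by (rule cs_bounded_linear[OF f bounded_linear_mult_right])
 have "tc (tadj (%t. Sw u * f t)) (%t. Sw u * f t) = tc (tadj f) f"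
  by (simp add: fun_eq_iff twisted_conv_def twisted_adj_def star_mult mult.assoc Sw_cancel[OF u] flip: \<alpha>_hom(3))
 then have "star (\<iota> (%t. Sw u * f t)) * \<iota> (%t. Sw u * f t) = star (\<iota> f) * \<iota> f"
  by (simp flip: \<iota>_tadj[OF f] \<iota>_tadj[OF F] \<iota>_tc[OF tadj_in[OF f] f] \<iota>_tc[OF tadj_in[OF F] F])
 then have "(norm (\<iota> (%t. Sw u * f t)))\<^sup>2 = (norm (\<iota> f))\<^sup>2" by (simp flip: cstar_identity)
 then show ?thesis by (simp add: power2_eq_iff_nonneg)
qed

text \<open>A character of the image of \<open>C_c(G)\<close> attains the norm of the positive
  element built from \<open>\<phi>\<close>, and \<open>functional_is_fourier\<close> recognises it
  as a point of the dual group. This upper bound for the full norm is where the proof of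
  faithfulness starts.\<close>

lemma norm_tens_one:
 assumes \<phi>: "\<phi> \<in> Cc" and c: "\<And>gm. cmod (fourier \<phi> gm) \<le> c"
 shows "norm (\<iota> (tens \<phi> 1)) \<le> c"
proof -
 define j where "j f = \<iota> (tens f 1)" for f
 define D where "D = j ` Cc"
 have c0: "0 \<le> c" using c[of 0] norm_ge_zero order_trans by blast
 have j_add: "j (%t. f t + g t) = j f + j g" if "f \<in> Cc" "g \<in> Cc" for f g
  unfolding j_def \<iota>_add[OF tens_in[OF that(1)] tens_in[OF that(2)], symmetric] by (simp add: tens_def[abs_def] scaleC_add_left)
 have j_scale: "j (%t. z * f t) = z *\<^sub>C j f" if "f \<in> Cc" for f z
  unfolding j_def \<iota>_scale[OF tens_in[OF that], symmetric] by (simp add: tens_def[abs_def] scaleC_scaleC)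
 have j_conv: "j (conv f g) = j f * j g" if "f \<in> Cc" "g \<in> Cc" for f g
  unfolding j_def \<iota>_tc[OF tens_in[OF that(1)] tens_in[OF that(2)], symmetric] tc_tens_tens[OF hom_deg_one that] by simp
 have j_star: "j (cadj f) = star (j f)" if "f \<in> Cc" for f
  unfolding j_def \<iota>_tadj[OF tens_in[OF that], symmetric] tadj_tens[OF hom_deg_one] by simp
 have sc: "(%t. z * f t) \<in> Cc" if "f \<in> Cc" for f :: "'g => complex" and z
  by (rule cs_cmult[OF that]) simp
 have D: "comm_star_subalgebra D"
  unfolding comm_star_subalgebra_def complex_subspace_def
 proof (intro conjI ballI allI)
  show "0 \<in> D" using j_scale[OF \<phi>, of 0] sc[OF \<phi>, of 0] by (auto simp: D_def intro: image_eqI[of _ _ "%t. 0"])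
  fix x assume "x \<in> D"
  then obtain f where f: "x = j f" "f \<in> Cc" unfolding D_def by blast
  show "star x \<in> D" unfolding f(1) j_star[OF f(2), symmetric] D_def by (rule imageI[OF cadj_in[OF f(2)]])
  show "z *\<^sub>C x \<in> D" for z unfolding f(1) j_scale[OF f(2), symmetric] D_def by (rule imageI[OF sc[OF f(2)]])
  fix y assume "y \<in> D"
  then obtain g where g: "y = j g" "g \<in> Cc" unfolding D_def by blast
  show "x + y \<in> D" unfolding f(1) g(1) j_add[OF f(2) g(2), symmetric] D_def
   by (rule imageI[OF cs_add[OF f(2) g(2)]])
  show "x * y \<in> D" unfolding f(1) g(1) j_conv[OF f(2) g(2), symmetric] D_def by (rule imageI[OF conv_in[OF f(2) g(2)]])
  show "x * y = y * x"
   unfolding f(1) g(1) j_conv[OF f(2) g(2), symmetric] j_conv[OF g(2) f(2), symmetric] conv_commute[OF f(2) g(2)] ..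
 qed
 define f0 where "f0 = conv (cadj \<phi>) \<phi>"
 have f0: "f0 \<in> Cc" unfolding f0_def by (rule conv_in[OF cadj_in[OF \<phi>] \<phi>])
 have x0: "j f0 = star (j \<phi>) * j \<phi>" unfolding f0_def j_conv[OF cadj_in[OF \<phi>] \<phi>] j_star[OF \<phi>] ..
 have x0D: "j f0 \<in> D" unfolding D_def by (rule imageI[OF f0])
 have x0s: "star (j f0) = j f0" unfolding x0 by (simp add: star_mult star_star)
 have jD: "j f \<in> D" if "f \<in> Cc" for f unfolding D_def by (rule imageI[OF that])
 obtain \<kappa> :: "'c => complex" where \<kappa>:
  "\<And>x y. x \<in> D ==> y \<in> D ==> \<kappa> (x + y) = \<kappa> x + \<kappa> y"
  "\<And>c x. x \<in> D ==> \<kappa> (c *\<^sub>C x) = c * \<kappa> x"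
  "\<And>x y. x \<in> D ==> y \<in> D ==> \<kappa> (x * y) = \<kappa> x * \<kappa> y"
  "\<And>x. x \<in> D ==> cmod (\<kappa> x) \<le> norm x" "cmod (\<kappa> (j f0)) = norm (j f0)"
  by (rule comm_star_subalgebra_character[OF D x0D x0s]) (rule that)
 have sq: "(norm (j \<phi>))\<^sup>2 = cmod (\<kappa> (j f0))" by (simp only: \<kappa>(5)) (simp only: x0 cstar_identity)
 have "(norm (j \<phi>))\<^sup>2 \<le> c\<^sup>2"
 proof (cases "\<kappa> (j f0) = 0")
  case True then show ?thesis using sq by simp
 next
  case False
  have bd: "cmod (\<kappa> (j f)) \<le> (\<integral>t. cmod (f t) \<partial>\<mu>)" if "f \<in> Cc" for f
   using order_trans[OF \<kappa>(4)[OF jD[OF that]] norm_\<iota>[OF tens_in[OF that], of 1, folded j_def]]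
   by (simp add: L1_def tens_def norm_scaleC)
  obtain gm where gm: "\<And>f. f \<in> Cc ==> \<kappa> (j f) = fourier f gm"
   by (rule functional_is_fourier[of "%f. \<kappa> (j f)", OF _ _ _ bd f0 False])
    (use \<kappa>(1-3)[OF jD] in \<open>auto simp: j_add j_scale j_conv jD\<close>)
  have "cmod (\<kappa> (j f0)) = (cmod (fourier \<phi> gm))\<^sup>2"
   unfolding gm[OF f0] unfolding f0_def fourier_conv[OF cadj_in[OF \<phi>] \<phi>] fourier_cadj[OF \<phi>]
   by (simp add: norm_mult power2_eq_square)
  also have "\<dots> \<le> c\<^sup>2" by (intro power_mono c) simp
  finally show ?thesis using sq by simp
 qed
 then show ?thesis using c0 by (simp add: j_def power2_le_iff_abs_le)
qed

lemma star_el: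
 assumes "\<phi> \<in> Cc" "u \<in> Wn n" "v \<in> Wn n"
 obtains \<theta> where "star (el u v \<phi>) = el v u (twist \<theta> (cadj \<phi>))"
proof (rule that)
 show "star (el u v \<phi>) = el v u (twist (- (wt \<omega> u - wt \<omega> v)) (cadj \<phi>))"
  unfolding el_def \<iota>_tadj[OF tens_in[OF assms(1)], symmetric] tadj_tens[OF hom_deg_Sw[OF assms(2,3)]]
  by (simp add: star_mult star_star)
qed

text \<open>Stripping \<open>S_u\<close> on the left, and \<open>S_v\<close> after taking adjoints,
  leaves the function alone; the twist merely translates its Fourier transform.\<close>

lemma norm_el:
 assumes \<phi>: "\<phi> \<in> Cc" and c: "\<And>gm. cmod (fourier \<phi> gm) \<le> c"
  and u: "u \<in> Wn n" and v: "v \<in> Wn n"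
 shows "norm (el u v \<phi>) \<le> c"
proof -
 have red: "norm (el u v \<psi>) = norm (\<iota> (tens \<psi> (star (Sw v))))" if "\<psi> \<in> Cc" "u \<in> Wn n" for \<psi> u v
  using norm_lmult[OF tens_in[OF that(1)] that(2), of "star (Sw v)"] by (simp add: el_def tens_def[abs_def] mult_scaleC_right)
 obtain \<theta> where \<theta>: "star (el [] v \<phi>) = el v [] (twist \<theta> (cadj \<phi>))"
  by (rule star_el[OF \<phi> _ v, of "[]"]) (simp, rule that)
 have "norm (el u v \<phi>) = norm (el [] v \<phi>)" using red[OF \<phi> u] red[OF \<phi>, of "[]"] by simp
 also have "\<dots> = norm (el v [] (twist \<theta> (cadj \<phi>)))" unfolding \<theta>[symmetric] by simp
 also have "\<dots> = norm (\<iota> (tens (twist \<theta> (cadj \<phi>)) 1))"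
  using red[OF twist_in[OF cadj_in[OF \<phi>], of \<theta>] v, of "[]"] by simp
 also have "\<dots> \<le> c"
  by (rule norm_tens_one[OF twist_in[OF cadj_in[OF \<phi>]]]) (simp add: fourier_twist fourier_cadj[OF \<phi>] c)
 finally show ?thesis .
qed

section \<open>Spans graded by word lengths\<close>

text \<open>\<open>P\<close> restricts the two word lengths. Typical restrictions are both equal to
  \<open>k\<close>, a fixed difference, or a common bound \<open>L\<close>.\<close>

definition els :: "(nat => nat => bool) => 'c set" where
 "els P = addspan {el u v \<phi> | u v \<phi>. u \<in> Wn n \<and> v \<in> Wn n \<and> P (length u) (length v) \<and> \<phi> \<in> Cc}"

lemma el_in_els: "u \<in> Wn n ==> v \<in> Wn n ==> P (length u) (length v) ==> \<phi> \<in> Cc ==> el u v \<phi> \<in> els P"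
 unfolding els_def by (rule addspan_base) blast

lemma els_induct [consumes 1, case_names zero add]:
 assumes "x \<in> els P" "Q 0"
  "\<And>u v \<phi> y. u \<in> Wn n ==> v \<in> Wn n ==> P (length u) (length v) ==> \<phi> \<in> Cc ==>
    y \<in> els P ==> Q y ==> Q (el u v \<phi> + y)"
 shows "Q x"
 using assms(1) unfolding els_def
 by (induction rule: addspan.induct) (use assms(2,3) in \<open>auto simp: els_def\<close>)

lemma els_add: "x \<in> els P ==> y \<in> els P ==> x + y \<in> els P"
 unfolding els_def by (rule addspan_add)

lemma els_zero: "0 \<in> els P"
 unfolding els_def by (rule addspan.zero)

lemma els_subset:
 assumes "\<And>u v \<phi>. u \<in> Wn n ==> v \<in> Wn n ==> P (length u) (length v) ==> \<phi> \<in> Cc ==> el u v \<phi> \<in> els Q"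
  and "x \<in> els P"
 shows "x \<in> els Q"
 using assms(2) by (induction rule: els_induct) (simp_all add: els_zero els_add assms(1))

lemma els_star:
 assumes "x \<in> els P" "\<And>k l. P k l ==> Q l k"
 shows "star x \<in> els Q"
 using assms(1)
proof (induction rule: els_induct)
 case (add u v \<phi> y)
 obtain \<theta> where \<theta>: "star (el u v \<phi>) = el v u (twist \<theta> (cadj \<phi>))"
  by (rule star_el[OF add(4,1,2)]) (rule that)
 have "el v u (twist \<theta> (cadj \<phi>)) \<in> els Q" by (intro el_in_els add assms(2) twist_in cadj_in)
 then show ?case using add(6) by (simp add: star_add \<theta> els_add)
qed (simp add: els_zero)

text \<open>The inner words cancel along the shorter one, and the rest of the longer one is appended
  to the outer word of the other factor; assumptions \<open>1\<close> and \<open>2\<close> are the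
  two cases.\<close>

lemma els_mult:
 assumes x: "x \<in> els P" and y: "y \<in> els Q"
  and 1: "\<And>a b c d. P a b ==> Q c d ==> b \<le> c ==> R (a + (c - b)) d"
  and 2: "\<And>a b c d. P a b ==> Q c d ==> c \<le> b ==> R a (d + (b - c))"
 shows "x * y \<in> els R"
 using x y unfolding els_def
proof (rule addspan_mult[rotated])
 fix b c
 assume "b \<in> {el u v \<phi> | u v \<phi>. u \<in> Wn n \<and> v \<in> Wn n \<and> P (length u) (length v) \<and> \<phi> \<in> Cc}"
  and "c \<in> {el u v \<phi> | u v \<phi>. u \<in> Wn n \<and> v \<in> Wn n \<and> Q (length u) (length v) \<and> \<phi> \<in> Cc}"
 then obtain u v f u' v' g where b: "b = el u v f" "u \<in> Wn n" "v \<in> Wn n" "P (length u) (length v)" "f \<in> Cc"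
  and c: "c = el u' v' g" "u' \<in> Wn n" "v' \<in> Wn n" "Q (length u') (length v')" "g \<in> Cc"
  by blast
 define h where "h = conv (twist (wt \<omega> u' - wt \<omega> v') f) g"
 have h: "h \<in> Cc" unfolding h_def by (intro conv_in twist_in b c)
 have bc: "b * c = \<iota> (tens h (Sw u * (star (Sw v) * Sw u') * star (Sw v')))"
  unfolding b(1) c(1) el_def \<iota>_tc[OF tens_in[OF b(5)] tens_in[OF c(5)], symmetric]
   tc_tens_tens[OF hom_deg_Sw[OF c(2,3)] b(5) c(5)] h_def by (simp add: mult.assoc)
 have "b * c \<in> els R" using Sw_star_mult[OF b(3) c(2)]
 proof (elim disjE bexE conjE)
  fix r assume r: "r \<in> Wn n" "u' = v @ r" "star (Sw v) * Sw u' = Sw r"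
  have "b * c = el (u @ r) v' h" unfolding bc r(3) by (simp add: el_def Sw_append)
  moreover have "R (length (u @ r)) (length v')" using 1[OF b(4) c(4)] r(2) by simp
  ultimately show ?thesis using b(2) c(3) r(1) h by (simp add: el_in_els)
 next
  fix r assume r: "r \<in> Wn n" "v = u' @ r" "star (Sw v) * Sw u' = star (Sw r)"
  have "b * c = el u (v' @ r) h" unfolding bc r(3) by (simp add: el_def Sw_append star_mult mult.assoc)
  moreover have "R (length u) (length (v' @ r))" using 2[OF b(4) c(4)] r(2) by simp
  ultimately show ?thesis using b(2) c(3) r(1) h by (simp add: el_in_els)
 next
  assume r: "star (Sw v) * Sw u' = 0"
  have "b * c = el [] [] (%t. 0 * h t)" unfolding bc r by (simp add: el_def tens_def[abs_def])
  then have "b * c = 0" unfolding el_scale[OF h] by simp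
  then show ?thesis by (simp add: els_zero)
 qed
 then show "b * c \<in> addspan {el u v \<phi> | u v \<phi>. u \<in> Wn n \<and> v \<in> Wn n \<and> R (length u) (length v) \<and> \<phi> \<in> Cc}"
  unfolding els_def .
qed

section \<open>Comparison of the norm with the norm of the coefficient matrix\<close>

definition rn :: "'c => real" where
 "rn x = opn (rc x)"

lemma mbd_rn: "mbd (rc x) (rn x)"
 unfolding rn_def by (rule mbd_opn[OF mbd_rc])

lemma rn_nonneg: "0 \<le> rn x" and rn_le: "rn x \<le> norm x"
 unfolding rn_def by (rule opn_nonneg[OF mbd_rc], rule opn_le[OF mbd_rc])

lemma dist_rn: "dist (rn x) (rn y) \<le> dist x y"
proof -
 have "rn x \<le> rn y + norm (x - y)" for x y
 proof -
  have "rc x = (%e e'. rc y e e' + rc (x - y) e e')" by (intro ext) (simp add: rc_diff)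
  then show ?thesis unfolding rn_def using opn_add[OF mbd_rc[of y] mbd_rc[of "x - y"]] opn_le[OF mbd_rc[of "x - y"]] by simp
 qed
 from this[of x y] this[of y x] show ?thesis by (simp add: dist_norm norm_minus_commute abs_le_iff)
qed

lemma continuous_on_rn [continuous_intros]:
 assumes "continuous_on A f"
 shows "continuous_on A (%x. rn (f x))"
proof -
 have "continuous_on UNIV rn"
  by (rule lipschitz_on_continuous_on[OF lipschitz_onI[of _ _ 1]]) (simp_all add: dist_rn)
 then show ?thesis by (rule continuous_on_compose2[OF _ assms]) simp
qed

lemma rn_\<iota>: "f \<in> Cc ==> rn (\<iota> f) = cn f"
 unfolding rn_def cn_def by (rule arg_cong[where f = opn]) (intro ext rc_\<iota>)

lemma rn_cstar: "rn (star x * x) = (rn x)\<^sup>2"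
proof (rule \<iota>_closed_imp[of "%x. rn (star x * x) = (rn x)\<^sup>2" x])
 fix f :: "'g => 'a" assume f: "f \<in> Cc"
 show "rn (star (\<iota> f) * \<iota> f) = (rn (\<iota> f))\<^sup>2"
  unfolding \<iota>_tadj[OF f, symmetric] \<iota>_tc[OF tadj_in[OF f] f, symmetric]
  by (simp add: rn_\<iota> f tc_in tadj_in cn_cstar)
qed (intro closed_Collect_eq continuous_intros)

text \<open>Both norms satisfy the C*-identity, so at iterated squares of \<open>star x * x\<close>
  each is a power of its value at \<open>x\<close>, and \<open>power_trick\<close> absorbs a factor
  that grows like \<open>2^m\<close>. The sets \<open>E m\<close> record where the iterated squares
  lie.\<close>

lemma norm_le_rn_power:
 assumes E: "star x * x \<in> E 0" "\<And>m y. y \<in> E m ==> y * y \<in> E (Suc m)"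
  and bd: "\<And>m y. y \<in> E m ==> norm y \<le> A * 2 ^ m * rn y"
 shows "norm x \<le> rn x"
proof (rule power_trick[OF norm_ge_zero rn_nonneg])
 fix m :: nat
 define h where "h m = ((%y. y * y) ^^ m) (star x * x)" for m
 have "h m \<in> E m \<and> star (h m) = h m \<and> norm (h m) = norm x ^ (2 ^ Suc m) \<and> rn (h m) = rn x ^ (2 ^ Suc m)"
 proof (induction m)
  case 0
  then show ?case using E(1) by (simp add: h_def star_mult star_star cstar_identity rn_cstar power2_eq_square)
 next
  case (Suc m)
  have h: "h (Suc m) = h m * h m" by (simp add: h_def)
  have "norm (h m * h m) = (norm (h m))\<^sup>2" "rn (h m * h m) = (rn (h m))\<^sup>2"
   using cstar_identity[of "h m"] rn_cstar[of "h m"] Suc by simp_all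
  then show ?case using Suc unfolding h by (simp add: E(2) star_mult power_mult[symmetric] mult.commute)
 qed
 then show "norm x ^ 2 ^ Suc m \<le> A * 2 ^ m * rn x ^ 2 ^ Suc m" using bd[of "h m" m] by simp
qed

abbreviation "words k \<equiv> {w. w \<in> Wn n \<and> length w = k}"

lemma finite_words: "finite (words k)"
 using finite_lists_length_eq[of "{1..n}" k] by (simp add: lists_eq_set)

lemma idx_deg_exists: "\<exists>d\<in>idx n. deg d = gm"
 by (rule bexI[of _ "(%_. 1, gm, 0)"]) (use n2 in \<open>auto simp: deg_def idx_def\<close>)

text \<open>Words of length \<open>k\<close> give matrix units, so this span is a matrix algebra
  over functions of the degree. Each coefficient function is read off from single entries, which
  bounds the norm by \<open>card P\<close> times \<open>rn\<close>; passing to powers removes the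
  factor because the level is closed under products.\<close>

lemma norm_le_rn_level:
 assumes x: "x \<in> els (%a b. a = k \<and> b = k)"
 shows "norm x \<le> rn x"
proof -
 let ?E = "els (%a b. a = k \<and> b = k)"
 define P where "P = words k \<times> words k"
 have P: "finite P" unfolding P_def by (intro finite_cartesian_product finite_words)
 have bound: "norm y \<le> real (card P) * rn y" if "y \<in> ?E" for y
 proof -
  \<comment> \<open>Summands with the same pair of words are merged, so that each pair carries one
    function.\<close>
  have "\<exists>\<Phi>. (\<forall>p. \<Phi> p \<in> Cc) \<and> y = (\<Sum>p\<in>P. el (fst p) (snd p) (\<Phi> p))"
   using that
  proof (induction rule: els_induct)
   case zero
   have z: "(%t. 0::complex) \<in> (Cc :: ('g => complex) set)" by (rule csI[of _ "{}"]) simp_all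
   then show ?case using el_scale[OF z, of _ _ 0] by (intro exI[of _ "%p t. 0"]) simp
  next
   case (add u v \<phi> y)
   then obtain \<Phi> where \<Phi>: "\<And>p. \<Phi> p \<in> Cc" "y = (\<Sum>p\<in>P. el (fst p) (snd p) (\<Phi> p))" by blast
   define \<Psi> where "\<Psi> = \<Phi>((u, v) := (%t. \<phi> t + \<Phi> (u, v) t))"
   have uv: "(u, v) \<in> P" using add unfolding P_def by simp
   have "\<Psi> p \<in> Cc" for p using \<Phi>(1) add(4) by (simp add: \<Psi>_def cs_add)
   moreover have "el u v \<phi> + y = (\<Sum>p\<in>P. el (fst p) (snd p) (\<Psi> p))"
    unfolding \<Phi>(2) sum.remove[OF P uv] using el_add[OF add(4) \<Phi>(1)] by (simp add: \<Psi>_def add.assoc)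
   ultimately show ?case by blast
  qed
  then obtain \<Phi> where \<Phi>: "\<And>p. \<Phi> p \<in> Cc" "y = (\<Sum>p\<in>P. el (fst p) (snd p) (\<Phi> p))" by blast
  have "norm (el (fst p) (snd p) (\<Phi> p)) \<le> rn y" if p: "p \<in> P" for p
  proof -
   obtain u v where uv: "p = (u, v)" "u \<in> words k" "v \<in> words k" using p unfolding P_def by blast
   have "cmod (fourier (\<Phi> p) gm) \<le> rn y" for gm
   proof -
    \<comment> \<open>Every degree occurs among the basis vectors, so each value of the Fourier
      transform is an entry of the matrix.\<close>
    obtain d where d: "d \<in> idx n" "deg d = gm - wt \<omega> v" using idx_deg_exists by blast
    have "rc (el (fst q) (snd q) (\<Phi> q)) (act \<omega> u d) (act \<omega> v d) = (if q = p then fourier (\<Phi> p) gm else 0)" if q: "q \<in> P" for q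
    proof -
     obtain u' v' where q: "q = (u', v')" "u' \<in> words k" "v' \<in> words k" using q unfolding P_def by blast
     show ?thesis
     proof (cases "v' = v")
      case True
      have "act \<omega> u d = act \<omega> u' d \<longleftrightarrow> u' = u" using act_same_length[of u u' \<omega> d d] uv q by auto
      then show ?thesis using rc_el(1)[OF \<Phi>(1)[of q], of u' v "act \<omega> u d" d] True q uv d by simp
     next
      case False
      then have "act \<omega> v d \<noteq> act \<omega> v' d'" for d' using act_same_length[of v v' \<omega> d d'] uv q by auto
      then show ?thesis using rc_el(2)[OF \<Phi>(1)[of q], of u' v'] False q uv by simp
     qed
    qed
    then have "rc y (act \<omega> u d) (act \<omega> v d) = fourier (\<Phi> p) gm" unfolding \<Phi>(2) rc_sum using p P by simp
    then show ?thesis using mbd_entry[OF mbd_rn, of y "act \<omega> u d" "act \<omega> v d"] by simp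
   qed
   then show ?thesis using norm_el[OF \<Phi>(1)] uv by simp
  qed
  then have "norm y \<le> (\<Sum>p\<in>P. rn y)" unfolding \<Phi>(2) by (intro order_trans[OF norm_sum sum_mono]) (simp add: \<Phi>(2))
  then show ?thesis by simp
 qed
 show ?thesis
 proof (rule norm_le_rn_power[of x "%_. ?E" "real (card P)"])
  show "star x * x \<in> ?E" by (rule els_mult[OF els_star[OF x, of "%a b. a = k \<and> b = k"] x]) auto
  show "y * y \<in> ?E" if "y \<in> ?E" for y by (rule els_mult[OF that that]) auto
  fix m y assume "y \<in> ?E"
  from bound[OF this] have "norm y \<le> real (card P) * 1 * rn y" by simp
  also have "\<dots> \<le> real (card P) * 2 ^ m * rn y" by (intro mult_right_mono mult_left_mono rn_nonneg) simp_all
  finally show "norm y \<le> real (card P) * 2 ^ m * rn y" .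
 qed
qed

text \<open>Inserting the sum of the range projections of the \<open>S_i\<close> in the middle
  lengthens both words by one letter.\<close>

lemma els_level:
 assumes "x \<in> els (%a b. a = b \<and> a \<le> k)"
 shows "x \<in> els (%a b. a = k \<and> b = k)"
proof (rule els_subset[OF _ assms])
 fix u v and \<phi> :: "'g => complex" assume uv: "u \<in> Wn n" "v \<in> Wn n" "length u = length v \<and> length u \<le> k"
  and \<phi>: "\<phi> \<in> Cc"
 from uv show "el u v \<phi> \<in> els (%a b. a = k \<and> b = k)"
 proof (induction "k - length u" arbitrary: u v)
  case 0 then show ?case by (intro el_in_els \<phi>) auto
 next
  case (Suc m)
  have split: "tens \<phi> (Sw u * star (Sw v)) = (%t. \<Sum>i=1..n. tens \<phi> (Sw (u @ [i]) * star (Sw (v @ [i]))) t)"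
  proof
   fix t
   have "Sw u * star (Sw v) = Sw u * (\<Sum>i=1..n. S i * star (S i)) * star (Sw v)" unfolding S_sum by simp
   also have "\<dots> = (\<Sum>i=1..n. Sw (u @ [i]) * star (Sw (v @ [i])))"
    by (simp add: Sw_append star_mult sum_distrib_left sum_distrib_right mult.assoc)
   finally show "tens \<phi> (Sw u * star (Sw v)) t = (\<Sum>i=1..n. tens \<phi> (Sw (u @ [i]) * star (Sw (v @ [i]))) t)"
    by (simp add: tens_def scaleC_sum_right)
  qed
  have \<iota>_sum: "\<iota> (%t. \<Sum>i\<in>T. F i t) = (\<Sum>i\<in>T. \<iota> (F i))" if "finite T" "\<And>i. F i \<in> Cc" for T and F :: "nat => 'g => 'a"
   using that(1)
  proof induction
   case empty
   show ?case using \<iota>_scale[OF that(2), of 0] by simp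
  next
   case (insert i T)
   show ?case using insert \<iota>_add[OF that(2)[of i] cs_sum[of T F, OF that(2)]] by simp
  qed
  have "el u v \<phi> = (\<Sum>i=1..n. el (u @ [i]) (v @ [i]) \<phi>)"
   unfolding el_def split by (rule \<iota>_sum) (simp_all add: tens_in[OF \<phi>])
  moreover have "el (u @ [i]) (v @ [i]) \<phi> \<in> els (%a b. a = k \<and> b = k)" if "i \<in> {1..n}" for i
   by (rule Suc(1)) (use Suc(2-) that in auto)
  ultimately show ?case unfolding els_def by (simp only: addspan_sum)
 qed
qed

lemma rc_els_lev:
 assumes "x \<in> els (%a b. int a - int b = j)" "lev e - lev e' \<noteq> j"
 shows "rc x e e' = 0"
 using assms(1)
proof (induction rule: els_induct)
 case (add u v \<phi> y)
 have "rc (el u v \<phi>) e e' = 0"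
 proof (cases "\<exists>d. e' = act \<omega> v d")
  case True
  then obtain d where d: "e' = act \<omega> v d" by blast
  have "e \<noteq> act \<omega> u d" using assms(2) add(3) unfolding d by auto
  then show ?thesis unfolding d rc_el(1)[OF add(4,1,2)] by simp
 next
  case False
  then show ?thesis by (intro rc_el(2)[OF add(4,1,2)]) blast
 qed
 then show ?case using add by (simp add: rc_add)
qed simp

text \<open>\<open>star x * x\<close> has gauge degree 0, so its terms can be brought to one common
  level.\<close>

lemma norm_le_rn_homogeneous:
 assumes x: "x \<in> els (%a b. int a - int b = j \<and> a \<le> L \<and> b \<le> L)"
 shows "norm x \<le> rn x"
proof -
 have "star x * x \<in> els (%a b. a = b \<and> a \<le> 2 * L)"
  by (rule els_mult[OF els_star[OF x, of "%a b. int b - int a = j \<and> a \<le> L \<and> b \<le> L"] x]) auto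
 then have "norm (star x * x) \<le> rn (star x * x)" by (intro norm_le_rn_level[OF els_level])
 then show ?thesis unfolding cstar_identity rn_cstar by (rule power2_le_imp_le[OF _ rn_nonneg])
qed

text \<open>There are \<open>2 * L + 1\<close> possible gauge degrees. The matrix of each
  homogeneous part is a block of the matrix of \<open>x\<close>, so \<open>mbd_block\<close> bounds
  it by \<open>rn x\<close>.\<close>

lemma norm_le_rn_els:
 assumes x: "x \<in> els (%a b. a \<le> L \<and> b \<le> L)"
 shows "norm x \<le> real (2 * L + 1) * rn x"
proof -
 let ?E = "%j. els (%a b. int a - int b = j \<and> a \<le> L \<and> b \<le> L)"
 let ?J = "{- int L..int L}"
 have "\<exists>y. (\<forall>j. y j \<in> ?E j) \<and> x = (\<Sum>j\<in>?J. y j)"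
  using x
 proof (induction rule: els_induct)
  case zero then show ?case by (intro exI[of _ "%j. 0"]) (simp add: els_zero)
 next
  case (add u v \<phi> x)
  then obtain y where y: "\<And>j. y j \<in> ?E j" "x = (\<Sum>j\<in>?J. y j)" by blast
  let ?k = "int (length u) - int (length v)"
  have k: "?k \<in> ?J" using add(3) by auto
  have "el u v \<phi> \<in> ?E ?k" using add by (intro el_in_els) auto
  then have "(y(?k := el u v \<phi> + y ?k)) j \<in> ?E j" for j using y(1) by (simp add: els_add)
  moreover have "el u v \<phi> + x = (\<Sum>j\<in>?J. (y(?k := el u v \<phi> + y ?k)) j)"
   unfolding y(2) sum.remove[OF finite_atLeastAtMost_int k] by (simp add: add.assoc)
  ultimately show ?case by blast
 qed
 then obtain y where y: "\<And>j. y j \<in> ?E j" "x = (\<Sum>j\<in>?J. y j)" by blast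
 have y0: "rc (y j) e e' = 0" if "lev e - lev e' \<noteq> j" for j e e'
  by (rule rc_els_lev[OF els_subset[OF el_in_els y(1)] that]) auto
 have "norm (y j) \<le> rn x" if j: "j \<in> ?J" for j
 proof -
  have "rc (y j) = (%e e'. if lev e = lev e' + j then rc x e e' else 0)"
  proof (intro ext)
   fix e e' :: "'g idx"
   have "rc x e e' = rc (y j) e e'" if "lev e = lev e' + j"
    unfolding y(2) rc_sum using sum.mono_neutral_right[of ?J "{j}" "%i. rc (y i) e e'"] that j y0[of e e'] by auto
   then show "rc (y j) e e' = (if lev e = lev e' + j then rc x e e' else 0)" using y0[of e e' j] by auto
  qed
  then have "mbd (rc (y j)) (rn x)" using mbd_block[OF mbd_rn[of x], of lev "%e'. lev e' + j"] by simp
  then have "rn (y j) \<le> rn x" unfolding rn_def[of "y j"] by (rule opn_le)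
  then show ?thesis using norm_le_rn_homogeneous[OF y(1)[of j]] by simp
 qed
 then have "norm x \<le> (\<Sum>j\<in>?J. rn x)" unfolding y(2) by (intro order_trans[OF norm_sum sum_mono]) (simp add: y(2))
 then show ?thesis by (simp add: algebra_simps)
qed

text \<open>Squaring doubles the word lengths, so the factor from \<open>norm_le_rn_els\<close> is
  at most \<open>(4 * L + 1) * 2^m\<close> at the \<open>m\<close>-th iterated square, which
  \<open>power_trick\<close> removes.\<close>

lemma norm_le_rn_span:
 assumes x: "x \<in> els (%a b. a \<le> L \<and> b \<le> L)"
 shows "norm x \<le> rn x"
proof (rule norm_le_rn_power[of x "%m. els (%a b. a \<le> 2 * L * 2 ^ m \<and> b \<le> 2 * L * 2 ^ m)" "real (4 * L + 1)"])
 show "star x * x \<in> els (%a b. a \<le> 2 * L * 2 ^ 0 \<and> b \<le> 2 * L * 2 ^ 0)"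
  by (rule els_mult[OF els_star[OF x, of "%a b. a \<le> L \<and> b \<le> L"] x]) auto
 show "y * y \<in> els (%a b. a \<le> 2 * L * 2 ^ Suc m \<and> b \<le> 2 * L * 2 ^ Suc m)"
  if "y \<in> els (%a b. a \<le> 2 * L * 2 ^ m \<and> b \<le> 2 * L * 2 ^ m)" for m y
  by (rule els_mult[OF that that]) auto
 fix m y assume "y \<in> els (%a b. a \<le> 2 * L * 2 ^ m \<and> b \<le> 2 * L * 2 ^ m)"
 from norm_le_rn_els[OF this] have "norm y \<le> real (2 * (2 * L * 2 ^ m) + 1) * rn y" .
 also have "\<dots> \<le> real (4 * L + 1) * 2 ^ m * rn y"
  by (intro mult_right_mono rn_nonneg) (simp add: algebra_simps)
 finally show "norm y \<le> real (4 * L + 1) * 2 ^ m * rn y" .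
qed

lemma V0_els:
 assumes "f \<in> V0"
 obtains L where "\<iota> f \<in> els (%a b. a \<le> L \<and> b \<le> L)"
proof -
 have "\<exists>L. \<iota> f \<in> els (%a b. a \<le> L \<and> b \<le> L)"
  using assms
 proof induction
  case zero
  have "(%t. 0::'a) \<in> (Cc :: ('g => 'a) set)" by (rule csI[of _ "{}"]) simp_all
  from \<iota>_scale[OF this, of 0] show ?case by (simp add: els_zero)
 next
  case (add \<phi> u v g)
  then obtain L where L: "\<iota> g \<in> els (%a b. a \<le> L \<and> b \<le> L)" by blast
  let ?L = "L + length u + length v"
  have "\<iota> g \<in> els (%a b. a \<le> ?L \<and> b \<le> ?L)" by (rule els_subset[OF el_in_els L]) auto
  moreover have "el u v \<phi> \<in> els (%a b. a \<le> ?L \<and> b \<le> ?L)" using add by (intro el_in_els) auto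
  ultimately show ?case
   unfolding \<iota>_add[OF tens_in[OF add(1)] V0_in[OF add(4)]] by (intro exI[of _ ?L] els_add) (simp_all add: el_def)
 qed
 then show ?thesis using that by blast
qed

lemma els_dense:
 assumes "0 < e"
 obtains y L where "y \<in> els (%a b. a \<le> L \<and> b \<le> L)" "norm (x - y) \<le> e"
proof -
 have "x \<in> closure (\<iota> ` Cc)" using \<iota>_dense by simp
 then obtain f where f: "f \<in> Cc" "dist (\<iota> f) x < e / 2"
  using assms unfolding closure_approachable by (metis half_gt_zero imageE)
 obtain g where g: "g \<in> V0" "L1 (%t. f t - g t) \<le> e / 2" using V0_dense[OF f(1), of "e / 2"] assms by auto
 obtain L where L: "\<iota> g \<in> els (%a b. a \<le> L \<and> b \<le> L)" using g(1) by (rule V0_els)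
 have "norm (\<iota> f - \<iota> g) \<le> e / 2"
  using norm_\<iota>[OF cs_diff[OF f(1) V0_in[OF g(1)]]] g(2) \<iota>_diff[OF f(1) V0_in[OF g(1)]] by simp
 then have "norm (x - \<iota> g) \<le> e" using f(2) norm_triangle_ineq[of "x - \<iota> f" "\<iota> f - \<iota> g"] by (simp add: dist_norm norm_minus_commute)
 then show ?thesis using that L by blast
qed

lemma norm_eq_rn: "norm x = rn x"
proof (rule antisym[OF _ rn_le], rule field_le_epsilon)
 fix e :: real assume e: "0 < e"
 obtain y L where y: "y \<in> els (%a b. a \<le> L \<and> b \<le> L)" "norm (x - y) \<le> e / 2"
  by (rule els_dense[of "e / 2" x]) (use e in simp, rule that)
 show "norm x \<le> rn x + e"
  using norm_le_rn_span[OF y(1)] y(2) dist_rn[of x y] norm_triangle_ineq[of "x - y" y] by (simp add: dist_norm)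
qed

lemma rc_faithful:
 assumes "\<And>e e'. rc x e e' = rc y e e'"
 shows "x = y"
proof -
 have "rc (x - y) = (%e e'. 0)" by (intro ext) (simp add: rc_diff assms)
 then have "rn (x - y) \<le> 0" unfolding rn_def using opn_le[OF mbd_zero] by simp
 then show ?thesis by (simp flip: norm_eq_rn)
qed

end

section \<open>Uniform limits of Fourier transforms\<close>

text \<open>Basic neighbourhoods for uniform convergence on compact sets. They are translation
  invariant, so the estimates below are uniform in the centre.\<close>

definition near :: "'g::topological_ab_group_add set => real => 'g character => 'g character => bool" where
 "near K e gm \<psi> \<longleftrightarrow> (\<forall>t\<in>K. cmod (pairing t \<psi> - pairing t gm) < e)"

lemma near_translate: "near K e (gm + \<theta>) (\<psi> + \<theta>) \<longleftrightarrow> near K e gm \<psi>"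
 by (simp add: near_def pairing_add_right norm_mult flip: left_diff_distrib)

definition ucont :: "('g::topological_ab_group_add character => complex) => bool" where
 "ucont F \<longleftrightarrow> (\<forall>\<epsilon>>0. \<exists>K e. compact K \<and> 0 < e \<and> (\<forall>gm \<psi>. near K e gm \<psi> --> cmod (F \<psi> - F gm) \<le> \<epsilon>))"

lemma ucontE:
 assumes "ucont F" "0 < \<epsilon>"
 obtains K e where "compact K" "0 < e" "\<And>gm \<psi>. near K e gm \<psi> ==> cmod (F \<psi> - F gm) \<le> \<epsilon>"
proof -
 have "\<exists>K e. compact K \<and> 0 < e \<and> (\<forall>gm \<psi>. near K e gm \<psi> --> cmod (F \<psi> - F gm) \<le> \<epsilon>)"
  by (rule mp[OF spec[OF assms(1)[unfolded ucont_def]] assms(2)])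
 then show ?thesis by (elim exE conjE) (rule that, assumption+, simp)
qed

lemma ucont_zero: "ucont (%gm. 0)"
 unfolding ucont_def
proof (intro allI impI)
 fix \<epsilon> :: real assume "0 < \<epsilon>"
 then show "\<exists>K e. compact K \<and> 0 < e \<and> (\<forall>gm \<psi>. near K e gm \<psi> --> cmod (0 - 0) \<le> \<epsilon>)"
  by (metis compact_empty diff_self norm_zero order_less_imp_le zero_less_one)
qed

lemma ucont_add:
 assumes "ucont F" "ucont G"
 shows "ucont (%gm. F gm + G gm)"
 unfolding ucont_def
proof (intro allI impI)
 fix \<epsilon> :: real assume "0 < \<epsilon>"
 then have \<epsilon>: "0 < \<epsilon> / 2" by simp
 obtain K e where K: "compact K" "0 < e" "\<And>gm \<psi>. near K e gm \<psi> ==> cmod (F \<psi> - F gm) \<le> \<epsilon> / 2"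
  using assms(1) \<epsilon> by (rule ucontE) (rule that)
 obtain L d where L: "compact L" "0 < d" "\<And>gm \<psi>. near L d gm \<psi> ==> cmod (G \<psi> - G gm) \<le> \<epsilon> / 2"
  using assms(2) \<epsilon> by (rule ucontE) (rule that)
 have "cmod (F \<psi> + G \<psi> - (F gm + G gm)) \<le> \<epsilon>" if "near (K \<union> L) (min e d) gm \<psi>" for gm \<psi>
 proof -
  have "near K e gm \<psi>" "near L d gm \<psi>" using that by (auto simp: near_def)
  then show ?thesis using norm_triangle_mono[OF K(3) L(3), of gm \<psi> gm \<psi>] by (simp add: algebra_simps)
 qed
 then show "\<exists>K e. compact K \<and> 0 < e \<and> (\<forall>gm \<psi>. near K e gm \<psi> --> cmod (F \<psi> + G \<psi> - (F gm + G gm)) \<le> \<epsilon>)"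
  using K L by (intro exI[of _ "K \<union> L"] exI[of _ "min e d"]) (auto intro: compact_Un)
qed

lemma ucont_translate: "ucont F ==> ucont (%gm. F (gm + \<theta>))"
 unfolding ucont_def by (metis near_translate)

context lca
begin

lemma ucont_fourier:
 assumes \<phi>: "\<phi> \<in> Cc"
 shows "ucont (fourier \<phi>)"
 unfolding ucont_def
proof (intro allI impI)
 fix \<epsilon> :: real assume \<epsilon>: "0 < \<epsilon>"
 obtain K where K: "compact K" "\<And>t. t \<notin> K ==> \<phi> t = 0" using \<phi> by (rule csE) (rule that)
 define I where "I = (\<integral>t. cmod (\<phi> t) \<partial>\<mu>)"
 have I: "0 \<le> I" by (simp add: I_def)
 define e where "e = \<epsilon> / (I + 1)"
 have e: "0 < e" using \<epsilon> I by (simp add: e_def)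
 have "cmod (fourier \<phi> \<psi> - fourier \<phi> gm) \<le> \<epsilon>" if "near K e gm \<psi>" for gm \<psi>
 proof -
  have "fourier \<phi> \<psi> - fourier \<phi> gm = (\<integral>t. (pairing t \<psi> - pairing t gm) * \<phi> t \<partial>\<mu>)"
   unfolding fourier_def by (simp add: left_diff_distrib Bochner_Integration.integral_diff integrable_pairing \<phi>)
  also have "cmod \<dots> \<le> (\<integral>t. e * cmod (\<phi> t) \<partial>\<mu>)"
  proof (rule order_trans[OF integral_norm_bound integral_mono])
   show "integrable \<mu> (%t. cmod ((pairing t \<psi> - pairing t gm) * \<phi> t))"
    by (intro integrable_norm) (simp add: left_diff_distrib integrable_pairing \<phi>)
   show "integrable \<mu> (%t. e * cmod (\<phi> t))" by (intro integrable_mult_right integrable_norm integrable_cs \<phi>)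
   fix t show "cmod ((pairing t \<psi> - pairing t gm) * \<phi> t) \<le> e * cmod (\<phi> t)"
   proof (cases "t \<in> K")
    case True
    then have "cmod (pairing t \<psi> - pairing t gm) \<le> e" using that by (simp add: near_def less_imp_le)
    then show ?thesis unfolding norm_mult by (rule mult_right_mono) simp
   qed (simp add: K(2))
  qed
  also have "\<dots> = e * I" by (simp add: I_def)
  also have "\<dots> \<le> e * (I + 1)" using e by simp
  also have "\<dots> = \<epsilon>" using I by (simp add: e_def)
  finally show ?thesis .
 qed
 then show "\<exists>K e. compact K \<and> 0 < e \<and> (\<forall>gm \<psi>. near K e gm \<psi> --> cmod (fourier \<phi> \<psi> - fourier \<phi> gm) \<le> \<epsilon>)"
  using K(1) e by blast
qed

text \<open>Real-valued uniform limits of Fourier transforms, in the role of \<open>C_0\<close> of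
  the dual group. All cutoff functions are taken from here.\<close>

definition DR :: "('g character => real) set" where
 "DR = {r. \<forall>e>0. \<exists>\<phi>\<in>Cc. \<forall>gm. cmod (complex_of_real (r gm) - fourier \<phi> gm) \<le> e}"

lemma DRE:
 assumes "r \<in> DR" "0 < e"
 obtains \<phi> where "\<phi> \<in> Cc" "\<And>gm. cmod (complex_of_real (r gm) - fourier \<phi> gm) \<le> e"
 using assms unfolding DR_def by blast

lemma DRI: "(\<And>e. 0 < e ==> \<exists>\<phi>\<in>Cc. \<forall>gm. cmod (complex_of_real (r gm) - fourier \<phi> gm) \<le> e) ==> r \<in> DR"
 unfolding DR_def by blast

lemma DR_fourier: "\<phi> \<in> Cc ==> (\<And>gm. fourier \<phi> gm = complex_of_real (r gm)) ==> r \<in> DR"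
 by (rule DRI, rule bexI[of _ \<phi>]) simp_all

lemma DR_norm_fourier:
 assumes \<phi>: "\<phi> \<in> Cc"
 shows "(%gm. (cmod (fourier \<phi> gm))\<^sup>2) \<in> DR"
 by (rule DR_fourier[OF conv_in[OF cadj_in[OF \<phi>] \<phi>]])
  (simp add: fourier_conv[OF cadj_in[OF \<phi>] \<phi>] fourier_cadj[OF \<phi>] complex_norm_square mult.commute del: of_real_power)

lemma DR_bounded:
 assumes "r \<in> DR"
 obtains B where "0 \<le> B" "\<And>gm. \<bar>r gm\<bar> \<le> B"
proof -
 obtain \<phi> where \<phi>: "\<phi> \<in> Cc" "\<And>gm. cmod (complex_of_real (r gm) - fourier \<phi> gm) \<le> 1"
  by (rule DRE[OF assms, of 1]) (simp, rule that)
 have "\<bar>r gm\<bar> \<le> 1 + (\<integral>t. cmod (\<phi> t) \<partial>\<mu>)" for gm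
  using norm_triangle_mono[OF \<phi>(2)[of gm] norm_fourier[OF \<phi>(1), of gm]] by simp
 moreover have "0 \<le> 1 + (\<integral>t. cmod (\<phi> t) \<partial>\<mu>)" by (simp add: add_nonneg_nonneg)
 ultimately show ?thesis using that by blast
qed

lemma DR_limit:
 assumes "\<And>e. 0 < e ==> \<exists>s\<in>DR. \<forall>gm. \<bar>r gm - s gm\<bar> \<le> e"
 shows "r \<in> DR"
proof (rule DRI)
 fix e :: real assume "0 < e"
 then have e: "0 < e / 2" by simp
 obtain s where s: "s \<in> DR" "\<And>gm. \<bar>r gm - s gm\<bar> \<le> e / 2" using assms[OF e] by blast
 obtain \<phi> where \<phi>: "\<phi> \<in> Cc" "\<And>gm. cmod (complex_of_real (s gm) - fourier \<phi> gm) \<le> e / 2"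
  by (rule DRE[OF s(1) e]) (rule that)
 have "cmod (complex_of_real (r gm) - fourier \<phi> gm) \<le> e" for gm
 proof -
  have "cmod (complex_of_real (r gm - s gm)) \<le> e / 2" using s(2) by (simp only: norm_of_real)
  from norm_triangle_mono[OF this \<phi>(2)[of gm]] show ?thesis by simp
 qed
 then show "\<exists>\<phi>\<in>Cc. \<forall>gm. cmod (complex_of_real (r gm) - fourier \<phi> gm) \<le> e" using \<phi>(1) by blast
qed

lemma DR_add:
 assumes "r \<in> DR" "s \<in> DR"
 shows "(%gm. r gm + s gm) \<in> DR"
proof (rule DRI)
 fix e :: real assume "0 < e"
 then have e: "0 < e / 2" by simp
 obtain \<phi> where \<phi>: "\<phi> \<in> Cc" "\<And>gm. cmod (complex_of_real (r gm) - fourier \<phi> gm) \<le> e / 2"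
  by (rule DRE[OF assms(1) e]) (rule that)
 obtain \<psi> where \<psi>: "\<psi> \<in> Cc" "\<And>gm. cmod (complex_of_real (s gm) - fourier \<psi> gm) \<le> e / 2"
  by (rule DRE[OF assms(2) e]) (rule that)
 show "\<exists>\<phi>\<in>Cc. \<forall>gm. cmod (complex_of_real (r gm + s gm) - fourier \<phi> gm) \<le> e"
 proof (intro bexI[OF _ cs_add[OF \<phi>(1) \<psi>(1)]] allI)
  fix gm show "cmod (complex_of_real (r gm + s gm) - fourier (%t. \<phi> t + \<psi> t) gm) \<le> e"
   using norm_triangle_mono[OF \<phi>(2)[of gm] \<psi>(2)[of gm]] by (simp add: fourier_add[OF \<phi>(1) \<psi>(1)] algebra_simps)
 qed
qed

lemma DR_mult:
 assumes "r \<in> DR" "s \<in> DR"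
 shows "(%gm. r gm * s gm) \<in> DR"
proof (rule DRI)
 fix e :: real assume e: "0 < e"
 obtain B where B: "0 \<le> B" "\<And>gm. \<bar>s gm\<bar> \<le> B" using DR_bounded[OF assms(2)] by blast
 obtain \<phi> where \<phi>: "\<phi> \<in> Cc" "\<And>gm. cmod (complex_of_real (r gm) - fourier \<phi> gm) \<le> e / (2 * (B + 1))"
  by (rule DRE[OF assms(1), of "e / (2 * (B + 1))"]) (use e B in simp, rule that)
 define I where "I = (\<integral>t. cmod (\<phi> t) \<partial>\<mu>)"
 have I: "0 \<le> I" by (simp add: I_def)
 obtain \<psi> where \<psi>: "\<psi> \<in> Cc" "\<And>gm. cmod (complex_of_real (s gm) - fourier \<psi> gm) \<le> e / (2 * (I + 1))"
  by (rule DRE[OF assms(2), of "e / (2 * (I + 1))"]) (use e I in simp, rule that)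
 show "\<exists>\<phi>\<in>Cc. \<forall>gm. cmod (complex_of_real (r gm * s gm) - fourier \<phi> gm) \<le> e"
 proof (intro bexI[OF _ conv_in[OF \<phi>(1) \<psi>(1)]] allI)
  fix gm
  have "cmod ((complex_of_real (r gm) - fourier \<phi> gm) * complex_of_real (s gm)) \<le> e / (2 * (B + 1)) * B"
   unfolding norm_mult using e B by (intro mult_mono \<phi>) simp_all
  also have "\<dots> \<le> e / 2" using e B by (simp add: field_simps)
  finally have 1: "cmod ((complex_of_real (r gm) - fourier \<phi> gm) * complex_of_real (s gm)) \<le> e / 2" .
  have "cmod (fourier \<phi> gm * (complex_of_real (s gm) - fourier \<psi> gm)) \<le> I * (e / (2 * (I + 1)))"
   unfolding norm_mult using I by (intro mult_mono \<psi> norm_fourier[OF \<phi>(1), folded I_def]) simp_all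
  also have "\<dots> \<le> e / 2" using e I by (simp add: field_simps)
  finally have 2: "cmod (fourier \<phi> gm * (complex_of_real (s gm) - fourier \<psi> gm)) \<le> e / 2" .
  show "cmod (complex_of_real (r gm * s gm) - fourier (conv \<phi> \<psi>) gm) \<le> e"
   using norm_triangle_mono[OF 1 2] by (simp add: fourier_conv[OF \<phi>(1) \<psi>(1)] algebra_simps)
 qed
qed

lemma DR_scale:
 assumes "r \<in> DR"
 shows "(%gm. c * r gm) \<in> DR"
proof (rule DRI)
 fix e :: real assume e: "0 < e"
 have d: "0 < e / (\<bar>c\<bar> + 1)" using e by (simp add: add_nonneg_pos)
 obtain \<phi> where \<phi>: "\<phi> \<in> Cc" "\<And>gm. cmod (complex_of_real (r gm) - fourier \<phi> gm) \<le> e / (\<bar>c\<bar> + 1)"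
  by (rule DRE[OF assms d]) (rule that)
 have c: "(%t. complex_of_real c * \<phi> t) \<in> Cc" by (rule cs_cmult[OF \<phi>(1)]) simp
 show "\<exists>\<phi>\<in>Cc. \<forall>gm. cmod (complex_of_real (c * r gm) - fourier \<phi> gm) \<le> e"
 proof (intro bexI[OF _ c] allI)
  fix gm
  have "cmod (complex_of_real (c * r gm) - fourier (%t. complex_of_real c * \<phi> t) gm) = \<bar>c\<bar> * cmod (complex_of_real (r gm) - fourier \<phi> gm)"
   by (simp add: fourier_scale norm_mult flip: right_diff_distrib)
  also have "\<dots> \<le> (\<bar>c\<bar> + 1) * (e / (\<bar>c\<bar> + 1))" by (intro mult_mono \<phi>) simp_all
  also have "\<dots> = e" by (simp add: add_nonneg_eq_0_iff)
  finally show "cmod (complex_of_real (c * r gm) - fourier (%t. complex_of_real c * \<phi> t) gm) \<le> e" .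
 qed
qed

lemma DR_zero: "(%gm. 0) \<in> DR"
 by (rule DR_fourier[of "%t. 0"]) (auto intro: csI[of _ "{}"] simp: fourier_def)

lemma DR_diff: "r \<in> DR ==> s \<in> DR ==> (%gm. r gm - s gm) \<in> DR"
 using DR_add[of r "%gm. (- 1) * s gm"] DR_scale[of s "- 1"] by simp

lemma DR_sum: "(\<And>i. i \<in> T ==> f i \<in> DR) ==> (%gm. \<Sum>i\<in>T. f i gm) \<in> DR"
 by (induction T rule: infinite_finite_induct) (simp_all add: DR_zero DR_add)

lemma DR_translate:
 assumes "r \<in> DR"
 shows "(%gm. r (gm + \<theta>)) \<in> DR"
proof (rule DRI)
 fix e :: real assume "0 < e"
 then obtain \<phi> where \<phi>: "\<phi> \<in> Cc" "\<And>gm. cmod (complex_of_real (r gm) - fourier \<phi> gm) \<le> e"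
  by (rule DRE[OF assms]) (rule that)
 then show "\<exists>\<phi>\<in>Cc. \<forall>gm. cmod (complex_of_real (r (gm + \<theta>)) - fourier \<phi> gm) \<le> e"
  by (intro bexI[OF _ twist_in[OF \<phi>(1), of \<theta>]]) (simp add: fourier_twist)
qed

text \<open>Functional calculus by polynomial approximation on the bounded range;
  \<open>F 0 = 0\<close> is required because constants need not lie in \<open>DR\<close>.\<close>

lemma DR_compose:
 assumes r: "r \<in> DR" and F: "continuous_on UNIV F" "F 0 = (0::real)"
 shows "(%gm. F (r gm)) \<in> DR"
proof (rule DR_limit)
 have poly: "(%gm. g (r gm) - g 0) \<in> DR" if "real_polynomial_function g" for g
  using that
 proof induction
  case (linear f)
  then have "f x = f 1 * x" for x using linear_scale[OF bounded_linear.linear, of f x 1] by simp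
  then have "(%gm. f (r gm) - f 0) = (%gm. f 1 * r gm)" by (metis diff_zero mult_zero_right)
  then show ?case using DR_scale[OF r, of "f 1"] by simp
 next
  case const then show ?case by (simp add: DR_zero)
 next
  case (add f g)
  then show ?case using DR_add[OF add.IH] by (simp add: algebra_simps)
 next
  case (mult f g)
  have "(%gm. f (r gm) * g (r gm) - f 0 * g 0) =
    (%gm. (f (r gm) - f 0) * (g (r gm) - g 0) + (f 0 * (g (r gm) - g 0) + g 0 * (f (r gm) - f 0)))"
   by (simp add: fun_eq_iff algebra_simps)
  then show ?case using mult.IH by (simp only: DR_add DR_mult DR_scale)
 qed
 fix e :: real assume e: "0 < e"
 obtain B where B: "0 \<le> B" "\<And>gm. \<bar>r gm\<bar> \<le> B" using DR_bounded[OF r] by blast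
 obtain g where g: "real_polynomial_function g" "\<And>x. x \<in> {-B..B} ==> \<bar>F x - g x\<bar> < e / 2"
  by (rule Stone_Weierstrass_real_polynomial_function[of "{-B..B}" F "e / 2"])
   (use e continuous_on_subset[OF F(1)] in auto)
 have "\<bar>F (r gm) - (g (r gm) - g 0)\<bar> \<le> e" for gm
 proof -
  have "r gm \<in> {-B..B}" "0 \<in> {-B..B}" using B(2)[of gm] B(1) by (simp_all add: abs_le_iff)
  from g(2)[OF this(1)] g(2)[OF this(2)] F(2) show ?thesis by linarith
 qed
 then show "\<exists>s\<in>DR. \<forall>gm. \<bar>F (r gm) - s gm\<bar> \<le> e" by (intro bexI[OF _ poly[OF g(1)]] allI)
qed

lemma DR_ucont:
 assumes "r \<in> DR"
 shows "ucont (%gm. complex_of_real (r gm))"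
 unfolding ucont_def
proof (intro allI impI)
 fix \<epsilon> :: real assume "0 < \<epsilon>"
 then have \<epsilon>: "0 < \<epsilon> / 3" by simp
 obtain \<phi> where \<phi>: "\<phi> \<in> Cc" "\<And>gm. cmod (complex_of_real (r gm) - fourier \<phi> gm) \<le> \<epsilon> / 3"
  by (rule DRE[OF assms \<epsilon>]) (rule that)
 obtain K e where K: "compact K" "0 < e" "\<And>gm \<psi>. near K e gm \<psi> ==> cmod (fourier \<phi> \<psi> - fourier \<phi> gm) \<le> \<epsilon> / 3"
  using ucont_fourier[OF \<phi>(1)] \<epsilon> by (rule ucontE) (rule that)
 have "cmod (complex_of_real (r \<psi>) - complex_of_real (r gm)) \<le> \<epsilon>" if "near K e gm \<psi>" for gm \<psi>
 proof -
  have "cmod (fourier \<phi> gm - complex_of_real (r gm)) \<le> \<epsilon> / 3" using \<phi>(2)[of gm] by (simp add: norm_minus_commute)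
  from norm_triangle_mono[OF norm_triangle_mono[OF \<phi>(2)[of \<psi>] K(3)[OF that]] this] show ?thesis by simp
 qed
 then show "\<exists>K e. compact K \<and> 0 < e \<and> (\<forall>gm \<psi>. near K e gm \<psi> --> cmod (complex_of_real (r \<psi>) - complex_of_real (r gm)) \<le> \<epsilon>)"
  using K by blast
qed

lemma DR_nearE:
 assumes "r \<in> DR" "0 < \<epsilon>"
 obtains K e where "compact K" "0 < e" "\<And>gm \<psi>. near K e gm \<psi> ==> \<bar>r \<psi> - r gm\<bar> \<le> \<epsilon>"
 by (rule ucontE[OF DR_ucont[OF assms(1)] assms(2)]) (rule that, simp_all add: norm_of_real del: of_real_diff flip: of_real_diff)

lemma DR_open:
 assumes "r \<in> DR"
 shows "open {gm. c < r gm}"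
 unfolding open_character_def
proof
 fix gm assume "gm \<in> {gm. c < r gm}"
 then have c: "0 < (r gm - c) / 2" by simp
 obtain K e where K: "compact K" "0 < e" "\<And>gm' \<psi>. near K e gm' \<psi> ==> \<bar>r \<psi> - r gm'\<bar> \<le> (r gm - c) / 2"
  by (rule DR_nearE[OF assms c]) (rule that)
 have "\<psi> \<in> {gm. c < r gm}" if "\<forall>t\<in>K. cmod (pairing t \<psi> - pairing t gm) < e" for \<psi>
 proof -
  have "\<bar>r \<psi> - r gm\<bar> \<le> (r gm - c) / 2" using K(3)[of gm \<psi>] that by (simp add: near_def)
  from abs_le_D2[OF this] show ?thesis using c by (simp add: field_simps)
 qed
 then show "\<exists>K e. compact K \<and> e > 0 \<and> (\<forall>\<psi>. (\<forall>t\<in>K. cmod (pairing t \<psi> - pairing t gm) < e) --> \<psi> \<in> {gm. c < r gm})"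
  using K by blast
qed

text \<open>Translation is continuous in \<open>L^1\<close>, and the Fourier transform turns it into
  multiplication by the pairing. Hence finitely many points of \<open>K\<close> control all of
  \<open>K\<close> wherever \<open>fourier f\<close> is not small.\<close>

lemma equicontinuous_pairing:
 assumes f: "f \<in> Cc" and K: "compact (K :: 'g set)" and d: "0 < d"
 obtains J where "finite J" "J \<subseteq> K"
  "\<And>t. t \<in> K ==> \<exists>j\<in>J. \<forall>gm. cmod (pairing t gm - pairing j gm) * cmod (fourier f gm) \<le> d"
proof -
 have "\<forall>j. \<exists>U. open U \<and> j \<in> U \<and> (\<forall>s\<in>U. (\<integral>t. norm (f (t - s) - f (t - j)) \<partial>\<mu>) \<le> d)"
  by (intro allI translation_L1_continuous[OF f d])
 from choice[OF this] obtain U where U: "\<And>j. open (U j)" "\<And>j. j \<in> U j"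
  "\<And>j s. s \<in> U j ==> (\<integral>t. norm (f (t - s) - f (t - j)) \<partial>\<mu>) \<le> d" by blast
 obtain J where J: "J \<subseteq> K" "finite J" "K \<subseteq> (\<Union>j\<in>J. U j)"
  by (rule compactE_image[OF K, of K U]) (use U in auto)
 have "\<exists>j\<in>J. \<forall>gm. cmod (pairing t gm - pairing j gm) * cmod (fourier f gm) \<le> d" if t: "t \<in> K" for t
 proof -
  obtain j where j: "j \<in> J" "t \<in> U j" using J(3) t by blast
  note ft = cs_translate[OF f]
  have "cmod (pairing t gm - pairing j gm) * cmod (fourier f gm) \<le> d" for gm
  proof -
   have "fourier (%s. f (s - t) - f (s - j)) gm = (pairing t gm - pairing j gm) * fourier f gm"
    using fourier_add[OF cs_diff[OF ft ft] ft, of t j j gm]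
    by (simp add: fourier_translate[OF f] left_diff_distrib)
   from norm_fourier[OF cs_diff[OF ft ft], of t j gm, unfolded this] U(3)[OF j(2)]
   show ?thesis by (simp add: norm_mult)
  qed
  then show ?thesis using j(1) by blast
 qed
 with J that show ?thesis by blast
qed

lemma DR_bump:
 fixes gm0 :: "'g character"
 assumes K: "compact K" and e: "0 < e"
 obtains h where "h \<in> DR" "h gm0 = 1" "\<And>gm. 0 \<le> h gm" "\<And>gm. h gm \<le> 1" "\<And>gm. h gm \<noteq> 0 ==> near K e gm0 gm"
proof -
 obtain f1 where f1: "f1 \<in> Cc" "fourier f1 gm0 \<noteq> 0" using fourier_nonzero by blast
 define f where "f = (%t. inverse (fourier f1 gm0) * f1 t)"
 have f: "f \<in> Cc" unfolding f_def by (rule cs_cmult[OF f1(1)]) simp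
 have f0: "fourier f gm0 = 1" unfolding f_def fourier_scale using f1(2) by simp
 obtain J where J: "finite J" "J \<subseteq> K"
  "\<And>t. t \<in> K ==> \<exists>j\<in>J. \<forall>gm. cmod (pairing t gm - pairing j gm) * cmod (fourier f gm) \<le> e / 8"
  by (rule equicontinuous_pairing[OF f K, of "e / 8"]) (use e in simp, rule that)
 define q where "q j gm = (cmod (fourier (%t. f (t - j) - pairing j gm0 * f t) gm))\<^sup>2" for j gm
 have qf: "(%t. f (t - j) - pairing j gm0 * f t) \<in> Cc" for j
  by (intro cs_diff cs_translate cs_cmult f) simp
 have q: "q j gm = (cmod (pairing j gm - pairing j gm0))\<^sup>2 * (cmod (fourier f gm))\<^sup>2" for j gm
 proof -
  have s: "(%t. pairing j gm0 * f t) \<in> Cc" by (rule cs_cmult[OF f]) simp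
  have "fourier (%t. f (t - j) - pairing j gm0 * f t) gm = (pairing j gm - pairing j gm0) * fourier f gm"
   using fourier_add[OF qf s, of j gm]
   by (simp add: fourier_translate[OF f] fourier_scale left_diff_distrib)
  then show ?thesis by (simp add: q_def norm_mult power_mult_distrib)
 qed
 \<comment> \<open>\<open>r\<close> is 1 at \<open>gm0\<close>, and with the factor
   \<open>16 / e^2\<close> the condition \<open>r > 1/2\<close> forces a deviation of at most
   \<open>e / 4\<close> at every node \<open>j\<close>. A node approximates \<open>t\<close> up to
   \<open>e / 4\<close> at \<open>gm\<close> and up to \<open>e / 8\<close> at \<open>gm0\<close>;
   together this stays below \<open>e\<close>.\<close>
 define r where "r gm = (cmod (fourier f gm))\<^sup>2 - (16 / e\<^sup>2) * (\<Sum>j\<in>J. q j gm)" for gm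
 have r: "r \<in> DR" unfolding r_def[abs_def] q_def[abs_def]
  by (intro DR_diff DR_scale DR_sum DR_norm_fourier f qf)
 define h where "h gm = min 1 (max 0 (2 * r gm - 1))" for gm
 have "(%gm. min 1 (max 0 (2 * r gm - 1))) \<in> DR"
  by (rule DR_compose[OF r]) (auto intro!: continuous_intros)
 then have hD: "h \<in> DR" unfolding h_def[abs_def] .
 have h0: "h gm0 = 1" unfolding h_def r_def by (simp add: q f0)
 have "near K e gm0 gm" if "h gm \<noteq> 0" for gm
  unfolding near_def
 proof
  fix t assume t: "t \<in> K"
  define F where "F = cmod (fourier f gm)"
  have r2: "1 / 2 < r gm" using that unfolding h_def by (auto simp: min_def max_def split: if_splits)
  have S0: "0 \<le> (\<Sum>j\<in>J. q j gm)" by (intro sum_nonneg) (simp add: q_def)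
  have c0: "0 < 16 / e\<^sup>2" using e by simp
  have F2: "1 / 2 < F\<^sup>2" using r2 mult_nonneg_nonneg[OF less_imp_le[OF c0] S0] unfolding r_def F_def by linarith
  have F: "1 / 2 < F" by (rule power2_less_imp_less) (use F2 in \<open>simp_all add: power2_eq_square F_def\<close>)
  obtain j where j: "j \<in> J" "\<And>gm. cmod (pairing t gm - pairing j gm) * cmod (fourier f gm) \<le> e / 8" using J(3)[OF t] by blast
  have "q j gm \<le> (\<Sum>j\<in>J. q j gm)" by (rule member_le_sum[OF j(1) _ J(1)]) (simp add: q_def)
  then have "(16 / e\<^sup>2) * q j gm \<le> (16 / e\<^sup>2) * (\<Sum>j\<in>J. q j gm)" using c0 by (intro mult_left_mono) simp_all
  also have "\<dots> \<le> F\<^sup>2" using r2 unfolding r_def F_def by simp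
  finally have "16 / e\<^sup>2 * (cmod (pairing j gm - pairing j gm0))\<^sup>2 * F\<^sup>2 \<le> 1 * F\<^sup>2" by (simp add: q F_def)
  then have "16 / e\<^sup>2 * (cmod (pairing j gm - pairing j gm0))\<^sup>2 \<le> 1" by (rule mult_right_le_imp_le) (use F2 in linarith)
  then have "(cmod (pairing j gm - pairing j gm0))\<^sup>2 \<le> (e / 4)\<^sup>2" using e by (simp add: field_simps power2_eq_square)
  then have 1: "cmod (pairing j gm - pairing j gm0) \<le> e / 4" by (rule power2_le_imp_le) (use e in simp)
  have "cmod (pairing t gm - pairing j gm) * (1 / 2) \<le> cmod (pairing t gm - pairing j gm) * F" using F by (intro mult_left_mono) simp_all
  then have 2: "cmod (pairing t gm - pairing j gm) \<le> e / 4" using j(2)[of gm] unfolding F_def by linarith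
  have 3: "cmod (pairing j gm0 - pairing t gm0) \<le> e / 8" using j(2)[of gm0] by (simp add: f0 norm_minus_commute)
  show "cmod (pairing t gm - pairing t gm0) < e"
   using norm_triangle_mono[OF norm_triangle_mono[OF 2 1] 3] e by simp
 qed
 with hD h0 show ?thesis by (intro that[of h]) (auto simp: h_def)
qed

text \<open>The usable form of compactness of superlevel sets. The values at finitely many nodes are
  sorted into cells of side \<open>1 / N\<close>, and one representative of each occupied cell
  suffices.\<close>

lemma DR_totally_bounded:
 assumes r: "r \<in> DR" and \<delta>: "0 < \<delta>" and K: "compact (K :: 'g set)" and e: "0 < e"
 obtains T where "finite T" "\<And>gm. \<delta> \<le> r gm ==> \<exists>\<theta>\<in>T. near K e \<theta> gm"
proof -
 obtain f where f: "f \<in> Cc" "\<And>gm. cmod (complex_of_real (r gm) - fourier f gm) \<le> \<delta> / 2"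
  by (rule DRE[OF r, of "\<delta> / 2"]) (use \<delta> in simp, rule that)
 define A where "A = {gm. \<delta> \<le> r gm}"
 have fA: "\<delta> / 2 \<le> cmod (fourier f gm)" if "gm \<in> A" for gm
  using norm_triangle_mono[OF f(2)[of gm] order_refl, of "fourier f gm"] that by (simp add: A_def)
 obtain J where J: "finite J" "J \<subseteq> K"
  "\<And>t. t \<in> K ==> \<exists>j\<in>J. \<forall>gm. cmod (pairing t gm - pairing j gm) * cmod (fourier f gm) \<le> e * \<delta> / 8"
  by (rule equicontinuous_pairing[OF f(1) K, of "e * \<delta> / 8"]) (use e \<delta> in simp, rule that)
 \<comment> \<open>Points of one cell differ at a node by at most \<open>2 / N < e / 4\<close>, and
   each of them changes by at most \<open>e / 4\<close> between the node and
   \<open>t\<close>.\<close>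
 obtain N :: nat where N: "8 / e < real N" using reals_Archimedean2 by blast
 have N0: "0 < real N" using N e by (meson divide_pos_pos less_trans zero_less_numeral)
 define cell where "cell gm = restrict (%j. (\<lfloor>real N * Re (pairing j gm)\<rfloor>, \<lfloor>real N * Im (pairing j gm)\<rfloor>)) J" for gm
 have "cell gm \<in> J \<rightarrow>\<^sub>E {- int N..int N} \<times> {- int N..int N}" for gm
 proof -
  have fl: "\<lfloor>real N * x\<rfloor> \<in> {- int N..int N}" if "\<bar>x\<bar> \<le> 1" for x
  proof -
   have "- real N \<le> real N * x" "real N * x \<le> real N"
    using that mult_left_mono[of "-1" x "real N"] mult_left_mono[of x 1 "real N"] by auto
   then show ?thesis by (auto simp: le_floor_iff floor_le_iff)
  qed
  show ?thesis unfolding cell_def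
   using fl[OF order_trans[OF abs_Re_le_cmod]] fl[OF order_trans[OF abs_Im_le_cmod]] by auto
 qed
 then have fin: "finite (cell ` A)"
  by (intro finite_subset[of "cell ` A" "J \<rightarrow>\<^sub>E {- int N..int N} \<times> {- int N..int N}"] finite_PiE[OF J(1)]) auto
 define T where "T = (%c. SOME gm. gm \<in> A \<and> cell gm = c) ` cell ` A"
 have "\<exists>\<theta>\<in>T. near K e \<theta> gm" if "\<delta> \<le> r gm" for gm
 proof -
  have gm: "gm \<in> A" using that by (simp add: A_def)
  define \<theta> where "\<theta> = (SOME \<theta>. \<theta> \<in> A \<and> cell \<theta> = cell gm)"
  have \<theta>: "\<theta> \<in> A" "cell \<theta> = cell gm" using someI[of "%\<theta>. \<theta> \<in> A \<and> cell \<theta> = cell gm" gm] gm unfolding \<theta>_def by auto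
  have "\<theta> \<in> T" using gm unfolding T_def \<theta>_def by blast
  moreover have "near K e \<theta> gm" unfolding near_def
  proof
   fix t assume t: "t \<in> K"
   obtain j where j: "j \<in> J" "\<And>gm. cmod (pairing t gm - pairing j gm) * cmod (fourier f gm) \<le> e * \<delta> / 8" using J(3)[OF t] by blast
   have b: "cmod (pairing t \<eta> - pairing j \<eta>) \<le> e / 4" if "\<eta> \<in> A" for \<eta>
   proof -
    have "cmod (pairing t \<eta> - pairing j \<eta>) * (\<delta> / 2) \<le> cmod (pairing t \<eta> - pairing j \<eta>) * cmod (fourier f \<eta>)"
     by (intro mult_left_mono fA that) simp
    also note j(2)[of \<eta>]
    also have "e * \<delta> / 8 = e / 4 * (\<delta> / 2)" by simp
    finally have "cmod (pairing t \<eta> - pairing j \<eta>) * (\<delta> / 2) \<le> e / 4 * (\<delta> / 2)" .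
    then show ?thesis by (rule mult_right_le_imp_le) (use \<delta> in simp)
   qed
   have c: "cell \<theta> j = cell gm j" using \<theta>(2) by simp
   have fd: "\<bar>x - y\<bar> \<le> 1 / real N" if "\<lfloor>real N * x\<rfloor> = \<lfloor>real N * y\<rfloor>" for x y :: real
   proof -
    have "\<bar>real N * x - real N * y\<bar> \<le> 1" using that by linarith
    then have "real N * \<bar>x - y\<bar> \<le> 1" using N0 by (simp add: abs_mult flip: right_diff_distrib)
    then show ?thesis using N0 by (simp add: field_simps)
   qed
   have "\<bar>Re (pairing j gm - pairing j \<theta>)\<bar> \<le> 1 / real N" "\<bar>Im (pairing j gm - pairing j \<theta>)\<bar> \<le> 1 / real N"
    using c j(1) by (auto simp: cell_def intro!: fd)
   then have "cmod (pairing j gm - pairing j \<theta>) \<le> 2 / real N"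
    using cmod_le[of "pairing j gm - pairing j \<theta>"] by simp
   also have "\<dots> < e / 4" using N N0 e by (simp add: field_simps)
   finally have 2: "cmod (pairing j gm - pairing j \<theta>) < e / 4" .
   have 3: "cmod (pairing j \<theta> - pairing t \<theta>) \<le> e / 4" using b[OF \<theta>(1)] by (simp add: norm_minus_commute)
   show "cmod (pairing t gm - pairing t \<theta>) < e"
    using norm_triangle_mono[OF norm_triangle_mono[OF b[OF gm] less_imp_le[OF 2]] 3] e by simp
  qed
  ultimately show ?thesis by blast
 qed
 moreover have "finite T" unfolding T_def using fin by (rule finite_imageI)
 ultimately show ?thesis using that by blast
qed

end

context crossed
begin

text \<open>The element \<open>S_w h\<close> for \<open>h\<close> in \<open>DR\<close>, a limit of
  elements \<open>el w [] \<phi>\<close>. Its coefficients determine it by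
  \<open>rc_faithful\<close>; the second clause keeps right multiplication computable.\<close>

definition X :: "nat list => ('g character => real) => 'c" where
 "X w h = (SOME x. (\<forall>e e'. rc x e e' = (if e' \<in> idx n \<and> e = act \<omega> w e' then complex_of_real (h (deg e')) else 0)) \<and>
   (\<forall>a e e'. rc (a * x) e e' = rc a e (act \<omega> w e') * complex_of_real (h (deg e'))))"

lemma rc_mult_el:
 assumes \<phi>: "\<phi> \<in> Cc" and u: "u \<in> Wn n" and v: "v \<in> Wn n"
 shows "rc (a * el u v \<phi>) e (act \<omega> v d) = rc a e (act \<omega> u d) * fourier \<phi> (deg d + wt \<omega> v)"
  and "(\<And>d. e' \<noteq> act \<omega> v d) ==> rc (a * el u v \<phi>) e e' = 0"
proof -
 have eq: "rc (\<iota> f * el u v \<phi>) e e' = cm (tc f (tens \<phi> (Sw u * star (Sw v)))) e e'" if f: "f \<in> Cc" for f e e'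
  unfolding el_def \<iota>_tc[OF f tens_in[OF \<phi>], symmetric] by (rule rc_\<iota>[OF tc_in[OF f tens_in[OF \<phi>]]])
 show "rc (a * el u v \<phi>) e (act \<omega> v d) = rc a e (act \<omega> u d) * fourier \<phi> (deg d + wt \<omega> v)"
 proof (rule \<iota>_closed_imp[of "%a. rc (a * el u v \<phi>) e (act \<omega> v d) = rc a e (act \<omega> u d) * fourier \<phi> (deg d + wt \<omega> v)" a])
  fix f :: "'g => 'a" assume f: "f \<in> Cc"
  show "rc (\<iota> f * el u v \<phi>) e (act \<omega> v d) = rc (\<iota> f) e (act \<omega> u d) * fourier \<phi> (deg d + wt \<omega> v)"
   unfolding eq[OF f] rc_\<iota>[OF f] by (rule cm_tc_tens(1)[OF f \<phi> u v])
 qed (intro closed_Collect_eq continuous_intros)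
 assume e': "\<And>d. e' \<noteq> act \<omega> v d"
 show "rc (a * el u v \<phi>) e e' = 0"
 proof (rule \<iota>_closed_imp[of "%a. rc (a * el u v \<phi>) e e' = 0" a])
  fix f :: "'g => 'a" assume f: "f \<in> Cc"
  show "rc (\<iota> f * el u v \<phi>) e e' = 0" unfolding eq[OF f] by (rule cm_tc_tens(2)[OF f \<phi> u v e'])
 qed (intro closed_Collect_eq continuous_intros)
qed

lemma X_spec:
 assumes w: "w \<in> Wn n" and h: "h \<in> DR"
 shows "(\<forall>e e'. rc (X w h) e e' = (if e' \<in> idx n \<and> e = act \<omega> w e' then complex_of_real (h (deg e')) else 0)) \<and>
   (\<forall>a e e'. rc (a * X w h) e e' = rc a e (act \<omega> w e') * complex_of_real (h (deg e')))"
proof -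
 have "\<forall>k. \<exists>\<phi>. \<phi> \<in> Cc \<and> (\<forall>gm. cmod (complex_of_real (h gm) - fourier \<phi> gm) \<le> inverse (real (Suc k)))"
  using h unfolding DR_def Bex_def by simp
 from choice[OF this] obtain \<phi> where \<phi>: "\<And>k. \<phi> k \<in> Cc"
  "\<And>k gm. cmod (complex_of_real (h gm) - fourier (\<phi> k) gm) \<le> inverse (real (Suc k))" by blast
 have "(%k. fourier (\<phi> k) gm - complex_of_real (h gm)) \<longlonglongrightarrow> 0" for gm
  by (rule Lim_null_comparison[OF always_eventually LIMSEQ_inverse_real_of_nat])
   (use \<phi>(2)[of gm] in \<open>simp add: norm_minus_commute\<close>)
 then have lim: "(%k. fourier (\<phi> k) gm) \<longlonglongrightarrow> complex_of_real (h gm)" for gm by (rule LIM_zero_cancel)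
 define x where "x k = el w [] (\<phi> k)" for k
 \<comment> \<open>\<open>norm_el\<close> bounds the norm by the supremum of the Fourier transform,
   so uniform convergence on the dual group gives a Cauchy sequence.\<close>
 have diff: "norm (x k - x l) \<le> inverse (real (Suc k)) + inverse (real (Suc l))" for k l
 proof -
  note d = cs_diff[OF \<phi>(1) \<phi>(1)]
  have "x k - x l = el w [] (%t. \<phi> k t - \<phi> l t)"
   unfolding x_def using el_add[OF d \<phi>(1), of w "[]" k l l] by simp
  moreover have "cmod (fourier (%t. \<phi> k t - \<phi> l t) gm) \<le> inverse (real (Suc k)) + inverse (real (Suc l))" for gm
  proof -
   have f: "fourier (%t. \<phi> k t - \<phi> l t) gm = fourier (\<phi> k) gm - fourier (\<phi> l) gm"
    using fourier_add[OF d \<phi>(1), of k l l gm] by simp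
   have "cmod (fourier (\<phi> k) gm - complex_of_real (h gm)) \<le> inverse (real (Suc k))"
    using \<phi>(2)[of gm k] by (simp add: norm_minus_commute)
   from norm_triangle_mono[OF this \<phi>(2)[of gm l]] show ?thesis unfolding f by simp
  qed
  ultimately show ?thesis using norm_el[OF d _ w, of k l _ "[]"] by simp
 qed
 have "Cauchy x"
 proof (rule metric_CauchyI)
  fix e :: real assume "0 < e"
  then obtain M where M: "inverse (real (Suc M)) < e / 2" using reals_Archimedean[of "e / 2"] by auto
  have "dist (x k) (x l) < e" if "M \<le> k" "M \<le> l" for k l
  proof -
   have "inverse (real (Suc k)) \<le> inverse (real (Suc M))" "inverse (real (Suc l)) \<le> inverse (real (Suc M))"
    using that by (intro le_imp_inverse_le; simp)+
   then show ?thesis using diff[of k l] M unfolding dist_norm by linarith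
  qed
  then show "\<exists>M. \<forall>k\<ge>M. \<forall>l\<ge>M. dist (x k) (x l) < e" by blast
 qed
 then obtain y where y: "x \<longlonglongrightarrow> y" using Cauchy_convergent convergent_def by blast
 have cont: "(%k. rc (f (x k)) e e') \<longlonglongrightarrow> rc (f y) e e'" if "continuous_on UNIV f" for f e e'
  by (rule continuous_on_tendsto_compose[OF continuous_on_rc[OF that] y]) simp_all
 have "rc y e e' = (if e' \<in> idx n \<and> e = act \<omega> w e' then complex_of_real (h (deg e')) else 0)" for e e'
 proof (rule LIMSEQ_unique)
  show "(%k. rc (x k) e e') \<longlonglongrightarrow> rc y e e'" using cont[of "%x. x"] by simp
  show "(%k. rc (x k) e e') \<longlonglongrightarrow> (if e' \<in> idx n \<and> e = act \<omega> w e' then complex_of_real (h (deg e')) else 0)"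
  proof -
   have "rc (x k) e e' = (if e' \<in> idx n \<and> e = act \<omega> w e' then fourier (\<phi> k) (deg e') else 0)" for k
    unfolding x_def using rc_el(1)[OF \<phi>(1) w, of "[]" k e e'] by simp
   note eq = this
   show ?thesis
   proof (cases "e' \<in> idx n \<and> e = act \<omega> w e'")
    case True show ?thesis unfolding eq if_P[OF True] by (rule lim)
   next
    case False show ?thesis unfolding eq if_not_P[OF False] by (rule tendsto_const)
   qed
  qed
 qed
 note 1 = this
 have "rc (a * y) e e' = rc a e (act \<omega> w e') * complex_of_real (h (deg e'))" for a e e'
 proof (rule LIMSEQ_unique)
  show "(%k. rc (a * x k) e e') \<longlonglongrightarrow> rc (a * y) e e'" by (rule cont) (intro continuous_intros)
  show "(%k. rc (a * x k) e e') \<longlonglongrightarrow> rc a e (act \<omega> w e') * complex_of_real (h (deg e'))"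
   unfolding x_def using rc_mult_el(1)[OF \<phi>(1) w, of "[]" a _ e e'] by (simp, intro tendsto_intros lim)
 qed
 note 2 = this
 show ?thesis unfolding X_def by (rule someI[where x = y]) (intro conjI allI 1 2)
qed

lemma rc_X: "w \<in> Wn n ==> h \<in> DR ==>
  rc (X w h) e e' = (if e' \<in> idx n \<and> e = act \<omega> w e' then complex_of_real (h (deg e')) else 0)"
 using X_spec by blast

lemma rc_mult_X: "w \<in> Wn n ==> h \<in> DR ==> rc (a * X w h) e e' = rc a e (act \<omega> w e') * complex_of_real (h (deg e'))"
 using X_spec by blast

lemma rc_star_X_mult:
 assumes "w \<in> Wn n" "h \<in> DR"
 shows "rc (star (X w h) * a) e e' = complex_of_real (h (deg e)) * rc a (act \<omega> w e) e'"
proof -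
 have "rc (star (X w h) * a) e e' = cnj (rc (star a * X w h) e' e)" by (simp add: rc_star[symmetric] star_mult star_star)
 then show ?thesis by (simp add: rc_mult_X[OF assms] rc_star)
qed

lemma star_X_Nil: "h \<in> DR ==> star (X [] h) = X [] h"
 by (rule rc_faithful) (auto simp: rc_star rc_X)

lemma rc_X_Nil_mult: "h \<in> DR ==> rc (X [] h * a) e e' = complex_of_real (h (deg e)) * rc a e e'"
 using rc_star_X_mult[of "[]" h a e e'] by (simp add: star_X_Nil)

lemma norm_diagonal_le:
 assumes "0 \<le> c" "\<And>e. cmod (rc x e e) \<le> c" "\<And>e e'. e \<noteq> e' ==> rc x e e' = 0"
 shows "norm x \<le> c"
proof -
 have "cmod (rc x e e') \<le> c" for e e' using assms(1) assms(2)[of e] assms(3)[of e e'] by (cases "e = e'") simp_all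
 then have "mbd (rc x) c" by (rule mbd_partial_injection[OF assms(1)]) (use assms(3) in metis)+
 then show ?thesis unfolding norm_eq_rn rn_def by (rule opn_le)
qed

end

section \<open>Density of the spectrum implies simplicity and pure infiniteness\<close>

text \<open>The words \<open>1^k 2\<close> form a prefix code: different \<open>k\<close> give
  orthogonal ranges, whatever letters follow.\<close>

definition codew :: "nat => nat list" where
 "codew k = replicate k 1 @ [2]"

lemma act_codew: "act \<omega> (codew k @ r) e = act \<omega> (codew l @ r') e' ==> k = l"
proof (induction k arbitrary: l)
 case 0 then show ?case by (cases l) (simp_all add: codew_def)
next
 case (Suc k) then show ?case by (cases l) (simp_all add: codew_def)
qed

lemma fst_act: "k < length w ==> fst (act \<omega> w e) k = w ! k"
proof (induction w arbitrary: k)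
 case (Cons i w) then show ?case by (cases k) (simp_all add: icons_def)
qed simp

text \<open>The block of \<open>L\<close> ones followed by a 2 marks its own position: a nonzero
  shift by at most \<open>L\<close> letters would put a 1 where the 2 stands. This is the
  aperiodicity that removes off-diagonal terms.\<close>

lemma act_tail_length:
 assumes "act \<omega> (s @ replicate L 1 @ [2]) e = act \<omega> (s' @ replicate L 1 @ [2]) e'" "length s \<le> L" "length s' \<le> L"
 shows "length s = length s'"
proof -
 have *: "\<not> length s < length s'"
  if eq: "act \<omega> (s @ replicate L 1 @ [2]) e = act \<omega> (s' @ replicate L 1 @ [2]) e'" and s': "length s' \<le> L" for s s' e e'
 proof
  assume l: "length s < length s'"
  let ?k = "length s + L"
  have "fst (act \<omega> (s @ replicate L 1 @ [2]) e) ?k = 2" by (subst fst_act) (simp_all add: nth_append)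
  moreover have "fst (act \<omega> (s' @ replicate L 1 @ [2]) e') ?k = 1" using l s' by (subst fst_act) (auto simp: nth_append)
  ultimately show False unfolding eq by simp
 qed
 show ?thesis using *[OF assms(1,3)] *[OF assms(1)[symmetric] assms(2)] by simp
qed

lemma idx_decompose:
 assumes "e \<in> idx n"
 obtains w d where "w \<in> Wn n" "length w = L" "d \<in> idx n" "e = act \<omega> w d"
proof -
 have "\<exists>w d. w \<in> Wn n \<and> length w = L \<and> d \<in> idx n \<and> e = act \<omega> w d"
  using assms
 proof (induction L arbitrary: e)
  case 0 then show ?case by (intro exI[of _ "[]"] exI[of _ e]) simp
 next
  case (Suc L)
  obtain w d where wd: "w \<in> Wn n" "length w = L" "d \<in> idx n" "itl \<omega> e = act \<omega> w d"
   using Suc.IH[OF itl_in_idx[OF Suc.prems]] by blast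
  have "e = act \<omega> (ihd e # w) d" using icons_itl[of \<omega> e] wd(4) by simp
  then show ?case using wd ihd_in[OF Suc.prems] by (intro exI[of _ "ihd e # w"] exI[of _ d]) simp
 qed
 then show ?thesis using that by blast
qed

context crossed
begin

lemma codew_in: "codew k \<in> Wn n"
 using n2 by (auto simp: codew_def)

lemma rc_X_Nil: "h \<in> DR ==> rc (X [] h) e e' = of_bool (e' \<in> idx n \<and> e = e') * complex_of_real (h (deg e'))"
 using rc_X[of "[]" h e e'] by simp

section \<open>Products of the elements \<open>X w h\<close>\<close>

lemma X_Nil_mult:
 assumes "c \<in> DR" "w \<in> Wn n" "h \<in> DR" "\<And>gm. c (gm + wt \<omega> w) * h gm = k gm" "k \<in> DR"
 shows "X [] c * X w h = X w k"
proof (rule rc_faithful)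
 fix e e' show "rc (X [] c * X w h) e e' = rc (X w k) e e'"
  by (simp add: rc_X_Nil_mult[OF assms(1)] rc_X[OF assms(2,3)] rc_X[OF assms(2,5)] assms(4)[symmetric])
qed

lemma X_mult_Nil:
 assumes "c \<in> DR" "w \<in> Wn n" "h \<in> DR" "\<And>gm. h gm * c gm = k gm" "k \<in> DR"
 shows "X w h * X [] c = X w k"
proof (rule rc_faithful)
 fix e e' show "rc (X w h * X [] c) e e' = rc (X w k) e e'"
  using rc_mult_X[of "[]" c "X w h" e e'] assms(1)
  by (simp add: rc_X[OF assms(2,3)] rc_X[OF assms(2,5)] assms(4)[symmetric])
qed

lemma DR_power2: "h \<in> DR ==> (%gm. (h gm)\<^sup>2) \<in> DR"
 using DR_mult[of h h] by (simp add: power2_eq_square)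

lemma star_X_mult_same:
 assumes "w \<in> Wn n" "h \<in> DR"
 shows "star (X w h) * X w h = X [] (%gm. (h gm)\<^sup>2)"
proof (rule rc_faithful)
 fix e e' show "rc (star (X w h) * X w h) e e' = rc (X [] (%gm. (h gm)\<^sup>2)) e e'"
  unfolding rc_star_X_mult[OF assms] rc_X[OF assms] rc_X_Nil[OF DR_power2[OF assms(2)]] by (simp add: power2_eq_square)
qed

lemma star_X_mult_orthogonal:
 assumes "w \<in> Wn n" "w' \<in> Wn n" "h \<in> DR" "h' \<in> DR" "\<And>e e'. act \<omega> w e \<noteq> act \<omega> w' e'"
 shows "star (X w h) * X w' h' = 0"
 by (rule rc_faithful) (simp only: rc_star_X_mult[OF assms(1,3)] rc_X[OF assms(2,4)] assms(5) simp_thms if_False mult_zero_right rc_zero)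

lemma X_sum:
 assumes "\<And>i. i \<in> T ==> f i \<in> DR"
 shows "(\<Sum>i\<in>T. X [] (f i)) = X [] (%gm. \<Sum>i\<in>T. f i gm)"
 by (rule rc_faithful) (simp add: rc_sum rc_X_Nil assms DR_sum sum_distrib_left del: of_bool_conj)

text \<open>Towers whose index ranges \<open>{m..<m + N}\<close> do not meet have orthogonal ranges;
  this keeps the several partial isometries of one construction apart.\<close>

definition tower :: "nat => nat => 'c => bool" where
 "tower m N x \<longleftrightarrow> (\<exists>w h. (\<forall>k<N. w k \<in> Wn n \<and> h k \<in> DR) \<and> x = (\<Sum>k<N. X (codew (m + k) @ w k) (h k)))"

lemma tower_orthogonal:
 assumes "tower m N x" "tower m' N' x'" "m + N \<le> m'"
 shows "star x * x' = 0"
proof -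
 obtain w h where x: "\<And>k. k < N ==> w k \<in> Wn n \<and> h k \<in> DR" "x = (\<Sum>k<N. X (codew (m + k) @ w k) (h k))"
  using assms(1) unfolding tower_def by blast
 obtain w' h' where x': "\<And>k. k < N' ==> w' k \<in> Wn n \<and> h' k \<in> DR" "x' = (\<Sum>k<N'. X (codew (m' + k) @ w' k) (h' k))"
  using assms(2) unfolding tower_def by blast
 have "star (X (codew (m + k) @ w k) (h k)) * X (codew (m' + l) @ w' l) (h' l) = 0" if "k < N" "l < N'" for k l
 proof (rule star_X_mult_orthogonal)
  fix e e' show "act \<omega> (codew (m + k) @ w k) e \<noteq> act \<omega> (codew (m' + l) @ w' l) e'"
   using act_codew[of \<omega> "m + k" "w k" e "m' + l" "w' l" e'] that assms(3) by linarith
 qed (use x(1) x'(1) that codew_in in simp_all)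
 then show ?thesis unfolding x(2) x'(2) star_sum sum_distrib_left sum_distrib_right by simp
qed

lemma DR_clamp: "g \<in> DR ==> 0 \<le> b ==> (%gm. min 1 (max 0 (a * g gm - b))) \<in> DR"
 by (rule DR_compose) (auto intro!: continuous_intros)

lemma els_closed_imp:
 assumes "closed {x. Q x}" "\<And>L y. y \<in> els (%k l. k \<le> L \<and> l \<le> L) ==> Q y"
 shows "Q x"
proof -
 have "\<exists>y\<in>{x. Q x}. dist y x < e" if e: "0 < e" for e
 proof -
  obtain y L where "y \<in> els (%a b. a \<le> L \<and> b \<le> L)" "norm (x - y) \<le> e / 2"
   by (rule els_dense[of "e / 2" x]) (use e in simp, rule that)
  then show ?thesis using assms(2)[of y L] e by (intro bexI[of _ y]) (simp_all add: dist_norm norm_minus_commute)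
 qed
 then show ?thesis using closed_approachable[OF assms(1)] by blast
qed

lemma rc_els_support:
 assumes "b \<in> els P" "rc b e e' \<noteq> 0"
 shows "\<exists>u v d. P (length u) (length v) \<and> u \<in> Wn n \<and> v \<in> Wn n \<and> e = act \<omega> u d \<and> e' = act \<omega> v d"
 using assms
proof (induction rule: els_induct)
 case (add u v \<phi> y)
 show ?case
 proof (cases "rc (el u v \<phi>) e e' = 0")
  case True
  with add show ?thesis by (simp add: rc_add)
 next
  case False
  then obtain d where d: "e' = act \<omega> v d" using rc_el(2)[OF add(4,1,2)] by blast
  have "e = act \<omega> u d" using False unfolding d rc_el(1)[OF add(4,1,2)] by (simp split: if_splits)
  then show ?thesis using add(1-3) d by blast
 qed
qed simp

text \<open>The columns of \<open>b\<close> are finite, so right multiplication by \<open>b\<close>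
  is a finite matrix product even for an arbitrary left factor.\<close>

lemma rc_els_product:
 assumes "b \<in> els P"
 shows "\<exists>C. finite C \<and> (\<forall>c. rc b c e' \<noteq> 0 --> c \<in> C) \<and> (\<forall>a e. rc (a * b) e e' = (\<Sum>c\<in>C. rc a e c * rc b c e'))"
 using assms
proof (induction rule: els_induct)
 case zero show ?case by (rule exI[of _ "{}"]) simp
next
 case (add u v \<phi> y)
 obtain C where C: "finite C" "\<And>c. rc y c e' \<noteq> 0 ==> c \<in> C" "\<And>a e. rc (a * y) e e' = (\<Sum>c\<in>C. rc a e c * rc y c e')"
  using add.IH by blast
 have "\<exists>k. \<forall>a e. (rc (el u v \<phi>) e e' \<noteq> 0 --> e = k) \<and> rc (a * el u v \<phi>) e e' = rc a e k * rc (el u v \<phi>) k e'"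
 proof (cases "\<exists>d. e' = act \<omega> v d")
  case True
  then obtain d where d: "e' = act \<omega> v d" by blast
  have "rc a e (act \<omega> u d) = 0" if "d \<notin> idx n" for a e using that add(1) by (intro rc_outside) simp
  then show ?thesis unfolding d rc_mult_el(1)[OF add(4,1,2)] rc_el(1)[OF add(4,1,2)] by (intro exI[of _ "act \<omega> u d"]) simp
 next
  case False
  then have "e' \<noteq> act \<omega> v d" for d by blast
  from rc_mult_el(2)[OF add(4,1,2) this] rc_el(2)[OF add(4,1,2) this] show ?thesis
   by (intro exI[of _ e'] allI) simp
 qed
 then obtain k where k: "\<And>e. rc (el u v \<phi>) e e' \<noteq> 0 ==> e = k" "\<And>a e. rc (a * el u v \<phi>) e e' = rc a e k * rc (el u v \<phi>) k e'" by blast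
 show ?case
 proof (intro exI[of _ "insert k C"] conjI allI impI)
  show "finite (insert k C)" using C(1) by simp
  show "c \<in> insert k C" if "rc (el u v \<phi> + y) c e' \<noteq> 0" for c
  proof -
   have "rc (el u v \<phi>) c e' \<noteq> 0 \<or> rc y c e' \<noteq> 0" using that by (auto simp: rc_add)
   then show ?thesis using k(1) C(2) by blast
  qed
  fix a e
  have "(\<Sum>c\<in>insert k C. rc a e c * rc y c e') = (\<Sum>c\<in>C. rc a e c * rc y c e')"
   using C by (intro sum.mono_neutral_right) auto
  moreover have "(\<Sum>c\<in>insert k C. rc a e c * rc (el u v \<phi>) c e') = (\<Sum>c\<in>{k}. rc a e c * rc (el u v \<phi>) c e')"
   using C(1) k(1) by (intro sum.mono_neutral_right) auto
  ultimately show "rc (a * (el u v \<phi> + y)) e e' = (\<Sum>c\<in>insert k C. rc a e c * rc (el u v \<phi> + y) c e')"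
   by (simp add: distrib_left rc_add sum.distrib k(2) C(3))
 qed
qed

text \<open>The diagonal entry is the squared length of a column of \<open>x\<close>. The inequality
  over a finite set of rows is the form that survives limits.\<close>

lemma diagonal_square:
 assumes A: "finite A"
 shows "(\<Sum>e\<in>A. (cmod (rc x e e'))\<^sup>2) \<le> Re (rc (star x * x) e' e')"
proof (rule els_closed_imp[where Q = "%x. (\<Sum>e\<in>A. (cmod (rc x e e'))\<^sup>2) \<le> Re (rc (star x * x) e' e')"])
 show "closed {x. (\<Sum>e\<in>A. (cmod (rc x e e'))\<^sup>2) \<le> Re (rc (star x * x) e' e')}" by (intro closed_Collect_le continuous_intros)
 fix L y assume "y \<in> els (%k l. k \<le> L \<and> l \<le> L)"
 from rc_els_product[OF this, of e'] obtain C where C: "finite C" "\<And>c. rc y c e' \<noteq> 0 ==> c \<in> C"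
  "\<And>a e. rc (a * y) e e' = (\<Sum>c\<in>C. rc a e c * rc y c e')" by blast
 have "rc (star y * y) e' e' = complex_of_real (\<Sum>c\<in>C. (cmod (rc y c e'))\<^sup>2)"
  by (simp add: C(3) rc_star complex_norm_square mult.commute del: of_real_power)
 then have "Re (rc (star y * y) e' e') = (\<Sum>c\<in>C. (cmod (rc y c e'))\<^sup>2)" by simp
 moreover have "(\<Sum>e\<in>A. (cmod (rc y e e'))\<^sup>2) = (\<Sum>e\<in>A \<inter> C. (cmod (rc y e e'))\<^sup>2)"
  by (rule sum.mono_neutral_right[OF A]) (use C(2) in fastforce)+
 moreover have "\<dots> \<le> (\<Sum>e\<in>C. (cmod (rc y e e'))\<^sup>2)" using C(1) by (intro sum_mono2) auto
 ultimately show "(\<Sum>e\<in>A. (cmod (rc y e e'))\<^sup>2) \<le> Re (rc (star y * y) e' e')" by simp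
qed

lemma norm_X_Nil: "h \<in> DR ==> (\<And>gm. 0 \<le> h gm \<and> h gm \<le> 1) ==> norm (X [] h) \<le> 1"
 by (rule norm_diagonal_le) (simp_all add: rc_X_Nil norm_mult)

section \<open>Approximate units from cutoff functions\<close>

text \<open>\<open>h\<close> is 1 wherever \<open>r\<close> exceeds 1. Enlarging \<open>r\<close>
  only sharpens the condition, so thresholds belonging to several elements can be added.\<close>

definition cutoff :: "('g character => real) => ('g character => real) => bool" where
 "cutoff r h \<longleftrightarrow> h \<in> DR \<and> (\<forall>gm. 0 \<le> h gm \<and> h gm \<le> 1 \<and> (h gm \<noteq> 1 --> r gm \<le> 1))"

lemma cutoff_exists:
 assumes "r \<in> DR"
 obtains h where "cutoff r h" "\<And>gm. h gm \<noteq> 0 ==> 1 / 3 \<le> r gm"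
proof (rule that)
 show "cutoff r (%gm. min 1 (max 0 (3 / 2 * r gm - 1 / 2)))" unfolding cutoff_def
  by (intro conjI DR_clamp assms) (auto simp: min_def max_def split: if_splits)
qed (auto simp: min_def max_def split: if_splits)

text \<open>The scaled square makes \<open>h\<close> differ from 1 only where the Fourier transform
  of \<open>\<phi>\<close> is at most \<open>\<delta>\<close> in modulus.\<close>

lemma approximate_unit_el:
 assumes uv: "u \<in> Wn n" "v \<in> Wn n" and \<phi>: "\<phi> \<in> Cc" and \<delta>: "0 < \<delta>"
  and h: "cutoff (%gm. 1 / \<delta>\<^sup>2 * (cmod (fourier \<phi> gm))\<^sup>2) h"
 shows "norm (el u v \<phi> - el u v \<phi> * X [] h) \<le> \<delta>"
proof -
 have hD: "h \<in> DR" and k: "0 \<le> h gm" "h gm \<le> 1" "h gm \<noteq> 1 ==> 1 / \<delta>\<^sup>2 * (cmod (fourier \<phi> gm))\<^sup>2 \<le> 1" for gm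
  using h unfolding cutoff_def by blast+
 let ?d = "el u v \<phi> - el u v \<phi> * X [] h"
 have rcd: "rc ?d e e' = rc (el u v \<phi>) e e' * complex_of_real (1 - h (deg e'))" for e e'
  using rc_mult_X[of "[]" h "el u v \<phi>" e e'] hD by (simp add: rc_diff right_diff_distrib)
 have nz: "\<exists>d. e = act \<omega> u d \<and> e' = act \<omega> v d \<and> rc (el u v \<phi>) e e' = fourier \<phi> (deg e')" if nz: "rc (el u v \<phi>) e e' \<noteq> 0" for e e'
 proof -
  obtain d where d: "e' = act \<omega> v d" using rc_el(2)[OF \<phi> uv] nz by blast
  show ?thesis using nz unfolding d rc_el(1)[OF \<phi> uv] by (intro exI[of _ d]) (auto split: if_splits)
 qed
 have "mbd (rc ?d) \<delta>"
 proof (rule mbd_partial_injection)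
  fix e e' :: "'g idx"
  show "cmod (rc ?d e e') \<le> \<delta>"
  proof (cases "rc (el u v \<phi>) e e' = 0 \<or> h (deg e') = 1")
   case False
   then have "rc (el u v \<phi>) e e' = fourier \<phi> (deg e')" "1 / \<delta>\<^sup>2 * (cmod (fourier \<phi> (deg e')))\<^sup>2 \<le> 1" using nz[of e e'] k(3) by blast+
   then have "cmod (rc (el u v \<phi>) e e') \<le> \<delta>"
    using \<delta> power2_le_imp_le[of "cmod (rc (el u v \<phi>) e e')" \<delta>] by (simp add: divide_le_eq)
   then have "cmod (rc (el u v \<phi>) e e') * \<bar>1 - h (deg e')\<bar> \<le> \<delta> * 1"
    using k(1,2)[of "deg e'"] \<delta> by (intro mult_mono) simp_all
   then show ?thesis unfolding rcd norm_mult norm_of_real by simp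
  qed (use \<delta> in \<open>auto simp: rcd\<close>)
 next
  fix e a b assume "rc ?d e a \<noteq> 0" "rc ?d e b \<noteq> 0"
  then have "rc (el u v \<phi>) e a \<noteq> 0" "rc (el u v \<phi>) e b \<noteq> 0" unfolding rcd by auto
  from nz[OF this(1)] nz[OF this(2)] show "a = b" by (metis act_inject)
 next
  fix e a b assume "rc ?d a e \<noteq> 0" "rc ?d b e \<noteq> 0"
  then have "rc (el u v \<phi>) a e \<noteq> 0" "rc (el u v \<phi>) b e \<noteq> 0" unfolding rcd by auto
  from nz[OF this(1)] nz[OF this(2)] show "a = b" by (metis act_inject)
 qed (use \<delta> in simp)
 then show ?thesis unfolding norm_eq_rn rn_def by (rule opn_le)
qed

lemma approximate_unit:
 assumes "0 < \<epsilon>"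
 shows "\<exists>r\<in>DR. (\<forall>gm. 0 \<le> r gm) \<and> (\<forall>h. cutoff r h --> norm (x - x * X [] h) \<le> \<epsilon>)"
proof -
 have els: "\<exists>r\<in>DR. (\<forall>gm. 0 \<le> r gm) \<and> (\<forall>h. cutoff r h --> norm (y - y * X [] h) \<le> \<epsilon>)"
  if "y \<in> els P" "0 < \<epsilon>" for y P \<epsilon>
  using that
 proof (induction arbitrary: \<epsilon> rule: els_induct)
  case zero then show ?case by (intro bexI[OF _ DR_zero]) simp
 next
  case (add u v \<phi> y)
  then have e: "0 < \<epsilon> / 2" by simp
  obtain r where r: "r \<in> DR" "\<And>gm. 0 \<le> r gm" "\<And>h. cutoff r h ==> norm (y - y * X [] h) \<le> \<epsilon> / 2" using add.IH[OF e] by blast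
  define s where "s gm = 1 / (\<epsilon> / 2)\<^sup>2 * (cmod (fourier \<phi> gm))\<^sup>2" for gm
  have s: "s \<in> DR" "\<And>gm. 0 \<le> s gm" unfolding s_def[abs_def] by (intro DR_scale DR_norm_fourier add, simp)
  show ?case
  proof (intro bexI[OF _ DR_add[OF r(1) s(1)]] conjI allI impI)
   show "0 \<le> r gm + s gm" for gm using r(2) s(2) by (simp add: add_nonneg_nonneg)
   fix h assume h: "cutoff (%gm. r gm + s gm) h"
   have "r gm \<le> r gm + s gm" "s gm \<le> r gm + s gm" for gm using r(2) s(2) by simp_all
   then have "cutoff r h" "cutoff s h" using h unfolding cutoff_def by (meson order_trans)+
   note 1 = approximate_unit_el[OF add(1,2,4) e this(2)[unfolded s_def[abs_def]]] and 2 = r(3)[OF this(1)]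
   show "norm (el u v \<phi> + y - (el u v \<phi> + y) * X [] h) \<le> \<epsilon>"
    using norm_triangle_mono[OF 1 2] by (simp add: distrib_right algebra_simps)
  qed
 qed
 have e: "0 < \<epsilon> / 3" using assms by simp
 obtain y L where y: "y \<in> els (%a b. a \<le> L \<and> b \<le> L)" "norm (x - y) \<le> \<epsilon> / 3" by (rule els_dense[OF e]) (rule that)
 obtain r where r: "r \<in> DR" "\<And>gm. 0 \<le> r gm" "\<And>h. cutoff r h ==> norm (y - y * X [] h) \<le> \<epsilon> / 3" using els[OF y(1) e] by blast
 have "norm (x - x * X [] h) \<le> \<epsilon>" if h: "cutoff r h" for h
 proof -
  have "norm (X [] h) \<le> 1" using h unfolding cutoff_def by (intro norm_X_Nil) blast+
  then have "norm ((y - x) * X [] h) \<le> \<epsilon> / 3"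
   using order_trans[OF norm_mult_ineq mult_mono[OF y(2)[unfolded norm_minus_commute[of x]] _ _ norm_ge_zero], of "X [] h" 1] e by simp
  from norm_triangle_mono[OF norm_triangle_mono[OF y(2) r(3)[OF h]] this] show ?thesis by (simp add: left_diff_distrib)
 qed
 then show ?thesis using r(1,2) by blast
qed

context
 assumes dense: "closure {wt \<omega> w | w. w \<in> Wn n} = UNIV"
begin

text \<open>The support of \<open>G\<close> is totally bounded, hence covered by finitely many
  translates of one small neighbourhood. Density supplies for each centre a word that moves it to
  where \<open>g\<close> is close to 1; the prefix \<open>codew (m + k)\<close> makes the ranges
  orthogonal, and its weight is compensated in the choice of the word. Normalising the resulting
  bumps gives \<open>star x * x = X [] G\<close>.\<close>

lemma tower_exists:
 assumes r: "r \<in> DR" and G: "G \<in> DR" "\<And>gm. 0 \<le> G gm" "\<And>gm. G gm \<noteq> 0 ==> 1 / 3 \<le> r gm"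
  and g: "g \<in> DR" "g gm0 = 1"
 obtains x N where "tower m N x" "star x * x = X [] G"
  "\<forall>c\<in>DR. (\<forall>gm. 5 / 6 \<le> g gm --> c gm = 1) --> X [] c * x = x"
  "\<forall>c\<in>DR. (\<forall>gm. G gm \<noteq> 0 --> c gm = 1) --> x * X [] c = x"
proof -
 \<comment> \<open>The centres reach \<open>g > 11/12\<close>; an oscillation of at most 1/24 leaves
   \<open>g > 7/8\<close>, which exceeds 5/6 by 1/24. This is the lower bound for
   \<open>A\<close>.\<close>
 obtain K e where K: "compact K" "0 < e" "\<And>gm \<psi>. near K e gm \<psi> ==> \<bar>g \<psi> - g gm\<bar> \<le> 1 / 24"
  by (rule DR_nearE[OF g(1), of "1 / 24"]) (simp, rule that)
 obtain T where T: "finite T" "\<And>gm. 1 / 3 \<le> r gm ==> \<exists>\<theta>\<in>T. near K e \<theta> gm"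
  by (rule DR_totally_bounded[OF r _ K(1,2), of "1 / 3"]) (simp, rule that)
 obtain N \<theta> where N: "T = \<theta> ` {k::nat. k < N}" using finite_imp_nat_seg_image_inj_on[OF T(1)] by blast
 have ex: "\<exists>w. w \<in> Wn n \<and> 11 / 12 < g (\<theta> k + wt \<omega> (codew (m + k) @ w))" for k
 proof -
  let ?\<eta> = "\<theta> k + wt \<omega> (codew (m + k))"
  let ?U = "{gm. 11 / 12 < g (gm + ?\<eta>)}"
  have "gm0 - ?\<eta> \<in> ?U" by (simp add: g(2))
  then have "?U \<inter> closure {wt \<omega> w | w. w \<in> Wn n} \<noteq> {}" unfolding dense by blast
  then have "?U \<inter> {wt \<omega> w | w. w \<in> Wn n} \<noteq> {}"
   unfolding open_Int_closure_eq_empty[OF DR_open[OF DR_translate[OF g(1)]]] .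
  then obtain w where "w \<in> Wn n" "11 / 12 < g (wt \<omega> w + ?\<eta>)" by blast
  then show ?thesis by (intro exI[of _ w]) (simp add: add_ac)
 qed
 obtain w where w': "\<forall>k. w k \<in> Wn n \<and> 11 / 12 < g (\<theta> k + wt \<omega> (codew (m + k) @ w k))"
  using choice[OF allI[OF ex]] by (rule exE) (rule that)
 have w: "w k \<in> Wn n" "11 / 12 < g (\<theta> k + wt \<omega> (codew (m + k) @ w k))" for k
  using spec[OF w', of k] by (rule conjunct1, rule conjunct2)
 define W where "W k = codew (m + k) @ w k" for k
 have W: "W k \<in> Wn n" for k using w(1) codew_in by (simp add: W_def)
 define a where "a k gm = max 0 (g (gm + wt \<omega> (W k)) - 5 / 6)" for k gm
 define A where "A gm = (\<Sum>k<N. a k gm)" for gm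
 have aD: "a k \<in> DR" for k unfolding a_def[abs_def]
  by (rule DR_compose[OF DR_translate[OF g(1)], where F = "%x. max 0 (x - 5 / 6)"]) (auto intro!: continuous_intros)
 have a0: "0 \<le> a k gm" for k gm by (simp add: a_def)
 have AD: "A \<in> DR" unfolding A_def[abs_def] by (rule DR_sum) (rule aD)
 have A: "1 / 24 \<le> A gm" if rgm: "1 / 3 \<le> r gm" for gm
 proof -
  obtain k where k: "k < N" "near K e (\<theta> k) gm" using T(2)[OF rgm] unfolding N by blast
  have "\<bar>g (gm + wt \<omega> (W k)) - g (\<theta> k + wt \<omega> (W k))\<bar> \<le> 1 / 24"
   by (rule K(3)) (simp only: near_translate k(2))
  with w(2)[of k] have "1 / 24 \<le> a k gm" unfolding a_def W_def[symmetric] by linarith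
  also have "\<dots> \<le> A gm" unfolding A_def by (rule member_le_sum) (use k a0 in auto)
  finally show ?thesis .
 qed
 \<comment> \<open>Where \<open>G\<close> is nonzero the maximum equals \<open>A\<close>; elsewhere
   it keeps the quotient continuous.\<close>
 define h where "h k gm = sqrt (G gm * a k gm / max (A gm) (1 / 24))" for k gm
 have hD: "h k \<in> DR" for k
 proof -
  have nz: "max x (1 / 24) \<noteq> 0" for x :: real by (simp add: max_def)
  \<comment> \<open>The value 24 at 0 is subtracted to enter \<open>DR\<close>, and is added back
    under the root.\<close>
  have q: "(%gm. 1 / max (A gm) (1 / 24) - 24) \<in> DR"
   by (rule DR_compose[OF AD, where F = "%x. 1 / max x (1 / 24) - 24"]) (auto intro!: continuous_intros simp: nz)
  have "(%gm. sqrt (24 * (G gm * a k gm) + G gm * a k gm * (1 / max (A gm) (1 / 24) - 24))) \<in> DR"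
   by (rule DR_compose[of _ sqrt]) (intro DR_add DR_scale DR_mult G aD q, auto intro!: continuous_intros)
  then show ?thesis by (simp add: h_def[abs_def] algebra_simps)
 qed
 have h2: "(h k gm)\<^sup>2 = G gm * a k gm / max (A gm) (1 / 24)" for k gm
  unfolding h_def by (rule real_sqrt_pow2) (intro divide_nonneg_nonneg mult_nonneg_nonneg G a0, simp add: max_def)
 have hsum: "(\<Sum>k<N. (h k gm)\<^sup>2) = G gm" for gm
 proof (cases "G gm = 0")
  case False
  have A24: "1 / 24 \<le> A gm" by (rule A[OF G(3)[OF False]])
  have "(\<Sum>k<N. (h k gm)\<^sup>2) = G gm * A gm / max (A gm) (1 / 24)"
   by (simp add: h2 A_def sum_distrib_left sum_divide_distrib)
  then show ?thesis using A24 by (simp add: max_def)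
 qed (simp add: h2)
 have h_nz: "5 / 6 \<le> g (gm + wt \<omega> (W k))" "G gm \<noteq> 0" if "h k gm \<noteq> 0" for k gm
  using that by (auto simp: h_def a_def max_def split: if_splits)
 define x where "x = (\<Sum>k<N. X (W k) (h k))"
 have orth: "star (X (W k) (h k)) * X (W l) (h l) = (if l = k then X [] (%gm. (h k gm)\<^sup>2) else 0)" for k l
 proof (cases "l = k")
  case False
  have "act \<omega> (W k) e \<noteq> act \<omega> (W l) e'" for e e'
   using act_codew[of \<omega> "m + k" "w k" e "m + l" "w l" e'] False unfolding W_def by auto
  then show ?thesis using False by (simp add: star_X_mult_orthogonal[OF W W hD hD])
 qed (simp add: star_X_mult_same[OF W hD])
 have h2D: "(%gm. (h k gm)\<^sup>2) \<in> DR" for k using DR_mult[OF hD hD] by (simp add: power2_eq_square)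
 show ?thesis
 proof (rule that[of N x])
  show "tower m N x" unfolding tower_def x_def W_def
   by (intro exI[of _ w] exI[of _ h] conjI allI impI refl w(1) hD)
  have "star x * x = (\<Sum>k<N. X [] (%gm. (h k gm)\<^sup>2))"
   unfolding x_def star_sum sum_distrib_left sum_distrib_right orth by simp
  then show "star x * x = X [] G" by (simp add: X_sum[OF h2D] hsum)
  show "\<forall>c\<in>DR. (\<forall>gm. 5 / 6 \<le> g gm --> c gm = 1) --> X [] c * x = x"
  proof (intro ballI impI)
   fix c assume c: "c \<in> DR" and c1: "\<forall>gm. 5 / 6 \<le> g gm --> c gm = 1"
   have eq: "c (gm + wt \<omega> (W k)) * h k gm = h k gm" for k gm
    using c1 h_nz(1)[of k gm] by (cases "h k gm = 0") auto
   show "X [] c * x = x" unfolding x_def sum_distrib_left by (rule sum.cong[OF refl X_Nil_mult[OF c W hD eq hD]])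
  qed
  show "\<forall>c\<in>DR. (\<forall>gm. G gm \<noteq> 0 --> c gm = 1) --> x * X [] c = x"
  proof (intro ballI impI)
   fix c assume c: "c \<in> DR" and c1: "\<forall>gm. G gm \<noteq> 0 --> c gm = 1"
   have eq: "h k gm * c gm = h k gm" for k gm
    using c1 h_nz(2)[of k gm] by (cases "h k gm = 0") auto
   show "x * X [] c = x" unfolding x_def sum_distrib_right by (rule sum.cong[OF refl X_mult_Nil[OF c W hD eq hD]])
  qed
 qed
qed

text \<open>\<open>1 - y\<close> is an isometry in the unitization, \<open>p\<close> is its defect projection, and \<open>x2\<close> and \<open>x3\<close>
 map into the range of \<open>p\<close>.\<close>

lemma infinite_projection_exists:
 assumes g: "g \<in> DR" "g gm0 = 1"
 obtains p E z where "infinite_projection p" "E \<in> DR" "\<And>gm. 0 \<le> E gm" "\<And>gm. E gm \<le> 1" "\<And>gm. E gm \<noteq> 0 ==> g gm \<noteq> 0"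
  "\<And>gm. 5 / 6 \<le> g gm ==> E gm = 1" "p * X [] E = p" "star z * p * z = X [] (%gm. (E gm)\<^sup>2)"
proof -
 \<comment> \<open>Nested cutoffs: \<open>E\<close> is 1 where \<open>g \<ge> 2/3\<close> and
   vanishes where \<open>g < 1/3\<close>; \<open>d\<close> is 1 where \<open>g \<ge> 5/6\<close> and
   vanishes where \<open>g < 2/3\<close>. Hence \<open>E d = d\<close>, and a tower with range in
   \<open>g \<ge> 5/6\<close> is fixed by both.\<close>
 define E where "E gm = min 1 (max 0 (3 * g gm - 1))" for gm
 define d where "d gm = min 1 (max 0 (6 * g gm - 4))" for gm
 have ED: "E \<in> DR" and dD: "d \<in> DR" unfolding E_def[abs_def] d_def[abs_def] by (rule DR_clamp[OF g(1)], simp)+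
 have E: "0 \<le> E gm" "E gm \<le> 1" "E gm \<noteq> 0 ==> 1 / 3 \<le> g gm" "2 / 3 \<le> g gm ==> E gm = 1" for gm
  by (auto simp: E_def min_def max_def split: if_splits)
 have d: "0 \<le> d gm" "d gm \<le> 1" "d gm \<noteq> 0 ==> 2 / 3 \<le> g gm" "5 / 6 \<le> g gm ==> d gm = 1" for gm
  by (auto simp: d_def min_def max_def split: if_splits)
 have d2D: "(%gm. (d gm)\<^sup>2) \<in> DR" and E2D: "(%gm. (E gm)\<^sup>2) \<in> DR"
  using DR_mult[OF dD dD] DR_mult[OF ED ED] by (simp_all add: power2_eq_square)
 \<comment> \<open>\<open>1 - G = (1 - d)^2\<close>, so \<open>(1 - D) + x1\<close> becomes an
   isometry once \<open>star x1 * x1 = X [] G\<close> and \<open>D * x1 = x1\<close>.\<close>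
 define G where "G gm = 2 * d gm - (d gm)\<^sup>2" for gm
 have GD: "G \<in> DR" unfolding G_def[abs_def] by (intro DR_diff DR_scale dD d2D)
 have G0: "0 \<le> G gm" for gm
  using mult_nonneg_nonneg[of "d gm" "2 - d gm"] d(1,2)[of gm] by (simp add: G_def power2_eq_square algebra_simps)
 have Gd: "G gm \<noteq> 0 ==> 2 / 3 \<le> g gm" for gm using d(3)[of gm] by (cases "d gm = 0") (simp_all add: G_def)
 have Gr: "G gm \<noteq> 0 ==> 1 / 3 \<le> g gm" for gm using Gd[of gm] by simp
 have E2r: "(E gm)\<^sup>2 \<noteq> 0 ==> 1 / 3 \<le> g gm" for gm using E(3)[of gm] by simp
 \<comment> \<open>The three towers use consecutive index ranges, which makes them
   orthogonal.\<close>
 obtain x1 N1 where x1: "tower 0 N1 x1" "star x1 * x1 = X [] G"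
  "\<forall>c\<in>DR. (\<forall>gm. 5 / 6 \<le> g gm --> c gm = 1) --> X [] c * x1 = x1"
  "\<forall>c\<in>DR. (\<forall>gm. G gm \<noteq> 0 --> c gm = 1) --> x1 * X [] c = x1"
  by (rule tower_exists[OF g(1) GD G0 Gr g, of 0]) (assumption, rule that)
 obtain x2 N2 where x2: "tower N1 N2 x2" "star x2 * x2 = X [] (%gm. (E gm)\<^sup>2)"
  "\<forall>c\<in>DR. (\<forall>gm. 5 / 6 \<le> g gm --> c gm = 1) --> X [] c * x2 = x2"
  by (rule tower_exists[OF g(1) E2D _ E2r g, of N1]) (simp, assumption, rule that)
 obtain x3 N3 where x3: "tower (N1 + N2) N3 x3" "star x3 * x3 = X [] (%gm. (E gm)\<^sup>2)"
  "\<forall>c\<in>DR. (\<forall>gm. 5 / 6 \<le> g gm --> c gm = 1) --> X [] c * x3 = x3"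
  by (rule tower_exists[OF g(1) E2D _ E2r g, of "N1 + N2"]) (simp, assumption, rule that)
 have o12: "star x1 * x2 = 0" and o13: "star x1 * x3 = 0" and o23: "star x2 * x3 = 0"
  by (rule tower_orthogonal[OF x1(1) x2(1)], simp, rule tower_orthogonal[OF x1(1) x3(1)], simp, rule tower_orthogonal[OF x2(1) x3(1)], simp)
 define D e where "D = X [] d" and "e = X [] E"
 have sD: "star D = D" and se: "star e = e" unfolding D_def e_def by (simp_all add: star_X_Nil dD ED)
 have D1: "D * x1 = x1" "D * x2 = x2" "D * x3 = x3" unfolding D_def
  using x1(3) x2(3) x3(3) dD d(4) by blast+
 have E56: "5 / 6 \<le> g gm ==> E gm = 1" for gm using E(4)[of gm] by simp
 have e1: "e * x1 = x1" "x1 * e = x1" unfolding e_def using x1(3,4) ED E56 E(4) Gd by blast+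
 have de: "d gm * E gm = d gm" for gm using d(3)[of gm] E(4)[of gm] by (cases "d gm = 0") auto
 have De: "D * e = D" unfolding D_def e_def by (rule X_mult_Nil[OF ED _ dD de dD]) simp
 have ee: "X [] (%gm. (E gm)\<^sup>2) = e * e" unfolding e_def
  by (rule X_mult_Nil[OF ED _ ED _ E2D, symmetric]) (simp_all add: power2_eq_square)
 have x11: "star x1 * x1 = D + D - D * D"
  unfolding x1(2) D_def
  by (rule rc_faithful) (auto simp: rc_diff rc_add rc_X_Nil_mult rc_X GD dD G_def power2_eq_square)
 define y where "y = D - x1"
 \<comment> \<open>In the unitization \<open>p = 1 - (1 - y) * star (1 - y)\<close>.\<close>
 define p where "p = y + star y - y * star y"
 have x1D: "star x1 * D = star x1" using arg_cong[OF D1(1), of star] by (simp add: star_mult sD)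
 have sy: "star y = D - star x1" by (simp add: y_def star_diff sD)
 have yy: "star y * y = y + star y"
  unfolding sy unfolding y_def by (simp add: left_diff_distrib right_diff_distrib D1 x1D x11)
 have sp: "star p = p" by (simp add: p_def star_diff star_add star_mult star_star add.commute)
 have py: "p * y = p"
 proof -
  have "p * y = y * y + star y * y - y * (star y * y)" by (simp add: p_def left_diff_distrib distrib_right mult.assoc)
  then show ?thesis unfolding yy by (simp add: p_def distrib_left)
 qed
 have pp: "p * p = p"
 proof -
  have "p * p = p * y + p * star y - p * y * star y" by (subst (2) p_def) (simp add: right_diff_distrib distrib_left mult.assoc)
  then show ?thesis by (simp add: py)
 qed
 have px: "p * x = x" if "D * x = x" "star x1 * x = 0" for x
 proof -
  have "star y * x = x" using that by (simp add: sy left_diff_distrib)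
  then show ?thesis by (simp add: p_def left_diff_distrib distrib_right mult.assoc)
 qed
 have p2: "p * x2 = x2" and p3: "p * x3 = x3" by (rule px[OF D1(2) o12], rule px[OF D1(3) o13])
 have pe: "p * e = p"
 proof -
  have "star x1 * e = star x1" using arg_cong[OF e1(1), of star] by (simp add: star_mult se)
  then have "star y * e = star y" by (simp add: sy left_diff_distrib De)
  moreover have "y * e = y" by (simp add: y_def left_diff_distrib De e1)
  ultimately show ?thesis by (simp add: p_def left_diff_distrib distrib_right mult.assoc)
 qed
 have proj: "projection p" unfolding projection_def using pp sp by simp
 \<comment> \<open>\<open>x2\<close> carries \<open>p\<close> onto a subprojection \<open>q\<close>
   of \<open>p\<close>. It is proper, because \<open>x3\<close> is fixed by \<open>p\<close> but
   annihilated by \<open>q\<close>, being orthogonal to \<open>x2\<close>.\<close>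
 define v where "v = x2 * p"
 define q where "q = x2 * p * star x2"
 have pxxp: "p * (star x2 * (x2 * p)) = p"
 proof -
  have "star x2 * (x2 * p) = e * (e * p)" using x2(2) ee by (simp flip: mult.assoc)
  moreover have "e * p = p" using arg_cong[OF pe, of star] by (simp add: star_mult se sp)
  ultimately show ?thesis by (simp add: pp)
 qed
 have inf: "infinite_projection p" unfolding infinite_projection_def
 proof (intro conjI exI)
  show "projection p" by (rule proj)
  show "projection q" unfolding projection_def q_def
  proof
   have "x2 * p * star x2 * (x2 * p * star x2) = x2 * (p * (star x2 * (x2 * p))) * star x2" by (simp add: mult.assoc)
   then show "x2 * p * star x2 * (x2 * p * star x2) = x2 * p * star x2" by (simp add: pxxp)
   show "star (x2 * p * star x2) = x2 * p * star x2" by (simp add: star_mult star_star sp mult.assoc)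
  qed
  show "p * q = q" by (simp add: q_def p2 flip: mult.assoc)
  show "star v * v = p" by (simp add: v_def star_mult sp pxxp mult.assoc)
  show "v * star v = q" by (simp add: v_def q_def star_mult sp mult.assoc) (simp add: pp flip: mult.assoc[of p])
  show "q \<noteq> p"
  proof
   assume "q = p"
   then have "x3 = q * x3" using p3 by simp
   then have "x3 = 0" by (simp add: q_def mult.assoc o23)
   then have 0: "X [] (%gm. (E gm)\<^sup>2) = 0" using x3(2) by simp
   obtain d where "d \<in> idx n" "deg d = gm0" using idx_deg_exists by blast
   then have "rc (X [] (%gm. (E gm)\<^sup>2)) d d = complex_of_real ((E gm0)\<^sup>2)" by (simp add: rc_X E2D)
   moreover have "E gm0 = 1" using E56[of gm0] g(2) by simp
   ultimately show False unfolding 0 by simp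
  qed
 qed
 show ?thesis
 proof (rule that[OF inf ED E(1,2) _ E56])
  show "g gm \<noteq> 0" if "E gm \<noteq> 0" for gm using E(3)[OF that] by auto
  show "p * X [] E = p" using pe by (simp add: e_def)
  show "star x2 * p * x2 = X [] (%gm. (E gm)\<^sup>2)" by (simp add: mult.assoc p2 x2(2))
 qed
qed

section \<open>Compression to an infinite projection\<close>

text \<open>A term \<open>S_u \<phi> S_v^*\<close> survives the compression only if \<open>u\<close>
  and \<open>v\<close> are prefixes of \<open>w0\<close>, and then the marker \<open>1^L 2\<close>
  forces equal lengths, so \<open>u = v\<close>. What remains is a function of the degree; the last
  clause recovers its values from basis vectors that begin with \<open>w0\<close>.\<close>

lemma compress_els:
 assumes b: "b \<in> els (%k l. k \<le> L \<and> l \<le> L)" and w0: "w0 \<in> Wn n" "length w0 = L"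
 defines "w \<equiv> w0 @ replicate L 1 @ [2]"
 shows "\<exists>F. ucont F \<and> (\<forall>e e'. rc b (act \<omega> w e) (act \<omega> w e') = (if e = e' \<and> e \<in> idx n then F (deg e) else 0)) \<and>
   (\<forall>e\<in>idx n. rc b (act \<omega> w0 e) (act \<omega> w0 e) = F (deg e + wt \<omega> w0 - wt \<omega> w))"
 using b
proof (induction rule: els_induct)
 case zero
 then show ?case by (intro exI[of _ "%gm. 0"]) (simp add: ucont_zero)
next
 case (add u v \<phi> y)
 define t where "t = replicate L (1::nat) @ [2]"
 have w: "w = w0 @ t" by (simp add: w_def t_def)
 have tin: "t \<in> Wn n" using n2 by (auto simp: t_def)
 define P where "P \<longleftrightarrow> u = v \<and> (\<exists>s. w0 = v @ s)"
 obtain F where F: "ucont F" "\<And>e e'. rc y (act \<omega> w e) (act \<omega> w e') = (if e = e' \<and> e \<in> idx n then F (deg e) else 0)"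
  "\<And>e. e \<in> idx n ==> rc y (act \<omega> w0 e) (act \<omega> w0 e) = F (deg e + wt \<omega> w0 - wt \<omega> w)"
  using add.IH by blast
 have prefix: "\<exists>s. w0 = v' @ s" if "act \<omega> (w0 @ r) e = act \<omega> v' d" "length v' \<le> L" for v' r e d
 proof -
  have "act \<omega> (take (length v') w0) (act \<omega> (drop (length v') w0 @ r) e) = act \<omega> v' d"
   using that(1) by (simp flip: act_append append_assoc)
  from act_same_length[OF _ this] show ?thesis using that(2) w0(2) append_take_drop_id[of "length v'" w0] by (intro exI[of _ "drop (length v') w0"]) simp
 qed
 \<comment> \<open>\<open>r = t\<close> is the compressed entry. \<open>r = []\<close> is the
   diagonal entry behind \<open>w0\<close>, where the levels compare the lengths in place of the
   marker.\<close>
 have rc1: "rc (el u v \<phi>) (act \<omega> (w0 @ r) e) (act \<omega> (w0 @ r) e') =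
   (if P \<and> e = e' \<and> e \<in> idx n then fourier \<phi> (deg e + wt \<omega> (w0 @ r)) else 0)"
  if r: "r \<in> Wn n" "r = t \<or> r = [] \<and> e = e'" for r e e'
 proof (cases "\<exists>s. w0 = v @ s")
  case True
  then obtain s where s: "w0 = v @ s" by blast
  have sr: "s @ r \<in> Wn n" using w0(1) r(1) unfolding s by simp
  have "act \<omega> (w0 @ r) e = act \<omega> u (act \<omega> (s @ r) e') \<longleftrightarrow> u = v \<and> e = e'"
  proof
   assume eq: "act \<omega> (w0 @ r) e = act \<omega> u (act \<omega> (s @ r) e')"
   obtain s' where s': "w0 = u @ s'" using prefix[OF eq] add(3) by blast
   have eq2: "act \<omega> (s' @ r) e = act \<omega> (s @ r) e'" using eq unfolding s' by (simp add: act_append)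
   have "length s' = length s" using r(2)
   proof
    assume "r = t"
    moreover have "length s \<le> L" "length s' \<le> L" unfolding w0(2)[symmetric] by (simp add: s) (simp add: s')
    ultimately show ?thesis using act_tail_length eq2 unfolding t_def by blast
   next
    assume "r = [] \<and> e = e'"
    then show ?thesis using arg_cong[OF eq2, of lev] by simp
   qed
   then show "u = v \<and> e = e'" using s s' act_same_length[OF _ eq2] by auto
  next
   assume "u = v \<and> e = e'"
   then show "act \<omega> (w0 @ r) e = act \<omega> u (act \<omega> (s @ r) e')" unfolding s by (simp add: act_append)
  qed
  then have iff: "act \<omega> (s @ r) e' \<in> idx n \<and> act \<omega> (w0 @ r) e = act \<omega> u (act \<omega> (s @ r) e') \<longleftrightarrow> P \<and> e = e' \<and> e \<in> idx n"
   using True act_in_idx[OF sr, of \<omega> e'] by (auto simp: P_def)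
  have split: "act \<omega> (w0 @ r) e' = act \<omega> v (act \<omega> (s @ r) e')" unfolding s by (simp add: act_append)
  show ?thesis
   unfolding split rc_el(1)[OF add(4,1,2)] unfolding split[symmetric] iff by (auto simp: s algebra_simps)
 next
  case False
  then have "act \<omega> (w0 @ r) e' \<noteq> act \<omega> v d" for d using prefix add(3) by blast
  then show ?thesis using False by (simp add: rc_el(2)[OF add(4,1,2)] P_def)
 qed
 let ?F = "%gm. (if P then fourier \<phi> (gm + wt \<omega> w) else 0) + F gm"
 have "ucont ?F"
  using ucont_add[OF ucont_translate[OF ucont_fourier[OF add(4)]] F(1)] F(1) by (cases P) simp_all
 moreover have "rc (el u v \<phi> + y) (act \<omega> w e) (act \<omega> w e') = (if e = e' \<and> e \<in> idx n then ?F (deg e) else 0)" for e e'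
  unfolding rc_add F(2) unfolding w rc1[OF tin disjI1[OF refl]] by (cases "e = e'") simp_all
 moreover have "rc (el u v \<phi> + y) (act \<omega> w0 e) (act \<omega> w0 e) = ?F (deg e + wt \<omega> w0 - wt \<omega> w)" if "e \<in> idx n" for e
  using rc1[of "[]" e e] that by (simp add: rc_add F(3))
 ultimately show ?case by blast
qed

text \<open>A nonzero \<open>x\<close> has a nonzero column, so \<open>star x * x\<close> has a
  positive diagonal entry \<beta>. Compression along an aperiodic word turns an approximant into a
  function of the degree with value near \<beta> at \<open>gm0\<close>, and close to
  \<open>gm0\<close> an infinite projection is available.\<close>

lemma compress_to_infinite_projection:
 assumes x: "x \<noteq> 0"
 obtains z p g gm0 c y where "infinite_projection p" "norm (star z * (star x * x) * z - p) < 1"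
  "g \<in> DR" "g gm0 = 1" "c \<in> DR" "\<And>gm. 5 / 6 \<le> g gm ==> c gm = 1" "star y * p * y = X [] c"
proof -
 define b where "b = star x * x"
 have "\<exists>e1 e0. rc x e1 e0 \<noteq> 0"
 proof (rule ccontr)
  assume "\<not> ?thesis"
  then have "rc x e e' = rc 0 e e'" for e e' unfolding rc_zero by blast
  then show False using rc_faithful x by blast
 qed
 then obtain e1 e0 where e: "rc x e1 e0 \<noteq> 0" by blast
 define \<beta> where "\<beta> = Re (rc b e0 e0)"
 have \<beta>: "0 < \<beta>" using diagonal_square[of "{e1}" x e0] e unfolding \<beta>_def b_def
  using less_le_trans[of 0 "(cmod (rc x e1 e0))\<^sup>2"] by simp
 have sb: "star b = b" by (simp add: b_def star_mult star_star)
 have "cnj (rc b e0 e0) = rc b e0 e0" using rc_star[of b e0 e0] by (simp add: sb)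
 then have rb: "rc b e0 e0 = complex_of_real \<beta>" unfolding \<beta>_def by (simp add: complex_eq_iff)
 have e0: "e0 \<in> idx n" using e rc_outside by blast
 \<comment> \<open>Three errors of size \<open>\<epsilon>\<close> occur: the approximation by
   \<open>b'\<close>, the value of \<open>F\<close> at \<open>gm0\<close>, and the oscillation of
   \<open>F\<close>. They must add up to less than \<beta>.\<close>
 define \<epsilon> where "\<epsilon> = \<beta> / 8"
 have \<epsilon>: "0 < \<epsilon>" using \<beta> by (simp add: \<epsilon>_def)
 obtain b' L where b': "b' \<in> els (%k l. k \<le> L \<and> l \<le> L)" "norm (b - b') \<le> \<epsilon>"
  by (rule els_dense[OF \<epsilon>, of b]) (rule that)
 obtain w0 d where w0: "w0 \<in> Wn n" "length w0 = L" "d \<in> idx n" "e0 = act \<omega> w0 d"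
  using e0 by (rule idx_decompose) (rule that)
 define w where "w = w0 @ replicate L 1 @ [2]"
 have w: "w \<in> Wn n" using w0(1) n2 by (auto simp: w_def)
 obtain F where F: "ucont F" "\<And>e e'. rc b' (act \<omega> w e) (act \<omega> w e') = (if e = e' \<and> e \<in> idx n then F (deg e) else 0)"
  "\<And>e. e \<in> idx n ==> rc b' (act \<omega> w0 e) (act \<omega> w0 e) = F (deg e + wt \<omega> w0 - wt \<omega> w)"
  using compress_els[OF b'(1) w0(1,2)] unfolding w_def by blast
 \<comment> \<open>The degree at which \<open>F\<close> returns the diagonal entry of
   \<open>b'\<close> at \<open>e0\<close>.\<close>
 define gm0 where "gm0 = deg d + wt \<omega> w0 - wt \<omega> w"
 have F0: "cmod (F gm0 - complex_of_real \<beta>) \<le> \<epsilon>"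
 proof -
  have "F gm0 - complex_of_real \<beta> = rc (b' - b) e0 e0" using F(3)[OF w0(3)] rb by (simp add: gm0_def w0(4) rc_diff)
  then show ?thesis using order_trans[OF mbd_entry[OF mbd_rc, of "b' - b" e0 e0] b'(2)[unfolded norm_minus_commute[of b]]] by simp
 qed
 obtain K \<delta> where K: "compact K" "0 < \<delta>" "\<And>gm \<psi>. near K \<delta> gm \<psi> ==> cmod (F \<psi> - F gm) \<le> \<epsilon>"
  using F(1) \<epsilon> by (rule ucontE) (rule that)
 obtain g where g: "g \<in> DR" "g gm0 = 1" "\<And>gm. g gm \<noteq> 0 ==> near K \<delta> gm0 gm"
  by (rule DR_bump[OF K(1,2), of gm0]) (rule that)
 obtain p E y where p: "infinite_projection p" "E \<in> DR" "\<And>gm. 0 \<le> E gm" "\<And>gm. E gm \<le> 1" "\<And>gm. E gm \<noteq> 0 ==> g gm \<noteq> 0"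
  "\<And>gm. 5 / 6 \<le> g gm ==> E gm = 1" "p * X [] E = p" "star y * p * y = X [] (%gm. (E gm)\<^sup>2)"
  by (rule infinite_projection_exists[OF g(1,2)]) (rule that)
 have E2D: "(%gm. (E gm)\<^sup>2) \<in> DR" using DR_mult[OF p(2,2)] by (simp add: power2_eq_square)
 have E2: "(E gm)\<^sup>2 \<le> 1" for gm using p(3,4)[of gm] by (simp add: power_le_one)
 define z0 where "z0 = X w E"
 define Q where "Q = X [] (%gm. (E gm)\<^sup>2)"
 have "norm (star z0 * z0) \<le> 1" unfolding z0_def star_X_mult_same[OF w p(2)]
  by (rule norm_diagonal_le) (auto simp: rc_X E2D E2 norm_power power_le_one p(3,4))
 then have nz0: "norm z0 \<le> 1" unfolding cstar_identity using power2_le_imp_le[of "norm z0" 1] by simp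
 have 1: "norm (star z0 * (b - b') * z0) \<le> \<epsilon>"
 proof -
  have "norm (star z0 * (b - b') * z0) \<le> norm (star z0) * norm (b - b') * norm z0"
   by (intro order_trans[OF norm_mult_ineq] mult_right_mono norm_mult_ineq norm_ge_zero)
  also have "\<dots> \<le> 1 * \<epsilon> * 1" using nz0 b'(2) \<epsilon> by (intro mult_mono) simp_all
  finally show ?thesis by simp
 qed
 have 2: "norm (star z0 * b' * z0 - \<beta> *\<^sub>R Q) \<le> 2 * \<epsilon>"
 proof -
  have rcQ: "rc (star z0 * b' * z0 - \<beta> *\<^sub>R Q) e e' = of_bool (e' \<in> idx n \<and> e = e') * (complex_of_real ((E (deg e'))\<^sup>2) * (F (deg e') - complex_of_real \<beta>))" for e e'
  proof -
   have "rc (\<beta> *\<^sub>R Q) e e' = complex_of_real \<beta> * rc Q e e'"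
    using rc_scale[of "complex_of_real \<beta>" Q] by (simp add: scaleC_of_real)
   then show ?thesis unfolding rc_diff Q_def rc_X_Nil[OF E2D]
    by (simp add: z0_def rc_mult_X[OF w p(2)] mult.assoc[of "star _"] rc_star_X_mult[OF w p(2)] F(2) power2_eq_square algebra_simps) auto
  qed
  show ?thesis
  proof (rule norm_diagonal_le)
  show "cmod (rc (star z0 * b' * z0 - \<beta> *\<^sub>R Q) e e) \<le> 2 * \<epsilon>" for e
  proof (cases "e \<in> idx n \<and> E (deg e) \<noteq> 0")
   case True
   have "cmod (F (deg e) - F gm0) \<le> \<epsilon>" using K(3) g(3) p(5) True by blast
   from norm_triangle_mono[OF this F0] have "cmod (F (deg e) - complex_of_real \<beta>) \<le> 2 * \<epsilon>" by simp
   then have "(E (deg e))\<^sup>2 * cmod (F (deg e) - complex_of_real \<beta>) \<le> 1 * (2 * \<epsilon>)"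
    by (intro mult_mono E2) simp_all
   then show ?thesis unfolding rcQ using True by (simp add: norm_mult norm_power)
  qed (use \<epsilon> in \<open>auto simp: rcQ\<close>)
  qed (use \<epsilon> in \<open>simp_all add: rcQ\<close>)
 qed
 define R where "R = star z0 * b * z0 - \<beta> *\<^sub>R Q"
 have "R = star z0 * (b - b') * z0 + (star z0 * b' * z0 - \<beta> *\<^sub>R Q)"
  by (simp add: R_def right_diff_distrib left_diff_distrib)
 then have R: "norm R \<le> 3 * \<epsilon>" using norm_triangle_mono[OF 1 2] by simp
 have proj: "projection p" using p(1) unfolding infinite_projection_def by blast
 then have sp: "star p = p" and pp: "p * p = p" unfolding projection_def by auto
 have pQp: "p * Q * p = p"
 proof -
  have "Q = X [] E * X [] E" unfolding Q_def
   by (rule X_mult_Nil[OF p(2) _ p(2) _ E2D, symmetric]) (simp_all add: power2_eq_square)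
  then show ?thesis by (simp add: p(7) pp flip: mult.assoc)
 qed
 \<comment> \<open>Rescaling turns the approximate value \<beta> of the compression into 1.\<close>
 define z where "z = (1 / sqrt \<beta>) *\<^sub>R (z0 * p)"
 have "star z * b * z - p = (1 / \<beta>) *\<^sub>R (p * R * p)"
 proof -
  have "star z * b * z = (1 / \<beta>) *\<^sub>R (p * (star z0 * b * z0) * p)"
   using \<beta> by (simp add: z_def star_scaleR star_mult sp mult.assoc)
  moreover have "p = (1 / \<beta>) *\<^sub>R (p * (\<beta> *\<^sub>R Q) * p)" using \<beta> pQp by simp
  ultimately show ?thesis unfolding R_def by (simp add: right_diff_distrib left_diff_distrib scaleR_diff_right)
 qed
 also have "norm \<dots> \<le> (1 / \<beta>) * (1 * (3 * \<epsilon>) * 1)"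
 proof -
  have "norm (p * R * p) \<le> norm p * norm R * norm p"
   by (intro order_trans[OF norm_mult_ineq] mult_right_mono norm_mult_ineq norm_ge_zero)
  also have "\<dots> \<le> 1 * (3 * \<epsilon>) * 1" using R \<epsilon> norm_projection_le[OF proj] by (intro mult_mono) simp_all
  finally show ?thesis using \<beta> by (simp add: divide_right_mono)
 qed
 also have "\<dots> < 1" using \<beta> by (simp add: \<epsilon>_def)
 finally have "norm (star z * (star x * x) * z - p) < 1" by (simp add: b_def)
 then show ?thesis using that[OF p(1) _ g(1,2) E2D _ p(8)] p(6) by simp
qed

lemma dense_imp_purely_infinite: "purely_infinite TYPE('c)"
proof (rule purely_infinite_criterion)
 fix x :: 'c assume "x \<noteq> 0"
 then obtain z p where "infinite_projection p" "norm (star z * (star x * x) * z - p) < 1"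
  by (rule compress_to_infinite_projection) (rule that)
 then show "\<exists>z p. infinite_projection p \<and> norm (star z * (star x * x) * z - p) < 1" by blast
qed

text \<open>A nonzero ideal contains an infinite projection, hence a cutoff \<open>X [] c\<close>,
  hence every tower whose range lies where \<open>c = 1\<close>. The squares of towers contain an
  approximate unit.\<close>

lemma dense_imp_simple: "simple_cstar TYPE('c)"
 unfolding simple_cstar_def
proof (intro conjI allI impI)
 obtain h where h: "h \<in> DR" "h (0 :: 'g character) = 1" by (rule DR_bump[of "{}" 1 0]) auto
 obtain d where "d \<in> idx n" "deg d = (0 :: 'g character)" using idx_deg_exists by blast
 then have "rc (X [] h) d d = 1" by (simp add: rc_X h)
 then have "X [] h \<noteq> 0" by auto
 then show "\<exists>x::'c. x \<noteq> 0" by blast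
 fix I :: "'c set" assume I: "closed_ideal I"
 then have cI: "closed I" and zI: "0 \<in> I" and aI: "\<And>x y. x \<in> I ==> y \<in> I ==> x + y \<in> I"
  and mI: "\<And>x a. x \<in> I ==> a * x \<in> I" "\<And>x a. x \<in> I ==> x * a \<in> I"
  unfolding closed_ideal_def complex_subspace_def by blast+
 show "I = {0} \<or> I = UNIV"
 proof (cases "I = {0}")
  case False
  then obtain x where x: "x \<in> I" "x \<noteq> 0" using zI by blast
  obtain z p g gm0 c y where p: "infinite_projection p" "norm (star z * (star x * x) * z - p) < 1"
   "g \<in> DR" "g gm0 = 1" "c \<in> DR" "\<And>gm. 5 / 6 \<le> g gm ==> c gm = 1" "star y * p * y = X [] c"
   using x(2) by (rule compress_to_infinite_projection) (rule that)
  have "projection p" using p(1) unfolding infinite_projection_def by blast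
  then have "p \<in> I" using projection_mem_ideal[OF I x(1) _ p(2)] by blast
  then have c: "X [] c \<in> I" unfolding p(7)[symmetric] by (intro mI)
  \<comment> \<open>\<open>a = X [] c * a\<close> lies in the ideal, and
    \<open>star a * a = X [] G\<close>.\<close>
  have G: "X [] G \<in> I" if rG: "r \<in> DR" "G \<in> DR" "\<And>gm. 0 \<le> G gm" "\<And>gm. G gm \<noteq> 0 ==> 1 / 3 \<le> r gm" for r G
  proof -
   obtain a N where a: "star a * a = X [] G"
    "\<forall>c\<in>DR. (\<forall>gm. 5 / 6 \<le> g gm --> c gm = 1) --> X [] c * a = a"
    by (rule tower_exists[OF rG p(3,4), of 0]) (assumption, rule that)
   have "a \<in> I" using mI(2)[OF c, of a] a(2) p(5,6) by force
   then show ?thesis unfolding a(1)[symmetric] by (rule mI)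
  qed
  have "y \<in> I" for y
  proof -
   have "\<exists>y'\<in>I. dist y' y < e" if e: "0 < e" for e
   proof -
    obtain r where r: "r \<in> DR" "\<And>h. cutoff r h ==> norm (y - y * X [] h) \<le> e / 2"
     using approximate_unit[of "e / 2" y] e by auto
    obtain h where h: "cutoff r h" "\<And>gm. h gm \<noteq> 0 ==> 1 / 3 \<le> r gm" using r(1) by (rule cutoff_exists) (rule that)
    have "X [] h \<in> I" by (rule G[OF r(1) _ _ h(2)]) (use h(1) in \<open>simp_all add: cutoff_def\<close>)
    then show ?thesis using r(2)[OF h(1)] e by (intro bexI[of _ "y * X [] h"] mI(1)) (simp_all add: dist_norm norm_minus_commute)
   qed
   then show ?thesis using closed_approachable[OF cI] by blast
  qed
  then show ?thesis by blast
 qed simp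
qed

end

end

section \<open>Simplicity and pure infiniteness imply density\<close>

text \<open>Gaussian elimination: each equation removes one unknown.\<close>

lemma homogeneous_solution:
 fixes M :: "'a => 'b => complex"
 assumes "finite A" "finite B" "card A < card B"
 shows "\<exists>\<xi>. (\<exists>b\<in>B. \<xi> b \<noteq> 0) \<and> (\<forall>a\<in>A. (\<Sum>b\<in>B. M a b * \<xi> b) = 0)"
 using assms
proof (induction A arbitrary: B M rule: finite_induct)
 case empty
 then have "B \<noteq> {}" by auto
 then show ?case by (intro exI[of _ "%_. 1"]) auto
next
 case (insert a A)
 show ?case
 proof (cases "\<forall>b\<in>B. M a b = 0")
  case True
  then show ?thesis using insert.IH[OF insert.prems(1), of M] insert.prems(2) insert.hyps by auto
 next
  case False
  then obtain b0 where b0: "b0 \<in> B" "M a b0 \<noteq> 0" by blast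
  let ?B = "B - {b0}"
  have "finite ?B" "card A < card ?B" using insert b0(1) by simp_all
  from insert.IH[OF this, of "%c b. M c b - M c b0 * M a b / M a b0"]
  obtain \<xi> where \<xi>: "\<exists>b\<in>?B. \<xi> b \<noteq> 0" "\<forall>c\<in>A. (\<Sum>b\<in>?B. (M c b - M c b0 * M a b / M a b0) * \<xi> b) = 0" by blast
  define \<eta> where "\<eta> = \<xi>(b0 := - (\<Sum>b\<in>?B. M a b * \<xi> b) / M a b0)"
  have sum: "(\<Sum>b\<in>B. M c b * \<eta> b) = (\<Sum>b\<in>?B. (M c b - M c b0 * M a b / M a b0) * \<xi> b)" for c
  proof -
   have "(\<Sum>b\<in>B. M c b * \<eta> b) = M c b0 * \<eta> b0 + (\<Sum>b\<in>?B. M c b * \<xi> b)"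
    unfolding sum.remove[OF insert.prems(1) b0(1)] by (simp add: \<eta>_def)
   also have "M c b0 * \<eta> b0 = - (\<Sum>b\<in>?B. M c b0 * M a b / M a b0 * \<xi> b)"
    by (simp add: \<eta>_def sum_distrib_left sum_divide_distrib mult_ac)
   finally show ?thesis by (simp add: left_diff_distrib sum_subtractf)
  qed
  show ?thesis
  proof (intro exI[of _ \<eta>] conjI ballI)
   show "\<exists>b\<in>B. \<eta> b \<noteq> 0" using \<xi>(1) unfolding \<eta>_def by auto
   fix c assume "c \<in> insert a A"
   then show "(\<Sum>b\<in>B. M c b * \<eta> b) = 0" unfolding sum using \<xi>(2) b0(2) by auto
  qed
 qed
qed

text \<open>A square matrix that is bounded below is onto, so its adjoint satisfies the same lower
  bound, here at the basis vector \<open>a\<close>. This is where finite blocks differ from infinite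
  matrices.\<close>

lemma finite_matrix_cokernel:
 fixes W :: "'a => 'a => complex"
 assumes F: "finite F" "a \<in> F" and c: "0 < c"
  and low: "\<And>\<xi>. c * (l2 \<xi> F)\<^sup>2 \<le> (l2 (%e. \<Sum>b\<in>F. W e b * \<xi> b) F)\<^sup>2"
 shows "c \<le> (\<Sum>b\<in>F. (cmod (W a b))\<^sup>2)"
proof -
 \<comment> \<open>The extra unknown \<open>None\<close> has minus the basis vector \<open>a\<close>
   as its column; a nontrivial solution then maps \<open>\<zeta>\<close> to a multiple of that basis
   vector.\<close>
 define B where "B = insert None (Some ` F)"
 define M where "M e k = (case k of None => - of_bool (e = a) | Some b => W e b)" for e k
 have sumB: "(\<Sum>k\<in>B. M e k * \<xi> k) = (\<Sum>b\<in>F. W e b * \<xi> (Some b)) - of_bool (e = a) * \<xi> None" for e \<xi>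
  using F(1) by (simp add: B_def M_def sum.reindex)
 have "finite B" "card F < card B" using F(1) by (simp_all add: B_def card_image)
 from homogeneous_solution[OF F(1) this, of M] obtain \<xi> where \<xi>: "\<exists>k\<in>B. \<xi> k \<noteq> 0" "\<forall>e\<in>F. (\<Sum>k\<in>B. M e k * \<xi> k) = 0" by blast
 define \<zeta> where "\<zeta> b = \<xi> (Some b)" for b
 have eq: "(\<Sum>b\<in>F. W e b * \<zeta> b) = of_bool (e = a) * \<xi> None" if "e \<in> F" for e
  using \<xi>(2) that by (simp add: sumB \<zeta>_def)
 have "l2 (%e. \<Sum>b\<in>F. W e b * \<zeta> b) F = l2 (%e. of_bool (e = a) * \<xi> None) F" by (rule l2_cong) (rule eq)
 also have "\<dots> = cmod (\<xi> None)"
 proof -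
  have "(l2 (%e. of_bool (e = a) * \<xi> None) F)\<^sup>2 = (\<Sum>e\<in>F. if e = a then (cmod (\<xi> None))\<^sup>2 else 0)"
   unfolding l2_power2[OF F(1)] by (rule sum.cong) (simp_all add: norm_mult)
  then have "(l2 (%e. of_bool (e = a) * \<xi> None) F)\<^sup>2 = (cmod (\<xi> None))\<^sup>2" using F by simp
  then show ?thesis by (simp add: power2_eq_iff_nonneg)
 qed
 finally have bound: "c * (l2 \<zeta> F)\<^sup>2 \<le> (cmod (\<xi> None))\<^sup>2" using low[of \<zeta>] by simp
 have nz: "0 < cmod (\<xi> None)"
 proof (rule ccontr)
  assume "\<not> 0 < cmod (\<xi> None)"
  then have 0: "\<xi> None = 0" by simp
  then have "(l2 \<zeta> F)\<^sup>2 \<le> 0" using bound c by (simp add: mult_le_0_iff)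
  then have "(\<Sum>b\<in>F. (cmod (\<zeta> b))\<^sup>2) = 0" unfolding l2_power2[OF F(1)] by (intro antisym) (simp_all add: sum_nonneg)
  then have "\<forall>b\<in>F. \<zeta> b = 0" using F(1) by (simp add: sum_nonneg_eq_0_iff)
  then show False using \<xi>(1) 0 by (auto simp: B_def \<zeta>_def)
 qed
 have "cmod (\<xi> None) = cmod (\<Sum>b\<in>F. W a b * \<zeta> b)" using eq[OF F(2)] by simp
 also have "\<dots> \<le> l2 (%b. cnj (W a b)) F * l2 \<zeta> F"
  using l2_cauchy_schwarz[of "%b. cnj (W a b)" \<zeta> F] by simp
 finally have "(cmod (\<xi> None))\<^sup>2 \<le> (l2 (%b. cnj (W a b)) F)\<^sup>2 * (l2 \<zeta> F)\<^sup>2"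
  using power_mono[OF _ norm_ge_zero, of "\<xi> None" _ 2] by (fastforce simp flip: power_mult_distrib)
 then have "c * (cmod (\<xi> None))\<^sup>2 \<le> c * ((l2 (%b. cnj (W a b)) F)\<^sup>2 * (l2 \<zeta> F)\<^sup>2)" using c by (intro mult_left_mono) simp_all
 also have "\<dots> = (l2 (%b. cnj (W a b)) F)\<^sup>2 * (c * (l2 \<zeta> F)\<^sup>2)" by simp
 also have "\<dots> \<le> (l2 (%b. cnj (W a b)) F)\<^sup>2 * (cmod (\<xi> None))\<^sup>2" by (intro mult_left_mono bound) simp
 finally have "c \<le> (l2 (%b. cnj (W a b)) F)\<^sup>2" by (rule mult_right_le_imp_le) (use nz in simp)
 then show ?thesis unfolding l2_power2[OF F(1)] by simp
qed

text \<open>A decreasing sequence of natural numbers is eventually constant, so a monotone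
  subsequence can be made increasing, one coordinate after the other.\<close>

lemma monotone_subsequence:
 fixes c :: "nat => 'a => nat"
 assumes "finite I"
 shows "\<exists>f. strict_mono f \<and> (\<forall>i\<in>I. incseq (%k. c (f k) i))"
 using assms
proof induction
 case empty then show ?case by (intro exI[of _ id]) (simp add: strict_mono_def)
next
 case (insert i I)
 then obtain f where f: "strict_mono f" "\<forall>i\<in>I. incseq (%k. c (f k) i)" by blast
 have "\<exists>g. strict_mono g \<and> incseq (%k. c (f (g k)) i)"
 proof -
  obtain g where g: "strict_mono g" "monoseq (%k. c (f (g k)) i)" using seq_monosub[of "%k. c (f k) i"] by blast
  show ?thesis
  proof (cases "incseq (%k. c (f (g k)) i)")
   case True then show ?thesis using g(1) by blast
  next
   case False
   then have dec: "decseq (%k. c (f (g k)) i)" using g(2) by (auto simp: monoseq_iff)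
   obtain N where N: "\<And>k. c (f (g N)) i \<le> c (f (g k)) i"
    using ex_has_least_nat[of "%_. True" 0 "%k. c (f (g k)) i"] by auto
   have "c (f (g (k + N))) i = c (f (g N)) i" for k using N[of "k + N"] decseqD[OF dec, of N "k + N"] by simp
   then show ?thesis using g(1) by (intro exI[of _ "%k. g (k + N)"]) (simp add: strict_mono_def incseq_def)
  qed
 qed
 then obtain g where g: "strict_mono g" "incseq (%k. c (f (g k)) i)" by blast
 have "incseq (%k. c (f (g k)) j)" if "j \<in> I" for j
  using f(2) that strict_mono_mono[OF g(1)] by (auto simp: incseq_def mono_def)
 then show ?case using strict_mono_compose[OF f(1) g(1)] g(2) by (intro exI[of _ "%k. f (g k)"]) auto
qed

text \<open>Dickson's lemma for the letter counts of words.\<close>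

lemma infinite_words_comparable:
 assumes B: "infinite B" "B \<subseteq> lists {1..n::nat}"
 obtains w w' where "w \<in> B" "w' \<in> B" "mset w \<subset># mset w'"
proof -
 obtain s :: "nat => nat list" where s: "inj s" "range s \<subseteq> B" using infinite_countable_subset[OF B(1)] by blast
 obtain f where f: "strict_mono f" "\<forall>i\<in>{1..n}. incseq (%k. count (mset (s (f k))) i)"
  using monotone_subsequence[of "{1..n}" "%k. count (mset (s k))"] by auto
 have "infinite (range (%k. s (f k)))"
  using range_inj_infinite[OF inj_compose[OF s(1) strict_mono_imp_inj_on[OF f(1)]]] by (simp add: comp_def)
 then have "\<not> range (%k. s (f k)) \<subseteq> {w. set w \<subseteq> {1..n} \<and> length w \<le> length (s (f 0))}"
  using finite_subset finite_lists_length_le[of "{1..n}"] by blast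
 then obtain k where k: "\<not> length (s (f k)) \<le> length (s (f 0))" using s(2) B(2) by (auto simp: lists_eq_set)
 have "count (mset (s (f 0))) i \<le> count (mset (s (f k))) i" for i
 proof (cases "i \<in> {1..n}")
  case True then show ?thesis using f(2) incseqD[of _ 0 k] by blast
 next
  case False
  have "s (f 0) \<in> Wn n" using s(2) B(2) by blast
  then have "i \<notin> set (s (f 0))" using False by blast
  then have "count (mset (s (f 0))) i = 0" by (subst count_eq_zero_iff) simp
  then show ?thesis by linarith
 qed
 then have "mset (s (f 0)) \<subseteq># mset (s (f k))" by (rule mset_subset_eqI)
 moreover have "mset (s (f 0)) \<noteq> mset (s (f k))" using k by (metis size_mset order_refl)
 ultimately show ?thesis using s(2) by (intro that[of "s (f 0)" "s (f k)"]) (auto simp: subset_mset.less_le)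
qed

text \<open>\<open>DR_bump\<close> places an open set inside each set \<open>near K e gm\<close>, so
  these sets really are neighbourhoods.\<close>

lemma (in lca) closure_near:
 "gm \<in> closure T \<longleftrightarrow> (\<forall>K e. compact (K :: 'g set) --> 0 < e --> (\<exists>\<psi>\<in>T. near K e gm \<psi>))"
proof (intro iffI allI impI)
 fix K :: "'g set" and e :: real assume gm: "gm \<in> closure T" and K: "compact K" "0 < e"
 obtain h where h: "h \<in> DR" "h gm = 1" "\<And>\<psi>. h \<psi> \<noteq> 0 ==> near K e gm \<psi>" by (rule DR_bump[OF K, of gm]) (rule that)
 have "gm \<in> {\<psi>. 0 < h \<psi>} \<inter> closure T" using gm h(2) by simp
 then have "{\<psi>. 0 < h \<psi>} \<inter> closure T \<noteq> {}" by blast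
 then have "{\<psi>. 0 < h \<psi>} \<inter> T \<noteq> {}" unfolding open_Int_closure_eq_empty[OF DR_open[OF h(1)]] .
 then obtain \<psi> where "\<psi> \<in> T" "0 < h \<psi>" by blast
 then show "\<exists>\<psi>\<in>T. near K e gm \<psi>" using h(3)[of \<psi>] by force
next
 assume *: "\<forall>K e. compact (K :: 'g set) --> 0 < e --> (\<exists>\<psi>\<in>T. near K e gm \<psi>)"
 show "gm \<in> closure T"
 proof (rule ccontr)
  assume "gm \<notin> closure T"
  moreover have "open (- closure T)" by (rule open_Compl[OF closed_closure])
  ultimately obtain K e where K: "compact K" "0 < e" "\<And>\<psi>. (\<forall>t\<in>K. cmod (pairing t \<psi> - pairing t gm) < e) ==> \<psi> \<in> - closure T"
   unfolding open_character_def by (meson ComplI)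
  obtain \<psi> where "\<psi> \<in> T" "near K e gm \<psi>" using * K(1,2) by blast
  then show False using K(3)[of \<psi>] closure_subset[of T] unfolding near_def by blast
 qed
qed

lemma near_diff: "near K (e / 2) \<theta> gm ==> near K (e / 2) \<theta> \<psi> ==> near K e 0 (\<psi> - gm)"
 unfolding near_def
proof
 fix t assume *: "\<forall>t\<in>K. cmod (pairing t gm - pairing t \<theta>) < e / 2" "\<forall>t\<in>K. cmod (pairing t \<psi> - pairing t \<theta>) < e / 2" and t: "t \<in> K"
 have "pairing t (\<psi> - gm) - pairing t 0 = (pairing t \<psi> - pairing t gm) * cnj (pairing t gm)"
  by (simp add: pairing_diff_right left_diff_distrib)
 then have "cmod (pairing t (\<psi> - gm) - pairing t 0) = cmod (pairing t \<psi> - pairing t gm)" by (simp add: norm_mult)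
 also have "\<dots> < e" by (rule norm_diff_triangle_less[of _ "pairing t \<theta>" "e / 2" _ "e / 2", simplified])
  (use * t in \<open>auto simp: norm_minus_commute\<close>)
 finally show "cmod (pairing t (\<psi> - gm) - pairing t 0) < e" .
qed

context crossed
begin

section \<open>The closed semigroup of weights and reducing index sets\<close>

definition spectrum :: "'g character set" where
 "spectrum = closure {wt \<omega> w | w. w \<in> Wn n}"

lemma spectrum_iff: "gm \<in> spectrum \<longleftrightarrow>
  (\<forall>K e. compact K --> 0 < e --> (\<exists>w. w \<in> Wn n \<and> near K e gm (wt \<omega> w)))"
 unfolding spectrum_def closure_near by blast

lemma spectrum_word: "w \<in> Wn n ==> wt \<omega> w \<in> spectrum"
 unfolding spectrum_def by (rule subsetD[OF closure_subset]) blast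

lemma spectrum_add:
 assumes "gm \<in> spectrum" "\<psi> \<in> spectrum"
 shows "gm + \<psi> \<in> spectrum"
 unfolding spectrum_iff
proof (intro allI impI)
 fix K :: "'g set" and e :: real assume K: "compact K" "0 < e"
 then have e: "0 < e / 2" by simp
 obtain w where w: "w \<in> Wn n" "near K (e / 2) gm (wt \<omega> w)" using assms(1) K(1) e unfolding spectrum_iff by blast
 obtain w' where w': "w' \<in> Wn n" "near K (e / 2) \<psi> (wt \<omega> w')" using assms(2) K(1) e unfolding spectrum_iff by blast
 have "near K (e / 2) (gm + \<psi>) (wt \<omega> w + \<psi>)" using w(2) by (simp add: near_translate)
 moreover have "near K (e / 2) (wt \<omega> w + \<psi>) (wt \<omega> w + wt \<omega> w')"
  using w'(2) near_translate[of K "e / 2" \<psi> "wt \<omega> w" "wt \<omega> w'"] by (simp add: add.commute)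
 ultimately have "near K e (gm + \<psi>) (wt \<omega> (w @ w'))"
  unfolding near_def by (simp, intro ballI norm_diff_triangle_less[of _ _ "e / 2" _ "e / 2", simplified]) auto
 then show "\<exists>w. w \<in> Wn n \<and> near K e (gm + \<psi>) (wt \<omega> w)" using w(1) w'(1) by (intro exI[of _ "w @ w'"]) simp
qed

text \<open>The basis vectors in such a set span a reducing subspace of the representation.\<close>

definition reducing :: "'g idx set => bool" where
 "reducing \<Theta> \<longleftrightarrow> (\<forall>i d. i \<in> {1..n} --> icons \<omega> i d \<in> \<Theta> \<longleftrightarrow> d \<in> \<Theta>)"

lemma reducing_act: "reducing \<Theta> ==> w \<in> Wn n ==> act \<omega> w d \<in> \<Theta> \<longleftrightarrow> d \<in> \<Theta>"
proof (induction w)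
 case (Cons i w)
 then have "i \<in> {1..n}" "w \<in> Wn n" by simp_all
 then show ?case using Cons unfolding reducing_def act_simps by blast
qed simp

text \<open>Elements whose coefficients vanish on \<open>\<Theta>\<close> form a closed ideal, the
  kernel of the restricted representation. A bump at the degree of \<open>e0\<close> lies outside
  it.\<close>

lemma simple_faithful:
 assumes simple: "simple_cstar TYPE('c)" and \<Theta>: "reducing \<Theta>" "e0 \<in> \<Theta>" "e0 \<in> idx n"
  and x: "\<And>e e'. e \<in> \<Theta> ==> e' \<in> \<Theta> ==> rc x e e' = 0"
 shows "x = 0"
proof -
 define I where "I = {x. \<forall>e\<in>\<Theta>. \<forall>e'\<in>\<Theta>. rc x e e' = 0}"
 have right: "x * a \<in> I" if x: "x \<in> I" for x a
  unfolding I_def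
 proof (intro CollectI ballI)
  fix e e' assume e: "e \<in> \<Theta>" "e' \<in> \<Theta>"
  show "rc (x * a) e e' = 0"
  proof (rule els_closed_imp[of "%a. rc (x * a) e e' = 0"])
   show "closed {a. rc (x * a) e e' = 0}" by (intro closed_Collect_eq continuous_intros)
   fix L b assume b: "b \<in> els (%k l. k \<le> L \<and> l \<le> L)"
   obtain C where C: "rc (x * b) e e' = (\<Sum>c\<in>C. rc x e c * rc b c e')" using rc_els_product[OF b, of e'] by blast
   have "rc x e c * rc b c e' = 0" for c
   proof (cases "rc b c e' = 0")
    case False
    from rc_els_support[OF b this] obtain u v d where d: "u \<in> Wn n" "v \<in> Wn n" "c = act \<omega> u d" "e' = act \<omega> v d" by blast
    have "c \<in> \<Theta>" using e(2) unfolding d(3,4) reducing_act[OF \<Theta>(1) d(1)] reducing_act[OF \<Theta>(1) d(2)] .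
    then show ?thesis using x e(1) unfolding I_def by simp
   qed simp
   then show "rc (x * b) e e' = 0" unfolding C by (intro sum.neutral ballI)
  qed
 qed
 have star: "star x \<in> I" if "x \<in> I" for x using that unfolding I_def by (simp add: rc_star)
 have left: "a * x \<in> I" if "x \<in> I" for x a
  using star[OF right[OF star[OF that], of "star a"]] by (simp add: star_mult star_star)
 have "I = (\<Inter>e\<in>\<Theta>. \<Inter>e'\<in>\<Theta>. {x. rc x e e' = 0})" unfolding I_def by blast
 moreover have "closed (\<Inter>e\<in>\<Theta>. \<Inter>e'\<in>\<Theta>. {x. rc x e e' = 0})"
  by (intro closed_INT ballI closed_Collect_eq continuous_intros)
 ultimately have "closed_ideal I"
  unfolding closed_ideal_def complex_subspace_def using left right by (simp add: I_def rc_add rc_scale)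
 moreover have "I \<noteq> UNIV"
 proof -
  obtain h where h: "h \<in> DR" "h (deg e0) = 1" by (rule DR_bump[of "{}" 1 "deg e0"]) auto
  have "rc (X [] h) e0 e0 \<noteq> 0" by (simp add: rc_X_Nil h \<Theta>(3))
  then have "X [] h \<notin> I" using \<Theta>(2) unfolding I_def by blast
  then show ?thesis by blast
 qed
 ultimately have "I = {0}" using simple unfolding simple_cstar_def by blast
 then show ?thesis using x unfolding I_def by blast
qed

text \<open>The constant word of letter \<open>j\<close>, moved \<open>l\<close> steps backwards
  along its orbit: prepending \<open>j\<close> leads from \<open>l + 1\<close> to
  \<open>l\<close>.\<close>

definition base :: "nat => nat => 'g idx" where
 "base j l = (%_. j, - wt \<omega> (replicate l j), - int l)"

lemma icons_base [simp]: "icons \<omega> j (base j (Suc l)) = base j l"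
 by (auto simp: icons_def base_def fun_eq_iff split: nat.split)

lemma act_base: "act \<omega> (replicate m j) (base j (l + m)) = base j l"
proof (induction m arbitrary: l)
 case (Suc m)
 from Suc[of "Suc l"] show ?case by simp
qed simp

lemma deg_base: "deg (base j l) = - wt \<omega> (replicate l j)"
 by (simp add: base_def deg_def)

lemma replicate_in: "j \<in> {1..n} ==> replicate m j \<in> Wn n"
 by (induction m) simp_all

lemma base_in_idx: "j \<in> {1..n} ==> base j l \<in> idx n"
 by (auto simp: base_def idx_def)

text \<open>Since \<open>- \<omega> j\<close> lies in the closed semigroup, the constant word of
  letter \<open>j\<close> can be followed backwards without leaving it. This gives a reducing set on
  which all degrees lie in the semigroup, and a function supported off the semigroup vanishes
  there.\<close>

lemma recurrent_imp_dense:
 assumes simple: "simple_cstar TYPE('c)" and j: "j \<in> {1..n}" "- \<omega> j \<in> spectrum"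
 shows "spectrum = UNIV"
proof (rule ccontr)
 assume "spectrum \<noteq> UNIV"
 then obtain gm where gm: "gm \<notin> spectrum" by blast
 then obtain K e where K: "compact K" "0 < e" "\<And>w. w \<in> Wn n ==> \<not> near K e gm (wt \<omega> w)"
  unfolding spectrum_iff by blast
 have e2: "0 < e / 2" using K(2) by simp
 obtain h where h: "h \<in> DR" "h gm = 1" "\<And>\<psi>. h \<psi> \<noteq> 0 ==> near K (e / 2) gm \<psi>"
  by (rule DR_bump[OF K(1) e2, of gm]) (rule that)
 \<comment> \<open>One half of \<open>e\<close> is spent on the support of \<open>h\<close>, the
   other on approximating \<open>\<psi>\<close> by a weight.\<close>
 have off: "h \<psi> = 0" if \<psi>: "\<psi> \<in> spectrum" for \<psi>
 proof (rule ccontr)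
  assume "h \<psi> \<noteq> 0"
  then have 1: "near K (e / 2) gm \<psi>" by (rule h(3))
  obtain w where w: "w \<in> Wn n" "near K (e / 2) \<psi> (wt \<omega> w)" using \<psi> K(1) e2 unfolding spectrum_iff by blast
  have "near K e gm (wt \<omega> w)" using 1 w(2)
   unfolding near_def by (intro ballI norm_diff_triangle_less[of _ _ "e / 2" _ "e / 2", simplified]) auto
  then show False using K(3)[OF w(1)] by blast
 qed
 \<comment> \<open>The condition includes all tails, so deleting letters stays inside; prepending
   stays inside by the semigroup property.\<close>
 define \<Theta> where "\<Theta> = {e. \<forall>m. deg ((itl \<omega> ^^ m) e) \<in> spectrum}"
 have "reducing \<Theta>" unfolding reducing_def
 proof (intro allI impI iffI)
  fix i d assume i: "i \<in> {1..n}"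
  { assume *: "icons \<omega> i d \<in> \<Theta>"
   have "deg ((itl \<omega> ^^ m) d) \<in> spectrum" for m
    using *[unfolded \<Theta>_def mem_Collect_eq, rule_format, of "Suc m"] by (simp only: funpow_Suc_right comp_apply itl_icons)
   then show "d \<in> \<Theta>" unfolding \<Theta>_def by blast }
  assume d: "d \<in> \<Theta>"
  have dm: "deg ((itl \<omega> ^^ m) d) \<in> spectrum" for m using d unfolding \<Theta>_def by blast
  have "deg ((itl \<omega> ^^ m) (icons \<omega> i d)) \<in> spectrum" for m
  proof (cases m)
   case 0
   have "deg d + \<omega> i \<in> spectrum" using spectrum_add[OF dm[of 0] spectrum_word[of "[i]"]] i by simp
   then show ?thesis using 0 by simp
  next
   case (Suc m)
   show ?thesis unfolding Suc funpow_Suc_right comp_apply itl_icons by (rule dm)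
  qed
  then show "icons \<omega> i d \<in> \<Theta>" unfolding \<Theta>_def by blast
 qed
 moreover have "base j 0 \<in> \<Theta>"
 proof -
  have "(itl \<omega> ^^ m) (base j 0) = base j m" for m
  proof (induction m)
   case (Suc m)
   then show ?case using itl_icons[of \<omega> j "base j (Suc m)"] by simp
  qed simp
  moreover have "deg (base j m) \<in> spectrum" for m
  proof (induction m)
   case 0 show ?case using spectrum_word[of "[]"] by (simp add: deg_base)
  next
   case (Suc m)
   then show ?case using spectrum_add[OF Suc j(2)] by (simp add: deg_base algebra_simps)
  qed
  ultimately show ?thesis unfolding \<Theta>_def by simp
 qed
 moreover have "rc (X [] h) e e' = 0" if e: "e \<in> \<Theta>" "e' \<in> \<Theta>" for e e'
 proof -
  have "deg ((itl \<omega> ^^ 0) e') \<in> spectrum" using e(2) unfolding \<Theta>_def by blast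
  then show ?thesis by (simp add: rc_X_Nil[OF h(1)] off)
 qed
 ultimately have 0: "X [] h = 0" using simple_faithful[OF simple _ _ base_in_idx[OF j(1), of 0]] by blast
 obtain d where "d \<in> idx n" "deg d = gm" using idx_deg_exists by blast
 then have "rc (X [] h) d d = 1" by (simp add: rc_X_Nil h)
 then show False unfolding 0 by simp
qed

section \<open>The transient case: no \<open>- \<omega> i\<close> is a limit of weights\<close>

context
 fixes j :: nat
 assumes j: "j \<in> {1..n}" and transient: "\<And>i. i \<in> {1..n} ==> - \<omega> i \<notin> spectrum"
begin

text \<open>If the weight of \<open>i # w'\<close> were close to 0, that of \<open>w'\<close> would
  be close to \<open>- \<omega> i\<close>; finitely many letters allow a common
  neighbourhood.\<close>

lemma words_away_from_zero:
 obtains K e where "compact K" "0 < e" "\<And>w. w \<in> Wn n ==> w \<noteq> [] ==> \<not> near K e 0 (wt \<omega> w)"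
proof -
 have "\<forall>i. \<exists>Ke. i \<in> {1..n} --> compact (fst Ke) \<and> 0 < snd Ke \<and>
   (\<forall>w\<in>Wn n. \<not> near (fst Ke) (snd Ke) (- \<omega> i) (wt \<omega> w))"
 proof
  fix i
  show "\<exists>Ke. i \<in> {1..n} --> compact (fst Ke) \<and> 0 < snd Ke \<and> (\<forall>w\<in>Wn n. \<not> near (fst Ke) (snd Ke) (- \<omega> i) (wt \<omega> w))"
   using transient[of i] unfolding spectrum_iff by fastforce
 qed
 from choice[OF this] obtain Ke where Ke: "\<And>i. i \<in> {1..n} ==> compact (fst (Ke i)) \<and> 0 < snd (Ke i) \<and>
   (\<forall>w\<in>Wn n. \<not> near (fst (Ke i)) (snd (Ke i)) (- \<omega> i) (wt \<omega> w))" by blast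
 define K where "K = (\<Union>i\<in>{1..n}. fst (Ke i))"
 define e where "e = Min ((%i. snd (Ke i)) ` {1..n})"
 show ?thesis
 proof (rule that[of K e])
  show "compact K" unfolding K_def using Ke by (intro compact_UN) auto
  show "0 < e" unfolding e_def using Ke n2 by (subst Min_gr_iff) auto
  fix w assume w: "w \<in> Wn n" "w \<noteq> []"
  then obtain i w' where iw: "w = i # w'" "i \<in> {1..n}" "w' \<in> Wn n" by (cases w) auto
  show "\<not> near K e 0 (wt \<omega> w)"
  proof
   assume "near K e 0 (wt \<omega> w)"
   then have "near K e (- \<omega> i) (wt \<omega> w')"
    using near_translate[of K e "- \<omega> i" "\<omega> i" "wt \<omega> w'"] by (simp add: iw(1) add.commute)
   moreover have "e \<le> snd (Ke i)" unfolding e_def using iw(2) by (intro Min_le) auto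
   ultimately have "near (fst (Ke i)) (snd (Ke i)) (- \<omega> i) (wt \<omega> w')"
    using iw(2) unfolding near_def K_def by (meson UN_I less_le_trans)
   then show False using Ke[OF iw(2)] iw(3) by blast
  qed
 qed
qed

text \<open>Infinitely many indices with values in a totally bounded set leave infinitely many in
  one small cell, where differences are too close to 0 to be weights of nonempty words.\<close>

lemma no_nearby_pairs:
 fixes \<phi> :: "'x => 'g character"
 assumes r: "r \<in> DR" and A: "infinite A" "\<And>a. a \<in> A ==> 1 / 3 \<le> r (\<phi> a)"
 obtains B where "infinite B" "B \<subseteq> A" "\<And>a b w. a \<in> B ==> b \<in> B ==> w \<in> Wn n ==> w \<noteq> [] ==> \<phi> b \<noteq> \<phi> a + wt \<omega> w"
proof -
 obtain K e where K: "compact K" "0 < e" "\<And>w. w \<in> Wn n ==> w \<noteq> [] ==> \<not> near K e 0 (wt \<omega> w)"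
  by (rule words_away_from_zero) (rule that)
 obtain T where T: "finite T" "\<And>gm. 1 / 3 \<le> r gm ==> \<exists>\<theta>\<in>T. near K (e / 2) \<theta> gm"
  by (rule DR_totally_bounded[OF r _ K(1), of "1 / 3" "e / 2"]) (simp, use K(2) in simp, rule that)
 have "\<forall>a\<in>A. \<exists>\<theta>. \<theta> \<in> T \<and> near K (e / 2) \<theta> (\<phi> a)" using T(2) A(2) by blast
 from bchoice[OF this] obtain \<tau> where \<tau>: "\<And>a. a \<in> A ==> \<tau> a \<in> T \<and> near K (e / 2) (\<tau> a) (\<phi> a)" by blast
 have "finite (\<tau> ` A)" using \<tau> by (intro finite_subset[OF _ T(1)]) blast
 from pigeonhole_infinite[OF A(1) this] obtain a0 where a0: "infinite {a \<in> A. \<tau> a = \<tau> a0}" by blast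
 show ?thesis
 proof (rule that[OF a0])
  fix a b w assume ab: "a \<in> {a \<in> A. \<tau> a = \<tau> a0}" "b \<in> {a \<in> A. \<tau> a = \<tau> a0}" and w: "w \<in> Wn n" "w \<noteq> []"
  have "near K e 0 (\<phi> b - \<phi> a)" using \<tau>[of a] \<tau>[of b] ab by (intro near_diff[of K e "\<tau> a0"]) auto
  then show "\<phi> b \<noteq> \<phi> a + wt \<omega> w" using K(3)[OF w] by auto
 qed blast
qed

text \<open>Among infinitely many words two are comparable in their letter counts, so their weights
  differ by the weight of a nonempty word, against \<open>no_nearby_pairs\<close>.\<close>

lemma finite_words_in_support:
 assumes r: "r \<in> DR"
 shows "finite {w \<in> Wn n. 1 / 3 \<le> r (wt \<omega> w + \<theta>)}"
proof (rule ccontr)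
 assume inf: "infinite {w \<in> Wn n. 1 / 3 \<le> r (wt \<omega> w + \<theta>)}"
 obtain B where B: "infinite B" "B \<subseteq> {w \<in> Wn n. 1 / 3 \<le> r (wt \<omega> w + \<theta>)}"
  "\<And>a b w. a \<in> B ==> b \<in> B ==> w \<in> Wn n ==> w \<noteq> [] ==> wt \<omega> b + \<theta> \<noteq> wt \<omega> a + \<theta> + wt \<omega> w"
  by (rule no_nearby_pairs[OF r inf, of "%w. wt \<omega> w + \<theta>"]) (simp, rule that)
 have Bl: "B \<subseteq> Wn n" using B(2) by blast
 obtain w w' where w: "w \<in> B" "w' \<in> B" "mset w \<subset># mset w'" by (rule infinite_words_comparable[OF B(1) Bl]) (rule that)
 obtain v where v: "mset v = mset w' - mset w" using ex_mset by blast
 have sub: "mset w \<subseteq># mset w'" using w(3) by (simp add: subset_mset.less_imp_le)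
 have eq: "mset w' = mset w + mset v" unfolding v using sub by simp
 have "v \<noteq> []" using w(3) eq by auto
 moreover have "v \<in> Wn n"
 proof -
  have "set v \<subseteq> set w'" using eq by (metis set_mset_mset set_mset_union Un_upper2)
  then show ?thesis using w(2) Bl by (auto simp: lists_eq_set)
 qed
 moreover have "wt \<omega> w' = wt \<omega> w + wt \<omega> v"
 proof -
  have "wt \<omega> u = sum_mset (image_mset \<omega> (mset u))" for u by (simp flip: sum_mset_sum_list)
  then show ?thesis using eq by (simp only: image_mset_union sum_mset.union)
 qed
 ultimately show False using B(3)[OF w(1,2), of v] by (simp add: algebra_simps)
qed

text \<open>For a fixed word only finitely many \<open>l\<close> qualify, since the degrees of the
  base vectors differ by weights of powers of \<open>j\<close>; and there are finitely many words
  shorter than \<open>L\<close>.\<close>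

lemma long_words_in_support:
 assumes r: "r \<in> DR"
 obtains l0 where "\<And>l w. l0 \<le> l ==> w \<in> Wn n ==> 1 / 3 \<le> r (wt \<omega> w + deg (base j l)) ==> L \<le> length w"
proof -
 have "finite {l. 1 / 3 \<le> r (wt \<omega> w + deg (base j l))}" for w
 proof (rule ccontr)
  assume inf: "infinite {l. 1 / 3 \<le> r (wt \<omega> w + deg (base j l))}"
  obtain B where B: "infinite B" "\<And>a b v. a \<in> B ==> b \<in> B ==> v \<in> Wn n ==> v \<noteq> [] ==>
    wt \<omega> w + deg (base j b) \<noteq> wt \<omega> w + deg (base j a) + wt \<omega> v"
   by (rule no_nearby_pairs[OF r inf, of "%l. wt \<omega> w + deg (base j l)"]) (simp, rule that)
  obtain b where b: "b \<in> B" using B(1) by fastforce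
  obtain a where a: "a \<in> B" "b < a" using B(1) unfolding infinite_nat_iff_unbounded by blast
  have "deg (act \<omega> (replicate (a - b) j) (base j (b + (a - b)))) = deg (base j b)" unfolding act_base ..
  then have "deg (base j b) = deg (base j a) + wt \<omega> (replicate (a - b) j)" using a(2) by (simp add: add.commute)
  then show False using B(2)[OF a(1) b replicate_in[OF j, of "a - b"]] a(2) by (simp add: add.assoc)
 qed
 moreover have "finite {w. w \<in> Wn n \<and> length w < L}"
  by (rule finite_subset[OF _ finite_lists_length_le[of "{1..n}" L]]) (auto simp: lists_eq_set)
 ultimately have "finite (\<Union>w\<in>{w. w \<in> Wn n \<and> length w < L}. {l. 1 / 3 \<le> r (wt \<omega> w + deg (base j l))})" by blast
 then obtain l0 where l0: "\<forall>l\<in>(\<Union>w\<in>{w. w \<in> Wn n \<and> length w < L}. {l. 1 / 3 \<le> r (wt \<omega> w + deg (base j l))}). l < l0"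
  unfolding finite_nat_set_iff_bounded by blast
 show ?thesis
 proof (rule that[of l0], rule ccontr)
  fix l w assume "l0 \<le> l" "w \<in> Wn n" "1 / 3 \<le> r (wt \<omega> w + deg (base j l))" "\<not> L \<le> length w"
  then have "l < l0" using l0 by (simp add: not_le)
  then show False using \<open>l0 \<le> l\<close> by simp
 qed
qed

text \<open>\<open>y'\<close> is a cutoff of an approximant with words of length at most
  \<open>L\<close>. In the support of the cutoff, the orbit of a base vector taken far enough back
  has finitely many points, all reached by words of length at least \<open>L\<close>. A term
  \<open>S_u \<phi> S_v^*\<close> then replaces a prefix of such a word without reaching the base
  vector, so these points are mapped among themselves.\<close>

lemma approximate_block:
 assumes \<epsilon>: "0 < \<epsilon>" and a: "a = act \<omega> w0 (base j l1)" "w0 \<in> Wn n"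
 obtains y' F where "norm (y - y') \<le> \<epsilon>" "finite F" "a \<in> F"
  "\<And>e e'. e' \<in> F ==> rc y' e e' \<noteq> 0 ==> e \<in> F"
  "\<And>e e'. e \<in> F ==> e' \<in> F ==> rc (star y' * y') e e' = (\<Sum>c\<in>F. cnj (rc y' c e) * rc y' c e')"
proof -
 have e3: "0 < \<epsilon> / 3" using \<epsilon> by simp
 obtain b L where b: "b \<in> els (%k l. k \<le> L \<and> l \<le> L)" "norm (y - b) \<le> \<epsilon> / 3" by (rule els_dense[OF e3]) (rule that)
 obtain r1 where r1: "r1 \<in> DR" "\<And>gm. 0 \<le> r1 gm" "\<And>h. cutoff r1 h ==> norm (b - b * X [] h) \<le> \<epsilon> / 3"
  using approximate_unit[OF e3, of b] by blast
 \<comment> \<open>\<open>b\<close> is cut off on both sides; the left cutoff is obtained from the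
   adjoint.\<close>
 obtain r2 where r2: "r2 \<in> DR" "\<And>gm. 0 \<le> r2 gm" "\<And>h. cutoff r2 h ==> norm (star b - star b * X [] h) \<le> \<epsilon> / 3"
  using approximate_unit[OF e3, of "star b"] by blast
 define r where "r gm = r1 gm + r2 gm" for gm
 have r: "r \<in> DR" unfolding r_def[abs_def] by (rule DR_add[OF r1(1) r2(1)])
 obtain h where h: "cutoff r h" "\<And>gm. h gm \<noteq> 0 ==> 1 / 3 \<le> r gm" by (rule cutoff_exists[OF r]) (rule that)
 have "r1 gm \<le> r gm" "r2 gm \<le> r gm" for gm using r1(2) r2(2) by (simp_all add: r_def)
 then have c12: "cutoff r1 h" "cutoff r2 h" using h(1) unfolding cutoff_def by (meson order_trans)+
 have hD: "h \<in> DR" and nX: "norm (X [] h) \<le> 1" using h(1) unfolding cutoff_def by (blast, intro norm_X_Nil) blast+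
 define y' where "y' = X [] h * (b * X [] h)"
 have "norm (y - y') \<le> \<epsilon>"
 proof -
  have "norm (b - X [] h * b) = norm (star b - star b * X [] h)"
   using norm_star[of "b - X [] h * b"] by (simp add: star_diff star_mult star_X_Nil hD)
  then have "norm (b - X [] h * b) * norm (X [] h) \<le> \<epsilon> / 3 * 1" using r2(3)[OF c12(2)] nX e3 by (intro mult_mono) simp_all
  then have "norm ((b - X [] h * b) * X [] h) \<le> \<epsilon> / 3" using norm_mult_ineq[of "b - X [] h * b" "X [] h"] by simp
  from norm_triangle_mono[OF norm_triangle_mono[OF b(2) r1(3)[OF c12(1)]] this]
  show ?thesis by (simp add: y'_def left_diff_distrib mult.assoc)
 qed
 have rcy: "rc y' e e' = complex_of_real (h (deg e)) * rc b e e' * complex_of_real (h (deg e'))" for e e'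
  unfolding y'_def rc_X_Nil_mult[OF hD] using rc_mult_X[of "[]" h b e e'] hD by simp
 obtain l0 where l0: "\<And>l w. l0 \<le> l ==> w \<in> Wn n ==> 1 / 3 \<le> r (wt \<omega> w + deg (base j l)) ==> L \<le> length w"
  using r by (rule long_words_in_support) (rule that)
 \<comment> \<open>\<open>l \<ge> l0\<close> makes the words long, and \<open>l0\<close> further
   letters \<open>j\<close> express \<open>a\<close> over this deeper base vector.\<close>
 define l where "l = l0 + l1"
 \<comment> \<open>\<open>a\<close> is kept even if its degree lies outside the support; its row and
   column in \<open>y'\<close> are then zero.\<close>
 define F where "F = insert a ((%w. act \<omega> w (base j l)) ` {w \<in> Wn n. 1 / 3 \<le> r (wt \<omega> w + deg (base j l))})"
 have F: "finite F" "a \<in> F" unfolding F_def using finite_words_in_support[OF r] by simp_all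
 have inF: "act \<omega> w (base j l) \<in> F" if "w \<in> Wn n" "h (deg (act \<omega> w (base j l))) \<noteq> 0" for w
  using that h(2)[OF that(2)] unfolding F_def by (auto simp: add.commute)
 have al: "a = act \<omega> (w0 @ replicate l0 j) (base j l)"
  unfolding a(1) l_def using act_base[of l0 j l1] by (simp add: act_append add.commute)
 have alist: "w0 @ replicate l0 j \<in> Wn n" using a(2) replicate_in[OF j] by simp
 have inv: "e \<in> F" if e: "e' \<in> F" "rc y' e e' \<noteq> 0" for e e'
 proof -
  have nz: "h (deg e) \<noteq> 0" "rc b e e' \<noteq> 0" "h (deg e') \<noteq> 0" using e(2) unfolding rcy by auto
  obtain w where w: "w \<in> Wn n" "e' = act \<omega> w (base j l)"
   using e(1) al alist unfolding F_def by blast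
  have "1 / 3 \<le> r (wt \<omega> w + deg (base j l))" using h(2)[OF nz(3)] unfolding w(2) by (simp add: add.commute)
  then have len: "L \<le> length w" using l0[of l w] w(1) by (simp add: l_def)
  obtain u v d where d: "length v \<le> L" "u \<in> Wn n" "v \<in> Wn n" "e = act \<omega> u d" "e' = act \<omega> v d"
   using rc_els_support[OF b(1) nz(2)] by blast
  have "act \<omega> (take (length v) w) (act \<omega> (drop (length v) w) (base j l)) = act \<omega> v d"
   unfolding act_append[symmetric] append_take_drop_id using w(2) d(5) by simp
  from act_same_length[OF _ this] have "d = act \<omega> (drop (length v) w) (base j l)" using d(1) len by simp
  then have eu: "e = act \<omega> (u @ drop (length v) w) (base j l)" unfolding d(4) by (simp add: act_append)
  have "u @ drop (length v) w \<in> Wn n" using d(2) w(1) by (auto simp: lists_eq_set dest: in_set_dropD)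
  from inF[OF this] show ?thesis using nz(1) unfolding eu by blast
 qed
 have prod: "rc (star y' * y') e e' = (\<Sum>c\<in>F. cnj (rc y' c e) * rc y' c e')" if e: "e' \<in> F" for e e'
 proof -
  obtain C where C: "finite C" "\<And>c. rc b c e' \<noteq> 0 ==> c \<in> C" "\<And>a e. rc (a * b) e e' = (\<Sum>c\<in>C. rc a e c * rc b c e')"
   using rc_els_product[OF b(1), of e'] by blast
  have "rc (star y' * y') e e' = rc (star y' * X [] h * b) e e' * complex_of_real (h (deg e'))"
   using rc_mult_X[of "[]" h "star y' * X [] h * b" e e'] hD unfolding y'_def by (simp add: mult.assoc)
  also have "\<dots> = (\<Sum>c\<in>C. cnj (rc y' c e) * rc y' c e')"
  proof -
   have "rc (star y' * X [] h) e c = cnj (rc y' c e) * complex_of_real (h (deg c))" for c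
    using rc_mult_X[of "[]" h "star y'" e c] hD by (simp add: rc_star)
   then show ?thesis unfolding C(3) rcy[of _ e'] by (simp add: sum_distrib_left sum_distrib_right mult_ac)
  qed
  also have "\<dots> = (\<Sum>c\<in>C \<union> F. cnj (rc y' c e) * rc y' c e')"
   using C(1,2) F(1) by (intro sum.mono_neutral_left) (auto simp: rcy)
  also have "\<dots> = (\<Sum>c\<in>F. cnj (rc y' c e) * rc y' c e')"
   using C(1) F(1) inv[OF e] by (intro sum.mono_neutral_right) auto
  finally show ?thesis .
 qed
 show ?thesis by (rule that[OF \<open>norm (y - y') \<le> \<epsilon>\<close> F inv prod])
qed

text \<open>On the finite block \<open>W = 1 - y'\<close> is almost isometric, so by
  \<open>finite_matrix_cokernel\<close> its row at \<open>a\<close> has squared length at least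
  \<open>1 - \<delta>\<close>. This bounds the diagonal entry of the defect of \<open>1 - y'\<close>
  at \<open>a\<close>.\<close>

lemma block_defect:
 assumes y': "finite F" "a \<in> F" "\<And>e e'. e \<in> F ==> e' \<in> F ==> rc (star y' * y') e e' = (\<Sum>c\<in>F. cnj (rc y' c e) * rc y' c e')"
  and \<delta>: "norm (star y' * y' - (y' + star y')) \<le> \<delta>" "\<delta> < 1"
 shows "Re (rc (y' + star y' - y' * star y') a a) \<le> \<delta>"
proof -
 define t where "t = star y' * y' - (y' + star y')"
 define W where "W e b = of_bool (e = b) - rc y' e b" for e b
 have W\<xi>: "(\<Sum>b\<in>F. W e b * \<xi> b) = \<xi> e - (\<Sum>b\<in>F. rc y' e b * \<xi> b)" if "e \<in> F" for e \<xi>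
 proof -
  have "(\<Sum>b\<in>F. of_bool (e = b) * \<xi> b) = \<xi> e" using y'(1) that by (simp add: of_bool_def if_distrib[of "%z. z * _"] cong: if_cong)
  then show ?thesis by (simp add: W_def left_diff_distrib sum_subtractf)
 qed
 have low: "(1 - \<delta>) * (l2 \<xi> F)\<^sup>2 \<le> (l2 (%e. \<Sum>b\<in>F. W e b * \<xi> b) F)\<^sup>2" for \<xi>
 proof -
  define Y where "Y e = (\<Sum>b\<in>F. rc y' e b * \<xi> b)" for e
  have "complex_of_real ((l2 (%e. \<Sum>b\<in>F. W e b * \<xi> b) F)\<^sup>2) = (\<Sum>e\<in>F. cnj (\<xi> e - Y e) * (\<xi> e - Y e))"
   unfolding of_real_l2_power2[OF y'(1)] by (intro sum.cong refl) (simp add: W\<xi> Y_def)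
  also have "\<dots> = (\<Sum>e\<in>F. cnj (\<xi> e) * \<xi> e) + ((\<Sum>e\<in>F. cnj (Y e) * Y e) - (\<Sum>e\<in>F. cnj (\<xi> e) * Y e) - (\<Sum>e\<in>F. cnj (Y e) * \<xi> e))"
   by (simp add: algebra_simps sum.distrib sum_subtractf)
  also have "(\<Sum>e\<in>F. cnj (\<xi> e) * \<xi> e) = complex_of_real ((l2 \<xi> F)\<^sup>2)" by (rule of_real_l2_power2[OF y'(1), symmetric])
  also have "(\<Sum>e\<in>F. cnj (Y e) * Y e) - (\<Sum>e\<in>F. cnj (\<xi> e) * Y e) - (\<Sum>e\<in>F. cnj (Y e) * \<xi> e) = (\<Sum>e\<in>F. \<Sum>b\<in>F. cnj (\<xi> e) * rc t e b * \<xi> b)"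
  proof -
   have "(\<Sum>e\<in>F. \<Sum>b\<in>F. cnj (\<xi> e) * rc (star y' * y') e b * \<xi> b) = (\<Sum>e\<in>F. \<Sum>b\<in>F. \<Sum>c\<in>F. cnj (rc y' c e * \<xi> e) * (rc y' c b * \<xi> b))"
    by (intro sum.cong refl) (simp add: y'(3) sum_distrib_left sum_distrib_right mult_ac)
   also have "\<dots> = (\<Sum>c\<in>F. \<Sum>e\<in>F. \<Sum>b\<in>F. cnj (rc y' c e * \<xi> e) * (rc y' c b * \<xi> b))"
   proof -
    have "(\<Sum>e\<in>F. \<Sum>b\<in>F. \<Sum>c\<in>F. cnj (rc y' c e * \<xi> e) * (rc y' c b * \<xi> b)) = (\<Sum>e\<in>F. \<Sum>c\<in>F. \<Sum>b\<in>F. cnj (rc y' c e * \<xi> e) * (rc y' c b * \<xi> b))"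
     by (rule sum.cong[OF refl], rule sum.swap)
    also have "\<dots> = (\<Sum>c\<in>F. \<Sum>e\<in>F. \<Sum>b\<in>F. cnj (rc y' c e * \<xi> e) * (rc y' c b * \<xi> b))" by (rule sum.swap)
    finally show ?thesis .
   qed
   also have "\<dots> = (\<Sum>c\<in>F. cnj (Y c) * Y c)" by (simp add: Y_def sum_product cnj_sum)
   finally have 1: "(\<Sum>e\<in>F. \<Sum>b\<in>F. cnj (\<xi> e) * rc (star y' * y') e b * \<xi> b) = (\<Sum>c\<in>F. cnj (Y c) * Y c)" .
   have 2: "(\<Sum>e\<in>F. \<Sum>b\<in>F. cnj (\<xi> e) * rc y' e b * \<xi> b) = (\<Sum>e\<in>F. cnj (\<xi> e) * Y e)"
    by (simp add: Y_def sum_distrib_left mult.assoc)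
   have "(\<Sum>e\<in>F. \<Sum>b\<in>F. cnj (\<xi> e) * rc (star y') e b * \<xi> b) = (\<Sum>b\<in>F. \<Sum>e\<in>F. cnj (\<xi> e) * rc (star y') e b * \<xi> b)" by (rule sum.swap)
   also have "\<dots> = (\<Sum>b\<in>F. cnj (Y b) * \<xi> b)" by (simp add: Y_def rc_star cnj_sum sum_distrib_left sum_distrib_right mult_ac)
   finally have 3: "(\<Sum>e\<in>F. \<Sum>b\<in>F. cnj (\<xi> e) * rc (star y') e b * \<xi> b) = (\<Sum>b\<in>F. cnj (Y b) * \<xi> b)" .
   show ?thesis unfolding t_def rc_diff rc_add 1[symmetric] 2[symmetric] 3[symmetric]
    by (simp add: algebra_simps sum.distrib sum_subtractf)
  qed
  finally have "(l2 (%e. \<Sum>b\<in>F. W e b * \<xi> b) F)\<^sup>2 = Re (complex_of_real ((l2 \<xi> F)\<^sup>2) + (\<Sum>e\<in>F. \<Sum>b\<in>F. cnj (\<xi> e) * rc t e b * \<xi> b))"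
   by (metis Re_complex_of_real)
  moreover have "cmod (\<Sum>e\<in>F. \<Sum>b\<in>F. cnj (\<xi> e) * rc t e b * \<xi> b) \<le> \<delta> * l2 \<xi> F * l2 \<xi> F"
   using mbd_mono[OF mbd_rc[of t] \<delta>(1)[folded t_def]] y'(1) unfolding mbd_def by blast
  ultimately show ?thesis
   using abs_Re_le_cmod[of "\<Sum>e\<in>F. \<Sum>b\<in>F. cnj (\<xi> e) * rc t e b * \<xi> b"] by (simp add: power2_eq_square algebra_simps)
 qed
 have "1 - \<delta> \<le> (\<Sum>b\<in>F. (cmod (W a b))\<^sup>2)"
  by (rule finite_matrix_cokernel[OF y'(1,2) _ low]) (use \<delta>(2) in simp)
 also have "(\<Sum>b\<in>F. (cmod (W a b))\<^sup>2) = (\<Sum>b\<in>F. of_bool (a = b) * (1 - 2 * Re (rc y' a a)) + (cmod (rc y' a b))\<^sup>2)"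
 proof (rule sum.cong[OF refl])
  fix b show "(cmod (W a b))\<^sup>2 = of_bool (a = b) * (1 - 2 * Re (rc y' a a)) + (cmod (rc y' a b))\<^sup>2"
   unfolding W_def cmod_power2 by (cases "a = b") (simp_all add: power2_eq_square algebra_simps)
 qed
 also have "\<dots> = 1 - 2 * Re (rc y' a a) + (\<Sum>b\<in>F. (cmod (rc y' a b))\<^sup>2)"
  using y'(1,2) by (simp add: sum.distrib of_bool_def if_distrib[of "%z. z * _"] cong: if_cong)
 also have "(\<Sum>b\<in>F. (cmod (rc y' a b))\<^sup>2) \<le> Re (rc (y' * star y') a a)"
  using diagonal_square[OF y'(1), of "star y'" a] by (simp add: rc_star star_star)
 finally show ?thesis by (simp add: rc_diff rc_add rc_star)
qed

text \<open>An infinite projection gives \<open>y = p - v\<close> such that \<open>1 - y\<close> is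
  an isometry with nonzero defect \<open>D = p - q\<close>. Simplicity makes some diagonal entry of
  \<open>D\<close> on the orbit of a constant word positive, whereas a finite block approximating
  \<open>y\<close> has almost no defect at that basis vector.\<close>

lemma transient_contradiction:
 assumes simple: "simple_cstar TYPE('c)" and pi: "purely_infinite TYPE('c)"
 shows False
proof -
 obtain x :: 'c where "x \<noteq> 0" using simple unfolding simple_cstar_def by blast
 then have "hereditary_subalgebra (UNIV :: 'c set)" "(UNIV :: 'c set) \<noteq> {0}"
  by (auto simp: hereditary_subalgebra_def cstar_subalgebra_def complex_subspace_def)
 then obtain p :: 'c where p: "infinite_projection p" using pi unfolding purely_infinite_def by blast
 then obtain q v where q: "projection q" "p * q = q" "q \<noteq> p" "star v * v = p" "v * star v = q" and pr: "projection p"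
  unfolding infinite_projection_def by blast
 have pp: "p * p = p" "star p = p" and qq: "q * q = q" "star q = q" using pr q(1) unfolding projection_def by auto
 have qp: "q * p = q" using arg_cong[OF q(2), of star] by (simp add: star_mult pp qq)
 have vp: "v * p = v"
 proof -
  have "star (v - v * p) * (v - v * p) = p - p * p - p * p + p * p * p"
   by (simp add: star_diff star_mult pp(2) left_diff_distrib right_diff_distrib mult.assoc[symmetric] q(4)) (simp add: mult.assoc q(4) flip: q(4)[unfolded mult.assoc])
  then have "star (v - v * p) * (v - v * p) = 0" by (simp add: pp)
  then show ?thesis by simp
 qed
 have pv: "p * v = v"
 proof -
  have "(v - p * v) * star (v - p * v) = q - q * p - p * q + p * q * p"
   by (simp add: star_diff star_mult pp(2) left_diff_distrib right_diff_distrib mult.assoc q(5)) (simp add: q(5) flip: mult.assoc)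
  then have "star (star (v - p * v)) * star (v - p * v) = 0" by (simp add: star_star qp q(2))
  then have "star (v - p * v) = 0" by (simp only: star_mult_self_eq_0)
  then have "v - p * v = 0" by (metis star_star star_zero)
  then show ?thesis by simp
 qed
 define y where "y = p - v"
 have sv: "star v * p = star v" "p * star v = star v" using arg_cong[OF pv, of star] arg_cong[OF vp, of star] by (simp_all add: star_mult pp)
 have sy: "star y = p - star v" by (simp add: y_def star_diff pp)
 have yy: "star y * y = y + star y" unfolding sy unfolding y_def
  by (simp add: left_diff_distrib right_diff_distrib pp pv sv q(4))
 define D where "D = y + star y - y * star y"
 have D: "D = p - q" unfolding D_def sy unfolding y_def
  by (simp add: left_diff_distrib right_diff_distrib pp vp sv q(5))
 have DD: "star D * D = D" unfolding D by (simp add: star_diff pp qq left_diff_distrib right_diff_distrib q(2) qp)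
 \<comment> \<open>All basis vectors reached by words from some base vector of letter
   \<open>j\<close>; going back to larger \<open>l\<close> makes the set stable under
   deletion.\<close>
 define \<Theta> where "\<Theta> = {act \<omega> w (base j l) | w l. w \<in> Wn n}"
 have "reducing \<Theta>" unfolding reducing_def
 proof (intro allI impI iffI)
  fix i d assume i: "i \<in> {1..n}"
  { assume "icons \<omega> i d \<in> \<Theta>"
   then obtain w l where w: "w \<in> Wn n" "icons \<omega> i d = act \<omega> w (base j l)" unfolding \<Theta>_def by blast
   show "d \<in> \<Theta>"
   proof (cases w)
    case Nil
    then have "icons \<omega> i d = icons \<omega> j (base j (Suc l))" using w(2) by simp
    then have "d = act \<omega> [] (base j (Suc l))" by (simp only: icons_inject act_simps)
    then show ?thesis unfolding \<Theta>_def by blast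
   next
    case (Cons k w')
    then have "d = act \<omega> w' (base j l)" "w' \<in> Wn n" using w by simp_all
    then show ?thesis unfolding \<Theta>_def by blast
   qed }
  assume "d \<in> \<Theta>"
  then obtain w l where w: "w \<in> Wn n" "d = act \<omega> w (base j l)" unfolding \<Theta>_def by blast
  then have "icons \<omega> i d = act \<omega> (i # w) (base j l)" "i # w \<in> Wn n" using i by simp_all
  then show "icons \<omega> i d \<in> \<Theta>" unfolding \<Theta>_def by blast
 qed
 moreover have "base j 0 \<in> \<Theta>" unfolding \<Theta>_def by (intro CollectI exI[of _ "[]"] exI[of _ 0]) simp
 moreover have "D \<noteq> 0" using q(3) unfolding D by simp
 ultimately obtain e a where ea: "a \<in> \<Theta>" "rc D e a \<noteq> 0"
  using simple_faithful[OF simple _ _ base_in_idx[OF j, of 0], of \<Theta> D] by blast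
 obtain w l where a: "a = act \<omega> w (base j l)" "w \<in> Wn n" using ea(1) unfolding \<Theta>_def by blast
 define \<beta> where "\<beta> = Re (rc D a a)"
 have "(cmod (rc D e a))\<^sup>2 \<le> \<beta>" using diagonal_square[of "{e}" D a] unfolding DD \<beta>_def by simp
 then have \<beta>: "0 < \<beta>" using less_le_trans[of 0 "(cmod (rc D e a))\<^sup>2" \<beta>] ea(2) by simp
 \<comment> \<open>Replacing \<open>y\<close> by \<open>y'\<close> costs
   \<open>7 * \<epsilon>\<close> twice: 1/8 keeps \<open>7 * \<epsilon> < 1\<close>, and
   \<open>\<beta> / 15\<close> keeps \<open>14 * \<epsilon> < \<beta>\<close>.\<close>
 define \<epsilon> where "\<epsilon> = min (1 / 8) (\<beta> / 15)"
 have \<epsilon>: "0 < \<epsilon>" "\<epsilon> \<le> 1 / 8" "\<epsilon> \<le> \<beta> / 15" using \<beta> by (simp_all add: \<epsilon>_def)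
 obtain y' F where y': "norm (y - y') \<le> \<epsilon>" "finite F" "a \<in> F"
  "\<And>e e'. e \<in> F ==> e' \<in> F ==> rc (star y' * y') e e' = (\<Sum>c\<in>F. cnj (rc y' c e) * rc y' c e')"
  by (rule approximate_block[OF \<epsilon>(1) a, of y]) (rule that)
 define z where "z = y - y'"
 have z: "norm z \<le> \<epsilon>" "norm (star z) \<le> \<epsilon>" using y'(1) by (simp_all add: z_def)
 have nv: "norm v \<le> 1"
 proof -
  have "(norm v)\<^sup>2 \<le> 1\<^sup>2" using cstar_identity[of v] norm_projection_le[OF pr] by (simp add: q(4))
  then show ?thesis by (rule power2_le_imp_le) simp
 qed
 have ny: "norm y \<le> 2" unfolding y_def using norm_triangle_ineq4[of p v] norm_projection_le[OF pr] nv by linarith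
 have nm: "norm (c * d) \<le> s * k" if "norm c \<le> s" "norm d \<le> k" "0 \<le> s" for c d :: 'c and s k
  using order_trans[OF norm_mult_ineq mult_mono[OF that(1,2,3) norm_ge_zero]] .
 have y'z: "y' = y - z" by (simp add: z_def)
 \<comment> \<open>Three terms of size \<open>2 * \<epsilon>\<close> and one of size
   \<open>\<epsilon> * \<epsilon> \<le> \<epsilon>\<close>.\<close>
 have bd: "norm (b - c * z - star z * d + star z * z) \<le> 7 * \<epsilon>" if "norm b \<le> 2 * \<epsilon>" "norm c \<le> 2" "norm d \<le> 2" for b c d
 proof -
  have "norm (c * z) \<le> 2 * \<epsilon>" "norm (star z * d) \<le> \<epsilon> * 2" "norm (star z * z) \<le> \<epsilon> * \<epsilon>"
   using that z \<epsilon>(1) by (intro nm; simp)+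
  moreover have "\<epsilon> * \<epsilon> \<le> \<epsilon> * 1" using \<epsilon> by (intro mult_left_mono) simp_all
  ultimately show ?thesis using that(1) norm_triangle_ineq[of "b - c * z - star z * d" "star z * z"]
   norm_triangle_ineq4[of "b - c * z" "star z * d"] norm_triangle_ineq4[of b "c * z"] by linarith
 qed
 have nz2: "norm (z + star z) \<le> 2 * \<epsilon>" using norm_triangle_mono[OF z] by simp
 have "star y' * y' - (y' + star y') = (z + star z) - star y * z - star z * y + star z * z"
  unfolding y'z using yy by (simp add: star_diff left_diff_distrib right_diff_distrib algebra_simps)
 then have "norm (star y' * y' - (y' + star y')) \<le> 7 * \<epsilon>" using bd[OF nz2, of "star y" y] ny by simp
 note b1 = this
 have 1: "Re (rc (y' + star y' - y' * star y') a a) \<le> 7 * \<epsilon>"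
 proof (rule block_defect[OF y'(2,3)])
  show "rc (star y' * y') e e' = (\<Sum>c\<in>F. cnj (rc y' c e) * rc y' c e')" if "e \<in> F" "e' \<in> F" for e e'
   by (rule y'(4)[OF that])
  show "7 * \<epsilon> < 1" using \<epsilon>(2) by simp
 qed (rule b1)
 have "norm (D - (y' + star y' - y' * star y')) \<le> 7 * \<epsilon>"
 proof -
  have "D - (y' + star y' - y' * star y') = (z + star z) - y * star z - z * star y + z * star z"
   unfolding y'z D_def by (simp add: star_diff left_diff_distrib right_diff_distrib algebra_simps)
  moreover have "norm (y * star z) \<le> 2 * \<epsilon>" "norm (z * star y) \<le> \<epsilon> * 2" "norm (z * star z) \<le> \<epsilon> * \<epsilon>"
   using ny z \<epsilon>(1) by (intro nm; simp)+
  moreover have "\<epsilon> * \<epsilon> \<le> \<epsilon> * 1" using \<epsilon> by (intro mult_left_mono) simp_all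
  ultimately show ?thesis using nz2 norm_triangle_ineq[of "z + star z - y * star z - z * star y" "z * star z"]
   norm_triangle_ineq4[of "z + star z - y * star z" "z * star y"] norm_triangle_ineq4[of "z + star z" "y * star z"] by simp
 qed
 then have "cmod (rc (D - (y' + star y' - y' * star y')) a a) \<le> 7 * \<epsilon>"
  using order_trans[OF mbd_entry[OF mbd_rc]] by blast
 then have "\<beta> - Re (rc (y' + star y' - y' * star y') a a) \<le> 7 * \<epsilon>"
  using complex_Re_le_cmod[of "rc D a a - rc (y' + star y' - y' * star y') a a"] unfolding rc_diff[of D] \<beta>_def by simp
 then have "\<beta> \<le> 14 * \<epsilon>" using 1 by simp
 then show False using \<epsilon>(1,3) by simp
qed

end

text \<open>The forward direction is a dichotomy: either some \<open>- \<omega> i\<close> is a limit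
  of weights and \<open>recurrent_imp_dense\<close> applies, or none is and
  \<open>transient_contradiction\<close> excludes the hypothesis.\<close>

lemma simple_purely_infinite_iff:
 "simple_cstar TYPE('c) \<and> purely_infinite TYPE('c) \<longleftrightarrow> closure {wt \<omega> w | w. w \<in> Wn n} = UNIV"
proof
 assume spi: "simple_cstar TYPE('c) \<and> purely_infinite TYPE('c)"
 have "\<exists>i\<in>{1..n}. - \<omega> i \<in> spectrum"
  using transient_contradiction[of 1] spi n2 by fastforce
 then show "closure {wt \<omega> w | w. w \<in> Wn n} = UNIV"
  using recurrent_imp_dense spi unfolding spectrum_def by blast
next
 assume "closure {wt \<omega> w | w. w \<in> Wn n} = UNIV"
 then show "simple_cstar TYPE('c) \<and> purely_infinite TYPE('c)"
  using dense_imp_simple dense_imp_purely_infinite by blast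
qed

end

theorem corollary4p9:
  fixes n :: nat
    and S :: "nat \<Rightarrow> 'a::{cstar_algebra, real_normed_algebra_1, second_countable_topology}"
    and \<omega> :: "nat \<Rightarrow> 'g::{topological_ab_group_add, t2_space} character"
    and \<alpha> :: "'g \<Rightarrow> 'a \<Rightarrow> 'a"
    and \<mu> :: "'g measure"
    and \<iota> :: "('g \<Rightarrow> 'a) \<Rightarrow> 'c::cstar_algebra"
  assumes "n \<ge> 2"
    and "locally compact (UNIV :: 'g set)"
    and "haar_measure \<mu>"
    and "cuntz_algebra n S"
    and "cstar_action \<alpha>"
    and "\<And>t i. i \<in> {1..n} \<Longrightarrow> \<alpha> t (S i) = pairing t (\<omega> i) *\<^sub>C S i"
    and "crossed_product \<mu> \<alpha> \<iota>"
  shows "simple_cstar TYPE('c) \<and> purely_infinite TYPE('c) \<longleftrightarrow>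
    closure {sum_list (map \<omega> w) | w. w \<in> lists {1..n}} = (UNIV :: 'g character set)"
proof -
  interpret crossed \<mu> n S \<omega> \<alpha> \<iota>
    using assms by unfold_locales
  show ?thesis by (rule simple_purely_infinite_iff)
qed

end
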